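(* Let $(M,g)$ be a smooth connected compact Riemannian manifold of dimension $n\ge2$ with (nonempty) boundary, and let $f\in C^\infty(M)$ satisfy $$\nabla^2 f+fg=0\ \text{ in }M,\qquad \frac{\partial f}{\partial\nu}=1\ \text{ on }\partial M,$$ where $\nu$ is the outward unit normal on $\partial M$. Then: (i) if $f|_{\partial M}$ is constant, then $(M,g)$ is isometric to a spherical cap; (ii) if $f|_{\partial M}$ is not constant, then $(M,g)$ is isometric to the standard hemisphere.
   Context: A spherical cap here means a geodesic ball in the standard unit sphere $\mathbb S^n$. The standard hemisphere is the closed geodesic ball of radius $\pi/2$ in $\mathbb S^n$. *)

theory Defs
  imports "HOL-Analysis.Analysis"
begin

section \<open>Smooth functions on relatively open subsets of a half-space\<close>

primrec Ck_on :: "nat \<Rightarrow> 'a::euclidean_space set \<Rightarrow> ('a \<Rightarrow> 'b::euclidean_space) \<Rightarrow> bool" where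
  "Ck_on 0 W f \<longleftrightarrow> continuous_on W f"
| "Ck_on (Suc k) W f \<longleftrightarrow>
     (\<forall>x\<in>W. f differentiable (at x)) \<and> (\<forall>v. Ck_on k W (\<lambda>x. frechet_derivative f (at x) v))"

text \<open>On an arbitrary set, smoothness means that the function is locally the restriction of a
  smooth function on an open set.\<close>

definition smooth_on :: "'a::euclidean_space set \<Rightarrow> ('a \<Rightarrow> 'b::euclidean_space) \<Rightarrow> bool" where
  "smooth_on V f \<longleftrightarrow>
     (\<forall>x\<in>V. \<exists>W F. open W \<and> x \<in> W \<and> (\<forall>k. Ck_on k W F) \<and> (\<forall>y\<in>W \<inter> V. F y = f y))"

text \<open>The choice of the basis vector is immaterial.\<close>

definition inward :: "'a::euclidean_space" where
  "inward = (SOME b. b \<in> Basis)"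

definition half_space :: "'a::euclidean_space set" where
  "half_space = {x. 0 \<le> x \<bullet> inward}"

text \<open>Derivative of \<open>f\<close> at \<open>x\<close> in direction \<open>v\<close>, taken within \<open>V\<close>. It is only used for
  relatively open subsets \<open>V\<close> of the half-space, where derivatives are unique, also at points
  of the bounding hyperplane.\<close>

definition deriv_in ::
    "'a::euclidean_space set \<Rightarrow> ('a \<Rightarrow> 'b::euclidean_space) \<Rightarrow> 'a \<Rightarrow> 'a \<Rightarrow> 'b" where
  "deriv_in V f x v = frechet_derivative f (at x within V) v"


section \<open>Riemannian manifolds with boundary\<close>

text \<open>A chart is a pair of a domain and a coordinate map into the half-space; values of the
  map outside the domain are irrelevant. The dimension of the manifold is that of the type \<open>'a\<close>.
  The metric is given by its coordinate expressions: \<open>metric M c p u v\<close> is the inner product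
  of the tangent vectors at \<open>p\<close> whose coordinates in the chart \<open>c\<close> are \<open>u\<close> and \<open>v\<close>.\<close>

type_synonym ('p, 'a) chart = "'p set \<times> ('p \<Rightarrow> 'a)"

record ('p, 'a) riemannian =
  mtop :: "'p topology"
  charts :: "('p, 'a) chart set"
  metric :: "('p, 'a) chart \<Rightarrow> 'p \<Rightarrow> 'a \<Rightarrow> 'a \<Rightarrow> real"

definition chart_inv :: "('p, 'a) chart \<Rightarrow> 'a \<Rightarrow> 'p" where
  "chart_inv c = inv_into (fst c) (snd c)"

definition chart_image :: "('p, 'a) chart \<Rightarrow> 'a set" where
  "chart_image c = snd c ` fst c"

definition is_chart :: "'p topology \<Rightarrow> ('p, 'a::euclidean_space) chart \<Rightarrow> bool" where
  "is_chart T c \<longleftrightarrow>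
     openin T (fst c) \<and>
     openin (top_of_set half_space) (chart_image c) \<and>
     homeomorphic_map (subtopology T (fst c)) (top_of_set (chart_image c)) (snd c)"

definition smooth_manifold :: "('p, 'a::euclidean_space) riemannian \<Rightarrow> bool" where
  "smooth_manifold M \<longleftrightarrow>
     Hausdorff_space (mtop M) \<and> second_countable (mtop M) \<and>
     (\<forall>c\<in>charts M. is_chart (mtop M) c) \<and>
     \<Union> (fst ` charts M) = topspace (mtop M) \<and>
     (\<forall>c\<in>charts M. \<forall>d\<in>charts M. smooth_on (snd c ` (fst c \<inter> fst d)) (snd d \<circ> chart_inv c))"

definition metric_coord ::
    "('p, 'a) riemannian \<Rightarrow> ('p, 'a) chart \<Rightarrow> 'a \<Rightarrow> 'a \<Rightarrow> 'a \<Rightarrow> real" where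
  "metric_coord M c x u v = metric M c (chart_inv c x) u v"

definition riemannian_metric :: "('p, 'a::euclidean_space) riemannian \<Rightarrow> bool" where
  "riemannian_metric M \<longleftrightarrow>
     (\<forall>c\<in>charts M. \<forall>p\<in>fst c.
        bilinear (metric M c p) \<and>
        (\<forall>u v. metric M c p u v = metric M c p v u) \<and>
        (\<forall>u. u \<noteq> 0 \<longrightarrow> metric M c p u u > 0)) \<and>
     (\<forall>c\<in>charts M. \<forall>u v. smooth_on (chart_image c) (\<lambda>x. metric_coord M c x u v)) \<and>
     (\<forall>c\<in>charts M. \<forall>d\<in>charts M. \<forall>p\<in>fst c \<inter> fst d. \<forall>u v.
        let D = deriv_in (snd c ` (fst c \<inter> fst d)) (snd d \<circ> chart_inv c) (snd c p)
        in metric M c p u v = metric M d p (D u) (D v))"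

definition riemannian_manifold :: "('p, 'a::euclidean_space) riemannian \<Rightarrow> bool" where
  "riemannian_manifold M \<longleftrightarrow> smooth_manifold M \<and> riemannian_metric M"

definition boundary :: "('p, 'a::euclidean_space) riemannian \<Rightarrow> 'p set" where
  "boundary M = {p \<in> topspace (mtop M). \<exists>c\<in>charts M. p \<in> fst c \<and> snd c p \<bullet> inward = 0}"

definition smooth_function :: "('p, 'a::euclidean_space) riemannian \<Rightarrow> ('p \<Rightarrow> real) \<Rightarrow> bool" where
  "smooth_function M f \<longleftrightarrow> (\<forall>c\<in>charts M. smooth_on (chart_image c) (f \<circ> chart_inv c))"

text \<open>Christoffel symbols \<open>\<Gamma>(u,v) = u\<^sup>i v\<^sup>j \<Gamma>\<^sup>k\<^sub>i\<^sub>j e\<^sub>k\<close>, via the Koszul formula for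
  coordinate fields,
  \<open>2 g(\<Gamma>(u,v),w) = \<partial>\<^sub>u g(v,w) + \<partial>\<^sub>v g(u,w) - \<partial>\<^sub>w g(u,v)\<close>.\<close>

definition christoffel ::
    "('p, 'a::euclidean_space) riemannian \<Rightarrow> ('p, 'a) chart \<Rightarrow> 'a \<Rightarrow> 'a \<Rightarrow> 'a \<Rightarrow> 'a" where
  "christoffel M c x u v = (THE z. \<forall>w.
     2 * metric_coord M c x z w =
       deriv_in (chart_image c) (\<lambda>y. metric_coord M c y v w) x u +
       deriv_in (chart_image c) (\<lambda>y. metric_coord M c y u w) x v -
       deriv_in (chart_image c) (\<lambda>y. metric_coord M c y u v) x w)"

text \<open>In coordinates, \<open>(\<nabla>\<^sup>2 f)\<^sub>i\<^sub>j = \<partial>\<^sub>i \<partial>\<^sub>j f - \<Gamma>\<^sup>k\<^sub>i\<^sub>j \<partial>\<^sub>k f\<close>.\<close>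

definition hessian ::
    "('p, 'a::euclidean_space) riemannian \<Rightarrow> ('p \<Rightarrow> real) \<Rightarrow> ('p, 'a) chart \<Rightarrow> 'p \<Rightarrow> 'a \<Rightarrow> 'a \<Rightarrow> real"
  where
  "hessian M f c p u v =
     (let V = chart_image c; F = f \<circ> chart_inv c; x = snd c p
      in deriv_in V (\<lambda>y. deriv_in V F y v) x u - deriv_in V F x (christoffel M c x u v))"

text \<open>Coordinates of the outward unit normal at a boundary point \<open>p\<close>.\<close>

definition outward_normal ::
    "('p, 'a::euclidean_space) riemannian \<Rightarrow> ('p, 'a) chart \<Rightarrow> 'p \<Rightarrow> 'a" where
  "outward_normal M c p = (THE N.
     metric M c p N N = 1 \<and>
     (\<forall>v. v \<bullet> inward = 0 \<longrightarrow> metric M c p N v = 0) \<and>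
     N \<bullet> inward < 0)"

definition normal_derivative ::
    "('p, 'a::euclidean_space) riemannian \<Rightarrow> ('p \<Rightarrow> real) \<Rightarrow> ('p, 'a) chart \<Rightarrow> 'p \<Rightarrow> real" where
  "normal_derivative M f c p =
     deriv_in (chart_image c) (f \<circ> chart_inv c) (snd c p) (outward_normal M c p)"


section \<open>Isometries\<close>

definition coord_map ::
    "('p, 'a) chart \<Rightarrow> ('q, 'b) chart \<Rightarrow> ('p \<Rightarrow> 'q) \<Rightarrow> 'a \<Rightarrow> 'b" where
  "coord_map c d h = snd d \<circ> h \<circ> chart_inv c"

definition coord_dom ::
    "('p, 'a) chart \<Rightarrow> ('q, 'b) chart \<Rightarrow> ('p \<Rightarrow> 'q) \<Rightarrow> 'a set" where
  "coord_dom c d h = snd c ` (fst c \<inter> h -` fst d)"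

definition smooth_map ::
    "('p, 'a::euclidean_space) riemannian \<Rightarrow> ('q, 'b::euclidean_space) riemannian \<Rightarrow> ('p \<Rightarrow> 'q) \<Rightarrow> bool"
  where
  "smooth_map M N h \<longleftrightarrow>
     continuous_map (mtop M) (mtop N) h \<and>
     (\<forall>c\<in>charts M. \<forall>d\<in>charts N. smooth_on (coord_dom c d h) (coord_map c d h))"

definition diffeomorphism ::
    "('p, 'a::euclidean_space) riemannian \<Rightarrow> ('q, 'b::euclidean_space) riemannian \<Rightarrow> ('p \<Rightarrow> 'q) \<Rightarrow> bool"
  where
  "diffeomorphism M N h \<longleftrightarrow>
     smooth_map M N h \<and> (\<exists>k. smooth_map N M k \<and> homeomorphic_maps (mtop M) (mtop N) h k)"

definition isometric ::
    "('p, 'a::euclidean_space) riemannian \<Rightarrow> ('q, 'b::euclidean_space) riemannian \<Rightarrow> bool" where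
  "isometric M N \<longleftrightarrow>
     (\<exists>h. diffeomorphism M N h \<and>
        (\<forall>c\<in>charts M. \<forall>d\<in>charts N. \<forall>p\<in>fst c \<inter> h -` fst d. \<forall>u v.
           let D = deriv_in (coord_dom c d h) (coord_map c d h) (snd c p)
           in metric M c p u v = metric N d (h p) (D u) (D v)))"


section \<open>Geodesic balls in the unit sphere\<close>

text \<open>The Riemannian structure induced on a subset \<open>X\<close> of Euclidean space: the charts are
  those whose inverse is a smooth immersion into the ambient space, and the metric is the
  restriction of the Euclidean inner product. This is meaningful if \<open>X\<close> is an embedded
  submanifold, possibly with boundary, of dimension \<open>DIM('a)\<close>.\<close>

definition induced_riemannian :: "'b::euclidean_space set \<Rightarrow> ('b, 'a::euclidean_space) riemannian"
  where
  "induced_riemannian X =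
     \<lparr> mtop = top_of_set X,
       charts = {c. is_chart (top_of_set X) c \<and>
                    smooth_on (chart_image c) (chart_inv c) \<and>
                    (\<forall>x\<in>chart_image c. inj (deriv_in (chart_image c) (chart_inv c) x))},
       metric = (\<lambda>c p u v.
          let D = deriv_in (chart_image c) (chart_inv c) (snd c p) in D u \<bullet> D v) \<rparr>"

text \<open>Curves are required to be \<open>C\<^sup>1\<close> on the whole closed interval, so that the length
  integral always exists; piecewise \<open>C\<^sup>1\<close> curves would give the same infimum.\<close>

definition geodesic_dist :: "'b::euclidean_space set \<Rightarrow> 'b \<Rightarrow> 'b \<Rightarrow> real" where
  "geodesic_dist X x y =
     Inf {integral {0..1} (\<lambda>t. norm (vector_derivative \<gamma> (at t))) | \<gamma>.
            \<gamma> C1_differentiable_on {0..1} \<and> path_image \<gamma> \<subseteq> X \<and>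
            pathstart \<gamma> = x \<and> pathfinish \<gamma> = y}"

definition closed_geodesic_ball :: "'b::euclidean_space \<Rightarrow> real \<Rightarrow> 'b set" where
  "closed_geodesic_ball p r = {x \<in> sphere 0 1. geodesic_dist (sphere 0 1) p x \<le> r}"

text \<open>The unit sphere of dimension \<open>DIM('a)\<close> is the one in \<open>'a \<times> real\<close>. Radii are restricted to
  those for which the closed ball is a proper submanifold with boundary.\<close>

definition isometric_to_spherical_cap :: "('p, 'a::euclidean_space) riemannian \<Rightarrow> bool" where
  "isometric_to_spherical_cap M \<longleftrightarrow>
     (\<exists>(p :: 'a \<times> real) r. p \<in> sphere 0 1 \<and> 0 < r \<and> r < pi \<and>
        isometric M (induced_riemannian (closed_geodesic_ball p r) :: ('a \<times> real, 'a) riemannian))"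

definition standard_hemisphere :: "('a \<times> real, 'a::euclidean_space) riemannian" where
  "standard_hemisphere = induced_riemannian (closed_geodesic_ball (0, 1) (pi / 2))"

end

theory Submission
  imports Defs
begin

text \<open>With \<open>A\<^sup>2 = \<bar>\<nabla>f\<bar>\<^sup>2 + f\<^sup>2\<close>, which is constant, \<open>s = - f / A\<close> satisfies \<open>\<nabla>\<^sup>2 s + s g = 0\<close> and
\<open>\<bar>\<nabla>s\<bar>\<^sup>2 + s\<^sup>2 = 1\<close>. The flow of \<open>\<nabla>s\<close> never leaves \<open>M\<close> in positive time, pushes every point with
\<open>s > -1\<close> to a maximum \<open>s = 1\<close>, and scales \<open>g / (1 + s)\<^sup>2\<close> by \<open>exp (- 2 t)\<close>. Linearising it at a maximum gives a map \<open>\<Psi>\<close> of the basin of that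
maximum into the Euclidean space with \<open>\<Psi>\<^sup>* \<bar>dy\<bar>\<^sup>2 = g / (1 + s)\<^sup>2\<close>, \<open>\<bar>\<Psi>\<bar>\<^sup>2 = (1 - s) / (1 + s)\<close>, in which the flow is
\<open>exp (- t)\<close>. Every ray from the origin meets the image of the boundary exactly once, so the basin is compact and hence all of \<open>M\<close>.
As \<open>\<partial>s/\<partial>\<nu>\<close> is constant, the gauge \<open>w\<close> of \<open>\<Psi>(M)\<close> makes \<open>(w - \<bar>y\<bar>\<^sup>2 / w) / 2\<close> a 1-homogeneous
function with gradient of constant length \<open>B\<close>, where \<open>B\<^sup>2 = A\<^sup>2 - 1\<close>. Such a function is \<open>\<plusminus> B \<bar>y\<bar>\<close> or linear, so
\<open>\<Psi>(M)\<close> is a ball, and inverse stereographic projection maps it isometrically onto a cap centred at the pole, or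
onto a hemisphere.\<close>

section \<open>Calculus of \<open>C\<^sup>k\<close> functions on open sets\<close>

text \<open>The model is the unit sphere with s = cos r its height. There \<Psi> is stereographic
  projection from the pole s = -1, g / (1 + s)^2 is the flat metric of the target, and the flow of
  \<nabla>s contracts towards the pole s = 1. Dividing by A gives |\<nabla>s|^2 = 1 - s^2, so that
  s' = 1 - s^2 along the flow, an equation solved by the exponential decay of (1 - s) / (1 + s).
  Geodesics are avoided because they may stop at the boundary; the field \<nabla>s enters M there,
  as \<partial>s/\<partial>\<nu> = - 1/A. The price is that only nonnegative flow times exist, and
  only a small uniform time is constructed, which is then iterated. Charts take values in a
  half-space, so functions are handled through smooth extensions to open sets, while identities are
  claimed on the half-space only. The last homogeneous function is read off from the hemisphere: in
  these coordinates it is 2 B (e . y) <= 1 - |y|^2, and homogenising the equation of its boundary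
  gives (w - |y|^2 / w) / 2 = B (e . y).\<close>

abbreviation FD :: "('a::real_normed_vector \<Rightarrow> 'b::real_normed_vector) \<Rightarrow> 'a \<Rightarrow> 'a \<Rightarrow> 'b" where
 "FD f x \<equiv> frechet_derivative f (at x)"

definition C_inf_on :: "'a::euclidean_space set \<Rightarrow> ('a \<Rightarrow> 'b::euclidean_space) \<Rightarrow> bool" where
 "C_inf_on W f \<longleftrightarrow> (\<forall>k. Ck_on k W f)"

lemma C_inf_onD: "C_inf_on W f \<Longrightarrow> Ck_on k W f"
 by (simp add: C_inf_on_def)

lemma Ck_on_subset: "Ck_on k W f \<Longrightarrow> V \<subseteq> W \<Longrightarrow> Ck_on k V f"
 by (induct k arbitrary: f) (auto intro: continuous_on_subset)

lemma C_inf_on_subset: "C_inf_on W f \<Longrightarrow> V \<subseteq> W \<Longrightarrow> C_inf_on V f"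
 by (meson C_inf_on_def Ck_on_subset)

lemma Ck_on_cong:
 assumes "open W" "\<And>x. x \<in> W \<Longrightarrow> f x = g x" "Ck_on k W f"
 shows "Ck_on k W g"
 using assms(2,3)
proof (induct k arbitrary: f g)
 case 0
 then show ?case by (simp cong: continuous_on_cong)
next
 case (Suc k)
 have d: "g differentiable (at x)" "FD f x = FD g x" if "x \<in> W" for x
 proof -
  have "f differentiable (at x)" using Suc.prems that by simp
  then obtain D where "(f has_derivative D) (at x)" by (auto simp: differentiable_def)
  then have "(g has_derivative D) (at x)"
   using has_derivative_transform_within_open \<open>open W\<close> that Suc.prems(1) by blast
  then show "g differentiable (at x)" by (auto simp: differentiable_def)
  show "FD f x = FD g x"
   using frechet_derivative_transform_within_open[of f x W g] Suc.prems that \<open>open W\<close> by simp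
 qed
 have "Ck_on k W (\<lambda>x. FD g x v)" for v
  by (rule Suc.hyps[of "\<lambda>x. FD f x v"]) (use Suc.prems d in auto)
 then show ?case using d by simp
qed

lemma C_inf_on_cong:
 "open W \<Longrightarrow> (\<And>x. x \<in> W \<Longrightarrow> f x = g x) \<Longrightarrow> C_inf_on W f \<Longrightarrow> C_inf_on W g"
 using Ck_on_cong unfolding C_inf_on_def by blast

lemma Ck_on_SucI:
 assumes "open W" "\<And>x. x \<in> W \<Longrightarrow> (f has_derivative f' x) (at x)"
  "\<And>v. Ck_on k W (\<lambda>x. f' x v)"
 shows "Ck_on (Suc k) W f"
proof -
 have "f' x = FD f x" if "x \<in> W" for x
  using assms(2)[OF that] by (rule frechet_derivative_at)
 then have "Ck_on k W (\<lambda>x. FD f x v)" for v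
  using Ck_on_cong[OF assms(1) _ assms(3)] by simp
 then show ?thesis using assms(2) by (auto simp: differentiable_def)
qed

lemma Ck_on_SucD: "Ck_on (Suc k) W f \<Longrightarrow> Ck_on k W f"
proof (induct k arbitrary: f)
 case 0
 then show ?case
  by (auto intro!: continuous_at_imp_continuous_on differentiable_imp_continuous_within)
next
 case (Suc k)
 then show ?case by (subst Ck_on.simps) (metis Ck_on.simps(2))
qed

lemma Ck_on_has_derivative:
 "Ck_on (Suc k) W f \<Longrightarrow> x \<in> W \<Longrightarrow> (f has_derivative FD f x) (at x)"
 by (simp add: frechet_derivative_works)

lemma C_inf_on_has_derivative:
 "C_inf_on W f \<Longrightarrow> x \<in> W \<Longrightarrow> (f has_derivative FD f x) (at x)"
 using Ck_on_has_derivative[of 0] unfolding C_inf_on_def by blast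

lemma C_inf_on_continuous_on: "C_inf_on W f \<Longrightarrow> continuous_on W f"
 unfolding C_inf_on_def by (metis Ck_on.simps(1))

lemma C_inf_on_FD: "C_inf_on W f \<Longrightarrow> C_inf_on W (\<lambda>x. FD f x v)"
 unfolding C_inf_on_def by (metis Ck_on.simps(2))

lemma Ck_on_continuous_on: "Ck_on k W f \<Longrightarrow> continuous_on W f"
 by (induct k) (use Ck_on_SucD in auto)

lemma Ck_on_mono: "Ck_on k W f \<Longrightarrow> j \<le> k \<Longrightarrow> Ck_on j W f"
 by (induct k) (use Ck_on_SucD le_Suc_eq in blast)+

lemma Ck_on_const [simp]: "open W \<Longrightarrow> Ck_on k W (\<lambda>x. c)"
proof (induct k arbitrary: c)
 case (Suc k)
 show ?case by (rule Ck_on_SucI[where f'="\<lambda>x v. 0"]) (use Suc in auto)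
qed auto

lemma Ck_on_bounded_linear:
 assumes "open W" "bounded_linear f" shows "Ck_on k W f"
proof -
 have "Ck_on (Suc k) W f"
  by (rule Ck_on_SucI[where f'="\<lambda>x. f"]) (use assms bounded_linear_imp_has_derivative in auto)
 then show ?thesis by (rule Ck_on_SucD)
qed

lemma Ck_on_add:
 assumes "open W"
 shows "Ck_on k W f \<Longrightarrow> Ck_on k W g \<Longrightarrow> Ck_on k W (\<lambda>x. f x + g x)"
proof (induct k arbitrary: f g)
 case 0
 then show ?case by (auto intro: continuous_intros)
next
 case (Suc k)
 show ?case
  by (rule Ck_on_SucI[where f'="\<lambda>x v. FD f x v + FD g x v"])
   (use Suc assms Ck_on_has_derivative in \<open>auto intro!: has_derivative_add simp: frechet_derivative_works\<close>)
qed

lemma Ck_on_bilinear: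
 assumes "open W" and b: "bounded_bilinear b"
 shows "Ck_on k W f \<Longrightarrow> Ck_on k W g \<Longrightarrow> Ck_on k W (\<lambda>x. b (f x) (g x))"
proof (induct k arbitrary: f g)
 case 0
 then show ?case using bounded_bilinear.continuous_on[OF b] by auto
next
 case (Suc k)
 have "Ck_on k W f" "Ck_on k W g" using Suc.prems Ck_on_SucD by auto
 then show ?case
  by (intro Ck_on_SucI[where f'="\<lambda>x v. b (f x) (FD g x v) + b (FD f x v) (g x)"]
    assms bounded_bilinear.FDERIV[OF b] Ck_on_add Suc.hyps)
   (use Suc.prems in \<open>auto simp: frechet_derivative_works[symmetric]\<close>)
qed

lemma Ck_on_sum:
 "open W \<Longrightarrow> (\<And>i. i \<in> I \<Longrightarrow> Ck_on k W (f i)) \<Longrightarrow> Ck_on k W (\<lambda>x. \<Sum>i\<in>I. f i x)"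
 by (induct I rule: infinite_finite_induct) (auto intro!: Ck_on_add)

lemmas Ck_on_scaleR = Ck_on_bilinear[OF _ bounded_bilinear_scaleR]
lemmas Ck_on_mult = Ck_on_bilinear[OF _ bounded_bilinear_mult[where 'a=real]]
lemmas Ck_on_inner = Ck_on_bilinear[OF _ bounded_bilinear_inner]

lemma linear_basis_expand:
 fixes f :: "'a::euclidean_space \<Rightarrow> 'b::real_vector"
 assumes "linear f"
 shows "f v = (\<Sum>b\<in>Basis. (v \<bullet> b) *\<^sub>R f b)"
 using linear_sum[OF assms, of "\<lambda>b. (v \<bullet> b) *\<^sub>R b" Basis]
 by (simp add: linear_scale[OF assms] euclidean_representation)

text \<open>\<open>Ck_on\<close> controls \<open>FD g\<close> only in fixed directions, while the
  chain rule feeds it the moving direction \<open>FD f x v\<close>. Expanding that direction over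
  the basis leaves products of functions of order k, to which the induction hypothesis
  applies.\<close>

lemma Ck_on_compose:
 assumes "open W" "open V"
 shows "Ck_on k W f \<Longrightarrow> Ck_on k V g \<Longrightarrow> f ` W \<subseteq> V \<Longrightarrow> Ck_on k W (\<lambda>x. g (f x))"
proof (induct k arbitrary: g)
 case 0
 then show ?case using continuous_on_compose2 by auto
next
 case (Suc k)
 have k: "Ck_on k W f" using Suc.prems(1) by (rule Ck_on_SucD)
 have d: "((\<lambda>x. g (f x)) has_derivative
   (\<lambda>v. \<Sum>b\<in>Basis. (FD f x v \<bullet> b) *\<^sub>R FD g (f x) b)) (at x)" if "x \<in> W" for x
 proof -
  have g: "(g has_derivative FD g (f x)) (at (f x))"
   using Suc.prems that by (intro Ck_on_has_derivative[of k V]) auto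
  have f: "(f has_derivative FD f x) (at x)"
   using Suc.prems that by (intro Ck_on_has_derivative[of k W]) auto
  have "FD g (f x) (FD f x v) = (\<Sum>b\<in>Basis. (FD f x v \<bullet> b) *\<^sub>R FD g (f x) b)" for v
   by (rule linear_basis_expand) (use g has_derivative_linear in blast)
  then show ?thesis
   using has_derivative_compose[OF f g] by simp
 qed
 show ?case
 proof (rule Ck_on_SucI[OF assms(1) d])
  show "Ck_on k W (\<lambda>x. \<Sum>b\<in>Basis. (FD f x v \<bullet> b) *\<^sub>R FD g (f x) b)" for v
   using Suc.prems
   by (intro Ck_on_sum Ck_on_scaleR Ck_on_inner Suc.hyps assms k)
    (auto intro!: assms Suc.hyps Ck_on_const)
 qed auto
qed

lemma C_inf_on_const [simp]: "open W \<Longrightarrow> C_inf_on W (\<lambda>x. c)"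
 by (simp add: C_inf_on_def)

lemma C_inf_on_bounded_linear: "open W \<Longrightarrow> bounded_linear f \<Longrightarrow> C_inf_on W f"
 by (simp add: C_inf_on_def Ck_on_bounded_linear)

lemma C_inf_on_add: "open W \<Longrightarrow> C_inf_on W f \<Longrightarrow> C_inf_on W g \<Longrightarrow> C_inf_on W (\<lambda>x. f x + g x)"
 by (simp add: C_inf_on_def Ck_on_add)

lemma C_inf_on_sum:
 "open W \<Longrightarrow> (\<And>i. i \<in> I \<Longrightarrow> C_inf_on W (f i)) \<Longrightarrow> C_inf_on W (\<lambda>x. \<Sum>i\<in>I. f i x)"
 by (simp add: C_inf_on_def Ck_on_sum)

lemma C_inf_on_scaleR:
 "open W \<Longrightarrow> C_inf_on W f \<Longrightarrow> C_inf_on W g \<Longrightarrow> C_inf_on W (\<lambda>x. f x *\<^sub>R g x)"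
 by (simp add: C_inf_on_def Ck_on_scaleR)

lemma C_inf_on_mult:
 fixes f g :: "'a::euclidean_space \<Rightarrow> real"
 shows "open W \<Longrightarrow> C_inf_on W f \<Longrightarrow> C_inf_on W g \<Longrightarrow> C_inf_on W (\<lambda>x. f x * g x)"
 by (simp add: C_inf_on_def Ck_on_mult)

lemma C_inf_on_inner:
 "open W \<Longrightarrow> C_inf_on W f \<Longrightarrow> C_inf_on W g \<Longrightarrow> C_inf_on W (\<lambda>x. f x \<bullet> g x)"
 by (simp add: C_inf_on_def Ck_on_inner)

lemma C_inf_on_compose:
 "open W \<Longrightarrow> open V \<Longrightarrow> C_inf_on W f \<Longrightarrow> C_inf_on V g \<Longrightarrow> f ` W \<subseteq> V \<Longrightarrow> C_inf_on W (\<lambda>x. g (f x))"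
 by (simp add: C_inf_on_def Ck_on_compose)

lemma C_inf_on_linear_compose:
 assumes "open W" "C_inf_on W f" "bounded_linear g"
 shows "C_inf_on W (\<lambda>x. g (f x))"
 by (rule C_inf_on_compose[where V=UNIV]) (use assms in \<open>auto intro: C_inf_on_bounded_linear\<close>)

lemma C_inf_on_minus: "open W \<Longrightarrow> C_inf_on W f \<Longrightarrow> C_inf_on W (\<lambda>x. - f x)"
 by (rule C_inf_on_linear_compose[where g=uminus]) (auto intro: bounded_linear_minus bounded_linear_ident)

lemma C_inf_on_diff:
 "open W \<Longrightarrow> C_inf_on W f \<Longrightarrow> C_inf_on W g \<Longrightarrow> C_inf_on W (\<lambda>x. f x - g x)"
 using C_inf_on_add[OF _ _ C_inf_on_minus] by fastforce

lemma C_inf_on_ident: "open W \<Longrightarrow> C_inf_on W (\<lambda>x. x)"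
 by (simp add: C_inf_on_bounded_linear)

lemma C_inf_on_Pair:
 assumes "open W" "C_inf_on W f" "C_inf_on W g"
 shows "C_inf_on W (\<lambda>x. (f x, g x))"
proof -
 have "C_inf_on W (\<lambda>x. (f x, 0) + (0, g x))"
  by (intro C_inf_on_add C_inf_on_linear_compose[where g="\<lambda>y. (y, 0)"]
    C_inf_on_linear_compose[where g="\<lambda>y. (0, y)"] assms)
   (auto intro: bounded_linear_Pair bounded_linear_ident bounded_linear_zero)
 then show ?thesis by simp
qed

lemma C_inf_on_fst: "open W \<Longrightarrow> C_inf_on W f \<Longrightarrow> C_inf_on W (\<lambda>x. fst (f x))"
 by (rule C_inf_on_linear_compose[OF _ _ bounded_linear_fst])

lemma C_inf_on_snd: "open W \<Longrightarrow> C_inf_on W f \<Longrightarrow> C_inf_on W (\<lambda>x. snd (f x))"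
 by (rule C_inf_on_linear_compose[OF _ _ bounded_linear_snd])

lemma C_inf_on_inverse:
 assumes "open W" "C_inf_on W f" "\<And>x. x \<in> W \<Longrightarrow> f x \<noteq> (0::real)"
 shows "C_inf_on W (\<lambda>x. inverse (f x))"
 unfolding C_inf_on_def
proof
 fix k show "Ck_on k W (\<lambda>x. inverse (f x))"
 proof (induct k)
  case 0
  then show ?case using assms C_inf_on_continuous_on by (auto intro!: continuous_intros)
 next
  case (Suc k)
  show ?case
  proof (rule Ck_on_SucI[OF assms(1)])
   show "((\<lambda>x. inverse (f x)) has_derivative (\<lambda>v. (-1) * (inverse (f x) * (FD f x v * inverse (f x))))) (at x)"
    if "x \<in> W" for x
    using Deriv.has_derivative_inverse[OF assms(3)[OF that] C_inf_on_has_derivative[OF assms(2) that]]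
    by (simp add: mult.assoc)
   show "Ck_on k W (\<lambda>x. (-1) * (inverse (f x) * (FD f x v * inverse (f x))))" for v
    by (intro Ck_on_mult Suc assms Ck_on_const C_inf_onD[OF C_inf_on_FD])
  qed
 qed
qed

section \<open>Inverses of families of linear maps and the smooth inverse function theorem\<close>

lemma linear_two_sided_inverse:
 assumes "linear L" "\<And>u. L (K u) = u" "\<And>u. K (L u) = u"
 shows "linear K"
proof (rule linearI)
 fix a b r
 show "K (a + b) = K a + K b"
  using assms(3)[of "K a + K b"] by (simp add: linear_add[OF assms(1)] assms(2))
 show "K (r *\<^sub>R a) = r *\<^sub>R K a"
  using assms(3)[of "r *\<^sub>R K a"] by (simp add: linear_scale[OF assms(1)] assms(2))
qed

text \<open>In finite dimension the errors on the basis vectors bound the operator norm of the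
  error, so continuity in each fixed direction is enough.\<close>

lemma linear_family_close:
 fixes L :: "'a::euclidean_space \<Rightarrow> 'b::euclidean_space \<Rightarrow> 'c::euclidean_space"
 assumes W: "open W" and L: "\<And>x. x \<in> W \<Longrightarrow> linear (L x)" "\<And>u. continuous_on W (\<lambda>x. L x u)"
  and x0: "x0 \<in> W" and e: "e > 0"
 obtains r where "r > 0" "ball x0 r \<subseteq> W" "\<And>x u. x \<in> ball x0 r \<Longrightarrow> norm (L x u - L x0 u) \<le> e * norm u"
proof -
 let ?N = "\<lambda>x. \<Sum>b\<in>Basis. norm (L x b - L x0 b)"
 have "open (W \<inter> ?N -` {..<e})"
  by (intro continuous_open_preimage W continuous_intros L open_lessThan)
 then obtain r where r: "r > 0" "ball x0 r \<subseteq> W \<inter> ?N -` {..<e}" using x0 e by (auto elim: openE)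
 show ?thesis
 proof (rule that[OF r(1)])
  fix x u assume "x \<in> ball x0 r"
  then have x: "x \<in> W" "?N x \<le> e" using r by auto
  have lin: "linear (\<lambda>u. L x u - L x0 u)" by (intro linear_compose_sub L x x0)
  have "norm (L x u - L x0 u) \<le> (\<Sum>b\<in>Basis. norm ((u \<bullet> b) *\<^sub>R (L x b - L x0 b)))"
   by (subst linear_basis_expand[OF lin]) (rule norm_sum)
  also have "\<dots> \<le> (\<Sum>b\<in>Basis. norm u * norm (L x b - L x0 b))"
   by (intro sum_mono) (auto simp: Basis_le_norm intro!: mult_right_mono)
  also have "\<dots> \<le> e * norm u" unfolding sum_distrib_left[symmetric] mult.commute[of e] by (intro mult_left_mono x) simp
  finally show "norm (L x u - L x0 u) \<le> e * norm u" .
 qed (use r in auto)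
qed

lemma inverse_family_bounded:
 fixes L :: "'a::euclidean_space \<Rightarrow> 'b::euclidean_space \<Rightarrow> 'b"
 assumes "open W" "\<And>x. x \<in> W \<Longrightarrow> linear (L x)" "\<And>u. continuous_on W (\<lambda>x. L x u)"
  "inj (L x0)" "x0 \<in> W"
 obtains c r where "c > 0" "r > 0" "ball x0 r \<subseteq> W"
  "\<And>x u. x \<in> ball x0 r \<Longrightarrow> c * norm u \<le> norm (L x u)" "\<And>x. x \<in> ball x0 r \<Longrightarrow> inj (L x)"
proof -
 obtain c where c: "c > 0" "\<And>u. c * norm u \<le> norm (L x0 u)"
  using linear_inj_bounded_below_pos[OF assms(2)[OF assms(5)] assms(4)]
  by (metis mult.commute)
 then have "c / 2 > 0" by simp
 from linear_family_close[OF assms(1-3,5) this]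
 obtain r where r: "r > 0" "ball x0 r \<subseteq> W" "\<And>x u. x \<in> ball x0 r \<Longrightarrow> norm (L x u - L x0 u) \<le> c / 2 * norm u" by blast
 have b: "c/2 * norm u \<le> norm (L x u)" if "x \<in> ball x0 r" for x u
  using c(2)[of u] r(3)[OF that, of u] norm_triangle_sub[of "L x0 u" "L x u"] by (simp add: norm_minus_commute)
 have "inj (L x)" if x: "x \<in> ball x0 r" for x
  unfolding linear_injective_0[OF assms(2)[OF subsetD[OF r(2) x]]]
  using b[OF x] c(1) by (metis \<open>c / 2 > 0\<close> mult_pos_pos norm_zero not_less zero_less_norm_iff)
 then show ?thesis using that[OF _ r(1,2) b] c(1) by simp
qed

text \<open>Where one factor vanishes, the product rule needs only continuity of the other: the
  error f(y) (g(y) - g(x)) is of smaller order than y - x. This allows an inverse family to be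
  differentiated when so far only its continuity is known.\<close>

lemma has_derivative_scaleR_vanishing:
 fixes f :: "'a::real_normed_vector \<Rightarrow> real" and g :: "'a \<Rightarrow> 'b::real_normed_vector"
 assumes f: "(f has_derivative f') (at x)" "f x = 0" and g: "isCont g x"
 shows "((\<lambda>y. f y *\<^sub>R g y) has_derivative (\<lambda>h. f' h *\<^sub>R g x)) (at x)"
proof -
 obtain K where K: "K > 0" "\<And>h. norm (f' h) \<le> norm h * K"
  using bounded_linear.pos_bounded[OF has_derivative_bounded_linear[OF f(1)]] by blast
 let ?r = "\<lambda>y. norm (f y - f x - f' (y - x)) / norm (y - x)"
 have "((\<lambda>y. (?r y + K) * norm (g y - g x)) \<longlongrightarrow> (0 + K) * norm (g x - g x)) (at x)"
  using f(1) g unfolding has_derivative_iff_norm isCont_def by (intro tendsto_intros) auto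
 then have lim: "((\<lambda>y. (?r y + K) * norm (g y - g x)) \<longlongrightarrow> 0) (at x)" by simp
 have "((\<lambda>y. f y *\<^sub>R (g y - g x)) has_derivative (\<lambda>h. 0)) (at x)"
  unfolding has_derivative_iff_norm
 proof (intro conjI bounded_linear_zero Lim_null_comparison[OF _ lim] always_eventually allI)
  fix y
  have "norm (f y) \<le> norm (f y - f x - f' (y - x)) + norm (y - x) * K"
   using norm_triangle_ineq[of "f y - f x - f' (y - x)" "f' (y - x)"] K(2)[of "y - x"] f(2) by simp
  then have "norm (f y) / norm (y - x) \<le> ?r y + K"
   by (cases "y = x") (simp_all add: f(2) field_simps less_imp_le K(1))
  then show "norm (norm (f y *\<^sub>R (g y - g x) - f x *\<^sub>R (g x - g x) - 0) / norm (y - x)) \<le> (?r y + K) * norm (g y - g x)"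
   using mult_right_mono[of _ _ "norm (g y - g x)"] by (fastforce simp: f(2))
 qed
 from has_derivative_add[OF has_derivative_scaleR_left[OF f(1), of "g x"] this]
 show ?thesis by (simp add: algebra_simps)
qed

text \<open>Everything rests on K y - K x = - K y (L y - L x) K x. The uniform lower bound for L y
  near x gives continuity of K; since L y - L x vanishes at y = x, continuity of K then suffices for
  the derivative.\<close>

lemma inverse_family_has_derivative:
 fixes L :: "'a::euclidean_space \<Rightarrow> 'b::euclidean_space \<Rightarrow> 'b"
 assumes W: "open W" and L: "\<And>x. x \<in> W \<Longrightarrow> linear (L x)"
  and C: "\<And>u. Ck_on (Suc 0) W (\<lambda>x. L x u)"
  and K: "\<And>x u. x \<in> W \<Longrightarrow> L x (K x u) = u" "\<And>x u. x \<in> W \<Longrightarrow> K x (L x u) = u"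
  and x: "x \<in> W"
 shows "isCont (\<lambda>y. K y v) x"
  "((\<lambda>y. K y v) has_derivative (\<lambda>h. - K x (FD (\<lambda>y. L y (K x v)) x h))) (at x)"
proof -
 have lK: "linear (K x)" if "x \<in> W" for x
  by (rule linear_two_sided_inverse[OF L[OF that]]) (use K that in auto)
 have inj: "inj (L x)" using K x by (metis injI)
 obtain c r where cr: "c > 0" "r > 0" "ball x r \<subseteq> W"
  "\<And>y u. y \<in> ball x r \<Longrightarrow> c * norm u \<le> norm (L y u)"
  using inverse_family_bounded[OF W L Ck_on_continuous_on[OF C] inj x] by metis
 have diffK: "K y u - K x u = - K y (L y (K x u) - L x (K x u))" if "y \<in> W" for y u
  using K x that linear_diff[OF lK[OF that]] by simp
 have contK: "isCont (\<lambda>y. K y u) x" for u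
 proof -
  have "isCont (\<lambda>y. L y (K x u)) x"
   using Ck_on_continuous_on[OF C] W x continuous_on_eq_continuous_at by blast
  then have "((\<lambda>y. norm (L y (K x u) - L x (K x u)) / c) \<longlongrightarrow> norm (L x (K x u) - L x (K x u)) / c) (at x)"
   unfolding isCont_def by (intro tendsto_intros) (use cr in auto)
  then have lim: "((\<lambda>y. norm (L y (K x u) - L x (K x u)) / c) \<longlongrightarrow> 0) (at x)" by simp
  have "((\<lambda>y. K y u - K x u) \<longlongrightarrow> 0) (at x)"
  proof (rule Lim_null_comparison[OF _ lim], unfold eventually_at, intro exI[of _ r] conjI ballI impI)
   fix y assume "y \<noteq> x \<and> dist y x < r"
   then have y: "y \<in> ball x r" "y \<in> W" using cr(3) by (auto simp: dist_commute)
   have "c * norm (K y u - K x u) \<le> norm (L y (K x u) - L x (K x u))"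
    using cr(4)[OF y(1), of "K y u - K x u"] K(1)[OF y(2)] K(1)[OF x] linear_diff[OF L[OF y(2)]]
    by (simp add: norm_minus_commute)
   then show "norm (K y u - K x u) \<le> norm (L y (K x u) - L x (K x u)) / c"
    using cr(1) by (simp add: field_simps)
  qed (use cr in auto)
  then show ?thesis unfolding isCont_def by (rule LIM_zero_cancel)
 qed
 then show "isCont (\<lambda>y. K y v) x" .
 let ?l = "\<lambda>y. L y (K x v)"
 have dl: "(?l has_derivative FD ?l x) (at x)"
  using C x by (intro Ck_on_has_derivative[where k=0]) auto
 have "((\<lambda>y. (?l y - ?l x) \<bullet> b) has_derivative (\<lambda>h. FD ?l x h \<bullet> b)) (at x)" for b
  using has_derivative_inner_left[OF has_derivative_diff[OF dl has_derivative_const]] by simp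
 then have "((\<lambda>y. K x v - (\<Sum>b\<in>Basis. ((?l y - ?l x) \<bullet> b) *\<^sub>R K y b)) has_derivative
   (\<lambda>h. 0 - (\<Sum>b\<in>Basis. (FD ?l x h \<bullet> b) *\<^sub>R K x b))) (at x)"
  by (intro has_derivative_diff has_derivative_sum has_derivative_scaleR_vanishing contK has_derivative_const) auto
 then have "((\<lambda>y. K y v) has_derivative (\<lambda>h. 0 - (\<Sum>b\<in>Basis. (FD ?l x h \<bullet> b) *\<^sub>R K x b))) (at x)"
 proof (rule has_derivative_transform_within_open[OF _ W x])
  fix y assume y: "y \<in> W"
  have aux: "b - d = a" if "a - b = - d" for a b d :: 'b using that by (simp add: diff_eq_eq)
  have "K y v - K x v = - (\<Sum>b\<in>Basis. ((?l y - ?l x) \<bullet> b) *\<^sub>R K y b)"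
   unfolding linear_basis_expand[OF lK[OF y], of "?l y - ?l x", symmetric] by (rule diffK[OF y])
  then show "K x v - (\<Sum>b\<in>Basis. ((?l y - ?l x) \<bullet> b) *\<^sub>R K y b) = K y v" by (rule aux)
 qed
 then show "((\<lambda>y. K y v) has_derivative (\<lambda>h. - K x (FD ?l x h))) (at x)"
  by (simp add: linear_basis_expand[OF lK[OF x], symmetric])
qed

text \<open>The derivative - K (DL) K contains K itself but no derivative of K, so regularity
  bootstraps. The order \<open>max 1 k\<close> appears because continuity of the inverse is taken
  from the differentiability lemma, which asks for a C^1 family.\<close>

lemma Ck_on_inverse_family:
 fixes L :: "'a::euclidean_space \<Rightarrow> 'b::euclidean_space \<Rightarrow> 'b"
 assumes W: "open W" and L: "\<And>x. x \<in> W \<Longrightarrow> linear (L x)"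
  and C: "\<And>u. Ck_on (max 1 k) W (\<lambda>x. L x u)"
  and K: "\<And>x u. x \<in> W \<Longrightarrow> L x (K x u) = u" "\<And>x u. x \<in> W \<Longrightarrow> K x (L x u) = u"
 shows "Ck_on k W (\<lambda>x. K x v)"
 using C
proof (induct k arbitrary: v)
 case 0
 have "isCont (\<lambda>y. K y v) x" if "x \<in> W" for x
  by (rule inverse_family_has_derivative[OF W L _ K that]) (use 0 in auto)
 then show ?case by (simp add: continuous_at_imp_continuous_on)
next
 case (Suc k)
 have C1: "Ck_on (Suc 0) W (\<lambda>x. L x u)" for u
  by (rule Ck_on_mono[OF Suc.prems]) simp
 have Ck: "Ck_on (max 1 k) W (\<lambda>x. L x u)" for u
  by (rule Ck_on_mono[OF Suc.prems]) simp
 have Csk: "Ck_on (Suc k) W (\<lambda>x. L x u)" for u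
  by (rule Ck_on_mono[OF Suc.prems]) simp
 have IH: "Ck_on k W (\<lambda>x. K x v)" for v by (rule Suc.hyps[OF Ck])
 have lK: "linear (K x)" if "x \<in> W" for x
  by (rule linear_two_sided_inverse[OF L[OF that]]) (use K that in auto)
 have expK: "K x u = (\<Sum>b\<in>Basis. (u \<bullet> b) *\<^sub>R K x b)" if "x \<in> W" for x u
  using linear_basis_expand[OF lK[OF that]] .
 let ?d = "\<lambda>x h. - K x (FD (\<lambda>y. L y (K x v)) x h)"
 have eq: "?d x h = (-1) *\<^sub>R (\<Sum>b\<in>Basis. ((\<Sum>c\<in>Basis. (K x v \<bullet> c) *\<^sub>R FD (\<lambda>y. L y c) x h) \<bullet> b) *\<^sub>R K x b)"
  if x: "x \<in> W" for x h
 proof -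
  have "((\<lambda>y. \<Sum>c\<in>Basis. (K x v \<bullet> c) *\<^sub>R L y c) has_derivative
   (\<lambda>h. \<Sum>c\<in>Basis. (K x v \<bullet> c) *\<^sub>R FD (\<lambda>y. L y c) x h)) (at x)"
   by (intro has_derivative_sum has_derivative_scaleR_right Ck_on_has_derivative[OF C1 x])
  then have "((\<lambda>y. L y (K x v)) has_derivative
   (\<lambda>h. \<Sum>c\<in>Basis. (K x v \<bullet> c) *\<^sub>R FD (\<lambda>y. L y c) x h)) (at x)"
   by (rule has_derivative_transform_within_open[OF _ W x])
    (use linear_basis_expand[OF L] in auto)
  then have "FD (\<lambda>y. L y (K x v)) x = (\<lambda>h. \<Sum>c\<in>Basis. (K x v \<bullet> c) *\<^sub>R FD (\<lambda>y. L y c) x h)"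
   by (rule frechet_derivative_at[symmetric])
  then show ?thesis by (subst expK[OF x]) simp
 qed
 have "Ck_on k W (\<lambda>x. (-1) *\<^sub>R (\<Sum>b\<in>Basis. ((\<Sum>c\<in>Basis. (K x v \<bullet> c) *\<^sub>R FD (\<lambda>y. L y c) x h) \<bullet> b) *\<^sub>R K x b))" for h
  by (intro Ck_on_scaleR Ck_on_sum Ck_on_inner Ck_on_const IH W) (use Csk in auto)
 then have "Ck_on k W (\<lambda>x. ?d x h)" for h
  by (rule Ck_on_cong[OF W, rotated]) (use eq in auto)
 then show ?case
  by (intro Ck_on_SucI[OF W inverse_family_has_derivative(2)[OF W L C1 K]]) auto
qed

lemma C_inf_on_inverse_family:
 fixes L :: "'a::euclidean_space \<Rightarrow> 'b::euclidean_space \<Rightarrow> 'b"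
 assumes "open W" "\<And>x. x \<in> W \<Longrightarrow> linear (L x)"
  "\<And>u. C_inf_on W (\<lambda>x. L x u)"
  "\<And>x u. x \<in> W \<Longrightarrow> L x (K x u) = u" "\<And>x u. x \<in> W \<Longrightarrow> K x (L x u) = u"
 shows "C_inf_on W (\<lambda>x. K x v)"
 unfolding C_inf_on_def
 by (rule allI) (rule Ck_on_inverse_family[of W L, OF assms(1,2) C_inf_onD[OF assms(3)] assms(4,5)])

lemma C_inf_on_onorm_continuous:
 assumes S: "open S" "C_inf_on S f" "a \<in> S" and e: "e > 0"
 shows "\<exists>d>0. \<forall>x. dist a x < d \<longrightarrow> onorm (\<lambda>v. FD f x v - FD f a v) < e"
proof -
 have lin: "linear (FD f x)" if "x \<in> S" for x
  using C_inf_on_has_derivative[OF S(2) that] by (rule has_derivative_linear)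
 have "e / 2 > 0" using e by simp
 from linear_family_close[OF S(1) lin C_inf_on_continuous_on[OF C_inf_on_FD[OF S(2)]] S(3) this]
 obtain d where d: "d > 0" "\<And>x v. x \<in> ball a d \<Longrightarrow> norm (FD f x v - FD f a v) \<le> e / 2 * norm v" by metis
 have "onorm (\<lambda>v. FD f x v - FD f a v) \<le> e / 2" if "dist a x < d" for x
  by (rule onorm_le[OF d(2)]) (use that in simp)
 then show ?thesis using d(1) e by (intro exI[of _ d]) force
qed

text \<open>Local injectivity comes from the continuity of the derivative at x0, openness of the
  image from invariance of domain, and smoothness from DH = (DG)^{-1} o H: once H is C^k, so is its
  derivative.\<close>

theorem smooth_inverse_function:
 fixes G :: "'a::euclidean_space \<Rightarrow> 'a"
 assumes W: "open W" and G: "C_inf_on W G" and x0: "x0 \<in> W" and inj: "inj (FD G x0)"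
 obtains U H where "open U" "x0 \<in> U" "U \<subseteq> W" "inj_on G U" "open (G ` U)" "C_inf_on (G ` U) H"
  "\<And>x. x \<in> U \<Longrightarrow> H (G x) = x" "\<And>x. x \<in> U \<Longrightarrow> inj (FD G x)"
proof -
 have lin: "linear (FD G x)" if "x \<in> W" for x
  using C_inf_on_has_derivative[OF G that] by (rule has_derivative_linear)
 obtain g' where g': "linear g'" "g' \<circ> FD G x0 = id"
  using linear_injective_left_inverse[OF lin[OF x0] inj] by blast
 obtain r where r: "r > 0" "ball x0 r \<subseteq> W" "inj_on G (ball x0 r)"
 proof (rule has_derivative_locally_injective[where f'="FD G" and f=G, OF x0 W _ g'(2)])
  show "bounded_linear g'" using g' linear_conv_bounded_linear by blast
  show "(G has_derivative FD G x) (at x)" if "x \<in> W" for x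
   using C_inf_on_has_derivative[OF G that] .
  show "\<exists>d>0. \<forall>x. dist x0 x < d \<longrightarrow> onorm (\<lambda>v. FD G x v - FD G x0 v) < e" if "e > 0" for e
   using C_inf_on_onorm_continuous[OF W G x0 that] .
 qed
 obtain d where d: "d > 0" "\<And>x. x \<in> ball x0 d \<Longrightarrow> inj (FD G x)"
  using inverse_family_bounded[OF W lin C_inf_on_continuous_on[OF C_inf_on_FD[OF G]] inj x0] by metis
 define U where "U = ball x0 (min r d)"
 have U: "open U" "x0 \<in> U" "U \<subseteq> W" "inj_on G U"
  using r d unfolding U_def by (auto intro: inj_on_subset)
 have injU: "inj (FD G x)" if "x \<in> U" for x using d(2) that by (simp add: U_def)
 have contU: "continuous_on U G"
  using C_inf_on_continuous_on[OF G] U continuous_on_subset by blast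
 have op: "open (G ` U)" by (rule invariance_of_domain[OF contU U(1) U(4)])
 define H where "H = inv_into U G"
 have HG: "H (G x) = x" if "x \<in> U" for x
  using that U(4) by (simp add: H_def)
 have HU: "H y \<in> U" "G (H y) = y" if "y \<in> G ` U" for y
  using that HG by auto
 define K where "K = (\<lambda>y. inv (FD G (H y)))"
 have K: "FD G (H y) (K y u) = u" "K y (FD G (H y) u) = u" if "y \<in> G ` U" for y u
 proof -
  have "inj (FD G (H y))" using injU HU(1)[OF that] by blast
  moreover have "surj (FD G (H y))"
   using calculation lin HU(1)[OF that] U(3) linear_injective_imp_surjective by blast
  ultimately show "FD G (H y) (K y u) = u" "K y (FD G (H y) u) = u"
   by (simp_all add: K_def surj_f_inv_f)
 qed
 have dH: "(H has_derivative K y) (at y)" if y: "y \<in> G ` U" for y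
 proof (rule has_derivative_inverse_strong_x[where f=G and g=H and y=y, OF U(1) HU(1)[OF y] contU])
  show "(G has_derivative FD G (H y)) (at (H y))"
   using C_inf_on_has_derivative[OF G] HU(1)[OF y] U(3) by blast
  show "FD G (H y) \<circ> K y = id" using K(1)[OF y] by auto
 qed (use HG HU y in auto)
 have "Ck_on k (G ` U) H" for k
 proof (induct k)
  case 0
  have "isCont H y" if "y \<in> G ` U" for y
   using dH[OF that] by (rule has_derivative_continuous)
  then show ?case by (simp add: continuous_at_imp_continuous_on)
 next
  case (Suc k)
  note IH = this
  have "C_inf_on U (\<lambda>z. inv (FD G z) v)" for v
   by (rule C_inf_on_inverse_family[where L="FD G", OF U(1) lin[OF subsetD[OF U(3)]] C_inf_on_subset[OF C_inf_on_FD[OF G] U(3)]])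
    (use K HG in \<open>force simp: K_def\<close>)+
  then have "Ck_on k (G ` U) (\<lambda>y. K y v)" for v
   unfolding K_def by (intro Ck_on_compose[OF op U(1) IH C_inf_onD]) (use HU in auto)
  then show ?case by (intro Ck_on_SucI[OF op dH])
 qed
 then have "C_inf_on (G ` U) H" by (simp add: C_inf_on_def)
 then show ?thesis using that[OF U(1-4) op _ HG injU] by blast
qed

lemma has_vector_derivative_chain:
 assumes "(f has_derivative f') (at (p t))" "(p has_vector_derivative w) (at t within S)"
 shows "((\<lambda>t. f (p t)) has_vector_derivative f' w) (at t within S)"
proof -
 have "((\<lambda>t. f (p t)) has_derivative (\<lambda>h. f' (h *\<^sub>R w))) (at t within S)"
  using has_derivative_compose[OF assms(2)[unfolded has_vector_derivative_def] assms(1)] .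
 then show ?thesis
  using has_derivative_linear[OF assms(1)] by (simp add: has_vector_derivative_def linear_scale)
qed

section \<open>Smooth dependence of flows on initial values\<close>

text \<open>Star-shaped towards t = 0 in the time variable alone, as integration from 0 to t at
  fixed x requires.\<close>

definition time_star :: "(real \<times> 'a::euclidean_space) set \<Rightarrow> bool" where
 "time_star Q \<longleftrightarrow> (\<forall>q\<in>Q. \<forall>\<theta>\<in>{0..1}. (\<theta> * fst q, snd q) \<in> Q)"

text \<open>The weight \<theta>^j makes the class closed under differentiation: each derivative in t
  brings down one more factor \<theta>.\<close>

definition time_avg :: "nat \<Rightarrow> (real \<times> 'a::euclidean_space \<Rightarrow> 'b::euclidean_space) \<Rightarrow> real \<times> 'a \<Rightarrow> 'b" where
 "time_avg j u q = integral {0..1} (\<lambda>\<theta>. \<theta> ^ j *\<^sub>R u (\<theta> * fst q, snd q))"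

text \<open>The antiderivative \<open>\<integral>\<^sub>0\<^sup>t u(s, x) ds\<close>, rescaled to the unit interval so that the sign of \<open>t\<close>
 does not matter.\<close>

definition time_int :: "(real \<times> 'a::euclidean_space \<Rightarrow> 'b::euclidean_space) \<Rightarrow> real \<times> 'a \<Rightarrow> 'b" where
 "time_int u q = fst q *\<^sub>R time_avg 0 u q"

lemma time_starD: "time_star Q \<Longrightarrow> q \<in> Q \<Longrightarrow> \<theta> \<in> {0..1} \<Longrightarrow> (\<theta> * fst q, snd q) \<in> Q"
 by (auto simp: time_star_def)

lemma time_star_scale: "time_star Q \<Longrightarrow> (t, x) \<in> Q \<Longrightarrow> 0 \<le> \<theta> \<Longrightarrow> \<theta> \<le> 1 \<Longrightarrow> (\<theta> * t, x) \<in> Q"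
 using time_starD[of Q "(t, x)" \<theta>] by simp

lemma time_star_box: "time_star ({-a<..<a} \<times> B)"
 unfolding time_star_def
proof (intro ballI)
 fix q \<theta> assume q: "q \<in> {-a<..<a} \<times> B" "\<theta> \<in> {0..1::real}"
 then have "\<bar>\<theta> * fst q\<bar> \<le> 1 * \<bar>fst q\<bar>" unfolding abs_mult by (intro mult_right_mono) auto
 then show "(\<theta> * fst q, snd q) \<in> {-a<..<a} \<times> B" using q by (auto simp: abs_less_iff)
qed

lemma linear_time_space:
 fixes f :: "real \<times> 'a::real_vector \<Rightarrow> 'b::real_vector"
 assumes "linear f"
 shows "f v = fst v *\<^sub>R f (1, 0) + f (0, snd v)"
 using linear_add[OF assms, of "fst v *\<^sub>R (1, 0)" "(0, snd v)"] linear_scale[OF assms, of "fst v" "(1, 0)"] by simp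

lemma continuous_on_time_scaled:
 assumes "time_star Q" "continuous_on Q u" "S \<subseteq> Q"
 shows "continuous_on (S \<times> {0..1}) (\<lambda>p. u (snd p * fst (fst p), snd (fst p)))"
 by (rule continuous_on_compose2[OF assms(2)])
  (use assms in \<open>auto intro!: continuous_intros time_star_scale[OF assms(1)] simp: subset_iff\<close>)

lemma continuous_on_time_slice:
 assumes "time_star Q" "continuous_on Q u" "q \<in> Q"
 shows "continuous_on {0..1} (\<lambda>\<theta>. u (\<theta> * fst q, snd q))"
 by (rule continuous_on_compose2[OF assms(2)])
  (use assms in \<open>auto intro!: continuous_intros simp: time_star_def\<close>)

lemma time_slice_integrable:
 fixes u :: "real \<times> 'a::euclidean_space \<Rightarrow> 'b::euclidean_space"
 assumes "time_star Q" "continuous_on Q u" "q \<in> Q"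
 shows "(\<lambda>\<theta>. \<theta> ^ j *\<^sub>R u (\<theta> * fst q, snd q)) integrable_on {0..1}"
 by (intro integrable_continuous_real continuous_intros continuous_on_time_slice[OF assms])

lemma continuous_on_time_avg:
 assumes "time_star Q" "continuous_on Q u"
 shows "continuous_on Q (time_avg j u)"
proof -
 have "continuous_on (Q \<times> cbox 0 1) (\<lambda>(q, \<theta>). \<theta> ^ j *\<^sub>R u (\<theta> * fst q, snd q))"
  using continuous_on_time_scaled[OF assms subset_refl]
  by (auto simp: case_prod_beta intro!: continuous_intros)
 from integral_continuous_on_param[OF this] show ?thesis
  by (simp add: time_avg_def[abs_def])
qed

lemma time_avg_has_derivative:
 fixes u :: "real \<times> 'a::euclidean_space \<Rightarrow> 'b::euclidean_space"
 assumes Q: "open Q" "time_star Q" and u: "Ck_on 1 Q u" and q: "q \<in> Q"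
 shows "(time_avg j u has_derivative (\<lambda>v. fst v *\<^sub>R time_avg (Suc j) (\<lambda>q. FD u q (1, 0)) q
   + time_avg j (\<lambda>q. FD u q (0, snd v)) q)) (at q)"
proof -
 obtain r where r: "r > 0" "ball q r \<subseteq> Q" using Q q openE by blast
 have du: "(u has_derivative FD u p) (at p)" if "p \<in> Q" for p
  using u that by (intro Ck_on_has_derivative[where k=0]) auto
 have cu: "continuous_on Q u" using u Ck_on_continuous_on by blast
 have cD: "continuous_on Q (\<lambda>q. FD u q v)" for v
  using u unfolding One_nat_def Ck_on.simps by blast
 have lin: "linear (FD u p)" if "p \<in> Q" for p using du[OF that] has_derivative_linear by blast
 let ?s = "\<lambda>q \<theta>. (\<theta> * fst q, snd q) :: real \<times> 'a"
 define fx where "fx p \<theta> = Blinfun (\<lambda>v. \<theta> ^ j *\<^sub>R FD u (?s p \<theta>) (?s v \<theta>))" for p \<theta>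
 have ds: "((\<lambda>q. ?s q \<theta>) has_derivative (\<lambda>q. ?s q \<theta>)) (at p)" for p \<theta>
  by (intro bounded_linear_imp_has_derivative bounded_linear_Pair bounded_linear_snd
    bounded_linear_const_mult bounded_linear_fst)
 have dj: "((\<lambda>q. \<theta> ^ j *\<^sub>R u (?s q \<theta>)) has_derivative (\<lambda>v. \<theta> ^ j *\<^sub>R FD u (?s p \<theta>) (?s v \<theta>))) (at p)"
  if "p \<in> Q" "\<theta> \<in> {0..1}" for p \<theta>
  by (intro has_derivative_scaleR_right has_derivative_compose[OF ds du] time_starD Q that)
 have fx: "blinfun_apply (fx p \<theta>) = (\<lambda>v. \<theta> ^ j *\<^sub>R FD u (?s p \<theta>) (?s v \<theta>))"
  if "p \<in> Q" "\<theta> \<in> {0..1}" for p \<theta>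
  unfolding fx_def using has_derivative_bounded_linear[OF dj[OF that]] by (simp add: bounded_linear_Blinfun_apply)
 have split: "FD u (?s p \<theta>) (?s v \<theta>) = (\<theta> * fst v) *\<^sub>R FD u (?s p \<theta>) (1, 0) + FD u (?s p \<theta>) (0, snd v)"
  if "p \<in> Q" "\<theta> \<in> {0..1}" for p v \<theta>
  using linear_time_space[OF lin[OF time_starD[OF Q(2) that]], of "(\<theta> * fst v, snd v)"] by simp
 have cont: "continuous_on (ball q r \<times> cbox 0 1) (\<lambda>(p, \<theta>). fx p \<theta>)"
 proof (rule continuous_on_blinfun_componentwise)
  fix i :: "real \<times> 'a"
  have "continuous_on (ball q r \<times> {0..1}) (\<lambda>z. snd z ^ j *\<^sub>R ((snd z * fst i) *\<^sub>R FD u (?s (fst z) (snd z)) (1, 0)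
    + FD u (?s (fst z) (snd z)) (0, snd i)))"
   by (intro continuous_intros continuous_on_time_scaled[OF Q(2) cD r(2)])
  then show "continuous_on (ball q r \<times> cbox 0 1) (\<lambda>x. blinfun_apply (case x of (p, \<theta>) \<Rightarrow> fx p \<theta>) i)"
   unfolding box_real
  proof (rule continuous_on_eq)
   fix z :: "(real \<times> 'a) \<times> real" assume z: "z \<in> ball q r \<times> {0..1}"
   then have p: "fst z \<in> Q" "snd z \<in> {0..1}" using r by auto
   show "snd z ^ j *\<^sub>R ((snd z * fst i) *\<^sub>R FD u (?s (fst z) (snd z)) (1, 0)
    + FD u (?s (fst z) (snd z)) (0, snd i)) = blinfun_apply (case z of (p, \<theta>) \<Rightarrow> fx p \<theta>) i"
    using split[OF p, of i] fx[OF p] by (simp add: case_prod_beta)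
  qed
 qed
 have int: "(\<lambda>\<theta>. fx q \<theta>) integrable_on {0..1}"
 proof (rule integrable_continuous_real)
  have "continuous_on {0..1::real} (Pair q)" by (intro continuous_intros)
  then show "continuous_on {0..1} (fx q)"
   using continuous_on_compose2[OF cont, of "{0..1}" "Pair q"] r by (auto simp: image_subset_iff)
 qed
 have "((\<lambda>p. integral (cbox 0 1) (\<lambda>\<theta>. \<theta> ^ j *\<^sub>R u (?s p \<theta>))) has_derivative
   integral (cbox 0 1) (fx q)) (at q within ball q r)"
 proof (rule leibniz_rule[OF _ _ cont])
  fix p \<theta> assume "p \<in> ball q r" "\<theta> \<in> cbox (0::real) 1"
  then have p: "p \<in> Q" "\<theta> \<in> {0..1}" using r by auto
  show "((\<lambda>q. \<theta> ^ j *\<^sub>R u (?s q \<theta>)) has_derivative blinfun_apply (fx p \<theta>)) (at p within ball q r)"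
   unfolding fx[OF p] using dj[OF p] by (rule has_derivative_at_withinI)
 next
  show "(\<lambda>\<theta>. \<theta> ^ j *\<^sub>R u (?s p \<theta>)) integrable_on cbox 0 1" if "p \<in> ball q r" for p
   using time_slice_integrable[OF Q(2) cu] that r by auto
 qed (use r in auto)
 then have "(time_avg j u has_derivative integral {0..1} (fx q)) (at q)"
  using r by (simp add: time_avg_def[abs_def] at_within_open[of q "ball q r"])
 moreover have "blinfun_apply (integral {0..1} (fx q)) v =
   fst v *\<^sub>R time_avg (Suc j) (\<lambda>q. FD u q (1, 0)) q + time_avg j (\<lambda>q. FD u q (0, snd v)) q" for v
 proof -
  have "integral {0..1} (\<lambda>\<theta>. fx q \<theta> v) =
   integral {0..1} (\<lambda>\<theta>. fst v *\<^sub>R (\<theta> ^ Suc j *\<^sub>R FD u (?s q \<theta>) (1, 0)) + \<theta> ^ j *\<^sub>R FD u (?s q \<theta>) (0, snd v))"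
   by (rule integral_cong) (simp add: fx q split algebra_simps)
  also have "\<dots> = fst v *\<^sub>R time_avg (Suc j) (\<lambda>q. FD u q (1, 0)) q + time_avg j (\<lambda>q. FD u q (0, snd v)) q"
   unfolding time_avg_def
   by (subst integral_add[OF integrable_cmul[OF time_slice_integrable[OF Q(2) cD q]]
      time_slice_integrable[OF Q(2) cD q]]) (simp only: integral_cmul)
  finally show ?thesis using blinfun_apply_integral[OF int] by simp
 qed
 ultimately show ?thesis by (rule has_derivative_eq_rhs[OF _ ext])
qed

text \<open>Integrate the derivative of \<theta> u(\<theta> t, x) over the unit interval. The
  identity is what makes the time derivative of \<open>time_int u\<close> equal to u.\<close>

lemma time_avg_parts:
 fixes u :: "real \<times> 'a::euclidean_space \<Rightarrow> 'b::euclidean_space"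
 assumes Q: "open Q" "time_star Q" and u: "Ck_on 1 Q u" and q: "q \<in> Q"
 shows "time_avg 0 u q + fst q *\<^sub>R time_avg 1 (\<lambda>q. FD u q (1, 0)) q = u q"
proof -
 have du: "(u has_derivative FD u p) (at p)" if "p \<in> Q" for p
  using u that by (intro Ck_on_has_derivative[where k=0]) auto
 have cu: "continuous_on Q u" using u Ck_on_continuous_on by blast
 have cD: "continuous_on Q (\<lambda>q. FD u q v)" for v
  using u unfolding One_nat_def Ck_on.simps by blast
 have "((\<lambda>\<theta>. \<theta> *\<^sub>R u (\<theta> * fst q, snd q)) has_vector_derivative
   \<theta> *\<^sub>R FD u (\<theta> * fst q, snd q) (fst q, 0) + 1 *\<^sub>R u (\<theta> * fst q, snd q)) (at \<theta> within {0..1})"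
  if "\<theta> \<in> {0..1}" for \<theta>
 proof -
  have "((\<lambda>\<theta>. (\<theta> * fst q, snd q)) has_vector_derivative (fst q, 0)) (at \<theta> within {0..1})"
   by (auto intro!: derivative_eq_intros has_vector_derivative_Pair simp: has_real_derivative_iff_has_vector_derivative[symmetric])
  from has_vector_derivative_chain[where p="\<lambda>\<theta>. (\<theta> * fst q, snd q)", OF du[OF time_starD[OF Q(2) q that]] this]
  show ?thesis
   by (intro has_vector_derivative_scaleR) (auto intro!: derivative_eq_intros)
 qed
 from fundamental_theorem_of_calculus[OF _ this]
 have *: "((\<lambda>\<theta>. \<theta> *\<^sub>R FD u (\<theta> * fst q, snd q) (fst q, 0) + 1 *\<^sub>R u (\<theta> * fst q, snd q)) has_integral u q) {0..1}"
  by simp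
 have s: "FD u (\<theta> * fst q, snd q) (fst q, 0) = fst q *\<^sub>R FD u (\<theta> * fst q, snd q) (1, 0)" if "\<theta> \<in> {0..1}" for \<theta>
  using linear_scale[OF has_derivative_linear[OF du[OF time_starD[OF Q(2) q that]]], of "fst q" "(1, 0)"] by simp
 have "u q = integral {0..1} (\<lambda>\<theta>. fst q *\<^sub>R (\<theta> ^ 1 *\<^sub>R FD u (\<theta> * fst q, snd q) (1, 0)) + \<theta> ^ 0 *\<^sub>R u (\<theta> * fst q, snd q))"
  unfolding integral_unique[OF *, symmetric] by (rule integral_cong) (simp add: s algebra_simps)
 also have "\<dots> = fst q *\<^sub>R time_avg 1 (\<lambda>q. FD u q (1, 0)) q + time_avg 0 u q"
  unfolding time_avg_def
  by (subst integral_add[OF integrable_cmul[OF time_slice_integrable[OF Q(2) cD q]]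
     time_slice_integrable[OF Q(2) cu q]]) (simp only: integral_cmul)
 finally show ?thesis by simp
qed

lemma continuous_on_time_int:
 "time_star Q \<Longrightarrow> continuous_on Q u \<Longrightarrow> continuous_on Q (time_int u)"
 unfolding time_int_def[abs_def] by (intro continuous_intros continuous_on_time_avg)

lemma time_int_has_derivative:
 fixes u :: "real \<times> 'a::euclidean_space \<Rightarrow> 'b::euclidean_space"
 assumes Q: "open Q" "time_star Q" and u: "Ck_on 1 Q u" and q: "q \<in> Q"
 shows "(time_int u has_derivative (\<lambda>v. fst v *\<^sub>R u q + time_int (\<lambda>q. FD u q (0, snd v)) q)) (at q)"
proof -
 have "(time_int u has_derivative (\<lambda>v. fst q *\<^sub>R (fst v *\<^sub>R time_avg (Suc 0) (\<lambda>q. FD u q (1, 0)) q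
   + time_avg 0 (\<lambda>q. FD u q (0, snd v)) q) + fst v *\<^sub>R time_avg 0 u q)) (at q)"
  unfolding time_int_def[abs_def]
  by (intro has_derivative_scaleR time_avg_has_derivative[OF assms] has_derivative_fst has_derivative_ident)
 moreover have "fst q *\<^sub>R (fst v *\<^sub>R time_avg (Suc 0) (\<lambda>q. FD u q (1, 0)) q
   + time_avg 0 (\<lambda>q. FD u q (0, snd v)) q) + fst v *\<^sub>R time_avg 0 u q
   = fst v *\<^sub>R u q + time_int (\<lambda>q. FD u q (0, snd v)) q" for v
  unfolding time_avg_parts[OF assms, symmetric] time_int_def by (simp add: algebra_simps)
 ultimately show ?thesis by simp
qed

lemma time_int_cong:
 assumes "time_star Q" "q \<in> Q" "\<And>q. q \<in> Q \<Longrightarrow> u q = v q"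
 shows "time_int u q = time_int v q"
 unfolding time_int_def time_avg_def
 by (intro arg_cong[where f="\<lambda>x. fst q *\<^sub>R x"] integral_cong) (use assms time_starD[OF assms(1,2)] in auto)

lemma Ck_on_time_avg:
 assumes Q: "open Q" "time_star Q"
 shows "Ck_on k Q u \<Longrightarrow> Ck_on k Q (time_avg j u)"
proof (induct k arbitrary: u j)
 case 0
 then show ?case using continuous_on_time_avg[OF Q(2)] by simp
next
 case (Suc k)
 have C1: "Ck_on 1 Q u" by (rule Ck_on_mono[OF Suc.prems]) simp
 have FD: "Ck_on k Q (\<lambda>q. FD u q v)" for v using Suc.prems unfolding Ck_on.simps by blast
 show ?case
  by (rule Ck_on_SucI[OF Q(1) time_avg_has_derivative[OF Q C1]]; (assumption)?)
   (intro Ck_on_add Ck_on_scaleR Suc.hyps Q Ck_on_const FD)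
qed

lemma Ck_on_time_int:
 assumes Q: "open Q" "time_star Q" and u: "Ck_on k Q u"
 shows "Ck_on k Q (time_int u)"
 unfolding time_int_def[abs_def]
 by (intro Ck_on_scaleR Ck_on_time_avg Q u Ck_on_bounded_linear bounded_linear_fst)

lemma time_int_FD:
 fixes g :: "real \<times> 'a::euclidean_space \<Rightarrow> 'b::euclidean_space"
 assumes Q: "open Q" "time_star Q" and g: "Ck_on 1 Q g" and q: "q \<in> Q"
 shows "time_int (\<lambda>q. FD g q (1, 0)) q = g q - g (0, snd q)"
proof -
 have "((\<lambda>\<theta>. g (\<theta> * fst q, snd q)) has_vector_derivative fst q *\<^sub>R FD g (\<theta> * fst q, snd q) (1, 0)) (at \<theta> within {0..1})"
  if "\<theta> \<in> {0..1}" for \<theta>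
 proof -
  have dg: "(g has_derivative FD g (\<theta> * fst q, snd q)) (at (\<theta> * fst q, snd q))"
   using g time_starD[OF Q(2) q that] by (intro Ck_on_has_derivative[where k=0]) auto
  have "((\<lambda>\<theta>. (\<theta> * fst q, snd q)) has_vector_derivative (fst q, 0)) (at \<theta> within {0..1})"
   by (auto intro!: derivative_eq_intros has_vector_derivative_Pair simp: has_real_derivative_iff_has_vector_derivative[symmetric])
  from has_vector_derivative_chain[where p="\<lambda>\<theta>. (\<theta> * fst q, snd q)", OF dg this]
  show ?thesis using linear_scale[OF has_derivative_linear[OF dg], of "fst q" "(1, 0)"] by simp
 qed
 from integral_unique[OF fundamental_theorem_of_calculus[OF _ this]] show ?thesis
  by (simp add: time_int_def time_avg_def)
qed

lemma time_int_zero: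
 assumes "time_star Q" "q \<in> Q" "\<And>q. q \<in> Q \<Longrightarrow> u q = 0"
 shows "time_int u q = 0"
proof -
 have "time_avg 0 u q = integral {0..1::real} (\<lambda>\<theta>. 0)"
  unfolding time_avg_def by (rule integral_cong) (use assms time_starD[OF assms(1,2)] in simp)
 then show ?thesis by (simp add: time_int_def)
qed

text \<open>Differentiate \<open>f(y + t v) - f(y) = \<integral>\<^sub>0\<^sup>t \<partial>\<^sub>v f(y + s v) ds\<close> in the direction \<open>u\<close> and then in \<open>t\<close>.\<close>

lemma symmetric_second_derivative:
 fixes f :: "'a::euclidean_space \<Rightarrow> 'b::euclidean_space"
 assumes W: "open W" and f: "C_inf_on W f" and x: "x \<in> W"
 shows "FD (\<lambda>y. FD f y u) x v = FD (\<lambda>y. FD f y v) x u"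
proof -
 obtain r where r: "r > 0" "ball x r \<subseteq> W" using W x openE by blast
 \<comment> \<open>Chosen so that |t| |v| stays below r/2; the summand 1 covers v = 0.\<close>
 define \<delta> where "\<delta> = r / 2 / (1 + norm v)"
 have v1: "1 + norm v > 0" by (simp add: add_pos_nonneg)
 have \<delta>: "\<delta> > 0" "\<delta> * (1 + norm v) = r / 2"
  using r v1 unfolding \<delta>_def by (simp, metis less_irrefl nonzero_eq_divide_eq)
 define Q where "Q = {-\<delta><..<\<delta>} \<times> ball x (r / 2)"
 have Q: "open Q" "time_star Q" unfolding Q_def by (auto intro: open_Times time_star_box)
 let ?p = "\<lambda>q. snd q + fst q *\<^sub>R v"
 have pW: "?p q \<in> W" if "q \<in> Q" for q
 proof -
  have "\<bar>fst q\<bar> * norm v \<le> \<delta> * (1 + norm v)" using that \<delta>(1) by (intro mult_mono) (auto simp: Q_def)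
  moreover have "norm (snd q - x) < r / 2" using that by (auto simp: Q_def dist_norm norm_minus_commute)
  ultimately have "norm ((snd q - x) + fst q *\<^sub>R v) < r"
   using norm_triangle_ineq[of "snd q - x" "fst q *\<^sub>R v"] \<delta>(2) by simp
  then show ?thesis using r(2) by (auto simp: dist_norm norm_minus_commute algebra_simps)
 qed
 have CQ: "C_inf_on Q (\<lambda>q. F (?p q))" and
  FQ: "q \<in> Q \<Longrightarrow> FD (\<lambda>q. F (?p q)) q = (\<lambda>d. FD F (?p q) (snd d + fst d *\<^sub>R v))"
  if F: "C_inf_on W F" for F :: "'a \<Rightarrow> 'b" and q
 proof -
  show "C_inf_on Q (\<lambda>q. F (?p q))"
   by (rule C_inf_on_compose[OF Q(1) W _ F])
    (use pW in \<open>auto intro!: Q C_inf_on_add C_inf_on_scaleR C_inf_on_fst C_inf_on_snd C_inf_on_ident C_inf_on_const\<close>)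
  assume "q \<in> Q"
  have "(?p has_derivative ?p) (at q)" by (auto intro!: derivative_eq_intros)
  from has_derivative_compose[OF this C_inf_on_has_derivative[OF F pW[OF \<open>q \<in> Q\<close>]]]
  show "FD (\<lambda>q. F (?p q)) q = (\<lambda>d. FD F (?p q) (snd d + fst d *\<^sub>R v))" by (rule frechet_derivative_at[symmetric])
 qed
 note fv = C_inf_on_FD[OF f, of v] and fu = C_inf_on_FD[OF f, of u]
 let ?h = "\<lambda>q. FD f (?p q) v" and ?w = "\<lambda>q. FD (\<lambda>y. FD f y v) (?p q) u"
 have dT: "(time_int k has_derivative (\<lambda>d. fst d *\<^sub>R k q + time_int (\<lambda>q. FD k q (0, snd d)) q)) (at q)"
  if "C_inf_on Q k" "q \<in> Q" for k :: "real \<times> 'a \<Rightarrow> 'b" and q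
  by (rule time_int_has_derivative[OF Q C_inf_onD[OF that(1)] that(2)])
 have eq: "FD f (?p q) u - FD f (snd q) u = time_int ?w q" if q: "q \<in> Q" for q
 proof -
  have "f (?p q) - f (snd q) = time_int ?h q" if "q \<in> Q" for q
   using time_int_FD[OF Q C_inf_onD[OF CQ[OF f]] that] time_int_cong[OF Q(2) that, of "\<lambda>q. FD (\<lambda>q. f (?p q)) q (1, 0)" ?h]
   by (simp add: FQ[OF f])
  then have 1: "((\<lambda>q. f (?p q) - f (snd q)) has_derivative
    (\<lambda>d. fst d *\<^sub>R ?h q + time_int (\<lambda>q. FD ?h q (0, snd d)) q)) (at q)"
   using has_derivative_transform_within_open[OF dT[OF CQ[OF fv] q] Q(1) q] by simp
  have sW: "snd q \<in> W" using q r by (auto simp: Q_def)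
  have "((\<lambda>q. f (?p q) - f (snd q)) has_derivative (\<lambda>d. FD (\<lambda>q. f (?p q)) q d - FD f (snd q) (snd d))) (at q)"
   by (intro has_derivative_diff C_inf_on_has_derivative[OF CQ[OF f] q]
     has_derivative_compose[OF has_derivative_snd[OF has_derivative_ident] C_inf_on_has_derivative[OF f sW]])
  from fun_cong[OF has_derivative_unique[OF this 1], of "(0, u)"]
  show ?thesis using time_int_cong[OF Q(2) q, of "\<lambda>q. FD ?h q (0, u)" ?w] q by (simp add: FQ[OF f] FQ[OF fv])
 qed
 have q0: "(0, x) \<in> Q" using r \<delta> by (simp add: Q_def)
 have path: "((\<lambda>t. (t, x)) has_derivative (\<lambda>t. (t, 0))) (at 0)" by (auto intro!: derivative_eq_intros)
 have "((\<lambda>t. time_int ?w (t, x)) has_derivative (\<lambda>t. t *\<^sub>R ?w (0, x) + time_int (\<lambda>q. FD ?w q (0, 0)) (0, x))) (at 0)"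
  using has_derivative_compose[OF path dT[OF CQ[OF C_inf_on_FD[OF fv, of u]] q0]] by simp
 then have 1: "((\<lambda>t. FD f (x + t *\<^sub>R v) u - FD f x u) has_derivative
   (\<lambda>t. t *\<^sub>R ?w (0, x) + time_int (\<lambda>q. FD ?w q (0, 0)) (0, x))) (at 0)"
  by (rule has_derivative_transform_within_open[of _ _ _ _ "{-\<delta><..<\<delta>}"]) (use eq[of "(_, x)"] r \<delta> in \<open>auto simp: Q_def\<close>)
 have "((\<lambda>t. FD f (x + t *\<^sub>R v) u - FD f x u) has_derivative (\<lambda>t. FD (\<lambda>y. FD f y u) (x + 0 *\<^sub>R v) (t *\<^sub>R v) - 0)) (at 0)"
  by (intro has_derivative_diff has_derivative_const has_derivative_compose[OF _ C_inf_on_has_derivative[OF fu]])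
   (use x in \<open>auto intro!: derivative_eq_intros\<close>)
 from fun_cong[OF has_derivative_unique[OF this 1], of 1] show ?thesis by (simp add: time_int_def)
qed

lemma norm_time_int_le:
 assumes "time_star Q" "continuous_on Q u" "q \<in> Q"
  and "\<And>\<theta>. \<theta> \<in> {0..1} \<Longrightarrow> norm (u (\<theta> * fst q, snd q)) \<le> B"
 shows "norm (time_int u q) \<le> \<bar>fst q\<bar> * B"
proof -
 have "norm (time_avg 0 u q) \<le> B * (1 - 0)"
  unfolding time_avg_def
  using integral_bound[of 0 1 "\<lambda>\<theta>. u (\<theta> * fst q, snd q)" B] continuous_on_time_slice[OF assms(1-3)] assms(4)
  by simp
 then show ?thesis by (simp add: time_int_def mult_left_mono)
qed

lemma time_int_diff:
 assumes "time_star Q" "continuous_on Q u" "continuous_on Q v" "q \<in> Q"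
 shows "time_int u q - time_int v q = time_int (\<lambda>q. u q - v q) q"
 unfolding time_int_def time_avg_def
 using time_slice_integrable[OF assms(1,2,4), of 0] time_slice_integrable[OF assms(1,3,4), of 0]
 by (simp add: integral_diff scaleR_diff_right)

text \<open>An estimate on K for an integral from time 0 needs the integrand on all time segments
  ending in K; these form a compact set again.\<close>

lemma compact_time_hull:
 assumes "compact K" "K \<subseteq> Q" "time_star Q"
 shows "compact ((\<lambda>p. (snd p * fst (fst p), snd (fst p))) ` (K \<times> {0..1::real}))"
  "(\<lambda>p. (snd p * fst (fst p), snd (fst p))) ` (K \<times> {0..1}) \<subseteq> Q"
  "K \<subseteq> (\<lambda>p. (snd p * fst (fst p), snd (fst p))) ` (K \<times> {0..1})"
proof -
 show "compact ((\<lambda>p. (snd p * fst (fst p), snd (fst p))) ` (K \<times> {0..1::real}))"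
  by (intro compact_continuous_image compact_Times assms continuous_intros) auto
 show "(\<lambda>p. (snd p * fst (fst p), snd (fst p))) ` (K \<times> {0..1}) \<subseteq> Q"
  using assms by (auto intro!: time_star_scale[OF assms(3)] simp: subset_iff)
 show "K \<subseteq> (\<lambda>p. (snd p * fst (fst p), snd (fst p))) ` (K \<times> {0..1})"
  by (rule subsetI, rule_tac x="(x, 1)" in image_eqI) auto
qed

subsection \<open>Geometric convergence of all derivatives\<close>

text \<open>The ratio 3/4 is any number strictly between 1/2 and 1. Picard iteration on a short time
  interval halves the error, and when it is differentiated, inhomogeneous terms decaying like
  (3/4)^m enter; the gap between 1/2 and 3/4 absorbs them, so one ratio serves derivatives of all
  orders.\<close>

definition geo_conv :: "'a::euclidean_space set \<Rightarrow> (nat \<Rightarrow> 'a \<Rightarrow> 'b::euclidean_space) \<Rightarrow> bool" where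
 "geo_conv Q u \<longleftrightarrow> (\<forall>m. continuous_on Q (u m)) \<and>
   (\<forall>K. compact K \<and> K \<subseteq> Q \<longrightarrow> (\<exists>C. \<forall>m. \<forall>x\<in>K. norm (u (Suc m) x - u m x) \<le> C * (3/4) ^ m))"

primrec Ck_conv :: "nat \<Rightarrow> 'a::euclidean_space set \<Rightarrow> (nat \<Rightarrow> 'a \<Rightarrow> 'b::euclidean_space) \<Rightarrow> bool" where
 "Ck_conv 0 Q u \<longleftrightarrow> geo_conv Q u"
| "Ck_conv (Suc k) Q u \<longleftrightarrow> geo_conv Q u \<and> (\<forall>m. \<forall>x\<in>Q. u m differentiable (at x)) \<and>
   (\<forall>v. Ck_conv k Q (\<lambda>m x. FD (u m) x v))"

lemma geo_conv_cont: "geo_conv Q u \<Longrightarrow> continuous_on Q (u m)"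
 by (simp add: geo_conv_def)

lemma geo_convE:
 assumes "geo_conv Q u" "compact K" "K \<subseteq> Q"
 obtains C where "C \<ge> 0" "\<And>m x. x \<in> K \<Longrightarrow> norm (u (Suc m) x - u m x) \<le> C * (3/4) ^ m"
proof -
 obtain C where C: "\<forall>m. \<forall>x\<in>K. norm (u (Suc m) x - u m x) \<le> C * (3/4) ^ m"
  using assms unfolding geo_conv_def by blast
 show ?thesis
 proof (rule that[of "\<bar>C\<bar>"])
  fix m x assume "x \<in> K"
  then have "norm (u (Suc m) x - u m x) \<le> C * (3/4) ^ m" using C by blast
  also have "\<dots> \<le> \<bar>C\<bar> * (3/4) ^ m" by (intro mult_right_mono) auto
  finally show "norm (u (Suc m) x - u m x) \<le> \<bar>C\<bar> * (3/4) ^ m" .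
 qed simp
qed

text \<open>The factor 4 is 1 / (1 - 3/4), from the geometric series.\<close>

lemma geo_sum_bound:
 fixes f :: "nat \<Rightarrow> 'b::real_normed_vector"
 assumes "\<And>m. norm (f (Suc m) - f m) \<le> C * (3/4) ^ m" "C \<ge> 0"
 shows "norm (f (m + j) - f m) \<le> 4 * C * (3/4) ^ m"
proof -
 have "norm (f (m + j) - f m) \<le> 4 * C * ((3/4) ^ m - (3/4) ^ (m + j))"
 proof (induct j)
  case (Suc j)
  have "norm (f (m + Suc j) - f m) \<le> norm (f (Suc (m + j)) - f (m + j)) + norm (f (m + j) - f m)"
   using norm_triangle_ineq[of "f (Suc (m + j)) - f (m + j)" "f (m + j) - f m"] by simp
  also have "\<dots> \<le> C * (3/4) ^ (m + j) + 4 * C * ((3/4) ^ m - (3/4) ^ (m + j))"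
   by (intro add_mono assms Suc)
  finally show ?case by (simp add: algebra_simps)
 qed simp
 also have "\<dots> \<le> 4 * C * (3/4) ^ m" using assms(2) by (intro mult_left_mono) auto
 finally show ?thesis .
qed

lemma geo_conv_bounded:
 assumes "geo_conv Q u" "compact K" "K \<subseteq> Q"
 obtains B where "B \<ge> 0" "\<And>m x. x \<in> K \<Longrightarrow> norm (u m x) \<le> B"
proof -
 obtain C where C: "C \<ge> 0" "\<And>m x. x \<in> K \<Longrightarrow> norm (u (Suc m) x - u m x) \<le> C * (3/4) ^ m"
  using geo_convE[OF assms] by metis
 have "bounded (u 0 ` K)"
  using assms geo_conv_cont continuous_on_subset by (intro compact_imp_bounded compact_continuous_image) blast+
 then obtain B0 where B0: "\<And>x. x \<in> K \<Longrightarrow> norm (u 0 x) \<le> B0" by (auto simp: bounded_iff)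
 show ?thesis
 proof (rule that[of "\<bar>B0\<bar> + 4 * C"])
  fix m x assume x: "x \<in> K"
  have "norm (u (0 + m) x - u 0 x) \<le> 4 * C * (3/4) ^ 0"
   by (rule geo_sum_bound[where f="\<lambda>m. u m x"]) (use C x in auto)
  then show "norm (u m x) \<le> \<bar>B0\<bar> + 4 * C"
   using B0[OF x] norm_triangle_sub[of "u m x" "u 0 x"] by simp
 qed (use C in simp)
qed

lemma geo_conv_limit:
 assumes "geo_conv Q u"
 obtains U where "\<And>x. x \<in> Q \<Longrightarrow> (\<lambda>m. u m x) \<longlonglongrightarrow> U x"
  "\<And>K. compact K \<Longrightarrow> K \<subseteq> Q \<Longrightarrow> uniform_limit K u U sequentially"
proof -
 have C: "Cauchy (\<lambda>m. u m x)" if x: "x \<in> Q" for x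
 proof -
  obtain C where C: "C \<ge> 0" "\<And>m y. y \<in> {x} \<Longrightarrow> norm (u (Suc m) y - u m y) \<le> C * (3/4) ^ m"
   using geo_convE[OF assms, of "{x}"] x by auto
  have "summable (\<lambda>m. C * (3/4) ^ m)" by (intro summable_mult summable_geometric) auto
  then have "summable (\<lambda>m. u (Suc m) x - u m x)"
   by (rule summable_comparison_test') (use C in auto)
  then have "convergent (\<lambda>m. \<Sum>i<m. u (Suc i) x - u i x)" by (simp add: summable_iff_convergent)
  then have "convergent (\<lambda>m. u m x - u 0 x)"
   using sum_lessThan_telescope[of "\<lambda>m. u m x"] by simp
  then have "convergent (\<lambda>m. u m x - u 0 x + u 0 x)" by (intro convergent_add convergent_const)
  then have "convergent (\<lambda>m. u m x)" by simp
  then show ?thesis by (rule convergent_Cauchy)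
 qed
 define U where "U x = lim (\<lambda>m. u m x)" for x
 have U: "(\<lambda>m. u m x) \<longlonglongrightarrow> U x" if "x \<in> Q" for x
  using C[OF that] by (simp add: U_def Cauchy_convergent_iff convergent_LIMSEQ_iff)
 show ?thesis
 proof (rule that[OF U])
  fix K assume K: "compact K" "K \<subseteq> Q"
  obtain C where C: "C \<ge> 0" "\<And>m x. x \<in> K \<Longrightarrow> norm (u (Suc m) x - u m x) \<le> C * (3/4) ^ m"
   using geo_convE[OF assms K] by metis
  have bd: "norm (u m x - U x) \<le> 4 * C * (3/4) ^ m" if x: "x \<in> K" for m x
  proof -
   have "(\<lambda>j. norm (u (j + m) x - u m x)) \<longlonglongrightarrow> norm (U x - u m x)"
    by (intro tendsto_intros LIMSEQ_ignore_initial_segment U) (use x K in auto)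
   moreover have "norm (u (j + m) x - u m x) \<le> 4 * C * (3/4) ^ m" for j
    using geo_sum_bound[where f="\<lambda>m. u m x" and C=C and m=m and j=j] C x by (simp add: add.commute)
   ultimately have "norm (U x - u m x) \<le> 4 * C * (3/4) ^ m"
    by (intro LIMSEQ_le_const2) auto
   then show ?thesis by (simp add: norm_minus_commute)
  qed
  have "(\<lambda>m. 4 * C * (3/4::real) ^ m) \<longlonglongrightarrow> 4 * C * 0"
   by (intro tendsto_intros LIMSEQ_realpow_zero) auto
  then have z: "(\<lambda>m. 4 * C * (3/4::real) ^ m) \<longlonglongrightarrow> 0" by simp
  show "uniform_limit K u U sequentially"
  proof (rule uniform_limitI)
   fix e :: real assume "e > 0"
   from order_tendstoD(2)[OF z this]
   show "\<forall>\<^sub>F n in sequentially. \<forall>x\<in>K. dist (u n x) (U x) < e"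
    by eventually_elim (use bd in \<open>auto simp: dist_norm intro: le_less_trans\<close>)
  qed
 qed
qed

lemma Ck_conv_geo: "Ck_conv k Q u \<Longrightarrow> geo_conv Q u"
 by (cases k) auto

text \<open>Uniform convergence on closed balls of the derivatives along a basis permits termwise
  differentiation; the induction then proceeds with the limits of the directional
  derivatives.\<close>

theorem Ck_conv_limit:
 assumes "open Q" "Ck_conv k Q u" "\<And>x. x \<in> Q \<Longrightarrow> (\<lambda>m. u m x) \<longlonglongrightarrow> U x"
 shows "Ck_on k Q U"
  "0 < k \<Longrightarrow> x \<in> Q \<Longrightarrow> (\<lambda>m. FD (u m) x v) \<longlonglongrightarrow> FD U x v"
proof -
 have "Ck_on k Q U \<and> (\<forall>x\<in>Q. \<forall>v. 0 < k \<longrightarrow> (\<lambda>m. FD (u m) x v) \<longlonglongrightarrow> FD U x v)"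
  using assms(2,3)
 proof (induct k arbitrary: u U)
  case 0
  then have g: "geo_conv Q u" by simp
  obtain U' where U': "\<And>x. x \<in> Q \<Longrightarrow> (\<lambda>m. u m x) \<longlonglongrightarrow> U' x"
   "\<And>K. compact K \<Longrightarrow> K \<subseteq> Q \<Longrightarrow> uniform_limit K u U' sequentially"
   using geo_conv_limit[OF g] by blast
  have eq: "U x = U' x" if "x \<in> Q" for x using U'(1) 0(2) that LIMSEQ_unique by blast
  have "isCont U x" if x: "x \<in> Q" for x
  proof -
   obtain r where r: "r > 0" "cball x r \<subseteq> Q" using assms(1) x open_contains_cball by blast
   have "continuous_on (cball x r) U'"
    by (rule uniform_limit_theorem[OF _ U'(2)])
     (use r g in \<open>auto intro!: always_eventually intro: continuous_on_subset[OF geo_conv_cont]\<close>)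
   then have "continuous_on (cball x r) U"
    by (rule continuous_on_eq) (use eq r in auto)
   then show ?thesis by (rule continuous_on_interior) (use r in simp)
  qed
  then show ?case by (simp add: continuous_at_imp_continuous_on)
 next
  case (Suc k)
  have geo: "geo_conv Q (\<lambda>m x. FD (u m) x b)" for b
   using Suc.prems(1) Ck_conv_geo[of k Q "\<lambda>m x. FD (u m) x b"] by auto
  have "\<exists>w. \<forall>x\<in>Q. (\<lambda>m. FD (u m) x b) \<longlonglongrightarrow> w x" for b
   by (rule geo_conv_limit[OF geo]) blast
  then obtain W where W: "\<And>b x. x \<in> Q \<Longrightarrow> (\<lambda>m. FD (u m) x b) \<longlonglongrightarrow> W b x" by metis
  have du: "(u m has_derivative FD (u m) x) (at x)" if "x \<in> Q" for m x
   using Suc.prems(1) that by (simp add: frechet_derivative_works)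
  have lin: "linear (FD (u m) x)" if "x \<in> Q" for m x
   using du[OF that] has_derivative_linear by blast
  let ?g = "\<lambda>x h. \<Sum>b\<in>Basis. (h \<bullet> b) *\<^sub>R W b x"
  have W_eq: "W v x = ?g x v" if "x \<in> Q" for v x
  proof -
   have "(\<lambda>m. \<Sum>b\<in>Basis. (v \<bullet> b) *\<^sub>R FD (u m) x b) \<longlonglongrightarrow> ?g x v"
    by (intro tendsto_intros W that)
   then show ?thesis
    using LIMSEQ_unique[OF W[OF that, of v]] linear_basis_expand[OF lin[OF that], of _ v] by simp
  qed
  have dU: "(U has_derivative ?g x) (at x)" if x: "x \<in> Q" for x
  proof -
   obtain r where r: "r > 0" "cball x r \<subseteq> Q" using assms(1) x open_contains_cball by blast
   have ul: "uniform_limit (cball x r) (\<lambda>m y. FD (u m) y b) (W b) sequentially" for b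
   proof -
    obtain W' where W': "\<And>x. x \<in> Q \<Longrightarrow> (\<lambda>m. FD (u m) x b) \<longlonglongrightarrow> W' x"
     "\<And>K. compact K \<Longrightarrow> K \<subseteq> Q \<Longrightarrow> uniform_limit K (\<lambda>m y. FD (u m) y b) W' sequentially"
     by (rule geo_conv_limit[OF geo]) blast
    have "W' y = W b y" if "y \<in> cball x r" for y
     using W'(1) W r that LIMSEQ_unique by blast
    then show ?thesis
     using W'(2)[OF compact_cball r(2)]
     by (subst uniform_limit_cong'[where g="\<lambda>m y. FD (u m) y b" and i=W']) auto
   qed
   have "\<exists>g. \<forall>y\<in>cball x r. (\<lambda>m. u m y) \<longlonglongrightarrow> g y \<and> (g has_derivative ?g y) (at y within cball x r)"
   proof (rule has_derivative_sequence)
    show "(u n has_derivative FD (u n) y) (at y within cball x r)" if "y \<in> cball x r" for n y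
     using du that r has_derivative_at_withinI by blast
    show "\<forall>\<^sub>F n in sequentially. \<forall>y\<in>cball x r. \<forall>h. norm (FD (u n) y h - ?g y h) \<le> e * norm h"
     if e: "e > 0" for e
    proof -
     define e' where "e' = e / DIM('a)"
     have "e' > 0" using e by (simp add: e'_def)
     then have "\<forall>\<^sub>F n in sequentially. \<forall>b\<in>Basis. \<forall>y\<in>cball x r. dist (FD (u n) y b) (W b y) < e'"
      using ul by (intro eventually_ball_finite) (auto simp: uniform_limit_iff)
     then show ?thesis
     proof eventually_elim
      case (elim n)
      show ?case
      proof (intro ballI allI)
       fix y h assume y: "y \<in> cball x r"
       then have yQ: "y \<in> Q" using r by auto
       have "norm (FD (u n) y h - ?g y h) = norm (\<Sum>b\<in>Basis. (h \<bullet> b) *\<^sub>R (FD (u n) y b - W b y))"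
        by (subst linear_basis_expand[OF lin[OF yQ]]) (simp add: sum_subtractf scaleR_diff_right)
       also have "\<dots> \<le> (\<Sum>b\<in>(Basis::'a set). norm h * e')"
       proof (rule sum_norm_le)
        fix b :: 'a assume b: "b \<in> Basis"
        have "norm (FD (u n) y b - W b y) \<le> e'"
         using elim y b by (auto simp: dist_norm intro: less_imp_le)
        then show "norm ((h \<bullet> b) *\<^sub>R (FD (u n) y b - W b y)) \<le> norm h * e'"
         using b by (auto simp: Basis_le_norm intro!: mult_mono)
       qed
       also have "\<dots> = e * norm h" by (simp add: e'_def)
       finally show "norm (FD (u n) y h - ?g y h) \<le> e * norm h" .
      qed
     qed
    qed
   qed (use r Suc.prems(2) x in auto)
   then obtain g where g: "\<And>y. y \<in> cball x r \<Longrightarrow> (\<lambda>m. u m y) \<longlonglongrightarrow> g y"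
    "\<And>y. y \<in> cball x r \<Longrightarrow> (g has_derivative ?g y) (at y within cball x r)" by blast
   have "(g has_derivative ?g x) (at x)"
    using has_derivative_subset[OF g(2)[of x], of "ball x r"] r
    by (simp add: ball_subset_cball at_within_open[of x "ball x r"])
   moreover have "g y = U y" if "y \<in> ball x r" for y
    using g(1)[of y] Suc.prems(2)[of y] that r LIMSEQ_unique by (metis ball_subset_cball subset_iff)
   ultimately show ?thesis
    using has_derivative_transform_within_open[of g "?g x" x UNIV "ball x r" U] r by simp
  qed
  have "Ck_on (Suc k) Q U"
  proof (rule Ck_on_SucI[OF assms(1) dU])
   show "Ck_on k Q (\<lambda>x. ?g x v)" for v
    using Suc.hyps[of "\<lambda>m x. FD (u m) x v" "\<lambda>x. ?g x v"] Suc.prems(1) W W_eq by simp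
  qed
  moreover have "(\<lambda>m. FD (u m) x v) \<longlonglongrightarrow> FD U x v" if "x \<in> Q" for x v
   using frechet_derivative_at[OF dU[OF that]] W[OF that, of v] W_eq[OF that, of v] by metis
  ultimately show ?case by blast
 qed
 then show "Ck_on k Q U" "0 < k \<Longrightarrow> x \<in> Q \<Longrightarrow> (\<lambda>m. FD (u m) x v) \<longlonglongrightarrow> FD U x v" by auto
qed

lemma geo_conv_cong:
 "(\<And>m x. x \<in> Q \<Longrightarrow> u m x = v m x) \<Longrightarrow> geo_conv Q u \<Longrightarrow> geo_conv Q v"
 unfolding geo_conv_def by (metis (no_types, lifting) continuous_on_eq subset_iff)

lemma geo_convI:
 assumes "\<And>m. continuous_on Q (u m)"
  "\<And>K. compact K \<Longrightarrow> K \<subseteq> Q \<Longrightarrow> \<exists>C. \<forall>m. \<forall>x\<in>K. norm (u (Suc m) x - u m x) \<le> C * (3/4) ^ m"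
 shows "geo_conv Q u"
 using assms by (simp add: geo_conv_def)

lemma geo_conv_const: "continuous_on Q f \<Longrightarrow> geo_conv Q (\<lambda>_. f)"
 by (rule geo_convI) (auto intro!: exI[of _ 0])

lemma geo_conv_bilinear:
 assumes b: "bounded_bilinear b" and u: "geo_conv Q u" and v: "geo_conv Q v"
 shows "geo_conv Q (\<lambda>m x. b (u m x) (v m x))"
proof (rule geo_convI)
 show "continuous_on Q (\<lambda>x. b (u m x) (v m x))" for m
  by (rule bounded_bilinear.continuous_on[OF b geo_conv_cont[OF u] geo_conv_cont[OF v]])
 fix K assume K: "compact K" "K \<subseteq> Q"
 obtain C where C: "C \<ge> 0" "\<And>m x. x \<in> K \<Longrightarrow> norm (u (Suc m) x - u m x) \<le> C * (3/4) ^ m"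
  using geo_convE[OF u K] by metis
 obtain D where D: "D \<ge> 0" "\<And>m x. x \<in> K \<Longrightarrow> norm (v (Suc m) x - v m x) \<le> D * (3/4) ^ m"
  using geo_convE[OF v K] by metis
 obtain U where U: "U \<ge> 0" "\<And>m x. x \<in> K \<Longrightarrow> norm (u m x) \<le> U"
  using geo_conv_bounded[OF u K] by metis
 obtain V where V: "V \<ge> 0" "\<And>m x. x \<in> K \<Longrightarrow> norm (v m x) \<le> V"
  using geo_conv_bounded[OF v K] by metis
 obtain k where k: "k > 0" "\<And>x y. norm (b x y) \<le> norm x * norm y * k"
  using bounded_bilinear.pos_bounded[OF b] by blast
 show "\<exists>C. \<forall>m. \<forall>x\<in>K. norm (b (u (Suc m) x) (v (Suc m) x) - b (u m x) (v m x)) \<le> C * (3/4) ^ m"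
 proof (intro exI allI ballI)
  fix m x assume x: "x \<in> K"
  have eq: "b (u (Suc m) x) (v (Suc m) x) - b (u m x) (v m x)
    = b (u (Suc m) x - u m x) (v (Suc m) x) + b (u m x) (v (Suc m) x - v m x)"
   by (simp add: bounded_bilinear.diff_left[OF b] bounded_bilinear.diff_right[OF b])
  have "norm (b (u (Suc m) x) (v (Suc m) x) - b (u m x) (v m x))
   \<le> norm (u (Suc m) x - u m x) * norm (v (Suc m) x) * k + norm (u m x) * norm (v (Suc m) x - v m x) * k"
   unfolding eq by (rule order_trans[OF norm_triangle_ineq add_mono[OF k(2) k(2)]])
  also have "\<dots> \<le> C * (3/4) ^ m * V * k + U * (D * (3/4) ^ m) * k"
   using C D U V k x by (intro add_mono mult_right_mono mult_mono) auto
  also have "\<dots> = (C * V * k + U * D * k) * (3/4) ^ m" by (simp add: algebra_simps)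
  finally show "norm (b (u (Suc m) x) (v (Suc m) x) - b (u m x) (v m x)) \<le> (C * V * k + U * D * k) * (3/4) ^ m" .
 qed
qed

lemma geo_conv_add:
 assumes u: "geo_conv Q u" and v: "geo_conv Q v"
 shows "geo_conv Q (\<lambda>m x. u m x + v m x)"
proof (rule geo_convI)
 show "continuous_on Q (\<lambda>x. u m x + v m x)" for m
  by (intro continuous_intros geo_conv_cont[OF u] geo_conv_cont[OF v])
 fix K assume K: "compact K" "K \<subseteq> Q"
 obtain C where C: "C \<ge> 0" "\<And>m x. x \<in> K \<Longrightarrow> norm (u (Suc m) x - u m x) \<le> C * (3/4) ^ m"
  using geo_convE[OF u K] by metis
 obtain D where D: "D \<ge> 0" "\<And>m x. x \<in> K \<Longrightarrow> norm (v (Suc m) x - v m x) \<le> D * (3/4) ^ m"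
  using geo_convE[OF v K] by metis
 show "\<exists>C. \<forall>m. \<forall>x\<in>K. norm (u (Suc m) x + v (Suc m) x - (u m x + v m x)) \<le> C * (3/4) ^ m"
 proof (intro exI allI ballI)
  fix m x assume x: "x \<in> K"
  have "norm (u (Suc m) x + v (Suc m) x - (u m x + v m x)) \<le> C * (3/4) ^ m + D * (3/4) ^ m"
   unfolding add_diff_add by (rule order_trans[OF norm_triangle_ineq add_mono[OF C(2)[OF x] D(2)[OF x]]])
  then show "norm (u (Suc m) x + v (Suc m) x - (u m x + v m x)) \<le> (C + D) * (3/4) ^ m"
   by (simp add: algebra_simps)
 qed
qed

lemma C_inf_on_cball_bounds:
 fixes F :: "'a::euclidean_space \<Rightarrow> 'b::euclidean_space"
 assumes "open W" "C_inf_on W F" "cball p R \<subseteq> W"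
 obtains L where "L \<ge> 0" "\<And>x y. x \<in> cball p R \<Longrightarrow> y \<in> cball p R \<Longrightarrow> norm (F x - F y) \<le> L * norm (x - y)"
  "\<And>x h. x \<in> cball p R \<Longrightarrow> norm (FD F x h) \<le> L * norm h" "\<And>x. x \<in> cball p R \<Longrightarrow> norm (F x) \<le> L"
proof -
 have cD: "continuous_on (cball p R) (\<lambda>x. FD F x b)" for b
  using C_inf_on_continuous_on[OF C_inf_on_FD[OF assms(2)]] assms(3) continuous_on_subset by blast
 have "\<forall>b. \<exists>M. \<forall>x\<in>cball p R. norm (FD F x b) \<le> M"
  using compact_imp_bounded[OF compact_continuous_image[OF cD compact_cball]] by (auto simp: bounded_iff)
 from choice[OF this]
 obtain M where M: "\<And>b x. x \<in> cball p R \<Longrightarrow> norm (FD F x b) \<le> M b" by blast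
 have "bounded (F ` cball p R)"
  by (rule compact_imp_bounded[OF compact_continuous_image[OF
     continuous_on_subset[OF C_inf_on_continuous_on[OF assms(2)] assms(3)] compact_cball]])
 then obtain N where N: "\<And>x. x \<in> cball p R \<Longrightarrow> norm (F x) \<le> N" unfolding bounded_iff by blast
 define L where "L = (\<Sum>b\<in>(Basis::'a set). \<bar>M b\<bar>) + \<bar>N\<bar>"
 have dF: "(F has_derivative FD F x) (at x)" if "x \<in> cball p R" for x
  using C_inf_on_has_derivative[OF assms(2)] assms(3) that by blast
 have bd: "norm (FD F x h) \<le> L * norm h" if x: "x \<in> cball p R" for x h
 proof -
  have "norm (FD F x h) \<le> (\<Sum>b\<in>Basis. norm ((h \<bullet> b) *\<^sub>R FD F x b))"
   by (subst linear_basis_expand[OF has_derivative_linear[OF dF[OF x]]]) (rule norm_sum)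
  also have "\<dots> \<le> (\<Sum>b\<in>Basis. norm h * \<bar>M b\<bar>)"
  proof (rule sum_mono)
   fix b :: 'a assume "b \<in> Basis"
   then show "norm ((h \<bullet> b) *\<^sub>R FD F x b) \<le> norm h * \<bar>M b\<bar>"
    using M[OF x, of b] by (auto simp: Basis_le_norm intro!: mult_mono)
  qed
  also have "\<dots> \<le> L * norm h"
   unfolding L_def sum_distrib_left[symmetric] by (simp add: algebra_simps)
  finally show ?thesis .
 qed
 show ?thesis
 proof (rule that[OF _ _ bd])
  show "L \<ge> 0" unfolding L_def by (intro add_nonneg_nonneg sum_nonneg) auto
  show "norm (F x - F y) \<le> L * norm (x - y)" if "x \<in> cball p R" "y \<in> cball p R" for x y
   by (rule differentiable_bound[OF convex_cball has_derivative_at_withinI[OF dF] onorm_le[OF bd] that])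
  show "norm (F x) \<le> L" if "x \<in> cball p R" for x
  proof -
   have "0 \<le> (\<Sum>b\<in>(Basis::'a set). \<bar>M b\<bar>)" by (intro sum_nonneg) auto
   then show ?thesis using N[OF that] unfolding L_def by linarith
  qed
 qed
qed

lemma geo_conv_compose:
 assumes W: "open W" "C_inf_on W F" "cball p R \<subseteq> W" and u: "geo_conv Q u"
  and uW: "\<And>m x. x \<in> Q \<Longrightarrow> u m x \<in> cball p R"
 shows "geo_conv Q (\<lambda>m x. F (u m x))"
proof (rule geo_convI)
 show "continuous_on Q (\<lambda>x. F (u m x))" for m
  by (rule continuous_on_compose2[OF C_inf_on_continuous_on[OF W(2)] geo_conv_cont[OF u]])
   (use uW W in blast)
 fix K assume K: "compact K" "K \<subseteq> Q"
 obtain C where C: "C \<ge> 0" "\<And>m x. x \<in> K \<Longrightarrow> norm (u (Suc m) x - u m x) \<le> C * (3/4) ^ m"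
  using geo_convE[OF u K] by metis
 obtain L where L: "L \<ge> 0" "\<And>x y. x \<in> cball p R \<Longrightarrow> y \<in> cball p R \<Longrightarrow> norm (F x - F y) \<le> L * norm (x - y)"
  by (rule C_inf_on_cball_bounds[OF W]) blast
 show "\<exists>C. \<forall>m. \<forall>x\<in>K. norm (F (u (Suc m) x) - F (u m x)) \<le> C * (3/4) ^ m"
 proof (intro exI allI ballI)
  fix m x assume x: "x \<in> K"
  have "norm (F (u (Suc m) x) - F (u m x)) \<le> L * norm (u (Suc m) x - u m x)"
   by (rule L(2)) (use uW x K in blast)+
  also have "\<dots> \<le> L * (C * (3/4) ^ m)" by (intro mult_left_mono C L x)
  finally show "norm (F (u (Suc m) x) - F (u m x)) \<le> L * C * (3/4) ^ m" by (simp add: mult.assoc)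
 qed
qed

lemma norm_time_int_le':
 assumes "time_star Q" "continuous_on Q u" "q \<in> Q"
  and "\<And>\<theta>. \<theta> \<in> {0..1} \<Longrightarrow> \<bar>fst q\<bar> * norm (u (\<theta> * fst q, snd q)) \<le> C"
 shows "norm (time_int u q) \<le> C"
proof (cases "fst q = 0")
 case True
 then show ?thesis using assms(4)[of 0] by (simp add: time_int_def)
next
 case False
 have "norm (time_int u q) \<le> \<bar>fst q\<bar> * (C / \<bar>fst q\<bar>)"
  by (rule norm_time_int_le[OF assms(1-3)]) (use assms(4) False in \<open>simp add: field_simps\<close>)
 then show ?thesis using False by simp
qed

lemma geo_conv_time_int:
 assumes Q: "time_star Q" and u: "geo_conv Q u"
 shows "geo_conv Q (\<lambda>m. time_int (u m))"
proof (rule geo_convI)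
 show "continuous_on Q (time_int (u m))" for m
  by (rule continuous_on_time_int[OF Q geo_conv_cont[OF u]])
 fix K assume K: "compact K" "K \<subseteq> Q"
 let ?K = "(\<lambda>p. (snd p * fst (fst p), snd (fst p))) ` (K \<times> {0..1::real})"
 note H = compact_time_hull[OF K Q]
 obtain C where C: "C \<ge> 0" "\<And>m x. x \<in> ?K \<Longrightarrow> norm (u (Suc m) x - u m x) \<le> C * (3/4) ^ m"
  by (rule geo_convE[OF u H(1,2)]) blast
 have "bounded (fst ` K)" by (intro compact_imp_bounded compact_continuous_image K continuous_intros)
 then obtain T where T: "\<And>q. q \<in> K \<Longrightarrow> \<bar>fst q\<bar> \<le> T" by (auto simp: bounded_iff)
 show "\<exists>C. \<forall>m. \<forall>x\<in>K. norm (time_int (u (Suc m)) x - time_int (u m) x) \<le> C * (3/4) ^ m"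
 proof (intro exI allI ballI)
  fix m q assume q: "q \<in> K"
  then have qQ: "q \<in> Q" using K by auto
  have "norm (time_int (u (Suc m)) q - time_int (u m) q) \<le> \<bar>fst q\<bar> * (C * (3/4) ^ m)"
   unfolding time_int_diff[OF Q geo_conv_cont[OF u] geo_conv_cont[OF u] qQ]
  proof (rule norm_time_int_le[OF Q _ qQ])
   show "continuous_on Q (\<lambda>q. u (Suc m) q - u m q)"
    by (intro continuous_intros geo_conv_cont[OF u])
   show "norm (u (Suc m) (\<theta> * fst q, snd q) - u m (\<theta> * fst q, snd q)) \<le> C * (3/4) ^ m"
    if "\<theta> \<in> {0..1}" for \<theta>
    by (rule C(2), rule image_eqI[where x="(q, \<theta>)"]) (use q that in auto)
  qed
  also have "\<dots> \<le> T * (C * (3/4) ^ m)" by (intro mult_right_mono T q) (use C in auto)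
  finally show "norm (time_int (u (Suc m)) q - time_int (u m) q) \<le> T * C * (3/4) ^ m" by (simp add: mult.assoc)
 qed
qed

lemma geo_conv_Suc:
 assumes "geo_conv Q (\<lambda>m. u (Suc m))" "continuous_on Q (u 0)"
 shows "geo_conv Q u"
proof (rule geo_convI)
 show cont: "continuous_on Q (u m)" for m
  using assms geo_conv_cont[OF assms(1)] by (cases m) auto
 fix K assume K: "compact K" "K \<subseteq> Q"
 obtain C where C: "C \<ge> 0" "\<And>m x. x \<in> K \<Longrightarrow> norm (u (Suc (Suc m)) x - u (Suc m) x) \<le> C * (3/4) ^ m"
  using geo_convE[OF assms(1) K] by metis
 have "continuous_on K (\<lambda>x. u 1 x - u 0 x)"
  using cont K continuous_on_subset by (intro continuous_intros) blast+
 then have "bounded ((\<lambda>x. u 1 x - u 0 x) ` K)"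
  using K by (intro compact_imp_bounded compact_continuous_image)
 then obtain B where B: "\<And>x. x \<in> K \<Longrightarrow> norm (u 1 x - u 0 x) \<le> B" by (auto simp: bounded_iff)
 show "\<exists>C. \<forall>m. \<forall>x\<in>K. norm (u (Suc m) x - u m x) \<le> C * (3/4) ^ m"
 proof (intro exI allI ballI)
  fix m x assume x: "x \<in> K"
  show "norm (u (Suc m) x - u m x) \<le> (\<bar>B\<bar> + 2 * C) * (3/4) ^ m"
  proof (cases m)
   case 0
   then show ?thesis using B[OF x] C(1) by auto
  next
   case (Suc j)
   have "norm (u (Suc m) x - u m x) \<le> C * (3/4) ^ j" using C(2)[OF x] Suc by simp
   also have "\<dots> \<le> (\<bar>B\<bar> + 2 * C) * (3/4) * (3/4) ^ j"
    using C(1) by (intro mult_right_mono) auto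
   finally show ?thesis using Suc by (simp add: algebra_simps)
  qed
 qed
qed

text \<open>This is the recursion satisfied by the derivatives of Picard iterates, with a matrix
  given by its columns \<open>a \<beta>\<close>. The hypothesis \<open>small\<close> makes the
  integral term halve the previous error, while the variation of b and a contributes a term of size
  (3/4)^m.\<close>

lemma geo_conv_time_recursion:
 fixes z b :: "nat \<Rightarrow> real \<times> 'a::euclidean_space \<Rightarrow> 'b::euclidean_space"
 assumes Q: "time_star Q"
  and z: "\<And>m q. q \<in> Q \<Longrightarrow> z (Suc m) q = b m q + time_int (\<lambda>p. \<Sum>\<beta>\<in>Basis. (z m p \<bullet> \<beta>) *\<^sub>R a \<beta> m p) q"
  and b: "geo_conv Q b" and a: "\<And>\<beta>. geo_conv Q (a \<beta>)" and z0: "continuous_on Q (z 0)"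
  and small: "\<And>m q p w. q \<in> Q \<Longrightarrow> p \<in> Q \<Longrightarrow> \<bar>fst q\<bar> * norm (\<Sum>\<beta>\<in>Basis. (w \<bullet> \<beta>) *\<^sub>R a \<beta> m p) \<le> norm w / 2"
 shows "geo_conv Q z"
proof (rule geo_convI)
 let ?A = "\<lambda>m p. \<Sum>\<beta>\<in>Basis. (z m p \<bullet> \<beta>) *\<^sub>R a \<beta> m p"
 have cA: "continuous_on Q (?A m)" if "continuous_on Q (z m)" for m
  by (intro continuous_intros that geo_conv_cont[OF a])
 show cont: "continuous_on Q (z m)" for m
 proof (induct m)
  case (Suc m)
  have "continuous_on Q (\<lambda>q. b m q + time_int (?A m) q)"
   by (intro continuous_intros geo_conv_cont[OF b] continuous_on_time_int[OF Q] cA Suc)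
  then show ?case by (rule continuous_on_eq) (simp add: z)
 qed (rule z0)
 fix K0 assume K0: "compact K0" "K0 \<subseteq> Q"
 define K where "K = (\<lambda>p. (snd p * fst (fst p), snd (fst p))) ` (K0 \<times> {0..1::real})"
 have K: "compact K" "K \<subseteq> Q" "K0 \<subseteq> K" using compact_time_hull[OF K0 Q] by (auto simp: K_def)
 have Kst: "(\<theta> * fst q, snd q) \<in> K" if qK: "q \<in> K" and th: "\<theta> \<in> {0..1}" for q \<theta>
 proof -
  obtain z where z: "q = (snd z * fst (fst z), snd (fst z))" "z \<in> K0 \<times> {0..1}"
   using qK unfolding K_def by blast
  then have "(fst z, \<theta> * snd z) \<in> K0 \<times> {0..1}"
   using th by (auto simp: mult_le_one)
  then show ?thesis unfolding K_def by (rule rev_image_eqI) (simp add: z)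
 qed
 obtain Bb where Bb: "Bb \<ge> 0" "\<And>m x. x \<in> K \<Longrightarrow> norm (b m x) \<le> Bb"
  using geo_conv_bounded[OF b K(1,2)] by metis
 obtain Cb where Cb: "Cb \<ge> 0" "\<And>m x. x \<in> K \<Longrightarrow> norm (b (Suc m) x - b m x) \<le> Cb * (3/4) ^ m"
  using geo_convE[OF b K(1,2)] by metis
 have "\<forall>\<beta>. \<exists>C\<ge>0. \<forall>m. \<forall>x\<in>K. norm (a \<beta> (Suc m) x - a \<beta> m x) \<le> C * (3/4) ^ m"
  using geo_convE[OF a K(1,2)] by metis
 from choice[OF this] obtain Ca where Ca: "\<And>\<beta>. Ca \<beta> \<ge> 0"
  "\<And>\<beta> m x. x \<in> K \<Longrightarrow> norm (a \<beta> (Suc m) x - a \<beta> m x) \<le> Ca \<beta> * (3/4) ^ m" by blast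
 have "bounded (fst ` K)" by (intro compact_imp_bounded compact_continuous_image K continuous_intros)
 then obtain T where T: "\<And>q. q \<in> K \<Longrightarrow> \<bar>fst q\<bar> \<le> T" by (auto simp: bounded_iff)
 have "bounded (z 0 ` K)"
  using z0 K continuous_on_subset by (intro compact_imp_bounded compact_continuous_image) blast+
 then obtain Z0 where Z0: "\<And>x. x \<in> K \<Longrightarrow> norm (z 0 x) \<le> Z0" by (auto simp: bounded_iff)
 \<comment> \<open>The bound reproduces itself: Bb + Z / 2 is at most Z.\<close>
 define Z where "Z = \<bar>Z0\<bar> + 2 * Bb"
 have bound: "norm (z m q) \<le> Z" if "q \<in> K" for m q
  using that
 proof (induct m arbitrary: q)
  case 0
  then show ?case using Z0[of q] Bb(1) by (simp add: Z_def)
 next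
  case (Suc m)
  have qQ: "q \<in> Q" using Suc K by auto
  have "norm (time_int (?A m) q) \<le> Z / 2"
  proof (rule norm_time_int_le'[OF Q cA[OF cont] qQ])
   fix \<theta> :: real assume \<theta>: "\<theta> \<in> {0..1}"
   let ?p = "(\<theta> * fst q, snd q)"
   have "\<bar>fst q\<bar> * norm (?A m ?p) \<le> norm (z m ?p) / 2"
    by (rule small[OF qQ]) (use Kst[OF Suc.prems \<theta>] K in blast)
   also have "\<dots> \<le> Z / 2" using Suc.hyps[OF Kst[OF Suc.prems \<theta>]] by simp
   finally show "\<bar>fst q\<bar> * norm (?A m ?p) \<le> Z / 2" .
  qed
  then have "norm (z (Suc m) q) \<le> Bb + Z / 2"
   unfolding z[OF qQ] using Bb(2)[OF Suc.prems, of m] by (meson add_mono norm_triangle_le)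
  also have "\<dots> \<le> Z" by (simp add: Z_def)
  finally show ?case .
 qed
 have Z: "Z \<ge> 0" using Bb(1) by (simp add: Z_def)
 define E where "E = Cb + \<bar>T\<bar> * (Z * (\<Sum>\<beta>\<in>Basis. Ca \<beta>))"
 have E: "E \<ge> 0" unfolding E_def using Cb Z Ca by (intro add_nonneg_nonneg mult_nonneg_nonneg sum_nonneg) auto
 \<comment> \<open>Arranged so that D / 2 + E <= (3/4) D, which closes the induction, and so that D
   >= 2 Z, which starts it.\<close>
 define D where "D = 2 * Z + 4 * E"
 have "norm (z (Suc m) q - z m q) \<le> D * (3/4) ^ m" if "q \<in> K" for m q
  using that
 proof (induct m arbitrary: q)
  case 0
  have "norm (z (Suc 0) q - z 0 q) \<le> Z + Z"
   using bound[OF 0] by (meson add_mono norm_triangle_le_diff)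
  then show ?case using E by (simp add: D_def)
 next
  case (Suc m)
  have qQ: "q \<in> Q" using Suc K by auto
  have "norm (time_int (?A (Suc m)) q - time_int (?A m) q)
    \<le> D * (3/4) ^ m / 2 + \<bar>T\<bar> * (Z * (\<Sum>\<beta>\<in>Basis. Ca \<beta>)) * (3/4) ^ m"
   unfolding time_int_diff[OF Q cA[OF cont] cA[OF cont] qQ]
  proof (rule norm_time_int_le'[OF Q _ qQ])
   show "continuous_on Q (\<lambda>q. ?A (Suc m) q - ?A m q)" by (intro continuous_intros cA cont geo_conv_cont[OF a])
   fix \<theta> :: real assume \<theta>: "\<theta> \<in> {0..1}"
   define p where "p = (\<theta> * fst q, snd q)"
   have pK: "p \<in> K" using Kst[OF Suc.prems \<theta>] by (simp add: p_def)
   then have pQ: "p \<in> Q" using K by auto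
   let ?d = "\<Sum>\<beta>\<in>Basis. ((z (Suc m) p - z m p) \<bullet> \<beta>) *\<^sub>R a \<beta> (Suc m) p"
   let ?e = "\<Sum>\<beta>\<in>Basis. (z m p \<bullet> \<beta>) *\<^sub>R (a \<beta> (Suc m) p - a \<beta> m p)"
   have eq: "?A (Suc m) p - ?A m p = ?d + ?e"
    by (simp add: sum_subtractf[symmetric] sum.distrib[symmetric] algebra_simps)
   have "\<bar>fst q\<bar> * norm ?d \<le> norm (z (Suc m) p - z m p) / 2" by (rule small[OF qQ pQ])
   also have "\<dots> \<le> D * (3/4) ^ m / 2" using Suc.hyps[OF pK] by simp
   finally have d: "\<bar>fst q\<bar> * norm ?d \<le> D * (3/4) ^ m / 2" .
   have "norm ?e \<le> (\<Sum>\<beta>\<in>Basis. Z * (Ca \<beta> * (3/4) ^ m))"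
   proof (rule sum_norm_le)
    fix \<beta> :: 'b assume "\<beta> \<in> Basis"
    then have "\<bar>z m p \<bullet> \<beta>\<bar> \<le> Z" using bound[OF pK, of m] Basis_le_norm[of \<beta> "z m p"] by linarith
    then show "norm ((z m p \<bullet> \<beta>) *\<^sub>R (a \<beta> (Suc m) p - a \<beta> m p)) \<le> Z * (Ca \<beta> * (3/4) ^ m)"
     using Ca(2)[OF pK, of \<beta> m] Z by (auto intro!: mult_mono)
   qed
   then have "\<bar>fst q\<bar> * norm ?e \<le> \<bar>T\<bar> * (\<Sum>\<beta>\<in>Basis. Z * (Ca \<beta> * (3/4) ^ m))"
    using T[OF Suc.prems] by (intro mult_mono) auto
   also have "\<dots> = \<bar>T\<bar> * (Z * (\<Sum>\<beta>\<in>Basis. Ca \<beta>)) * (3/4) ^ m"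
    by (simp add: sum_distrib_left sum_distrib_right mult_ac)
   finally have e: "\<bar>fst q\<bar> * norm ?e \<le> \<bar>T\<bar> * (Z * (\<Sum>\<beta>\<in>Basis. Ca \<beta>)) * (3/4) ^ m" .
   have "\<bar>fst q\<bar> * norm (?d + ?e) \<le> \<bar>fst q\<bar> * norm ?d + \<bar>fst q\<bar> * norm ?e"
    unfolding distrib_left[symmetric] by (intro mult_left_mono norm_triangle_ineq) auto
   then have "\<bar>fst q\<bar> * norm (?A (Suc m) p - ?A m p)
     \<le> D * (3/4) ^ m / 2 + \<bar>T\<bar> * (Z * (\<Sum>\<beta>\<in>Basis. Ca \<beta>)) * (3/4) ^ m"
    unfolding eq using d e by linarith
   then show "\<bar>fst q\<bar> * norm (?A (Suc m) (\<theta> * fst q, snd q) - ?A m (\<theta> * fst q, snd q))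
     \<le> D * (3/4) ^ m / 2 + \<bar>T\<bar> * (Z * (\<Sum>\<beta>\<in>Basis. Ca \<beta>)) * (3/4) ^ m"
    unfolding p_def .
  qed
  moreover have "z (Suc (Suc m)) q - z (Suc m) q = (b (Suc m) q - b m q) + (time_int (?A (Suc m)) q - time_int (?A m) q)"
   by (simp add: z[OF qQ])
  ultimately have "norm (z (Suc (Suc m)) q - z (Suc m) q)
    \<le> Cb * (3/4) ^ m + (D * (3/4) ^ m / 2 + \<bar>T\<bar> * (Z * (\<Sum>\<beta>\<in>Basis. Ca \<beta>)) * (3/4) ^ m)"
   using order_trans[OF norm_triangle_ineq add_mono[OF Cb(2)[OF Suc.prems]]] by presburger
  also have "\<dots> = (D / 2 + E) * (3/4) ^ m" by (simp add: E_def algebra_simps)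
  also have "\<dots> \<le> (D * (3/4)) * (3/4) ^ m" using Z by (intro mult_right_mono) (auto simp: D_def)
  finally show ?case by simp
 qed
 then show "\<exists>C. \<forall>m. \<forall>x\<in>K0. norm (z (Suc m) x - z m x) \<le> C * (3/4) ^ m" using K(3) by blast
qed

lemma Ck_conv_cong:
 assumes "open Q" "\<And>m x. x \<in> Q \<Longrightarrow> u m x = v m x" "Ck_conv k Q u"
 shows "Ck_conv k Q v"
 using assms(2,3)
proof (induct k arbitrary: u v)
 case 0
 then show ?case using geo_conv_cong[of Q u v] by simp
next
 case (Suc k)
 have du: "u m differentiable (at x)" if "x \<in> Q" for m x using Suc.prems that by simp
 have dv: "v m differentiable (at x)" if "x \<in> Q" for m x
 proof -
  from du[OF that] obtain D where "(u m has_derivative D) (at x)" by (auto simp: differentiable_def)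
  then have "(v m has_derivative D) (at x)"
   using has_derivative_transform_within_open assms(1) that Suc.prems(1) by blast
  then show ?thesis by (auto simp: differentiable_def)
 qed
 have eq: "FD (u m) x = FD (v m) x" if "x \<in> Q" for m x
  using frechet_derivative_transform_within_open[of "u m" x Q "v m"] du that assms(1) Suc.prems(1) by simp
 have "Ck_conv k Q (\<lambda>m x. FD (v m) x w)" for w
  by (rule Suc.hyps[of "\<lambda>m x. FD (u m) x w"]) (use Suc.prems eq in auto)
 then show ?case using Suc.prems geo_conv_cong[of Q u v] dv by simp
qed

lemma Ck_conv_SucI:
 assumes "open Q" "geo_conv Q u" "\<And>m x. x \<in> Q \<Longrightarrow> (u m has_derivative f' m x) (at x)"
  "\<And>v. Ck_conv k Q (\<lambda>m x. f' m x v)"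
 shows "Ck_conv (Suc k) Q u"
proof -
 have "Ck_conv k Q (\<lambda>m x. FD (u m) x v)" for v
  by (rule Ck_conv_cong[OF assms(1) _ assms(4)]) (use frechet_derivative_at[OF assms(3)] in auto)
 then show ?thesis using assms(2,3) by (auto simp: differentiable_def)
qed

lemma Ck_conv_SucD: "Ck_conv (Suc k) Q u \<Longrightarrow> Ck_conv k Q u"
proof (induct k arbitrary: u)
 case (Suc k)
 then show ?case by (subst Ck_conv.simps) (metis Ck_conv.simps(2))
qed simp

lemma Ck_conv_Ck_on: "Ck_conv k Q u \<Longrightarrow> Ck_on k Q (u m)"
 by (induct k arbitrary: u) (auto simp: geo_conv_cont simp del: split_paired_All)

lemma Ck_conv_has_derivative: "Ck_conv (Suc k) Q u \<Longrightarrow> x \<in> Q \<Longrightarrow> (u m has_derivative FD (u m) x) (at x)"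
 by (simp add: frechet_derivative_works)

lemma Ck_conv_FD: "Ck_conv (Suc k) Q u \<Longrightarrow> Ck_conv k Q (\<lambda>m x. FD (u m) x v)"
 by simp

lemma Ck_conv_const: "open Q \<Longrightarrow> Ck_on k Q f \<Longrightarrow> Ck_conv k Q (\<lambda>_. f)"
proof (induct k arbitrary: f)
 case 0
 then show ?case by (simp add: geo_conv_const)
next
 case (Suc k)
 then show ?case using geo_conv_const[OF Ck_on_continuous_on[OF Suc.prems(2)]] by auto
qed

lemma Ck_conv_add: "open Q \<Longrightarrow> Ck_conv k Q u \<Longrightarrow> Ck_conv k Q v \<Longrightarrow> Ck_conv k Q (\<lambda>m x. u m x + v m x)"
proof (induct k arbitrary: u v)
 case 0
 then show ?case by (simp add: geo_conv_add)
next
 case (Suc k)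
 show ?case
  by (rule Ck_conv_SucI[OF Suc.prems(1) geo_conv_add[OF Ck_conv_geo[OF Suc.prems(2)] Ck_conv_geo[OF Suc.prems(3)]]
    has_derivative_add[OF Ck_conv_has_derivative[OF Suc.prems(2)] Ck_conv_has_derivative[OF Suc.prems(3)]]
    Suc.hyps[OF Suc.prems(1) Ck_conv_FD[OF Suc.prems(2)] Ck_conv_FD[OF Suc.prems(3)]]])
qed

lemma Ck_conv_bilinear:
 assumes "open Q" and b: "bounded_bilinear b"
 shows "Ck_conv k Q u \<Longrightarrow> Ck_conv k Q v \<Longrightarrow> Ck_conv k Q (\<lambda>m x. b (u m x) (v m x))"
proof (induct k arbitrary: u v)
 case 0
 then show ?case by (simp add: geo_conv_bilinear[OF b])
next
 case (Suc k)
 note p = Suc.prems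
 show ?case
  by (rule Ck_conv_SucI[OF assms(1) geo_conv_bilinear[OF b Ck_conv_geo[OF p(1)] Ck_conv_geo[OF p(2)]]
    bounded_bilinear.FDERIV[OF b Ck_conv_has_derivative[OF p(1)] Ck_conv_has_derivative[OF p(2)]]
    Ck_conv_add[OF assms(1) Suc.hyps[OF Ck_conv_SucD[OF p(1)] Ck_conv_FD[OF p(2)]]
     Suc.hyps[OF Ck_conv_FD[OF p(1)] Ck_conv_SucD[OF p(2)]]]])
qed

lemmas Ck_conv_scaleR = Ck_conv_bilinear[OF _ bounded_bilinear_scaleR]
lemmas Ck_conv_inner = Ck_conv_bilinear[OF _ bounded_bilinear_inner]

lemma Ck_conv_sum:
 "open Q \<Longrightarrow> (\<And>i. i \<in> I \<Longrightarrow> Ck_conv k Q (u i)) \<Longrightarrow> Ck_conv k Q (\<lambda>m x. \<Sum>i\<in>I. u i m x)"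
 by (induct I rule: infinite_finite_induct) (auto intro!: Ck_conv_add Ck_conv_const)

lemma Ck_conv_compose:
 assumes Q: "open Q" and W: "open W" "cball p R \<subseteq> W" and uW: "\<And>m x. x \<in> Q \<Longrightarrow> u m x \<in> cball p R"
 shows "C_inf_on W F \<Longrightarrow> Ck_conv k Q u \<Longrightarrow> Ck_conv k Q (\<lambda>m x. F (u m x))"
proof (induct k arbitrary: F)
 case 0
 then show ?case using geo_conv_compose[OF W(1) _ W(2) _ uW] by simp
next
 case (Suc k)
 note p = Suc.prems
 have d: "((\<lambda>x. F (u m x)) has_derivative (\<lambda>v. \<Sum>b\<in>Basis. (FD (u m) x v \<bullet> b) *\<^sub>R FD F (u m x) b)) (at x)"
  if "x \<in> Q" for m x
 proof -
  have g: "(F has_derivative FD F (u m x)) (at (u m x))"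
   using C_inf_on_has_derivative[OF p(1)] uW[OF that] W by blast
  show ?thesis
   using has_derivative_compose[OF Ck_conv_has_derivative[OF p(2) that] g]
   by (subst (asm) linear_basis_expand[OF has_derivative_linear[OF g]])
 qed
 show ?case
  by (rule Ck_conv_SucI[OF Q geo_conv_compose[OF W(1) p(1) W(2) Ck_conv_geo[OF p(2)] uW] d]; (assumption)?)
   (intro Ck_conv_sum Ck_conv_scaleR Ck_conv_inner Ck_conv_FD[OF p(2)] Ck_conv_const Ck_on_const
    Suc.hyps[OF C_inf_on_FD[OF p(1)] Ck_conv_SucD[OF p(2)]] Q)
qed

lemma Ck_conv_time_int:
 assumes Q: "open Q" "time_star Q"
 shows "Ck_conv k Q u \<Longrightarrow> Ck_conv k Q (\<lambda>m. time_int (u m))"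
proof (induct k arbitrary: u)
 case 0
 then show ?case using geo_conv_time_int[OF Q(2)] by simp
next
 case (Suc k)
 note p = Suc.prems
 have C1: "Ck_on 1 Q (u m)" for m by (rule Ck_on_mono[OF Ck_conv_Ck_on[OF p]]) simp
 show ?case
  by (rule Ck_conv_SucI[OF Q(1) geo_conv_time_int[OF Q(2) Ck_conv_geo[OF p]] time_int_has_derivative[OF Q C1]];
    (assumption)?)
   (intro Ck_conv_add Ck_conv_scaleR Suc.hyps Q Ck_conv_const Ck_on_const Ck_conv_SucD[OF p] Ck_conv_FD[OF p])
qed

lemma Ck_conv_Suc:
 assumes "open Q" "Ck_conv k Q (\<lambda>m. u (Suc m))" "Ck_on k Q (u 0)"
 shows "Ck_conv k Q u"
 using assms(2,3)
proof (induct k arbitrary: u)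
 case 0
 then show ?case using geo_conv_Suc[of Q u] by simp
next
 case (Suc k)
 have "u m differentiable (at x)" if "x \<in> Q" for m x
 proof (cases m)
  case 0
  then show ?thesis using Suc.prems(2) that by simp
 next
  case (Suc j)
  then show ?thesis using Suc.prems(1) that unfolding Ck_conv.simps by blast
 qed
 moreover have "Ck_conv k Q (\<lambda>m x. FD (u m) x v)" for v
  by (rule Suc.hyps) (use Suc.prems in \<open>unfold Ck_conv.simps Ck_on.simps, blast+\<close>)
 ultimately show ?case
  using geo_conv_Suc[OF Ck_conv_geo[OF Suc.prems(1)] Ck_on_continuous_on[OF Suc.prems(2)]] by simp
qed

lemma Ck_conv_time_spaceI:
 fixes u :: "nat \<Rightarrow> real \<times> 'a::euclidean_space \<Rightarrow> 'b::euclidean_space"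
 assumes Q: "open Q" and u: "geo_conv Q u" and d: "\<And>m q. q \<in> Q \<Longrightarrow> (u m has_derivative FD (u m) q) (at q)"
  and "Ck_conv k Q (\<lambda>m q. FD (u m) q (1, 0))" "\<And>v. Ck_conv k Q (\<lambda>m q. FD (u m) q (0, v))"
 shows "Ck_conv (Suc k) Q u"
proof (rule Ck_conv_SucI[OF Q u d])
 fix v :: "real \<times> 'a"
 have "Ck_conv k Q (\<lambda>m q. fst v *\<^sub>R FD (u m) q (1, 0) + FD (u m) q (0, snd v))"
  by (intro Ck_conv_add Ck_conv_scaleR Q Ck_conv_const Ck_on_const assms)
 then show "Ck_conv k Q (\<lambda>m q. FD (u m) q v)"
  by (rule Ck_conv_cong[OF Q, rotated]) (rule linear_time_space[OF has_derivative_linear[OF d], symmetric])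
qed

text \<open>A spatial derivative of z satisfies a recursion with the same coefficients a, hence the
  same smallness, and with the derivatives of a paired with z as additional inhomogeneity. That term
  converges to order k by the induction hypothesis for z itself. The time derivative needs no
  recursion, being given by the integrand.\<close>

lemma Ck_conv_time_recursion:
 fixes z b :: "nat \<Rightarrow> real \<times> 'a::euclidean_space \<Rightarrow> 'b::euclidean_space"
 assumes Q: "open Q" "time_star Q" and a: "\<And>\<beta>. Ck_conv k Q (a \<beta>)"
  and small: "\<And>m q p w. q \<in> Q \<Longrightarrow> p \<in> Q \<Longrightarrow> \<bar>fst q\<bar> * norm (\<Sum>\<beta>\<in>Basis. (w \<bullet> \<beta>) *\<^sub>R a \<beta> m p) \<le> norm w / 2"
  and z: "\<And>m q. q \<in> Q \<Longrightarrow> z (Suc m) q = b m q + time_int (\<lambda>p. \<Sum>\<beta>\<in>Basis. (z m p \<bullet> \<beta>) *\<^sub>R a \<beta> m p) q"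
  and b: "Ck_conv k Q b" and z0: "Ck_on k Q (z 0)"
 shows "Ck_conv k Q z"
 using a b z z0
proof (induct k arbitrary: z b)
 case 0
 then show ?case
  using geo_conv_time_recursion[OF Q(2) _ _ _ _ small, of z b] by simp
next
 case (Suc k)
 note p = Suc.prems
 let ?A = "\<lambda>m p. \<Sum>\<beta>\<in>Basis. (z m p \<bullet> \<beta>) *\<^sub>R a \<beta> m p"
 have IH: "Ck_conv k Q z"
  using Suc.hyps[OF Ck_conv_SucD[OF p(1)] Ck_conv_SucD[OF p(2)] p(3) Ck_on_SucD[OF p(4)]] .
 have CA: "Ck_on (Suc k) Q (?A m)" if "Ck_on (Suc k) Q (z m)" for m
  by (intro Ck_on_sum Ck_on_scaleR Ck_on_inner that Ck_on_const Q Ck_conv_Ck_on[OF p(1)])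
 have Cz: "Ck_on (Suc k) Q (z m)" for m
 proof (induct m)
  case (Suc m)
  have "Ck_on (Suc k) Q (\<lambda>q. b m q + time_int (?A m) q)"
   by (intro Ck_on_add Ck_on_time_int CA Suc Q Ck_conv_Ck_on[OF p(2)])
  then show ?case by (rule Ck_on_cong[OF Q(1), rotated]) (simp add: p(3))
 qed (rule p(4))
 have dz: "(z m has_derivative FD (z m) q) (at q)" if "q \<in> Q" for m q
  by (rule Ck_on_has_derivative[OF Cz that])
 have dA: "(?A m has_derivative (\<lambda>w. \<Sum>\<beta>\<in>Basis. (z m q \<bullet> \<beta>) *\<^sub>R FD (a \<beta> m) q w + (FD (z m) q w \<bullet> \<beta>) *\<^sub>R a \<beta> m q)) (at q)"
  if "q \<in> Q" for m q
  by (intro has_derivative_sum has_derivative_scaleR has_derivative_inner_left dz that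
    Ck_conv_has_derivative[OF p(1)])
 have FA: "FD (?A m) q w = (\<Sum>\<beta>\<in>Basis. (z m q \<bullet> \<beta>) *\<^sub>R FD (a \<beta> m) q w) + (\<Sum>\<beta>\<in>Basis. (FD (z m) q w \<bullet> \<beta>) *\<^sub>R a \<beta> m q)"
  if "q \<in> Q" for m q w
  using fun_cong[OF frechet_derivative_at[OF dA[OF that, of m]], of w] by (simp add: sum.distrib)
 have C1: "Ck_on 1 Q (?A m)" for m by (rule Ck_on_mono[OF CA[OF Cz]]) simp
 have dzS: "FD (z (Suc m)) q v = FD (b m) q v + (fst v *\<^sub>R ?A m q + time_int (\<lambda>q. FD (?A m) q (0, snd v)) q)"
  if "q \<in> Q" for m q v
 proof -
  have "((\<lambda>q. b m q + time_int (?A m) q) has_derivative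
    (\<lambda>v. FD (b m) q v + (fst v *\<^sub>R ?A m q + time_int (\<lambda>q. FD (?A m) q (0, snd v)) q))) (at q)"
   by (rule has_derivative_add[OF Ck_conv_has_derivative[OF p(2) that] time_int_has_derivative[OF Q C1 that]])
  then have "(z (Suc m) has_derivative
    (\<lambda>v. FD (b m) q v + (fst v *\<^sub>R ?A m q + time_int (\<lambda>q. FD (?A m) q (0, snd v)) q))) (at q)"
   by (rule has_derivative_transform_within_open[OF _ Q(1) that]) (simp add: p(3))
  from fun_cong[OF frechet_derivative_at[OF this], of v] show ?thesis by simp
 qed
 have cont1: "continuous_on Q (\<lambda>p. \<Sum>\<beta>\<in>Basis. (z m p \<bullet> \<beta>) *\<^sub>R FD (a \<beta> m) p w)" for m w
  by (intro continuous_intros geo_conv_cont[OF Ck_conv_geo[OF IH]]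
    geo_conv_cont[OF Ck_conv_geo[OF Ck_conv_FD[OF p(1)]]])
 have contzw: "continuous_on Q (\<lambda>q. FD (z m) q w)" for m w
  using Cz[of m] Ck_on_continuous_on unfolding Ck_on.simps by blast
 have cont2: "continuous_on Q (\<lambda>p. \<Sum>\<beta>\<in>Basis. (FD (z m) p w \<bullet> \<beta>) *\<^sub>R a \<beta> m p)" for m w
  by (intro continuous_intros contzw geo_conv_cont[OF Ck_conv_geo[OF p(1)]])
 have space: "Ck_conv k Q (\<lambda>m q. FD (z m) q (0, v))" for v
 proof (rule Suc.hyps[OF Ck_conv_SucD[OF p(1)]])
  show "Ck_conv k Q (\<lambda>m q. FD (b m) q (0, v) + time_int (\<lambda>p. \<Sum>\<beta>\<in>Basis. (z m p \<bullet> \<beta>) *\<^sub>R FD (a \<beta> m) p (0, v)) q)"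
   by (intro Ck_conv_add Ck_conv_time_int Ck_conv_sum Ck_conv_scaleR Ck_conv_inner Q IH
     Ck_conv_const Ck_on_const Ck_conv_FD[OF p(1)] Ck_conv_FD[OF p(2)])
  show "FD (z (Suc m)) q (0, v) = FD (b m) q (0, v) + time_int (\<lambda>p. \<Sum>\<beta>\<in>Basis. (z m p \<bullet> \<beta>) *\<^sub>R FD (a \<beta> m) p (0, v)) q
    + time_int (\<lambda>p. \<Sum>\<beta>\<in>Basis. (FD (z m) p (0, v) \<bullet> \<beta>) *\<^sub>R a \<beta> m p) q" if "q \<in> Q" for m q
  proof -
   have "time_int (\<lambda>q. FD (?A m) q (0, v)) q - time_int (\<lambda>p. \<Sum>\<beta>\<in>Basis. (z m p \<bullet> \<beta>) *\<^sub>R FD (a \<beta> m) p (0, v)) q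
     = time_int (\<lambda>p. \<Sum>\<beta>\<in>Basis. (FD (z m) p (0, v) \<bullet> \<beta>) *\<^sub>R a \<beta> m p) q"
   proof -
    have "continuous_on Q (\<lambda>q. FD (?A m) q (0, v))"
     using continuous_on_add[OF cont1 cont2, of m "(0,v)" m "(0,v)"]
     by (rule continuous_on_eq) (simp add: FA)
    note time_int_diff[OF Q(2) this cont1 that, of m "(0, v)"]
    also have "time_int (\<lambda>q. FD (?A m) q (0, v) - (\<Sum>\<beta>\<in>Basis. (z m q \<bullet> \<beta>) *\<^sub>R FD (a \<beta> m) q (0, v))) q
      = time_int (\<lambda>p. \<Sum>\<beta>\<in>Basis. (FD (z m) p (0, v) \<bullet> \<beta>) *\<^sub>R a \<beta> m p) q"
     by (rule time_int_cong[OF Q(2) that]) (simp add: FA)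
    finally show ?thesis .
   qed
   then show ?thesis using dzS[OF that, of m "(0, v)"] by (simp add: algebra_simps)
  qed
  show "Ck_on k Q (\<lambda>q. FD (z 0) q (0, v))" using p(4) unfolding Ck_on.simps by blast
 qed
 have time: "Ck_conv k Q (\<lambda>m q. FD (z m) q (1, 0))"
 proof (rule Ck_conv_Suc[OF Q(1)])
  have "Ck_conv k Q (\<lambda>m q. FD (b m) q (1, 0) + ?A m q)"
   by (intro Ck_conv_add Ck_conv_sum Ck_conv_scaleR Ck_conv_inner Q IH
     Ck_conv_const Ck_on_const Ck_conv_SucD[OF p(1)] Ck_conv_FD[OF p(2)])
  then show "Ck_conv k Q (\<lambda>m q. FD (z (Suc m)) q (1, 0))"
  proof (rule Ck_conv_cong[OF Q(1), rotated])
   fix m q assume q: "q \<in> Q"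
   have "FD (?A m) x (0, 0) = 0" if "x \<in> Q" for x
    using linear_0[OF has_derivative_linear[OF Ck_on_has_derivative[OF CA[OF Cz] that]], of m]
    by (simp add: zero_prod_def)
   then show "FD (b m) q (1, 0) + ?A m q = FD (z (Suc m)) q (1, 0)"
    using dzS[OF q, of m "(1, 0)"] time_int_zero[OF Q(2) q, of "\<lambda>q. FD (?A m) q (0, 0)"] by simp
  qed
  show "Ck_on k Q (\<lambda>q. FD (z 0) q (1, 0))" using p(4) unfolding Ck_on.simps by blast
 qed
 show ?case by (rule Ck_conv_time_spaceI[OF Q(1) Ck_conv_geo[OF IH] dz time space])
qed

text \<open>The Picard iterates converge geometrically together with their derivatives of every
  order on one and the same domain, because differentiation leaves the coefficient DF of the
  integral term unchanged and puts the higher derivatives of F into inhomogeneous terms. The last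
  conclusion is the variational equation.\<close>

theorem smooth_flow:
 fixes F :: "'a::euclidean_space \<Rightarrow> 'a"
 assumes W: "open W" and F: "C_inf_on W F" and p: "p \<in> W"
 obtains a \<delta> y where "a > 0" "\<delta> > 0" "ball p \<delta> \<subseteq> W" "C_inf_on ({-a<..<a} \<times> ball p \<delta>) y"
  "\<And>q. q \<in> {-a<..<a} \<times> ball p \<delta> \<Longrightarrow> y q \<in> W"
  "\<And>x. x \<in> ball p \<delta> \<Longrightarrow> y (0, x) = x"
  "\<And>t x S. t \<in> {-a<..<a} \<Longrightarrow> x \<in> ball p \<delta> \<Longrightarrow>
    ((\<lambda>t. y (t, x)) has_vector_derivative F (y (t, x))) (at t within S)"
  "\<And>t x S v. t \<in> {-a<..<a} \<Longrightarrow> x \<in> ball p \<delta> \<Longrightarrow>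
    ((\<lambda>t. FD y (t, x) (0, v)) has_vector_derivative FD F (y (t, x)) (FD y (t, x) (0, v))) (at t within S)"
proof -
 obtain R where R: "R > 0" "cball p R \<subseteq> W" using W p open_contains_cball by blast
 obtain L where L: "L \<ge> 0" "\<And>x y. x \<in> cball p R \<Longrightarrow> y \<in> cball p R \<Longrightarrow> norm (F x - F y) \<le> L * norm (x - y)"
  "\<And>x h. x \<in> cball p R \<Longrightarrow> norm (FD F x h) \<le> L * norm h" "\<And>x. x \<in> cball p R \<Longrightarrow> norm (F x) \<le> L"
  by (rule C_inf_on_cball_bounds[OF W F R(2)]) blast
 \<comment> \<open>a L <= R/2 keeps the iterates in the ball of radius R, and a L <= 1/2 makes the
   iteration contract; L + 1 avoids division by zero.\<close>
 define a where "a = min (R/2) (1/2) / (L + 1)"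
 have "a * L = min (R/2) (1/2) * (L / (L + 1))" by (simp add: a_def)
 also have "\<dots> \<le> min (R/2) (1/2)" using R L(1) by (intro mult_left_le) auto
 finally have a: "a > 0" "a * L \<le> 1/2" "a * L \<le> R/2" using R L(1) by (auto simp: a_def)
 define Q where "Q = {-a<..<a} \<times> ball p (R/2)"
 have Q: "open Q" unfolding Q_def by (intro open_Times) auto
 have Qs: "time_star Q" unfolding Q_def by (rule time_star_box)
 have fq: "\<bar>fst q\<bar> \<le> a" "snd q \<in> ball p (R/2)" if "q \<in> Q" for q using that by (auto simp: Q_def)
 define y where "y = rec_nat snd (\<lambda>m ym q. snd q + time_int (\<lambda>p. F (ym p)) q)"
 have y0: "y 0 = snd" and yS: "y (Suc m) q = snd q + time_int (\<lambda>p. F (y m p)) q" for m q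
  by (auto simp: y_def)
 have yC: "Ck_on k Q (y m) \<and> (\<forall>q\<in>Q. y m q \<in> cball p R)" for m k
 proof (induct m arbitrary: k)
  case 0
  have "norm (p - snd q) \<le> R" if "q \<in> Q" for q
   using fq(2)[OF that] R by (auto simp: dist_norm)
  then show ?case using Q by (auto simp: y0 dist_norm intro: Ck_on_bounded_linear bounded_linear_snd)
 next
  case (Suc m)
  have FC: "Ck_on k Q (\<lambda>p. F (y m p))" for k
   by (rule Ck_on_compose[OF Q W]) (use Suc C_inf_onD[OF F] R in auto)
  have "Ck_on k Q (\<lambda>q. snd q + time_int (\<lambda>p. F (y m p)) q)"
   by (intro Ck_on_add Ck_on_time_int FC Q Qs Ck_on_bounded_linear bounded_linear_snd)
  moreover have "y (Suc m) q \<in> cball p R" if q: "q \<in> Q" for q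
  proof -
   have "norm (time_int (\<lambda>p. F (y m p)) q) \<le> \<bar>fst q\<bar> * L"
    by (rule norm_time_int_le[OF Qs Ck_on_continuous_on[OF FC[of 0]] q])
     (use Suc time_starD[OF Qs q] L(4) in blast)
   also have "\<dots> \<le> R/2" using fq(1)[OF q] L(1) a by (meson mult_right_mono order_trans)
   finally have "norm (time_int (\<lambda>p. F (y m p)) q) \<le> R/2" .
   moreover have "norm (snd q - p) \<le> R/2" using fq(2)[OF q] by (auto simp: dist_norm norm_minus_commute)
   ultimately have "norm ((snd q - p) + time_int (\<lambda>p. F (y m p)) q) \<le> R"
    using norm_triangle_ineq[of "snd q - p" "time_int (\<lambda>p. F (y m p)) q"] by linarith
   then show ?thesis by (simp add: yS dist_norm norm_minus_commute algebra_simps)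
  qed
  ultimately show ?case by (simp add: yS[abs_def])
 qed
 then have yC': "Ck_on k Q (y m)" and yB: "\<And>q. q \<in> Q \<Longrightarrow> y m q \<in> cball p R" for k m by auto
 have cF: "continuous_on Q (\<lambda>p. F (y m p))" for m
  by (rule continuous_on_compose2[OF C_inf_on_continuous_on[OF F] Ck_on_continuous_on[OF yC'[of 0]]])
   (use yB R in blast)
 have diff: "norm (y (Suc m) q - y m q) \<le> 2 * R * (1/2) ^ m" if "q \<in> Q" for m q
  using that
 proof (induct m arbitrary: q)
  case 0
  have "dist (y (Suc 0) q) (y 0 q) \<le> R + R"
   by (meson yB[OF 0] mem_cball dist_triangle_le dist_commute add_mono dist_triangle3 order_trans)
  then show ?case by (simp add: dist_norm)
 next
  case (Suc m)
  have eq: "y (Suc (Suc m)) q - y (Suc m) q = time_int (\<lambda>q. F (y (Suc m) q) - F (y m q)) q"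
   using yS[of "Suc m" q] yS[of m q] time_int_diff[OF Qs cF cF Suc.prems, of "Suc m" m] by simp
  have "norm (y (Suc (Suc m)) q - y (Suc m) q) \<le> \<bar>fst q\<bar> * (L * (2 * R * (1/2) ^ m))"
   unfolding eq
  proof (rule norm_time_int_le[OF Qs _ Suc.prems])
   show "continuous_on Q (\<lambda>q. F (y (Suc m) q) - F (y m q))"
    by (intro continuous_on_diff cF)
   fix \<theta> :: real assume "\<theta> \<in> {0..1}"
   from time_starD[OF Qs Suc.prems this] have i: "(\<theta> * fst q, snd q) \<in> Q" .
   let ?p = "(\<theta> * fst q, snd q)"
   have "norm (F (y (Suc m) ?p) - F (y m ?p)) \<le> L * norm (y (Suc m) ?p - y m ?p)"
    by (rule L(2)[OF yB[OF i] yB[OF i]])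
   also have "\<dots> \<le> L * (2 * R * (1/2) ^ m)" by (rule mult_left_mono[OF Suc.hyps[OF i] L(1)])
   finally show "norm (F (y (Suc m) ?p) - F (y m ?p)) \<le> L * (2 * R * (1/2) ^ m)" .
  qed
  also have "\<dots> \<le> a * (L * (2 * R * (1/2) ^ m))"
   using fq(1)[OF Suc.prems] L(1) R by (intro mult_right_mono) auto
  also have "\<dots> = (a * L) * (2 * R * (1/2) ^ m)" by simp
  also have "\<dots> \<le> 1/2 * (2 * R * (1/2) ^ m)" using a R by (intro mult_right_mono) auto
  finally show ?case by simp
 qed
 have geo: "geo_conv Q y"
 proof (rule geo_convI)
  show "continuous_on Q (y m)" for m using yC'[of 0] by simp
  fix K assume K: "compact K" "K \<subseteq> Q"
  have "norm (y (Suc m) q - y m q) \<le> 2 * R * (3/4) ^ m" if "q \<in> K" for m q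
  proof -
   have "2 * R * (1/2) ^ m \<le> 2 * R * (3/4) ^ m" using R by (intro mult_left_mono power_mono) auto
   then show ?thesis using diff[of q m] K that by force
  qed
  then show "\<exists>C. \<forall>m. \<forall>q\<in>K. norm (y (Suc m) q - y m q) \<le> C * (3/4) ^ m" by blast
 qed
 have linF: "linear (FD F x)" if "x \<in> cball p R" for x
  using C_inf_on_has_derivative[OF F] that R has_derivative_linear by blast
 have dF: "(F has_derivative FD F x) (at x)" if "x \<in> cball p R" for x
  using C_inf_on_has_derivative[OF F] that R by blast
 have dy: "(y m has_derivative FD (y m) q) (at q)" if "q \<in> Q" for m q
  by (rule Ck_on_has_derivative[OF yC'[of 1, unfolded One_nat_def] that])
 have dFy: "((\<lambda>q. F (y m q)) has_derivative (\<lambda>w. FD F (y m q) (FD (y m) q w))) (at q)" if "q \<in> Q" for m q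
  by (rule has_derivative_compose[OF dy[OF that] dF[OF yB[OF that]]])
 have C1F: "Ck_on 1 Q (\<lambda>q. F (y m q))" for m
  by (rule Ck_on_compose[OF Q W yC' C_inf_onD[OF F]]) (use yB R in auto)
 have dyS: "FD (y (Suc m)) q v = snd v + (fst v *\<^sub>R F (y m q) + time_int (\<lambda>q. FD F (y m q) (FD (y m) q (0, snd v))) q)"
  if "q \<in> Q" for m q v
 proof -
  have "((\<lambda>q. snd q + time_int (\<lambda>p. F (y m p)) q) has_derivative
    (\<lambda>v. snd v + (fst v *\<^sub>R F (y m q) + time_int (\<lambda>q. FD (\<lambda>q. F (y m q)) q (0, snd v)) q))) (at q)"
   by (intro has_derivative_add has_derivative_snd has_derivative_ident time_int_has_derivative[OF Q Qs C1F that])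
  then have "(y (Suc m) has_derivative
    (\<lambda>v. snd v + (fst v *\<^sub>R F (y m q) + time_int (\<lambda>q. FD (\<lambda>q. F (y m q)) q (0, snd v)) q))) (at q)"
   by (simp add: yS[abs_def])
  from fun_cong[OF frechet_derivative_at[OF this], of v, symmetric]
  have D: "FD (y (Suc m)) q v = snd v + (fst v *\<^sub>R F (y m q) + time_int (\<lambda>q. FD (\<lambda>q. F (y m q)) q (0, snd v)) q)" .
  have "FD (\<lambda>q. F (y m q)) x w = FD F (y m x) (FD (y m) x w)" if "x \<in> Q" for x w
   using fun_cong[OF frechet_derivative_at[OF dFy[OF that, of m]], of w] by simp
  then have "time_int (\<lambda>q. FD (\<lambda>q. F (y m q)) q (0, snd v)) q
    = time_int (\<lambda>q. FD F (y m q) (FD (y m) q (0, snd v))) q"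
   by (intro time_int_cong[OF Qs that]) simp
  then show ?thesis using D by simp
 qed
 have dyt: "FD (y (Suc m)) q (1, 0) = F (y m q)" if q: "q \<in> Q" for m q
 proof -
  have "FD F (y m x) (FD (y m) x (0, 0)) = 0" if "x \<in> Q" for x
   using linear_0[OF has_derivative_linear[OF dFy[OF that]], of m] by (simp add: zero_prod_def)
  then show ?thesis
   using dyS[OF q, of m "(1, 0)"] time_int_zero[OF Qs q, of "\<lambda>q. FD F (y m q) (FD (y m) q (0, 0))"] by simp
 qed
 have CC: "Ck_conv k Q y" for k
 proof (induct k)
  case 0
  then show ?case using geo by simp
 next
  case (Suc k)
  have aC: "Ck_conv k Q (\<lambda>m q. FD F (y m q) \<beta>)" for \<beta>
   by (rule Ck_conv_compose[OF Q W R(2) yB C_inf_on_FD[OF F] Suc])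
  have space: "Ck_conv k Q (\<lambda>m q. FD (y m) q (0, v))" for v
  proof (rule Ck_conv_time_recursion[OF Q Qs aC])
   show "\<bar>fst q\<bar> * norm (\<Sum>\<beta>\<in>Basis. (w \<bullet> \<beta>) *\<^sub>R FD F (y m r) \<beta>) \<le> norm w / 2"
    if "q \<in> Q" "r \<in> Q" for m q r w
   proof -
    have "\<bar>fst q\<bar> * norm (FD F (y m r) w) \<le> a * (L * norm w)"
     using fq(1)[OF that(1)] L(3)[OF yB[OF that(2)]] L(1) a by (intro mult_mono) auto
    also have "\<dots> \<le> 1/2 * norm w" unfolding mult.assoc[symmetric] using a by (intro mult_right_mono) auto
    finally show ?thesis using linear_basis_expand[OF linF[OF yB[OF that(2), of m]], of w] by simp
   qed
   show "FD (y (Suc m)) q (0, v) = v + time_int (\<lambda>r. \<Sum>\<beta>\<in>Basis. (FD (y m) r (0, v) \<bullet> \<beta>) *\<^sub>R FD F (y m r) \<beta>) q"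
    if "q \<in> Q" for m q
    using time_int_cong[OF Qs that, of "\<lambda>r. \<Sum>\<beta>\<in>Basis. (FD (y m) r (0, v) \<bullet> \<beta>) *\<^sub>R FD F (y m r) \<beta>"
     "\<lambda>q. FD F (y m q) (FD (y m) q (0, v))"] linear_basis_expand[OF linF[OF yB]] dyS[OF that, of m "(0, v)"] by simp
   show "Ck_conv k Q (\<lambda>m q. v)" by (intro Ck_conv_const Q Ck_on_const)
   show "Ck_on k Q (\<lambda>q. FD (y 0) q (0, v))" using yC'[of "Suc k" 0] unfolding Ck_on.simps by blast
  qed
  have time: "Ck_conv k Q (\<lambda>m q. FD (y m) q (1, 0))"
  proof (rule Ck_conv_Suc[OF Q])
   have "Ck_conv k Q (\<lambda>m q. F (y m q))" by (rule Ck_conv_compose[OF Q W R(2) yB F Suc])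
   then show "Ck_conv k Q (\<lambda>m q. FD (y (Suc m)) q (1, 0))"
    by (rule Ck_conv_cong[OF Q, rotated]) (simp add: dyt)
   show "Ck_on k Q (\<lambda>q. FD (y 0) q (1, 0))" using yC'[of "Suc k" 0] unfolding Ck_on.simps by blast
  qed
  show ?case by (rule Ck_conv_time_spaceI[OF Q geo dy time space])
 qed
 obtain Y where Y: "\<And>q. q \<in> Q \<Longrightarrow> (\<lambda>m. y m q) \<longlonglongrightarrow> Y q"
  by (rule geo_conv_limit[OF geo]) blast
 have CY: "C_inf_on Q Y" unfolding C_inf_on_def using Ck_conv_limit(1)[OF Q CC Y] by blast
 have DY: "(\<lambda>m. FD (y m) q v) \<longlonglongrightarrow> FD Y q v" if "q \<in> Q" for q v
  by (rule Ck_conv_limit(2)[OF Q CC[of 1] Y _ that]) auto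
 have YB: "Y q \<in> cball p R" if "q \<in> Q" for q
  using Lim_in_closed_set[OF closed_cball _ _ Y[OF that]] yB[OF that] by (auto intro: always_eventually)
 \<comment> \<open>The equation survives the limit because the time derivative of the iterate m + 1
   is F of the iterate m.\<close>
 have Yt: "FD Y q (1, 0) = F (Y q)" if q: "q \<in> Q" for q
 proof -
  have "isCont F (Y q)" using dF[OF YB[OF q]] has_derivative_continuous by blast
  then have "(\<lambda>m. F (y m q)) \<longlonglongrightarrow> F (Y q)" using Y[OF q] isCont_tendsto_compose by blast
  then show ?thesis
   using LIMSEQ_unique[OF LIMSEQ_Suc[OF DY[OF q, of "(1, 0)"]]] by (simp add: dyt[OF q])
 qed
 have Y0: "Y (0, x) = x" if "x \<in> ball p (R/2)" for x
 proof -
  have q: "(0, x) \<in> Q" using that a by (auto simp: Q_def)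
  have "y m (0, x) = x" for m by (cases m) (auto simp: y0 yS time_int_def)
  then have "(\<lambda>m. y m (0, x)) \<longlonglongrightarrow> x" by simp
  then show ?thesis using LIMSEQ_unique[OF Y[OF q]] by blast
 qed
 have path: "((\<lambda>t. (t, x)) has_vector_derivative (1, 0)) (at t within S)" for t and x :: 'a and S
  by (auto intro!: derivative_eq_intros has_vector_derivative_Pair)
 have inQ: "(t, x) \<in> Q" if "t \<in> {-a<..<a}" "x \<in> ball p (R/2)" for t x using that by (simp add: Q_def)
 show ?thesis
 proof (rule that[of a "R/2" Y])
  show "ball p (R/2) \<subseteq> W" using R by (auto simp: subset_iff)
  show "C_inf_on ({-a<..<a} \<times> ball p (R/2)) Y" using CY by (simp add: Q_def)
  show "Y q \<in> W" if "q \<in> {-a<..<a} \<times> ball p (R/2)" for q using YB that R by (auto simp: Q_def)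
  fix t x S assume tx: "t \<in> {-a<..<a}" "x \<in> ball p (R/2)"
  note q = inQ[OF tx]
  show "((\<lambda>t. Y (t, x)) has_vector_derivative F (Y (t, x))) (at t within S)"
   using has_vector_derivative_chain[where f=Y and p="\<lambda>t. (t, x)", OF C_inf_on_has_derivative[OF CY q] path] Yt[OF q] by simp
  fix v
  have "((\<lambda>t. FD Y (t, x) (0, v)) has_vector_derivative FD (\<lambda>q. FD Y q (0, v)) (t, x) (1, 0)) (at t within S)"
   by (rule has_vector_derivative_chain[where f="\<lambda>q. FD Y q (0, v)" and p="\<lambda>t. (t, x)",
      OF C_inf_on_has_derivative[OF C_inf_on_FD[OF CY] q] path])
  \<comment> \<open>Mixed derivatives commute, so this is the spatial derivative of F o Y.\<close>
  moreover have "FD (\<lambda>q. FD Y q (0, v)) (t, x) (1, 0) = FD F (Y (t, x)) (FD Y (t, x) (0, v))"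
  proof -
   have "((\<lambda>q. F (Y q)) has_derivative (\<lambda>w. FD F (Y (t, x)) (FD Y (t, x) w))) (at (t, x))"
    by (rule has_derivative_compose[OF C_inf_on_has_derivative[OF CY q] dF[OF YB[OF q]]])
   then have "((\<lambda>q. FD Y q (1, 0)) has_derivative (\<lambda>w. FD F (Y (t, x)) (FD Y (t, x) w))) (at (t, x))"
    by (rule has_derivative_transform_within_open[OF _ Q q]) (simp add: Yt)
   from fun_cong[OF frechet_derivative_at[OF this], of "(0, v)"]
   show ?thesis using symmetric_second_derivative[OF Q CY q] by metis
  qed
  ultimately show "((\<lambda>t. FD Y (t, x) (0, v)) has_vector_derivative FD F (Y (t, x)) (FD Y (t, x) (0, v))) (at t within S)"
   by simp
 qed (use a R Y0 in auto)
qed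

text \<open>On a short segment the maximum of |g - h| is at most half of itself. \<open>S\<close>
  may be a closed interval with t1 as an endpoint, as happens for curves starting on the
  boundary.\<close>

lemma ode_unique_local:
 fixes F :: "'a::euclidean_space \<Rightarrow> 'a"
 assumes W: "open W" and F: "C_inf_on W F" and S: "convex S" "t1 \<in> S" and eq: "g t1 = h t1" and gW: "g t1 \<in> W"
  and e: "e > 0"
  and dg: "\<And>t. t \<in> S \<Longrightarrow> \<bar>t - t1\<bar> < e \<Longrightarrow> (g has_vector_derivative F (g t)) (at t within S)"
  and dh: "\<And>t. t \<in> S \<Longrightarrow> \<bar>t - t1\<bar> < e \<Longrightarrow> (h has_vector_derivative F (h t)) (at t within S)"
 obtains e' where "e' > 0" "\<And>t. t \<in> S \<Longrightarrow> \<bar>t - t1\<bar> < e' \<Longrightarrow> g t = h t"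
proof -
 obtain R where R: "R > 0" "cball (g t1) R \<subseteq> W" using W gW open_contains_cball by blast
 obtain L where L: "L \<ge> 0" "\<And>x y. x \<in> cball (g t1) R \<Longrightarrow> y \<in> cball (g t1) R \<Longrightarrow> norm (F x - F y) \<le> L * norm (x - y)"
  by (rule C_inf_on_cball_bounds[OF W F R(2)]) blast
 have cont: "continuous (at t1 within S) g" "continuous (at t1 within S) h"
  using dg[OF S(2)] dh[OF S(2)] e has_vector_derivative_continuous by auto
 obtain e1 where e1: "e1 > 0" "\<And>t. t \<in> S \<Longrightarrow> dist t t1 < e1 \<Longrightarrow> dist (g t) (g t1) < R"
  using cont(1) R(1) unfolding continuous_within_eps_delta by metis
 obtain e2 where e2: "e2 > 0" "\<And>t. t \<in> S \<Longrightarrow> dist t t1 < e2 \<Longrightarrow> dist (h t) (h t1) < R"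
  using cont(2) R(1) unfolding continuous_within_eps_delta by metis
 define e' where "e' = min (min e e1) (min e2 (1 / (2 * (L + 1))))"
 have e': "e' > 0" "e' \<le> e" "e' \<le> e1" "e' \<le> e2" "e' * L \<le> 1/2"
 proof -
  show "e' > 0" using e e1 e2 L by (auto simp: e'_def)
  have "e' * L \<le> 1 / (2 * (L + 1)) * L" using L by (intro mult_right_mono) (auto simp: e'_def)
  also have "\<dots> \<le> 1/2" using L by (auto simp: field_simps)
  finally show "e' * L \<le> 1/2" .
 qed (auto simp: e'_def)
 show ?thesis
 proof (rule that[OF e'(1)])
  fix t assume t: "t \<in> S" "\<bar>t - t1\<bar> < e'"
  define J where "J = closed_segment t1 t"
  have JS: "J \<subseteq> S" using S t closed_segment_subset by (auto simp: J_def)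
  have Jt: "\<bar>s - t1\<bar> < e'" if "s \<in> J" for s
   using that t(2) by (auto simp: J_def closed_segment_eq_real_ivl split: if_splits)
  have in_ball: "g s \<in> cball (g t1) R" "h s \<in> cball (g t1) R" if "s \<in> J" for s
   using e1(2)[of s] e2(2)[of s] Jt[OF that] JS that e' eq by (auto simp: dist_real_def dist_commute less_imp_le)
  let ?d = "\<lambda>s. g s - h s"
  have dd: "(?d has_vector_derivative F (g s) - F (h s)) (at s within J)" if "s \<in> J" for s
   using dg[of s] dh[of s] Jt[OF that] e' JS that
   by (intro has_vector_derivative_diff) (auto intro: has_vector_derivative_within_subset)
  have "continuous_on J (\<lambda>s. norm (?d s))"
   using dd has_vector_derivative_continuous continuous_on_eq_continuous_within
   by (intro continuous_on_norm) blast
  then obtain s where s: "s \<in> J" "\<And>r. r \<in> J \<Longrightarrow> norm (?d r) \<le> norm (?d s)"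
   using continuous_attains_sup[of J "\<lambda>s. norm (?d s)"] by (auto simp: J_def)
  have "norm (?d s - ?d t1) \<le> (L * norm (?d s)) * norm (s - t1)"
  proof (rule differentiable_bound[where f'="\<lambda>r x. x *\<^sub>R (F (g r) - F (h r))"])
   show "convex J" by (simp add: J_def)
   show "(?d has_derivative (\<lambda>x. x *\<^sub>R (F (g r) - F (h r)))) (at r within J)" if "r \<in> J" for r
    using dd[OF that] by (simp add: has_vector_derivative_def)
   show "onorm (\<lambda>x. x *\<^sub>R (F (g r) - F (h r))) \<le> L * norm (?d s)" if "r \<in> J" for r
   proof (rule onorm_le)
    fix x :: real
    have "norm (F (g r) - F (h r)) \<le> L * norm (?d r)" by (rule L(2)[OF in_ball[OF that]])
    also have "\<dots> \<le> L * norm (?d s)" by (rule mult_left_mono[OF s(2)[OF that] L(1)])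
    finally show "norm (x *\<^sub>R (F (g r) - F (h r))) \<le> L * norm (?d s) * norm x"
     by (simp add: mult.commute[of _ "\<bar>x\<bar>"] mult_left_mono)
   qed
  qed (use s in \<open>auto simp: J_def\<close>)
  then have "norm (?d s) \<le> L * norm (?d s) * \<bar>s - t1\<bar>" using eq by simp
  also have "\<dots> \<le> L * norm (?d s) * e'" using Jt[OF s(1)] L by (intro mult_left_mono) auto
  also have "\<dots> = (e' * L) * norm (?d s)" by simp
  also have "\<dots> \<le> 1/2 * norm (?d s)" using e' by (intro mult_right_mono) auto
  finally have "norm (?d s) \<le> 0" by simp
  then show "g t = h t" using s(2)[of t] by (simp add: J_def)
 qed
qed

lemma ode_unique:
 fixes F :: "'a::euclidean_space \<Rightarrow> 'a"
 assumes W: "open W" and F: "C_inf_on W F" and S: "convex S" "t0 \<in> S" and eq: "g t0 = h t0"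
  and gW: "\<And>t. t \<in> S \<Longrightarrow> g t \<in> W"
  and dg: "\<And>t. t \<in> S \<Longrightarrow> (g has_vector_derivative F (g t)) (at t within S)"
  and dh: "\<And>t. t \<in> S \<Longrightarrow> (h has_vector_derivative F (h t)) (at t within S)"
  and t: "t \<in> S"
 shows "g t = h t"
proof -
 let ?E = "{t \<in> S. g t = h t}"
 have cont: "continuous_on S g" "continuous_on S h"
  using dg dh has_vector_derivative_continuous continuous_on_eq_continuous_within by blast+
 have "closedin (top_of_set S) ?E"
  by (rule closedin_continuous_maps_eq[where X="top_of_set S" and Y=euclidean, simplified])
   (use cont in \<open>auto simp: Hausdorff_space_euclidean\<close>)
 moreover have "openin (top_of_set S) ?E"
  unfolding openin_euclidean_subtopology_iff
 proof (intro conjI ballI)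
  fix t1 assume t1: "t1 \<in> ?E"
  then have "t1 \<in> S" "g t1 = h t1" "g t1 \<in> W" using gW[of t1] by auto
  from ode_unique_local[OF W F S(1) this zero_less_one dg dh]
  obtain e' where "e' > 0" "\<And>t. t \<in> S \<Longrightarrow> \<bar>t - t1\<bar> < e' \<Longrightarrow> g t = h t" by metis
  then show "\<exists>e>0. \<forall>t\<in>S. dist t t1 < e \<longrightarrow> t \<in> ?E"
   by (intro exI[of _ e']) (auto simp: dist_real_def)
 qed auto
 moreover have "connected S" using S convex_connected by blast
 ultimately have "?E = {} \<or> ?E = S" unfolding connected_clopen by blast
 then show ?thesis using S eq t by blast
qed

section \<open>Linearisation of a vector field at a radial zero\<close>

text \<open>Blow-up \<open>x = s y\<close>: since \<open>V(s y) = s y + s\<^sup>2 q(s, y)\<close> with \<open>q\<close> smooth, the singular equation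
 \<open>s x' = V(x)\<close> becomes the regular equation \<open>y' = q(s, y)\<close>.\<close>

lemma time_avg_scale:
 assumes Q: "time_star Q" "(c * s, y) \<in> Q" "(s, c *\<^sub>R y) \<in> Q"
  and u: "\<And>s. (c * s, y) \<in> Q \<Longrightarrow> (s, c *\<^sub>R y) \<in> Q \<Longrightarrow> u (s, c *\<^sub>R y) = k *\<^sub>R u (c * s, y)"
 shows "time_avg j u (s, c *\<^sub>R y) = k *\<^sub>R time_avg j u (c * s, y)"
proof -
 have "u (\<theta> * s, c *\<^sub>R y) = k *\<^sub>R u (\<theta> * (c * s), y)" if "\<theta> \<in> {0..1}" for \<theta>
  using u[of "\<theta> * s"] time_starD[OF Q(1,2) that] time_starD[OF Q(1,3) that] by (simp add: mult.left_commute)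
 then have "time_avg j u (s, c *\<^sub>R y) = integral {0..1} (\<lambda>\<theta>. k *\<^sub>R (\<theta> ^ j *\<^sub>R u (\<theta> * (c * s), y)))"
  unfolding time_avg_def by (intro integral_cong) (simp add: scaleR_left_commute)
 then show ?thesis by (simp only: time_avg_def integral_cmul fst_conv snd_conv)
qed

text \<open>q is the integral remainder in Taylor's formula for s \<mapsto> V(s y), smooth as an
  iterated average of the second derivative. The scaling law expresses that V(s y) depends on the
  product s y only.\<close>

lemma second_order_remainder:
 fixes V :: "'a::euclidean_space \<Rightarrow> 'a"
 assumes R: "R > 0" and V: "C_inf_on (ball 0 R) V" and V0: "V 0 = 0" and DV0: "\<And>u. FD V 0 u = u"
 obtains q where "C_inf_on ({-1<..<1} \<times> ball 0 R) q"
  "\<And>s y. \<bar>s\<bar> < 1 \<Longrightarrow> y \<in> ball 0 R \<Longrightarrow> V (s *\<^sub>R y) = s *\<^sub>R y + s\<^sup>2 *\<^sub>R q (s, y)"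
  "\<And>c s y. c \<in> {0..1} \<Longrightarrow> \<bar>s\<bar> < 1 \<Longrightarrow> y \<in> ball 0 R \<Longrightarrow> q (s, c *\<^sub>R y) = c\<^sup>2 *\<^sub>R q (c * s, y)"
proof -
 define Q where "Q = {-1<..<1::real} \<times> ball (0::'a) R"
 have Q: "open Q" "time_star Q" unfolding Q_def by (auto intro: open_Times time_star_box)
 have le: "\<bar>c\<bar> * a < b" if "\<bar>c\<bar> \<le> 1" "0 \<le> a" "a < b" for a b c :: real
  using mult_right_mono[of "\<bar>c\<bar>" 1 a] that by simp
 have inb: "s *\<^sub>R y \<in> ball 0 R" if "(s, y) \<in> Q" for s y using that le[of s "norm y"] by (auto simp: Q_def)
 have cQ: "(s, c *\<^sub>R y) \<in> Q" "(c * s, y) \<in> Q" if "c \<in> {0..1}" "(s, y) \<in> Q" for c s y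
  using that le[of c "norm y" R] le[of c "\<bar>s\<bar>" 1] abs_less_iff[of "c * s" 1]
  by (auto simp: Q_def abs_mult abs_less_iff[of s])
 define G where "G p = V (fst p *\<^sub>R snd p)" for p
 define G1 where "G1 p = FD G p (1, 0)" for p
 define G2 where "G2 p = FD G1 p (1, 0)" for p
 have "C_inf_on Q G" unfolding G_def[abs_def]
  by (rule C_inf_on_compose[OF Q(1) open_ball _ V])
   (use inb in \<open>auto intro!: C_inf_on_scaleR C_inf_on_fst C_inf_on_snd C_inf_on_ident Q\<close>)
 then have C: "C_inf_on Q G" "C_inf_on Q G1" "C_inf_on Q G2" unfolding G1_def[abs_def] G2_def[abs_def] by (auto intro: C_inf_on_FD)
 have G1: "G1 (s, y) = FD V (s *\<^sub>R y) y" if "(s, y) \<in> Q" for s y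
 proof -
  have "(V has_derivative FD V (s *\<^sub>R y)) (at (fst (s, y) *\<^sub>R snd (s, y)))" using C_inf_on_has_derivative[OF V inb[OF that]] by simp
  moreover have "((\<lambda>p. fst p *\<^sub>R snd p) has_derivative (\<lambda>d. s *\<^sub>R snd d + fst d *\<^sub>R y)) (at (s, y))"
   by (auto intro!: derivative_eq_intros)
  ultimately have "(G has_derivative (\<lambda>d. FD V (s *\<^sub>R y) (s *\<^sub>R snd d + fst d *\<^sub>R y))) (at (s, y))"
   unfolding G_def[abs_def] by (rule has_derivative_compose[rotated])
  from fun_cong[OF frechet_derivative_at[OF this], of "(1, 0)"] show ?thesis by (simp add: G1_def)
 qed
 have dG1: "((\<lambda>s. G1 (s, y)) has_vector_derivative G2 (s, y)) (at s)" if "(s, y) \<in> Q" for s y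
  unfolding G2_def by (rule has_vector_derivative_chain[where p="\<lambda>s. (s, y)", OF C_inf_on_has_derivative[OF C(2) that]])
   (auto intro!: derivative_eq_intros has_vector_derivative_Pair)
 have G1c: "G1 (s, c *\<^sub>R y) = c *\<^sub>R G1 (c * s, y)" if "c \<in> {0..1}" "(s, y) \<in> Q" for c s y
  unfolding G1[OF cQ(1)[OF that]] G1[OF cQ(2)[OF that]]
  using linear_scale[OF has_derivative_linear[OF C_inf_on_has_derivative[OF V inb[OF cQ(1)[OF that]]]], of c y] by (simp add: mult.commute)
 have G2c: "G2 (s, c *\<^sub>R y) = c\<^sup>2 *\<^sub>R G2 (c * s, y)" if c: "c \<in> {0..1}" and p: "(s, y) \<in> Q" for c s y
 proof -
  have "((\<lambda>s. c * s) has_vector_derivative c) (at s)"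
   by (auto intro!: derivative_eq_intros simp: has_real_derivative_iff_has_vector_derivative[symmetric])
  from has_vector_derivative_scaleR[OF DERIV_const vector_diff_chain_at[OF this dG1[OF cQ(2)[OF c p]]], of c]
  have "((\<lambda>s. c *\<^sub>R G1 (c * s, y)) has_vector_derivative c\<^sup>2 *\<^sub>R G2 (c * s, y)) (at s)"
   by (simp add: o_def power2_eq_square)
  then have "((\<lambda>s. G1 (s, c *\<^sub>R y)) has_vector_derivative c\<^sup>2 *\<^sub>R G2 (c * s, y)) (at s)"
   by (rule has_vector_derivative_transform_within_open[of _ _ _ "{-1<..<1}"]) (use p G1c[OF c] in \<open>auto simp: Q_def\<close>)
  with dG1[OF cQ(1)[OF c p]] show ?thesis by (rule vector_derivative_unique_at)
 qed
 define q where "q = time_avg 1 (time_avg 0 G2)"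
 have q1: "C_inf_on Q q"
  unfolding q_def C_inf_on_def by (intro allI Ck_on_time_avg Q C_inf_onD[OF C(3)])
 have q3: "q (s, c *\<^sub>R y) = c\<^sup>2 *\<^sub>R q (c * s, y)" if c: "c \<in> {0..1}" and p: "(s, y) \<in> Q" for c s y
 proof -
  have y: "y \<in> ball 0 R" using p by (simp add: Q_def)
  have i: "(s, y) \<in> Q" if "(s, c *\<^sub>R y) \<in> Q" for s using that y by (simp add: Q_def)
  show ?thesis unfolding q_def
  proof (rule time_avg_scale[OF Q(2) cQ(2)[OF c p] cQ(1)[OF c p]])
   fix s assume s: "(c * s, y) \<in> Q" "(s, c *\<^sub>R y) \<in> Q"
   show "time_avg 0 G2 (s, c *\<^sub>R y) = c\<^sup>2 *\<^sub>R time_avg 0 G2 (c * s, y)"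
    by (rule time_avg_scale[OF Q(2) s]) (rule G2c[OF c i])
  qed
 qed
 have q2: "V (s *\<^sub>R y) = s *\<^sub>R y + s\<^sup>2 *\<^sub>R q (s, y)" if p: "(s, y) \<in> Q" for s y
 proof -
  have G10: "G1 (0, y) = y" using G1[of 0 y] p DV0 by (simp add: Q_def)
  have w: "continuous_on Q (time_avg 0 G2)" using continuous_on_time_avg[OF Q(2) C_inf_on_continuous_on[OF C(3)]] .
  have "G1 (\<theta> * s, y) = y + (\<theta> * s) *\<^sub>R time_avg 0 G2 (\<theta> * s, y)" if "\<theta> \<in> {0..1}" for \<theta>
   using time_int_FD[OF Q C_inf_onD[OF C(2)] time_starD[OF Q(2) p that]] G10
   by (simp add: time_int_def G2_def[abs_def, symmetric] diff_eq_eq)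
  then have "time_avg 0 G1 (s, y) = integral {0..1} (\<lambda>\<theta>. y + s *\<^sub>R (\<theta> ^ 1 *\<^sub>R time_avg 0 G2 (\<theta> * fst (s, y), snd (s, y))))"
   unfolding time_avg_def[of 0 G1] by (intro integral_cong) (simp add: mult.commute)
  also have "\<dots> = y + s *\<^sub>R q (s, y)"
   unfolding q_def time_avg_def[of 1]
   by (subst integral_add[OF integrable_const_ivl integrable_cmul[OF time_slice_integrable[OF Q(2) w p]]]) (simp only: integral_cmul, simp)
  finally have "time_int G1 (s, y) = s *\<^sub>R y + s\<^sup>2 *\<^sub>R q (s, y)"
   by (simp add: time_int_def scaleR_add_right power2_eq_square)
  then show ?thesis
   using time_int_FD[OF Q C_inf_onD[OF C(1)] p] V0 by (simp add: G_def G1_def[abs_def])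
 qed
 show ?thesis
  by (rule that[of q]) (use q1 q2 q3 in \<open>auto simp: Q_def abs_less_iff\<close>)
qed

text \<open>If \<eta> solves y' = q(t, y) with \<eta>(0) = v, then t \<eta>(t) solves t x' = V(x)
  and leaves 0 with velocity v. The point \<open>E x\<close> is reached by this curve at the fixed
  time d when v = x / d. By the scaling law of q, \<open>E (c *\<^sub>R x)\<close> lies on the same
  curve at time c d, so E maps rays to these curves.\<close>

lemma linearise_radial_zero_at_0:
 fixes V :: "'a::euclidean_space \<Rightarrow> 'a"
 assumes R: "R > 0" and V: "C_inf_on (ball 0 R) V" and V0: "V 0 = 0" and DV0: "\<And>u. FD V 0 u = u"
 obtains r E where "r > 0" "C_inf_on (ball 0 r) E" "E 0 = 0" "\<And>x. FD E 0 x = x"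
  "\<And>x. x \<in> ball 0 r \<Longrightarrow> E x \<in> ball 0 R" "\<And>x. x \<in> ball 0 r \<Longrightarrow> FD E x x = V (E x)"
proof -
 obtain q where q: "C_inf_on ({-1<..<1} \<times> ball 0 R) q"
  "\<And>s y. \<bar>s\<bar> < 1 \<Longrightarrow> y \<in> ball 0 R \<Longrightarrow> V (s *\<^sub>R y) = s *\<^sub>R y + s\<^sup>2 *\<^sub>R q (s, y)"
  "\<And>c s y. c \<in> {0..1} \<Longrightarrow> \<bar>s\<bar> < 1 \<Longrightarrow> y \<in> ball 0 R \<Longrightarrow> q (s, c *\<^sub>R y) = c\<^sup>2 *\<^sub>R q (c * s, y)"
  by (rule second_order_remainder[OF assms]) blast
 define Q where "Q = {-1<..<1::real} \<times> ball (0::'a) R"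
 have Q: "open Q" unfolding Q_def by (intro open_Times) auto
 \<comment> \<open>Time becomes a coordinate, so that the flow theorem for autonomous fields
   applies.\<close>
 define F where "F p = (1::real, q p)" for p
 have CF: "C_inf_on Q F" unfolding F_def[abs_def]
  using q(1) by (intro C_inf_on_Pair C_inf_on_const Q) (simp add: Q_def)
 have 0: "0 \<in> Q" using R by (simp add: Q_def zero_prod_def)
 obtain a \<delta> Y where aY: "a > 0" "\<delta> > 0" "ball 0 \<delta> \<subseteq> Q" "C_inf_on ({-a<..<a} \<times> ball 0 \<delta>) Y"
  "\<And>q. q \<in> {-a<..<a} \<times> ball 0 \<delta> \<Longrightarrow> Y q \<in> Q"
  "\<And>x. x \<in> ball 0 \<delta> \<Longrightarrow> Y (0, x) = x"
  "\<And>t x S. t \<in> {-a<..<a} \<Longrightarrow> x \<in> ball 0 \<delta> \<Longrightarrow>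
    ((\<lambda>t. Y (t, x)) has_vector_derivative F (Y (t, x))) (at t within S)"
  by (rule smooth_flow[OF Q CF 0]) blast
 have vb: "(0, v) \<in> ball 0 \<delta>" if "norm v < \<delta>" for v :: 'a using that by (simp add: dist_Pair_Pair zero_prod_def)
 define \<eta> where "\<eta> t v = snd (Y (t, (0, v)))" for t v
 have fstY: "fst (Y (t, (0, v))) = t" if t: "t \<in> {-a<..<a}" and v: "norm v < \<delta>" for t v
 proof -
  have d: "((\<lambda>t. fst (Y (t, (0, v))) - t) has_vector_derivative 0) (at t within {-a<..<a})" if "t \<in> {-a<..<a}" for t
  proof -
   have "((\<lambda>t. fst (Y (t, (0, v)))) has_vector_derivative fst (F (Y (t, (0, v))))) (at t within {-a<..<a})"
    by (rule bounded_linear.has_vector_derivative[OF bounded_linear_fst aY(7)[OF that vb[OF v]]])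
   then show ?thesis
    using has_vector_derivative_diff[OF _ has_vector_derivative_id, of "\<lambda>t. fst (Y (t, (0, v)))"]
    by (fastforce simp: F_def)
  qed
  obtain c where "\<And>t. t \<in> {-a<..<a} \<Longrightarrow> fst (Y (t, (0, v))) - t = c"
   by (rule has_vector_derivative_zero_constant[OF _ d]) (auto intro: convex_real_interval)
  from this[OF t] this[of 0] show ?thesis using aY(1) aY(6)[OF vb[OF v]] by simp
 qed
 have Yeq: "Y (t, (0, v)) = (t, \<eta> t v)" if "t \<in> {-a<..<a}" "norm v < \<delta>" for t v
  using fstY[OF that] by (simp add: \<eta>_def prod_eq_iff)
 have \<eta>Q: "\<bar>t\<bar> < 1" "\<eta> t v \<in> ball 0 R" if "t \<in> {-a<..<a}" "norm v < \<delta>" for t v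
 proof -
  have "Y (t, (0, v)) \<in> Q" by (rule aY(5)) (use vb[OF that(2)] that(1) in blast)
  then show "\<bar>t\<bar> < 1" "\<eta> t v \<in> ball 0 R" unfolding Yeq[OF that] by (auto simp: Q_def)
 qed
 have d\<eta>: "((\<lambda>t. \<eta> t v) has_vector_derivative q (t, \<eta> t v)) (at t within S)"
  if "t \<in> {-a<..<a}" "norm v < \<delta>" for t v S
  using bounded_linear.has_vector_derivative[OF bounded_linear_snd aY(7)[OF that(1) vb[OF that(2)]]]
  unfolding Yeq[OF that] by (simp add: \<eta>_def[symmetric] F_def)
 have \<eta>0: "\<eta> 0 v = v" if "norm v < \<delta>" for v using aY(6)[OF vb[OF that]] by (simp add: \<eta>_def)
 \<comment> \<open>By the scaling law of q both sides solve the same equation with the same value c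
   v at time 0.\<close>
 have scale: "\<eta> t (c *\<^sub>R v) = c *\<^sub>R \<eta> (c * t) v" if t: "t \<in> {-a<..<a}" and v: "norm v < \<delta>" and c: "c \<in> {0..1}" for t v c
 proof -
  have ct: "c * t \<in> {-a<..<a}" if "t \<in> {-a<..<a}" for t
  proof -
   have "\<bar>c * t\<bar> \<le> 1 * \<bar>t\<bar>" unfolding abs_mult using c by (intro mult_right_mono) auto
   then show ?thesis using that by auto
  qed
  have cv: "norm (c *\<^sub>R v) < \<delta>"
  proof -
   have "c * norm v \<le> 1 * norm v" using c by (intro mult_right_mono) auto
   then show ?thesis using v c by simp
  qed
  have "Y (t, (0, c *\<^sub>R v)) = (\<lambda>t. (t, c *\<^sub>R \<eta> (c * t) v)) t"
  proof (rule ode_unique[OF Q CF, where S="{-a<..<a}" and ?t0.0=0 and g="\<lambda>t. Y (t, (0, c *\<^sub>R v))"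
     and h="\<lambda>t. (t, c *\<^sub>R \<eta> (c * t) v)"])
   show "Y (0, 0, c *\<^sub>R v) = (0, c *\<^sub>R \<eta> (c * 0) v)"
    using aY(6)[OF vb[OF cv]] \<eta>0[OF v] by simp
   fix t assume t: "t \<in> {-a<..<a}"
   show "Y (t, 0, c *\<^sub>R v) \<in> Q" by (rule aY(5)) (use vb[OF cv] t in blast)
   show "((\<lambda>t. Y (t, 0, c *\<^sub>R v)) has_vector_derivative F (Y (t, 0, c *\<^sub>R v))) (at t within {-a<..<a})"
    by (rule aY(7)[OF t vb[OF cv]])
   have q0: "q (t, c *\<^sub>R \<eta> (c * t) v) = c\<^sup>2 *\<^sub>R q (c * t, \<eta> (c * t) v)"
    by (rule q(3)[OF c \<eta>Q(1)[OF t v] \<eta>Q(2)[OF ct[OF t] v]])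
   have "((\<lambda>t. c * t) has_vector_derivative c) (at t within {-a<..<a})"
    by (auto intro!: derivative_eq_intros simp: has_real_derivative_iff_has_vector_derivative[symmetric])
   from vector_diff_chain_within[OF this d\<eta>[OF ct[OF t] v]]
   have "((\<lambda>t. \<eta> (c * t) v) has_vector_derivative c *\<^sub>R q (c * t, \<eta> (c * t) v)) (at t within {-a<..<a})"
    by (simp add: o_def)
   from has_vector_derivative_scaleR[OF DERIV_const this, of c]
   have "((\<lambda>t. c *\<^sub>R \<eta> (c * t) v) has_vector_derivative c\<^sup>2 *\<^sub>R q (c * t, \<eta> (c * t) v)) (at t within {-a<..<a})"
    by (simp add: power2_eq_square)
   from has_vector_derivative_Pair[OF has_vector_derivative_id this]
   show "((\<lambda>t. (t, c *\<^sub>R \<eta> (c * t) v)) has_vector_derivative F (t, c *\<^sub>R \<eta> (c * t) v)) (at t within {-a<..<a})"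
    by (simp add: F_def q0)
  qed (use t aY(1) in \<open>auto intro: convex_real_interval\<close>)
  then show ?thesis using Yeq[OF t cv] by simp
 qed
 \<comment> \<open>A time inside the existence interval; as d < 1, multiplying by d keeps E inside
   the ball of radius R.\<close>
 define d where "d = min a 1 / 2"
 have d: "d > 0" "d \<in> {-a<..<a}" "d < 1" using aY(1) by (auto simp: d_def)
 define r where "r = d * \<delta>"
 have r: "r > 0" using d aY by (simp add: r_def)
 have xd: "norm ((1/d) *\<^sub>R x) < \<delta>" if "x \<in> ball 0 r" for x :: 'a
  using that d by (simp add: r_def field_simps)
 define E where "E x = d *\<^sub>R \<eta> d ((1/d) *\<^sub>R x)" for x
 have CE: "C_inf_on (ball 0 r) E"
  unfolding E_def[abs_def] \<eta>_def
 proof (intro C_inf_on_scaleR C_inf_on_const open_ball C_inf_on_snd)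
  have "C_inf_on (ball 0 r) (\<lambda>x::'a. (d, (0::real, (1/d) *\<^sub>R x)))"
   by (intro C_inf_on_Pair C_inf_on_const open_ball C_inf_on_scaleR C_inf_on_ident)
  then show "C_inf_on (ball 0 r) (\<lambda>x. Y (d, 0, (1/d) *\<^sub>R x))"
  proof (rule C_inf_on_compose[OF open_ball _ _ aY(4), rotated])
   show "(\<lambda>x::'a. (d, 0::real, (1/d) *\<^sub>R x)) ` ball 0 r \<subseteq> {-a<..<a} \<times> ball 0 \<delta>"
   proof (intro image_subsetI SigmaI d(2))
    fix x :: 'a assume "x \<in> ball 0 r"
    from xd[OF this] show "(0::real, (1/d) *\<^sub>R x) \<in> ball 0 \<delta>" by (rule vb)
   qed
  qed (intro open_Times open_greaterThanLessThan open_ball)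
 qed
 have ray: "E (c *\<^sub>R x) = (c * d) *\<^sub>R \<eta> (c * d) ((1/d) *\<^sub>R x)" if "x \<in> ball 0 r" "c \<in> {0..1}" for x c
  using scale[OF d(2) xd[OF that(1)] that(2)] by (simp add: E_def mult.commute)
 have EV: "((\<lambda>c. E (c *\<^sub>R x)) has_vector_derivative
   d *\<^sub>R \<eta> (c * d) ((1/d) *\<^sub>R x) + (c * d) *\<^sub>R (d *\<^sub>R q (c * d, \<eta> (c * d) ((1/d) *\<^sub>R x)))) (at c within {0..1})"
  if x: "x \<in> ball 0 r" and c: "c \<in> {0..1}" for x c
 proof -
  have cd: "c * d \<in> {-a<..<a}"
  proof -
   have "c * d \<le> 1 * d" using c d by (intro mult_right_mono) auto
   moreover have "0 \<le> c * d" using c d by simp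
   ultimately show ?thesis using d(2) by (simp del: zero_le_mult_iff)
  qed
  have "((\<lambda>c. c * d) has_vector_derivative d) (at c within {0..1})"
   by (auto intro!: derivative_eq_intros simp: has_real_derivative_iff_has_vector_derivative[symmetric])
  from vector_diff_chain_within[OF this d\<eta>[OF cd xd[OF x]]]
  have 1: "((\<lambda>c. \<eta> (c * d) ((1/d) *\<^sub>R x)) has_vector_derivative d *\<^sub>R q (c * d, \<eta> (c * d) ((1/d) *\<^sub>R x))) (at c within {0..1})"
   by (simp add: o_def)
  have 2: "((\<lambda>c. c * d) has_real_derivative d) (at c within {0..1})" by (auto intro!: derivative_eq_intros)
  have "((\<lambda>c. (c * d) *\<^sub>R \<eta> (c * d) ((1/d) *\<^sub>R x)) has_vector_derivative
   d *\<^sub>R \<eta> (c * d) ((1/d) *\<^sub>R x) + (c * d) *\<^sub>R (d *\<^sub>R q (c * d, \<eta> (c * d) ((1/d) *\<^sub>R x)))) (at c within {0..1})"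
   using has_vector_derivative_scaleR[OF 2 1] by (simp add: add.commute)
  then show ?thesis by (rule has_vector_derivative_transform[OF c, rotated]) (use ray[OF x] in auto)
 qed
 have EV': "((\<lambda>c. E (c *\<^sub>R x)) has_vector_derivative FD E (c *\<^sub>R x) x) (at c within {0..1})"
  if x: "x \<in> ball 0 r" and c: "c \<in> {0..1}" for x c
 proof -
  have "c * norm x \<le> 1 * norm x" using c by (intro mult_right_mono) auto
  then have cx: "c *\<^sub>R x \<in> ball 0 r" using x c by simp
  have "((\<lambda>c. c *\<^sub>R x) has_vector_derivative x) (at c within {0..1})"
   by (auto intro!: derivative_eq_intros)
  then show ?thesis
   by (rule has_vector_derivative_chain[where p="\<lambda>c. c *\<^sub>R x" and f=E, OF C_inf_on_has_derivative[OF CE cx]])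
 qed
 \<comment> \<open>Two computations of the derivative of c \<mapsto> E (c x): by the chain rule and
   from the equation for \<eta>. At c = 0 they give DE(0) = id, at c = 1 the required equation. The
   derivatives are one-sided at the endpoints.\<close>
 have un: "FD E (c *\<^sub>R x) x = d *\<^sub>R \<eta> (c * d) ((1/d) *\<^sub>R x) + (c * d) *\<^sub>R (d *\<^sub>R q (c * d, \<eta> (c * d) ((1/d) *\<^sub>R x)))"
  if "x \<in> ball 0 r" "c \<in> {0..1}" for x c
  by (rule vector_derivative_unique_within_closed_interval[where a=0 and b=1 and x=c and f="\<lambda>c. E (c *\<^sub>R x)"];
   (unfold box_real)?; (rule EV'[OF that] EV[OF that] that(2) zero_less_one)?)
 show ?thesis
 proof (rule that[OF r CE])
  have "E 0 = E (0 *\<^sub>R 0)" by simp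
  also have "\<dots> = 0" using ray[of 0 0] r by simp
  finally show "E 0 = 0" .
  show "FD E 0 x = x" for x
  proof -
   define c where "c = r / (2 * (1 + norm x))"
   have pos: "1 + norm x > 0" by (simp add: add_pos_nonneg)
   have c: "c > 0" using r pos by (simp add: c_def)
   have "c * norm x \<le> c * (1 + norm x)" using c by simp
   also have "\<dots> = r / 2" using pos by (simp add: c_def divide_simps)
   also have "\<dots> < r" using r by simp
   finally have cx: "c *\<^sub>R x \<in> ball 0 r" using c by simp
   have "FD E (0 *\<^sub>R (c *\<^sub>R x)) (c *\<^sub>R x) = c *\<^sub>R x"
    using un[OF cx, of 0] \<eta>0[OF xd[OF cx]] d by simp
   then have "c *\<^sub>R FD E 0 x = c *\<^sub>R x"
    using linear_scale[OF has_derivative_linear[OF C_inf_on_has_derivative[OF CE]], of 0 c x] r by simp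
   then show ?thesis using c by simp
  qed
  fix x :: 'a assume x: "x \<in> ball 0 r"
  note h = \<eta>Q[OF d(2) xd[OF x]]
  have "norm (d *\<^sub>R \<eta> d ((1/d) *\<^sub>R x)) \<le> 1 * norm (\<eta> d ((1/d) *\<^sub>R x))"
   unfolding norm_scaleR using d by (intro mult_right_mono) auto
  then show "E x \<in> ball 0 R" using h by (simp add: E_def)
  show "FD E x x = V (E x)"
   using un[OF x, of 1] q(2)[OF h] by (simp add: E_def power2_eq_square)
 qed
qed

text \<open>E carries the Euler field x \<mapsto> x to V. A smooth linearisation exists because all
  eigenvalues of the linear part are 1, so that there are no resonances.\<close>

theorem linearise_radial_zero:
 fixes V :: "'a::euclidean_space \<Rightarrow> 'a"
 assumes W: "open W" and V: "C_inf_on W V" and p: "p \<in> W" and V0: "V p = 0" and DV0: "\<And>u. FD V p u = u"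
 obtains r E where "r > 0" "C_inf_on (ball 0 r) E" "E 0 = p" "\<And>x. FD E 0 x = x"
  "\<And>x. x \<in> ball 0 r \<Longrightarrow> E x \<in> W" "\<And>x. x \<in> ball 0 r \<Longrightarrow> FD E x x = V (E x)"
proof -
 obtain R where R: "R > 0" "ball p R \<subseteq> W" using W p openE by blast
 have tr: "(\<lambda>x. p + x) ` ball 0 R \<subseteq> W" using R by (auto simp: dist_norm subset_iff)
 have CV: "C_inf_on (ball 0 R) (\<lambda>x. V (p + x))"
  by (rule C_inf_on_compose[OF open_ball W _ V tr]) (intro C_inf_on_add C_inf_on_const C_inf_on_ident open_ball)
 have dp: "((\<lambda>x. p + x) has_derivative (\<lambda>h. h)) (at x)" for x by (auto intro!: derivative_eq_intros)
 have D: "FD (\<lambda>x. V (p + x)) 0 u = u" for u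
 proof -
  have "((\<lambda>x. V (p + x)) has_derivative FD V p) (at 0)"
   using has_derivative_compose[OF dp[of 0], of V "FD V p"] C_inf_on_has_derivative[OF V p] by simp
  from fun_cong[OF frechet_derivative_at[OF this], of u] show ?thesis using DV0 by simp
 qed
 have "V (p + 0) = 0" using V0 by simp
 then obtain r E where E: "r > 0" "C_inf_on (ball 0 r) E" "E 0 = 0" "\<And>x. FD E 0 x = x"
  "\<And>x. x \<in> ball 0 r \<Longrightarrow> E x \<in> ball 0 R" "\<And>x. x \<in> ball 0 r \<Longrightarrow> FD E x x = V (p + E x)"
  by (rule linearise_radial_zero_at_0[OF R(1) CV _ D]) blast
 have FE: "FD (\<lambda>x. p + E x) x = FD E x" if "x \<in> ball 0 r" for x
 proof -
  have "((\<lambda>x. p + E x) has_derivative FD E x) (at x)"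
   using has_derivative_add[OF has_derivative_const C_inf_on_has_derivative[OF E(2) that], of p] by simp
  from frechet_derivative_at[OF this] show ?thesis by simp
 qed
 show ?thesis
 proof (rule that[of r "\<lambda>x. p + E x"])
  show "C_inf_on (ball 0 r) (\<lambda>x. p + E x)" by (intro C_inf_on_add C_inf_on_const open_ball E)
  show "p + E x \<in> W" if "x \<in> ball 0 r" for x using tr E(5)[OF that] by blast
 qed (use E FE in auto)
qed

section \<open>Charts of a manifold with boundary\<close>

lemma inward_Basis [simp]: "inward \<in> Basis"
 unfolding inward_def by (rule someI_ex) (use nonempty_Basis in blast)

lemma openin_half_spaceE:
 assumes "openin (top_of_set half_space) \<Omega>" "x \<in> \<Omega>"
 obtains r where "r > 0" "ball x r \<inter> half_space \<subseteq> \<Omega>"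
 using assms unfolding openin_contains_ball by blast

lemma half_space_convex: "convex half_space"
 unfolding half_space_def using convex_halfspace_ge[of 0 inward] by (simp add: inner_commute)

text \<open>No basis vector points out of the half-space, so difference quotients in all positive
  basis directions are available even on the bounding hyperplane.\<close>

lemma half_space_derivative_unique:
 assumes \<Omega>: "openin (top_of_set half_space) \<Omega>" "x \<in> \<Omega>"
  and "(F has_derivative D) (at x within \<Omega>)" "(F has_derivative D') (at x within \<Omega>)"
 shows "D = D'"
proof (rule frechet_derivative_unique_within[OF assms(3,4)])
 fix i :: 'a and e :: real
 assume i: "i \<in> Basis" and e: "e > 0"
 obtain r where r: "r > 0" "ball x r \<inter> half_space \<subseteq> \<Omega>" using openin_half_spaceE[OF \<Omega>] .
 define d where "d = min e r / 2"
 have d: "d > 0" "d < e" "d < r" using e r by (auto simp: d_def)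
 have "x \<in> half_space" using \<Omega> openin_imp_subset by blast
 then have "x + d *\<^sub>R i \<in> half_space"
  using i d by (auto simp: half_space_def inner_add_left inner_Basis)
 moreover have "x + d *\<^sub>R i \<in> ball x r" using d i by (simp add: dist_norm)
 ultimately show "\<exists>d. 0 < \<bar>d\<bar> \<and> \<bar>d\<bar> < e \<and> x + d *\<^sub>R i \<in> \<Omega>"
  using d r by (intro exI[of _ d]) auto
qed

lemma deriv_in_eqI:
 assumes "openin (top_of_set half_space) \<Omega>" "x \<in> \<Omega>" "(F has_derivative D) (at x within \<Omega>)"
 shows "deriv_in \<Omega> F x = D"
proof -
 have "(F has_derivative frechet_derivative F (at x within \<Omega>)) (at x within \<Omega>)"
  using assms(3) by (simp add: frechet_derivative_works[symmetric] differentiable_def) blast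
 from half_space_derivative_unique[OF assms(1,2) this assms(3)] show ?thesis
  by (simp add: deriv_in_def fun_eq_iff)
qed

lemma has_derivative_within_ext:
 assumes "open W" "x \<in> W" "x \<in> \<Omega>" "(Ft has_derivative D) (at x)" "\<And>y. y \<in> W \<Longrightarrow> y \<in> \<Omega> \<Longrightarrow> Ft y = F y"
 shows "(F has_derivative D) (at x within \<Omega>)"
proof -
 obtain d where d: "d > 0" "ball x d \<subseteq> W" using assms(1,2) openE by blast
 show ?thesis
  by (rule has_derivative_transform_within[OF has_derivative_at_withinI[OF assms(4)] d(1) assms(3)])
   (use d assms(5) in \<open>auto simp: dist_commute subset_iff\<close>)
qed

text \<open>The bridge between derivatives within a chart image and ordinary derivatives: the former
  are computed on a smooth extension, where the C^k calculus applies.\<close>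

lemma deriv_in_ext:
 assumes "openin (top_of_set half_space) \<Omega>" "open W" "x \<in> W" "x \<in> \<Omega>" "C_inf_on W Ft"
  "\<And>y. y \<in> W \<Longrightarrow> y \<in> \<Omega> \<Longrightarrow> Ft y = F y"
 shows "deriv_in \<Omega> F x = FD Ft x"
 by (rule deriv_in_eqI[OF assms(1,4) has_derivative_within_ext[OF assms(2-4) C_inf_on_has_derivative[OF assms(5,3)] assms(6)]])

lemma smooth_onE:
 assumes "smooth_on V F" "x \<in> V"
 obtains W Ft where "open W" "x \<in> W" "C_inf_on W Ft" "\<And>y. y \<in> W \<Longrightarrow> y \<in> V \<Longrightarrow> Ft y = F y"
 using assms unfolding smooth_on_def C_inf_on_def by (metis IntI)

lemma FD_family:
 fixes T :: "'a::euclidean_space \<Rightarrow> 'b::euclidean_space \<Rightarrow> 'c::euclidean_space"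
 assumes W: "open W" "x \<in> W" and lin: "\<And>y. y \<in> W \<Longrightarrow> linear (T y)"
  and T: "\<And>b. (\<lambda>y. T y b) differentiable (at x)" and V: "(V has_derivative V') (at x)"
 shows "((\<lambda>y. T y (V y)) has_derivative (\<lambda>u. FD (\<lambda>y. T y (V x)) x u + T x (V' u))) (at x)"
proof -
 have dT: "((\<lambda>y. T y b) has_derivative FD (\<lambda>y. T y b) x) (at x)" for b
  using T by (simp add: frechet_derivative_works)
 have "((\<lambda>y. \<Sum>b\<in>Basis. (V x \<bullet> b) *\<^sub>R T y b) has_derivative
   (\<lambda>u. \<Sum>b\<in>Basis. (V x \<bullet> b) *\<^sub>R FD (\<lambda>y. T y b) x u)) (at x)"
  by (intro has_derivative_sum has_derivative_scaleR_right dT)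
 then have "((\<lambda>y. T y (V x)) has_derivative (\<lambda>u. \<Sum>b\<in>Basis. (V x \<bullet> b) *\<^sub>R FD (\<lambda>y. T y b) x u)) (at x)"
  by (rule has_derivative_transform_within_open[OF _ W]) (use linear_basis_expand[OF lin] in auto)
 from frechet_derivative_at[OF this]
 have D: "(\<Sum>b\<in>Basis. (V x \<bullet> b) *\<^sub>R FD (\<lambda>y. T y b) x u) = FD (\<lambda>y. T y (V x)) x u" for u
  by (rule fun_cong)
 have "((\<lambda>y. \<Sum>b\<in>Basis. (V y \<bullet> b) *\<^sub>R T y b) has_derivative
   (\<lambda>u. \<Sum>b\<in>Basis. (V x \<bullet> b) *\<^sub>R FD (\<lambda>y. T y b) x u + (V' u \<bullet> b) *\<^sub>R T x b)) (at x)"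
  by (intro has_derivative_sum has_derivative_scaleR has_derivative_inner_left dT V)
 then have "((\<lambda>y. T y (V y)) has_derivative
   (\<lambda>u. \<Sum>b\<in>Basis. (V x \<bullet> b) *\<^sub>R FD (\<lambda>y. T y b) x u + (V' u \<bullet> b) *\<^sub>R T x b)) (at x)"
  by (rule has_derivative_transform_within_open[OF _ W]) (use linear_basis_expand[OF lin] in auto)
 then show ?thesis
  unfolding sum.distrib D linear_basis_expand[OF lin[OF W(2)], symmetric] .
qed

lemma C_inf_on_family:
 fixes T :: "'a::euclidean_space \<Rightarrow> 'b::euclidean_space \<Rightarrow> 'c::euclidean_space"
 assumes W: "open W" and lin: "\<And>y. y \<in> W \<Longrightarrow> linear (T y)"
  and T: "\<And>b. C_inf_on W (\<lambda>y. T y b)" and V: "C_inf_on W V"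
 shows "C_inf_on W (\<lambda>y. T y (V y))"
proof (rule C_inf_on_cong[OF W])
 show "C_inf_on W (\<lambda>y. \<Sum>b\<in>Basis. (V y \<bullet> b) *\<^sub>R T y b)"
  by (intro C_inf_on_sum C_inf_on_scaleR C_inf_on_inner C_inf_on_const assms)
qed (use linear_basis_expand[OF lin] in auto)

text \<open>Kept to the chart property so that the chart lemmas apply to
  \<open>induced_riemannian\<close> structures as well, for which that property holds by
  definition.\<close>

locale atlas =
 fixes M :: "('p, 'a::euclidean_space) riemannian"
 assumes is_chart: "c \<in> charts M \<Longrightarrow> is_chart (mtop M) c"
begin

lemma
 assumes c: "c \<in> charts M"
 shows chart_open: "openin (mtop M) (fst c)"
  and image_open: "openin (top_of_set half_space) (chart_image c)"
  and chart_inj: "inj_on (snd c) (fst c)"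
  and chart_homeo: "homeomorphic_map (subtopology (mtop M) (fst c)) (top_of_set (chart_image c)) (snd c)"
proof -
 note ch = is_chart[OF c]
 then show "openin (mtop M) (fst c)" "openin (top_of_set half_space) (chart_image c)"
  and h: "homeomorphic_map (subtopology (mtop M) (fst c)) (top_of_set (chart_image c)) (snd c)"
  by (auto simp: is_chart_def)
 have "fst c \<subseteq> topspace (mtop M)" using ch openin_subset by (auto simp: is_chart_def)
 then have "topspace (subtopology (mtop M) (fst c)) = fst c" by auto
 then show "inj_on (snd c) (fst c)"
  using h homeomorphic_imp_injective_map by force
qed

lemma chart_subset: "c \<in> charts M \<Longrightarrow> fst c \<subseteq> topspace (mtop M)"
 using chart_open openin_subset by blast

lemma chart_inv_left: "c \<in> charts M \<Longrightarrow> p \<in> fst c \<Longrightarrow> chart_inv c (snd c p) = p"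
 using chart_inj by (simp add: chart_inv_def)

lemma chart_in_image: "p \<in> fst c \<Longrightarrow> snd c p \<in> chart_image c"
 by (simp add: chart_image_def)

lemma chart_inv_right: "x \<in> chart_image c \<Longrightarrow> snd c (chart_inv c x) = x"
 by (simp add: chart_image_def chart_inv_def f_inv_into_f)

lemma chart_inv_in: "x \<in> chart_image c \<Longrightarrow> chart_inv c x \<in> fst c"
 by (simp add: chart_image_def chart_inv_def inv_into_into)

lemma image_half: "c \<in> charts M \<Longrightarrow> chart_image c \<subseteq> half_space"
 using image_open openin_imp_subset by blast

lemma chart_half: "c \<in> charts M \<Longrightarrow> p \<in> fst c \<Longrightarrow> snd c p \<in> half_space"
 by (rule subsetD[OF image_half chart_in_image])

lemma chart_cont: "c \<in> charts M \<Longrightarrow> continuous_map (subtopology (mtop M) (fst c)) euclidean (snd c)"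
 using homeomorphic_imp_continuous_map[OF chart_homeo] continuous_map_in_subtopology by blast

lemma chart_inv_cont:
 assumes c: "c \<in> charts M"
 shows "continuous_map (top_of_set (chart_image c)) (mtop M) (chart_inv c)"
proof -
 obtain g where g: "homeomorphic_maps (subtopology (mtop M) (fst c)) (top_of_set (chart_image c)) (snd c) g"
  using chart_homeo[OF c] homeomorphic_map_maps by blast
 have "continuous_map (top_of_set (chart_image c)) (subtopology (mtop M) (fst c)) g"
  using g by (simp add: homeomorphic_maps_def)
 then have "continuous_map (top_of_set (chart_image c)) (mtop M) g"
  by (simp add: continuous_map_in_subtopology)
 moreover have "g x = chart_inv c x" if "x \<in> chart_image c" for x
 proof -
  have "chart_inv c x \<in> fst c" by (rule chart_inv_in[OF that])
  moreover have "fst c \<subseteq> topspace (mtop M)" using chart_subset[OF c] .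
  ultimately have "g (snd c (chart_inv c x)) = chart_inv c x"
   using g by (auto simp: homeomorphic_maps_def)
  then show ?thesis by (simp add: chart_inv_right[OF that])
 qed
 ultimately show ?thesis by (metis continuous_map_eq topspace_euclidean_subtopology)
qed

lemma chart_preimage_open:
 assumes c: "c \<in> charts M" and U: "open U"
 shows "openin (mtop M) {p \<in> fst c. snd c p \<in> U}"
proof -
 have "openin (subtopology (mtop M) (fst c)) {p \<in> topspace (subtopology (mtop M) (fst c)). snd c p \<in> U}"
  by (rule openin_continuous_map_preimage[OF chart_cont[OF c]]) (use U in simp)
 moreover have "topspace (subtopology (mtop M) (fst c)) = fst c" using chart_subset[OF c] by auto
 moreover have "{p \<in> topspace (subtopology (mtop M) (fst c)). snd c p \<in> U} = {p \<in> fst c. snd c p \<in> U}"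
  using chart_subset[OF c] by auto
 ultimately show ?thesis using chart_open[OF c] openin_trans_full by metis
qed

lemma chart_image_of_open:
 assumes c: "c \<in> charts M" and N: "openin (mtop M) N"
 shows "openin (top_of_set half_space) (snd c ` (fst c \<inter> N))"
proof -
 have "openin (top_of_set (chart_image c)) {x \<in> topspace (top_of_set (chart_image c)). chart_inv c x \<in> N}"
  by (rule openin_continuous_map_preimage[OF chart_inv_cont[OF c] N])
 moreover have "{x \<in> topspace (top_of_set (chart_image c)). chart_inv c x \<in> N} = snd c ` (fst c \<inter> N)"
 proof (intro equalityI subsetI)
  fix x assume "x \<in> {x \<in> topspace (top_of_set (chart_image c)). chart_inv c x \<in> N}"
  then have "x \<in> chart_image c" "chart_inv c x \<in> N" by auto
  then show "x \<in> snd c ` (fst c \<inter> N)"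
   using chart_inv_right[of x c] chart_inv_in[of x c] by (metis IntI image_eqI)
 next
  fix x assume "x \<in> snd c ` (fst c \<inter> N)"
  then obtain q where "q \<in> fst c" "q \<in> N" "x = snd c q" by blast
  then show "x \<in> {x \<in> topspace (top_of_set (chart_image c)). chart_inv c x \<in> N}"
   using chart_inv_left[OF c, of q] chart_in_image[of q c] by simp
 qed
 ultimately show ?thesis using image_open[OF c] openin_trans by metis
qed

lemma chart_nhd:
 assumes c: "c \<in> charts M" and p: "p \<in> fst c" and N: "openin (mtop M) N" "p \<in> N"
 obtains r where "r > 0" "\<And>x. x \<in> ball (snd c p) r \<Longrightarrow> x \<in> half_space \<Longrightarrow> x \<in> chart_image c \<and> chart_inv c x \<in> N"
proof -
 have "snd c p \<in> snd c ` (fst c \<inter> N)" using p N by blast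
 from openin_half_spaceE[OF chart_image_of_open[OF c N(1)] this]
 obtain r where r: "r > 0" "ball (snd c p) r \<inter> half_space \<subseteq> snd c ` (fst c \<inter> N)" by blast
 show ?thesis
 proof (rule that[OF r(1)])
  fix x assume "x \<in> ball (snd c p) r" "x \<in> half_space"
  then obtain q where "q \<in> fst c" "q \<in> N" "x = snd c q" using r by blast
  then show "x \<in> chart_image c \<and> chart_inv c x \<in> N"
   using chart_inv_left[OF c, of q] chart_in_image[of q c] by simp
 qed
qed

end

locale riemannian_mfd =
 fixes M :: "('p, 'a::euclidean_space) riemannian"
 assumes rm: "riemannian_manifold M"

sublocale riemannian_mfd \<subseteq> atlas M
 using rm by unfold_locales (auto simp: riemannian_manifold_def smooth_manifold_def)

context riemannian_mfd
begin

lemma chart_exists: "p \<in> topspace (mtop M) \<Longrightarrow> \<exists>c\<in>charts M. p \<in> fst c"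
 using rm by (auto simp: riemannian_manifold_def smooth_manifold_def)

lemma
 assumes "c \<in> charts M" "p \<in> fst c"
 shows metric_bilinear: "bilinear (metric M c p)"
  and metric_sym: "metric M c p u v = metric M c p v u"
  and metric_pos: "u \<noteq> 0 \<Longrightarrow> metric M c p u u > 0"
  and metric_smooth: "smooth_on (chart_image c) (\<lambda>x. metric_coord M c x u v)"
 using assms rm unfolding riemannian_manifold_def riemannian_metric_def by blast+

lemma metric_nondegenerate:
 assumes "c \<in> charts M" "p \<in> fst c" "\<And>w. metric M c p u w = metric M c p v w"
 shows "u = v"
proof (rule ccontr)
 assume "u \<noteq> v"
 then have "metric M c p (u - v) (u - v) > 0" using metric_pos[OF assms(1,2)] by simp
 then show False
  using assms(3) bilinear_lsub[OF metric_bilinear[OF assms(1,2)]] by simp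
qed

text \<open>T extends the coordinate change smoothly across the bounding hyperplane. Outside the
  half-space its values have no geometric meaning, hence the restriction of the clauses.\<close>

definition transition_map where
 "transition_map c d p W T \<longleftrightarrow> open W \<and> snd c p \<in> W \<and> C_inf_on W T \<and>
   (\<forall>y\<in>W \<inter> half_space. (y \<in> chart_image c \<and> chart_inv c y \<in> fst d \<and> T y = snd d (chart_inv c y)) \<and>
    (\<forall>u v. metric M c (chart_inv c y) u v = metric M d (chart_inv c y) (FD T y u) (FD T y v)))"

lemma transition_mapD:
 assumes "transition_map c d p W T"
 shows "open W" "snd c p \<in> W" "C_inf_on W T"
  "y \<in> W \<Longrightarrow> y \<in> half_space \<Longrightarrow> y \<in> chart_image c \<and> chart_inv c y \<in> fst d \<and> T y = snd d (chart_inv c y)"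
  "y \<in> W \<Longrightarrow> y \<in> half_space \<Longrightarrow>
    metric M c (chart_inv c y) u v = metric M d (chart_inv c y) (FD T y u) (FD T y v)"
  "c \<in> charts M \<Longrightarrow> p \<in> fst c \<Longrightarrow> T (snd c p) = snd d p"
  "c \<in> charts M \<Longrightarrow> p \<in> fst c \<Longrightarrow> metric M c p u v = metric M d p (FD T (snd c p) u) (FD T (snd c p) v)"
proof -
 show *: "open W" "snd c p \<in> W" "C_inf_on W T"
  "\<And>y. y \<in> W \<Longrightarrow> y \<in> half_space \<Longrightarrow> y \<in> chart_image c \<and> chart_inv c y \<in> fst d \<and> T y = snd d (chart_inv c y)"
  "\<And>y u v. y \<in> W \<Longrightarrow> y \<in> half_space \<Longrightarrow>
    metric M c (chart_inv c y) u v = metric M d (chart_inv c y) (FD T y u) (FD T y v)"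
  using assms unfolding transition_map_def by blast+
 assume p: "c \<in> charts M" "p \<in> fst c"
 show "T (snd c p) = snd d p" "metric M c p u v = metric M d p (FD T (snd c p) u) (FD T (snd c p) v)"
  using *(4,5)[OF *(2) chart_half[OF p]] chart_inv_left[OF p] by simp_all
qed

lemma transition:
 assumes c: "c \<in> charts M" and d: "d \<in> charts M" and p: "p \<in> fst c" "p \<in> fst d"
 obtains W T where "transition_map c d p W T"
proof -
 let ?V = "snd c ` (fst c \<inter> fst d)"
 have V: "openin (top_of_set half_space) ?V" by (rule chart_image_of_open[OF c chart_open[OF d]])
 have "smooth_on ?V (snd d \<circ> chart_inv c)"
  using rm c d by (auto simp: riemannian_manifold_def smooth_manifold_def)
 moreover have xV: "snd c p \<in> ?V" using p by blast
 ultimately obtain W0 T where W0: "open W0" "snd c p \<in> W0" "C_inf_on W0 T"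
  "\<And>y. y \<in> W0 \<Longrightarrow> y \<in> ?V \<Longrightarrow> T y = (snd d \<circ> chart_inv c) y"
  by (rule smooth_onE) blast
 obtain r where r: "r > 0" "ball (snd c p) r \<inter> half_space \<subseteq> ?V" using openin_half_spaceE[OF V xV] .
 let ?W = "W0 \<inter> ball (snd c p) r"
 have WV: "y \<in> ?V" "y \<in> chart_image c" "chart_inv c y \<in> fst c" "chart_inv c y \<in> fst d" "snd c (chart_inv c y) = y"
  if "y \<in> ?W" "y \<in> half_space" for y
 proof -
  have y: "y \<in> ?V" using that r by blast
  then obtain q where q: "q \<in> fst c" "q \<in> fst d" "y = snd c q" by blast
  then show "y \<in> ?V" "y \<in> chart_image c" "chart_inv c y \<in> fst c" "chart_inv c y \<in> fst d" "snd c (chart_inv c y) = y"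
   using chart_inv_left[OF c q(1)] chart_in_image[OF q(1)] by auto
 qed
 have "transition_map c d p ?W T"
  unfolding transition_map_def
 proof (intro conjI ballI allI)
  show "C_inf_on ?W T" by (rule C_inf_on_subset[OF W0(3)]) auto
  fix y assume "y \<in> ?W \<inter> half_space"
  then have y: "y \<in> ?W" "y \<in> half_space" by auto
  show "y \<in> chart_image c" "chart_inv c y \<in> fst d" "T y = snd d (chart_inv c y)"
   using WV[OF y] W0(4) y by auto
  fix u v
  have "deriv_in ?V (snd d \<circ> chart_inv c) y = FD T y"
   by (rule deriv_in_ext[OF V W0(1) _ WV(1)[OF y] W0(3,4)]) (use y in auto)
  moreover have "metric M c q u v = metric M d q (deriv_in ?V (snd d \<circ> chart_inv c) (snd c q) u)
    (deriv_in ?V (snd d \<circ> chart_inv c) (snd c q) v)" if "q \<in> fst c \<inter> fst d" for q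
   using rm c d that unfolding riemannian_manifold_def riemannian_metric_def Let_def by blast
  ultimately show "metric M c (chart_inv c y) u v = metric M d (chart_inv c y) (FD T y u) (FD T y v)"
   using WV[OF y] by (metis IntI)
 qed (use W0 r in auto)
 then show ?thesis by (rule that)
qed

lemma transition_bij:
 assumes c: "c \<in> charts M" and d: "d \<in> charts M" and p: "p \<in> fst c" "p \<in> fst d"
  and lin: "linear L" and L: "\<And>u v. metric M c p u v = metric M d p (L u) (L v)"
 shows "bij L"
proof -
 have "inj L"
  unfolding linear_injective_0[OF lin]
 proof (intro allI impI)
  fix u assume "L u = 0"
  then have "metric M c p u u = 0"
   using L[of u u] bilinear_lzero[OF metric_bilinear[OF d p(2)]] by simp
  then show "u = 0" using metric_pos[OF c p(1), of u] by force
 qed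
 then show ?thesis using lin linear_injective_imp_surjective bij_def by blast
qed

text \<open>Were p interior for the chart c, invariance of domain would make the transition map
  cover a full neighbourhood of a point of the hyperplane, although its values there lie in the
  half-space.\<close>

lemma boundary_chart_invariant:
 assumes c: "c \<in> charts M" and d: "d \<in> charts M" and p: "p \<in> fst c" "p \<in> fst d"
  and b: "snd d p \<bullet> inward = 0"
 shows "snd c p \<bullet> inward = 0"
proof (rule ccontr)
 assume "snd c p \<bullet> inward \<noteq> 0"
 then have pos: "snd c p \<bullet> inward > 0" using chart_half[OF c p(1)] by (simp add: half_space_def)
 obtain W T where "transition_map c d p W T" by (rule transition[OF c d p])
 note W = transition_mapD[OF this]
 let ?U = "W \<inter> {x. 0 < x \<bullet> inward}"
 have U: "open ?U" by (intro open_Int W open_Collect_less continuous_intros)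
 have WU: "y \<in> chart_image c" "chart_inv c y \<in> fst d" "T y = snd d (chart_inv c y)" if "y \<in> ?U" for y
  using W(4)[of y] that by (auto simp: half_space_def)
 have "inj_on T ?U"
 proof (rule inj_onI)
  fix x y assume xy: "x \<in> ?U" "y \<in> ?U" "T x = T y"
  then have "chart_inv c x = chart_inv c y" using inj_onD[OF chart_inj[OF d]] WU by metis
  then show "x = y" using WU(1) xy chart_inv_right by metis
 qed
 then have op: "open (T ` ?U)"
  using invariance_of_domain[OF _ U] C_inf_on_continuous_on[OF W(3)] continuous_on_subset by blast
 have "snd d p \<in> T ` ?U"
  by (rule image_eqI[of _ _ "snd c p"]) (use W(2,6) c p pos in auto)
 then obtain e where e: "e > 0" "ball (snd d p) e \<subseteq> T ` ?U" using op openE by blast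
 let ?z = "snd d p - (e/2) *\<^sub>R inward"
 have "?z \<in> ball (snd d p) e" using e inward_Basis by (simp add: dist_norm)
 then obtain y where y: "y \<in> ?U" "?z = T y" using e by blast
 then have "?z \<in> half_space" using WU chart_half[OF d] by metis
 moreover have "?z \<bullet> inward = - (e/2)" using b inward_Basis by (simp add: inner_diff_left)
 ultimately show False using e by (simp add: half_space_def)
qed

lemma boundary_iff:
 assumes "c \<in> charts M" "p \<in> fst c"
 shows "p \<in> boundary M \<longleftrightarrow> snd c p \<bullet> inward = 0"
proof
 assume "p \<in> boundary M"
 then obtain d where "d \<in> charts M" "p \<in> fst d" "snd d p \<bullet> inward = 0" unfolding boundary_def by blast
 then show "snd c p \<bullet> inward = 0" using boundary_chart_invariant[OF assms(1) _ assms(2)] by blast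
next
 assume "snd c p \<bullet> inward = 0"
 then show "p \<in> boundary M" unfolding boundary_def using assms chart_subset[OF assms(1)] by blast
qed

end

section \<open>The equation \<open>\<nabla>\<^sup>2 s + s g = 0\<close> in charts\<close>

lemma FD_linear_param:
 fixes T :: "'a::euclidean_space \<Rightarrow> 'b::euclidean_space \<Rightarrow> 'c::euclidean_space"
 assumes W: "open W" "x \<in> W" and lin: "\<And>y. y \<in> W \<Longrightarrow> linear (T y)"
  and T: "\<And>b. (\<lambda>y. T y b) differentiable (at x)"
 shows "linear (\<lambda>w. FD (\<lambda>y. T y w) x u)"
proof (rule linearI)
 have dT: "((\<lambda>y. T y b) has_derivative FD (\<lambda>y. T y b) x) (at x)" for b
  using T by (simp add: frechet_derivative_works)
 fix a b :: 'b and r :: real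
 have "((\<lambda>y. T y (a + b)) has_derivative (\<lambda>u. FD (\<lambda>y. T y a) x u + FD (\<lambda>y. T y b) x u)) (at x)"
  by (rule has_derivative_transform_within_open[OF has_derivative_add[OF dT dT] W]) (simp add: linear_add[OF lin])
 from fun_cong[OF frechet_derivative_at[OF this]]
 show "FD (\<lambda>y. T y (a + b)) x u = FD (\<lambda>y. T y a) x u + FD (\<lambda>y. T y b) x u" by simp
 have "((\<lambda>y. T y (r *\<^sub>R a)) has_derivative (\<lambda>u. r *\<^sub>R FD (\<lambda>y. T y a) x u)) (at x)"
  by (rule has_derivative_transform_within_open[OF has_derivative_scaleR_right[OF dT] W]) (simp add: linear_scale[OF lin])
 from fun_cong[OF frechet_derivative_at[OF this]]
 show "FD (\<lambda>y. T y (r *\<^sub>R a)) x u = r *\<^sub>R FD (\<lambda>y. T y a) x u" by simp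
qed

lemma bilinear_linear: "bilinear f \<Longrightarrow> linear (f x)" "bilinear f \<Longrightarrow> linear (\<lambda>x. f x y)"
 by (auto simp: bilinear_def)

lemma bilinear_basis_expand:
 fixes B :: "'a::euclidean_space \<Rightarrow> 'a \<Rightarrow> real"
 assumes "bilinear B"
 shows "B u v = (\<Sum>a\<in>Basis. \<Sum>b\<in>Basis. (u \<bullet> a) * (v \<bullet> b) * B a b)"
proof -
 have "B u v = (\<Sum>a\<in>Basis. (u \<bullet> a) *\<^sub>R B a v)"
  by (rule linear_basis_expand[OF bilinear_linear(2)[OF assms]])
 also have "\<dots> = (\<Sum>a\<in>Basis. (u \<bullet> a) *\<^sub>R (\<Sum>b\<in>Basis. (v \<bullet> b) *\<^sub>R B a b))"
  by (intro sum.cong refl arg_cong2[where f=scaleR] linear_basis_expand[OF bilinear_linear(1)[OF assms]])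
 finally show ?thesis by (simp add: sum_distrib_left mult.assoc)
qed

lemma functional_inner:
 fixes \<phi> :: "'a::euclidean_space \<Rightarrow> real"
 assumes "linear \<phi>"
 shows "(\<Sum>w\<in>Basis. \<phi> w *\<^sub>R w) \<bullet> u = \<phi> u"
 using linear_basis_expand[OF assms, of u] by (simp add: inner_sum_left inner_commute[of u] mult.commute)

definition gram :: "('a::euclidean_space \<Rightarrow> 'a \<Rightarrow> real) \<Rightarrow> 'a \<Rightarrow> 'a" where
 "gram B z = (\<Sum>w\<in>Basis. B z w *\<^sub>R w)"

lemma
 assumes B: "bilinear B"
 shows gram_linear: "linear (gram B)" and gram_inner: "gram B z \<bullet> w = B z w"
 unfolding gram_def[abs_def]
 by (auto intro!: linearI functional_inner bilinear_linear(1)[OF B]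
   simp: bilinear_ladd[OF B] bilinear_lmul[OF B] scaleR_add_left sum.distrib scaleR_sum_right)

lemma form_represents:
 fixes B :: "'a::euclidean_space \<Rightarrow> 'a \<Rightarrow> real"
 assumes B: "bilinear B" and nd: "\<And>z. (\<And>w. B z w = 0) \<Longrightarrow> z = 0" and \<phi>: "linear \<phi>"
 shows "\<exists>!z. \<forall>w. B z w = \<phi> w"
proof -
 have "inj (gram B)" unfolding linear_injective_0[OF gram_linear[OF B]] using nd gram_inner[OF B] by (metis inner_zero_left)
 then have "surj (gram B)" using gram_linear[OF B] linear_injective_imp_surjective by blast
 then obtain z where "gram B z = (\<Sum>w\<in>Basis. \<phi> w *\<^sub>R w)" by (metis surjD)
 then have z: "B z w = \<phi> w" for w using gram_inner[OF B, of z w] functional_inner[OF \<phi>, of w] by simp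
 moreover have "z' = z" if "\<forall>w. B z' w = \<phi> w" for z'
 proof -
  have "z' - z = 0" by (rule nd) (use that z bilinear_lsub[OF B] in simp)
  then show ?thesis by simp
 qed
 ultimately show ?thesis by blast
qed

lemma bilinear_coefficients:
 "bilinear (\<lambda>u v. \<Sum>a\<in>Basis. \<Sum>b\<in>Basis. (u \<bullet> a) * (v \<bullet> b) * k a b :: real)"
 unfolding bilinear_def
 by (auto intro!: linearI simp: inner_add_left distrib_right distrib_left sum.distrib sum_distrib_left mult_ac)

context riemannian_mfd
begin

lemma metric_represents:
 assumes "c \<in> charts M" "p \<in> fst c" "linear \<phi>"
 shows "\<exists>!z. \<forall>w. metric M c p z w = \<phi> w"
proof (rule form_represents[OF metric_bilinear[OF assms(1,2)] _ assms(3)])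
 fix z assume "\<And>w. metric M c p z w = 0"
 then show "z = 0" using metric_pos[OF assms(1,2), of z] by force
qed

definition metric_ext :: "('p, 'a) chart \<Rightarrow> 'a set \<Rightarrow> ('a \<Rightarrow> 'a \<Rightarrow> 'a \<Rightarrow> real) \<Rightarrow> bool" where
 "metric_ext c W G \<longleftrightarrow> open W \<and> W \<inter> half_space \<subseteq> chart_image c \<and> (\<forall>u v. C_inf_on W (\<lambda>x. G x u v)) \<and>
   (\<forall>x\<in>W. bilinear (G x) \<and> (\<forall>u v. G x u v = G x v u)) \<and>
   (\<forall>x\<in>W \<inter> half_space. G x = metric_coord M c x)"

lemma metric_ext_exists:
 assumes c: "c \<in> charts M" and p: "p \<in> fst c"
 obtains W G where "snd c p \<in> W" "metric_ext c W G"
proof -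
 let ?x = "snd c p"
 have xI: "?x \<in> chart_image c" by (rule chart_in_image[OF p])
 have "\<forall>bb. \<exists>WF. open (fst WF) \<and> ?x \<in> fst WF \<and> C_inf_on (fst WF) (snd WF) \<and>
   (\<forall>y\<in>fst WF. y \<in> chart_image c \<longrightarrow> snd WF y = metric_coord M c y (fst bb) (snd bb))"
 proof
  fix bb :: "'a \<times> 'a"
  obtain W F where "open W" "?x \<in> W" "C_inf_on W F"
   "\<And>y. y \<in> W \<Longrightarrow> y \<in> chart_image c \<Longrightarrow> F y = metric_coord M c y (fst bb) (snd bb)"
   by (rule smooth_onE[OF metric_smooth[OF c p, of "fst bb" "snd bb"] xI]) blast
  then show "\<exists>WF. open (fst WF) \<and> ?x \<in> fst WF \<and> C_inf_on (fst WF) (snd WF) \<and>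
   (\<forall>y\<in>fst WF. y \<in> chart_image c \<longrightarrow> snd WF y = metric_coord M c y (fst bb) (snd bb))"
   by (intro exI[of _ "(W, F)"]) auto
 qed
 from choice[OF this] obtain WF where WF: "\<And>bb. open (fst (WF bb))" "\<And>bb. ?x \<in> fst (WF bb)"
  "\<And>bb. C_inf_on (fst (WF bb)) (snd (WF bb))"
  "\<And>bb y. y \<in> fst (WF bb) \<Longrightarrow> y \<in> chart_image c \<Longrightarrow> snd (WF bb) y = metric_coord M c y (fst bb) (snd bb)"
  by blast
 obtain r where r: "r > 0" "ball ?x r \<inter> half_space \<subseteq> chart_image c"
  using openin_half_spaceE[OF image_open[OF c] xI] .
 define W where "W = ball ?x r \<inter> (\<Inter>bb\<in>Basis \<times> Basis. fst (WF bb))"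
 have W: "open W" unfolding W_def by (intro open_Int open_ball open_INT finite_cartesian_product finite_Basis ballI WF)
 have xW: "?x \<in> W" using WF r by (auto simp: W_def simp del: split_paired_All)
 \<comment> \<open>The coefficients with indices (a, b) and (b, a) were extended independently, so
   averaging is needed to keep the extension symmetric off the half-space.\<close>
 define G where "G x u v = (\<Sum>a\<in>Basis. \<Sum>b\<in>Basis. (u \<bullet> a) * (v \<bullet> b) * ((snd (WF (a, b)) x + snd (WF (b, a)) x) / 2))" for x u v
 have WFsub: "C_inf_on W (snd (WF (a, b)))" if "a \<in> Basis" "b \<in> Basis" for a b
  by (rule C_inf_on_subset[OF WF(3)]) (use that in \<open>auto simp: W_def\<close>)
 have "metric_ext c W G"
  unfolding metric_ext_def
 proof (intro conjI allI ballI W)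
  show "W \<inter> half_space \<subseteq> chart_image c" using r by (auto simp: W_def)
  fix u v
  have "C_inf_on W (\<lambda>x. \<Sum>a\<in>Basis. \<Sum>b\<in>Basis. (u \<bullet> a) * (v \<bullet> b) * (1/2) * (snd (WF (a, b)) x + snd (WF (b, a)) x))"
   by (intro C_inf_on_sum C_inf_on_mult C_inf_on_add C_inf_on_const W WFsub)
  then show "C_inf_on W (\<lambda>x. G x u v)" by (simp add: G_def)
 next
  fix x
  show "bilinear (G x)" unfolding G_def[abs_def] by (rule bilinear_coefficients)
  show "G x u v = G x v u" for u v
   unfolding G_def by (subst sum.swap) (simp add: add.commute mult.commute)
 next
  fix x assume x: "x \<in> W \<inter> half_space"
  then have xI: "x \<in> chart_image c" using r by (auto simp: W_def)
  have bil: "bilinear (metric_coord M c x)" and sym: "metric_coord M c x u v = metric_coord M c x v u" for u v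
   unfolding metric_coord_def using metric_bilinear[OF c chart_inv_in[OF xI]] metric_sym[OF c chart_inv_in[OF xI], of u v]
   by simp_all
  have e: "(snd (WF (a, b)) x + snd (WF (b, a)) x) / 2 = metric_coord M c x a b" if "a \<in> Basis" "b \<in> Basis" for a b
  proof -
   have "x \<in> fst (WF (a, b))" "x \<in> fst (WF (b, a))" using x that by (auto simp: W_def)
   then have "snd (WF (a, b)) x = metric_coord M c x a b" "snd (WF (b, a)) x = metric_coord M c x b a"
    using WF(4)[of x] xI by auto
   then show ?thesis using sym[of a b] by simp
  qed
  show "G x = metric_coord M c x"
  proof (intro ext)
   fix u v
   show "G x u v = metric_coord M c x u v"
    unfolding bilinear_basis_expand[OF bil, of u v] G_def by (simp add: e)
  qed
 qed
 then show ?thesis using that xW by blast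
qed

lemma metric_ext_subset: "metric_ext c W G \<Longrightarrow> open W' \<Longrightarrow> W' \<subseteq> W \<Longrightarrow> metric_ext c W' G"
 unfolding metric_ext_def by (blast intro: C_inf_on_subset)

lemma
 assumes "metric_ext c W G"
 shows metric_ext_open: "open W"
  and metric_ext_image: "x \<in> W \<Longrightarrow> x \<in> half_space \<Longrightarrow> x \<in> chart_image c"
  and metric_ext_smooth: "C_inf_on W (\<lambda>x. G x u v)"
  and metric_ext_bilinear: "x \<in> W \<Longrightarrow> bilinear (G x)"
  and metric_ext_sym: "x \<in> W \<Longrightarrow> G x u v = G x v u"
  and metric_ext_eq: "x \<in> W \<Longrightarrow> x \<in> half_space \<Longrightarrow> G x u v = metric M c (chart_inv c x) u v"
 using assms unfolding metric_ext_def metric_coord_def by auto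

text \<open>The right-hand side is linear in w and hence represented by exactly one vector, so the
  definite description in \<open>christoffel\<close> denotes.\<close>

lemma koszul:
 assumes c: "c \<in> charts M" and G: "metric_ext c W G" and x: "x \<in> W" "x \<in> half_space"
 shows "2 * G x (christoffel M c x u v) w =
  FD (\<lambda>y. G y v w) x u + FD (\<lambda>y. G y u w) x v - FD (\<lambda>y. G y u v) x w"
proof -
 note W = metric_ext_open[OF G] and xI = metric_ext_image[OF G x]
 have d: "deriv_in (chart_image c) (\<lambda>y. metric_coord M c y a b) x = FD (\<lambda>y. G y a b) x" for a b
  by (rule deriv_in_ext[OF image_open[OF c] W x(1) xI metric_ext_smooth[OF G]])
   (use metric_ext_eq[OF G] image_half[OF c] in \<open>auto simp: metric_coord_def\<close>)
 let ?\<phi> = "\<lambda>w. FD (\<lambda>y. G y v w) x u + FD (\<lambda>y. G y u w) x v - FD (\<lambda>y. G y u v) x w"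
 have diff: "(\<lambda>y. G y a b) differentiable (at x)" for a b
  using C_inf_on_has_derivative[OF metric_ext_smooth[OF G] x(1)] by (auto simp: differentiable_def)
 have lin: "linear ?\<phi>"
  by (intro linear_compose_add linear_compose_sub FD_linear_param[OF W x(1)] bilinear_linear(1) metric_ext_bilinear[OF G]
    diff has_derivative_linear[OF C_inf_on_has_derivative[OF metric_ext_smooth[OF G] x(1)]])
 have "linear (\<lambda>w. ?\<phi> w / 2)"
  using linear_compose_scale_right[OF lin, of "1/2"] by simp
 from metric_represents[OF c chart_inv_in[OF xI] this]
 obtain z where z: "\<And>w. metric M c (chart_inv c x) z w = ?\<phi> w / 2" by blast
 have "christoffel M c x u v = z" unfolding christoffel_def d
 proof (rule the_equality)
  show "\<forall>w. 2 * metric_coord M c x z w = ?\<phi> w" unfolding metric_coord_def z by simp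
  fix z' assume z': "\<forall>w. 2 * metric_coord M c x z' w = ?\<phi> w"
  show "z' = z"
  proof (rule metric_nondegenerate[OF c chart_inv_in[OF xI]])
   show "metric M c (chart_inv c x) z' w = metric M c (chart_inv c x) z w" for w
    using z'[rule_format, of w] z[of w] by (simp add: metric_coord_def)
  qed
 qed
 then show ?thesis using z[of w] metric_ext_eq[OF G x] by simp
qed

end

locale obata = riemannian_mfd M for M :: "('p, 'a::euclidean_space) riemannian" +
 fixes s :: "'p \<Rightarrow> real"
 assumes s_smooth: "smooth_function M s"
  and s_hess: "\<And>c p u v. c \<in> charts M \<Longrightarrow> p \<in> fst c \<Longrightarrow> hessian M s c p u v + s p * metric M c p u v = 0"
begin

text \<open>V extends - \<nabla>s past the bounding hyperplane. For the normalised s this sign gives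
  V the identity as derivative at a point with s = 1, the form required for linearisation.\<close>

definition obata_ext :: "('p, 'a) chart \<Rightarrow> 'a set \<Rightarrow> ('a \<Rightarrow> 'a \<Rightarrow> 'a \<Rightarrow> real) \<Rightarrow> ('a \<Rightarrow> real) \<Rightarrow> ('a \<Rightarrow> 'a) \<Rightarrow> bool"
 where "obata_ext c W G S V \<longleftrightarrow> metric_ext c W G \<and> C_inf_on W S \<and> C_inf_on W V \<and>
  (\<forall>x\<in>W \<inter> half_space. S x = s (chart_inv c x)) \<and> (\<forall>x\<in>W. \<forall>w. G x (V x) w = - FD S x w)"

lemma obata_ext_exists:
 assumes c: "c \<in> charts M" and p: "p \<in> fst c"
 obtains W G S V where "snd c p \<in> W" "obata_ext c W G S V"
proof -
 let ?x = "snd c p"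
 have xI: "?x \<in> chart_image c" by (rule chart_in_image[OF p])
 obtain W1 G where W1: "?x \<in> W1" "metric_ext c W1 G" by (rule metric_ext_exists[OF c p]) blast
 have "smooth_on (chart_image c) (s \<circ> chart_inv c)" using s_smooth c by (auto simp: smooth_function_def)
 then obtain W2 S where W2: "open W2" "?x \<in> W2" "C_inf_on W2 S"
  "\<And>y. y \<in> W2 \<Longrightarrow> y \<in> chart_image c \<Longrightarrow> S y = (s \<circ> chart_inv c) y" using xI by (rule smooth_onE) blast
 define L where "L x = gram (G x)" for x
 note bil = metric_ext_bilinear[OF W1(2)]
 have linL: "linear (L x)" and Lw: "L x z \<bullet> w = G x z w" if "x \<in> W1" for x z w
  unfolding L_def by (rule gram_linear[OF bil[OF that]], rule gram_inner[OF bil[OF that]])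
 have CL: "C_inf_on W1 (\<lambda>x. L x z)" for z unfolding L_def gram_def
  by (intro C_inf_on_sum C_inf_on_scaleR C_inf_on_const metric_ext_smooth[OF W1(2)] metric_ext_open[OF W1(2)])
 have "inj (L ?x)" unfolding linear_injective_0[OF linL[OF W1(1)]]
 proof (intro allI impI)
  fix z assume "L ?x z = 0"
  then have "metric M c p z z = 0"
   using Lw[OF W1(1), of z z] metric_ext_eq[OF W1(2,1) chart_half[OF c p]] chart_inv_left[OF c p] by simp
  then show "z = 0" using metric_pos[OF c p, of z] by force
 qed
 then obtain r where r: "r > 0" "ball ?x r \<subseteq> W1" "\<And>x. x \<in> ball ?x r \<Longrightarrow> inj (L x)"
  using inverse_family_bounded[OF metric_ext_open[OF W1(2)] linL C_inf_on_continuous_on[OF CL] _ W1(1)] by metis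
 define W where "W = W2 \<inter> ball ?x r"
 have W: "open W" "?x \<in> W" "W \<subseteq> W1" "W \<subseteq> W2" "W \<subseteq> ball ?x r" using W2 r by (auto simp: W_def)
 define K where "K x = inv (L x)" for x
 have surjL: "surj (L x)" if "x \<in> W" for x
  using linear_injective_imp_surjective[OF linL r(3)] W that by blast
 have K: "L x (K x u) = u" "K x (L x u) = u" if "x \<in> W" for x u
  using surjL[OF that] r(3)[of x] W that by (auto simp: K_def surj_f_inv_f)
 have linK: "linear (K x)" if "x \<in> W" for x
  by (rule linear_two_sided_inverse[OF linL]) (use K that W in auto)
 define V where "V x = K x (\<Sum>w\<in>Basis. (- FD S x w) *\<^sub>R w)" for x
 have CS: "C_inf_on W S" by (rule C_inf_on_subset[OF W2(3) W(4)])
 have CK: "C_inf_on W (\<lambda>x. K x v)" for v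
  by (rule C_inf_on_inverse_family[OF W(1) _ C_inf_on_subset[OF CL W(3)] K]) (use linL W in auto)
 have CV: "C_inf_on W V" unfolding V_def
  by (rule C_inf_on_family[OF W(1) linK CK]; (assumption)?)
   (intro W C_inf_on_sum C_inf_on_scaleR C_inf_on_minus C_inf_on_FD CS C_inf_on_const)
 have linS: "linear (\<lambda>w. - FD S x w)" if "x \<in> W" for x
  using has_derivative_linear[OF C_inf_on_has_derivative[OF CS that]] by (rule linear_compose_neg)
 have "G x (V x) w = - FD S x w" if x: "x \<in> W" for x w
 proof -
  have "G x (V x) w = (\<Sum>b\<in>Basis. (- FD S x b) *\<^sub>R b) \<bullet> w"
   using Lw[of x "V x" w] x W K(1)[OF x] by (auto simp: V_def)
  also have "\<dots> = - FD S x w"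
   by (rule functional_inner[OF linS[OF x]])
  finally show ?thesis .
 qed
 moreover have "S x = s (chart_inv c x)" if "x \<in> W" "x \<in> half_space" for x
  using W2(4)[of x] that W metric_ext_image[OF W1(2)] by auto
 ultimately have "obata_ext c W G S V"
  unfolding obata_ext_def using CS CV metric_ext_subset[OF W1(2) W(1,3)] by auto
 then show ?thesis using that W(2) by blast
qed

lemma
 assumes "obata_ext c W G S V"
 shows obata_ext_metric: "metric_ext c W G"
  and obata_ext_S: "C_inf_on W S" and obata_ext_V: "C_inf_on W V"
  and obata_ext_s: "x \<in> W \<Longrightarrow> x \<in> half_space \<Longrightarrow> S x = s (chart_inv c x)"
  and obata_ext_grad: "x \<in> W \<Longrightarrow> G x (V x) w = - FD S x w"
  and obata_ext_open: "open W"
  and obata_ext_image: "x \<in> W \<Longrightarrow> x \<in> half_space \<Longrightarrow> x \<in> chart_image c"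
 using assms unfolding obata_ext_def metric_ext_def by auto

text \<open>In invariant terms this is \<nabla>_u V = s u. Differentiate G(V, w) = - dS(w), insert
  the equation for the Hessian, and eliminate the Christoffel symbol by the Koszul formula.\<close>

lemma second_derivative_identity:
 assumes c: "c \<in> charts M" and E: "obata_ext c W G S V" and x: "x \<in> W" "x \<in> half_space"
 shows "2 * G x (FD V x u) w = 2 * S x * G x u w
  + FD (\<lambda>y. G y u (V x)) x w - FD (\<lambda>y. G y w (V x)) x u - FD (\<lambda>y. G y u w) x (V x)"
proof -
 note G = obata_ext_metric[OF E] and CS = obata_ext_S[OF E] and CV = obata_ext_V[OF E]
 note W = obata_ext_open[OF E] and xI = obata_ext_image[OF E x]
 let ?\<Omega> = "chart_image c" and ?F = "s \<circ> chart_inv c" and ?p = "chart_inv c x"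
 have p: "?p \<in> fst c" "snd c ?p = x" using chart_inv_in[OF xI] chart_inv_right[OF xI] by auto
 have d1: "deriv_in ?\<Omega> ?F y = FD S y" if "y \<in> W" "y \<in> ?\<Omega>" for y
  by (rule deriv_in_ext[OF image_open[OF c] W that CS])
   (use obata_ext_s[OF E] image_half[OF c] in auto)
 have d2: "deriv_in ?\<Omega> (\<lambda>y. deriv_in ?\<Omega> ?F y w) x = FD (\<lambda>y. FD S y w) x" for w
  by (rule deriv_in_ext[OF image_open[OF c] W x(1) xI C_inf_on_FD[OF CS]]) (use d1 in auto)
 let ?\<Gamma> = "christoffel M c x u w"
 have "FD (\<lambda>y. FD S y w) x u - FD S x ?\<Gamma> + S x * G x u w = 0"
  using s_hess[OF c p(1), of u w] metric_ext_eq[OF G x] obata_ext_s[OF E x]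
  by (simp add: hessian_def Let_def p(2) d2 d1[OF x(1) xI])
 then have h: "FD (\<lambda>y. FD S y w) x u = - G x (V x) ?\<Gamma> - S x * G x u w"
  using obata_ext_grad[OF E x(1), of ?\<Gamma>] by simp
 have lin: "linear (\<lambda>v. G y v w)" if "y \<in> W" for y
  using bilinear_linear(2)[OF metric_ext_bilinear[OF G that]] .
 have diff: "(\<lambda>y. G y a b) differentiable (at x)" for a b
  using C_inf_on_has_derivative[OF metric_ext_smooth[OF G] x(1)] by (auto simp: differentiable_def)
 have "((\<lambda>y. G y (V y) w) has_derivative (\<lambda>u. FD (\<lambda>y. G y (V x) w) x u + G x (FD V x u) w)) (at x)"
  by (rule FD_family[OF W x(1) lin diff C_inf_on_has_derivative[OF CV x(1)]])
 then have "((\<lambda>y. - FD S y w) has_derivative (\<lambda>u. FD (\<lambda>y. G y (V x) w) x u + G x (FD V x u) w)) (at x)"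
  by (rule has_derivative_transform_within_open[OF _ W x(1)]) (simp add: obata_ext_grad[OF E])
 from fun_cong[OF has_derivative_unique[OF this has_derivative_minus[OF
    C_inf_on_has_derivative[OF C_inf_on_FD[OF CS] x(1)]]], of u]
 have "FD (\<lambda>y. G y (V x) w) x u + G x (FD V x u) w = - FD (\<lambda>y. FD S y w) x u" .
 then have "2 * G x (FD V x u) w = 2 * G x ?\<Gamma> (V x) + 2 * S x * G x u w - 2 * FD (\<lambda>y. G y (V x) w) x u"
  using h metric_ext_sym[OF G x(1), of "V x" ?\<Gamma>] by simp
 moreover have "FD (\<lambda>y. G y (V x) w) x = FD (\<lambda>y. G y w (V x)) x"
  by (rule frechet_derivative_transform_within_open[OF diff W x(1)]) (rule metric_ext_sym[OF G])
 ultimately show ?thesis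
  using koszul[OF c G x, of u w "V x"] by simp
qed

text \<open>The left-hand side is the Lie derivative of the metric along V: the field is conformal
  with factor 2 s. It follows by symmetrising the preceding identity, which cancels the
  antisymmetric terms.\<close>

lemma conformal_identity:
 assumes c: "c \<in> charts M" and E: "obata_ext c W G S V" and x: "x \<in> W" "x \<in> half_space"
 shows "FD (\<lambda>y. G y u w) x (V x) + G x (FD V x u) w + G x u (FD V x w) = 2 * S x * G x u w"
proof -
 note G = obata_ext_metric[OF E] and W = obata_ext_open[OF E]
 have diff: "(\<lambda>y. G y a b) differentiable (at x)" for a b
  using C_inf_on_has_derivative[OF metric_ext_smooth[OF G] x(1)] by (auto simp: differentiable_def)
 have "FD (\<lambda>y. G y w u) x = FD (\<lambda>y. G y u w) x"
  by (rule frechet_derivative_transform_within_open[OF diff W x(1)]) (rule metric_ext_sym[OF G])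
 then show ?thesis
  using second_derivative_identity[OF c E x, of u w] second_derivative_identity[OF c E x, of w u]
   metric_ext_sym[OF G x(1), of u w] metric_ext_sym[OF G x(1), of u "FD V x w"] by simp
qed

text \<open>The derivative is 2 g(\<nabla>_u V, V) + 2 s ds(u) = 2 s g(u, V) - 2 s g(V, u).\<close>

lemma energy_derivative:
 assumes c: "c \<in> charts M" and E: "obata_ext c W G S V" and x: "x \<in> W" "x \<in> half_space"
 shows "((\<lambda>y. G y (V y) (V y) + (S y)\<^sup>2) has_derivative (\<lambda>u. 0)) (at x)"
proof -
 note G = obata_ext_metric[OF E] and W = obata_ext_open[OF E] and CV = obata_ext_V[OF E] and CS = obata_ext_S[OF E]
 have diff: "(\<lambda>y. G y a b) differentiable (at x)" for a b
  using C_inf_on_has_derivative[OF metric_ext_smooth[OF G] x(1)] by (auto simp: differentiable_def)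
 have dV: "(V has_derivative FD V x) (at x)" by (rule C_inf_on_has_derivative[OF CV x(1)])
 have d1: "((\<lambda>y. G y a (V y)) has_derivative (\<lambda>u. FD (\<lambda>y. G y a (V x)) x u + G x a (FD V x u))) (at x)" for a
  by (rule FD_family[OF W x(1) _ diff dV]) (rule bilinear_linear(1)[OF metric_ext_bilinear[OF G]])
 have "((\<lambda>y. G y (V y) (V y)) has_derivative (\<lambda>u. FD (\<lambda>y. G y (V x) (V y)) x u + G x (FD V x u) (V x))) (at x)"
  using FD_family[OF W x(1) _ _ dV, of "\<lambda>y v. G y v (V y)"] d1 bilinear_linear(2)[OF metric_ext_bilinear[OF G]]
  by (auto simp: differentiable_def)
 moreover have "FD (\<lambda>y. G y (V x) (V y)) x u = FD (\<lambda>y. G y (V x) (V x)) x u + G x (V x) (FD V x u)" for u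
  using frechet_derivative_at[OF d1[of "V x"]] by metis
 ultimately have 1: "((\<lambda>y. G y (V y) (V y)) has_derivative
   (\<lambda>u. FD (\<lambda>y. G y (V x) (V x)) x u + 2 * G x (FD V x u) (V x))) (at x)"
  using metric_ext_sym[OF G x(1), of "V x"] by (simp add: algebra_simps)
 have 2: "((\<lambda>y. (S y)\<^sup>2) has_derivative (\<lambda>u. 2 * S x * FD S x u)) (at x)"
  by (auto intro!: derivative_eq_intros C_inf_on_has_derivative[OF CS x(1)])
 have "G x u (V x) = - FD S x u" for u
  using obata_ext_grad[OF E x(1), of u] metric_ext_sym[OF G x(1), of u "V x"] by simp
 then have "FD (\<lambda>y. G y (V x) (V x)) x u + 2 * G x (FD V x u) (V x) + 2 * S x * FD S x u = 0" for u
  using second_derivative_identity[OF c E x, of u "V x"] by simp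
 then show ?thesis using has_derivative_add[OF 1 2] by (simp add: add.assoc)
qed

end

lemma locally_constant_imp_constant:
 assumes X: "connected_space X" and loc: "\<And>p. p \<in> topspace X \<Longrightarrow> \<exists>N. openin X N \<and> p \<in> N \<and> (\<forall>q\<in>N. g q = g p)"
  and p: "p \<in> topspace X" and q: "q \<in> topspace X"
 shows "g p = g q"
proof (rule ccontr)
 assume ne: "g p \<noteq> g q"
 have op: "openin X {r \<in> topspace X. g r \<in> B}" for B
 proof (subst openin_subopen, intro ballI)
  fix r assume r: "r \<in> {r \<in> topspace X. g r \<in> B}"
  then obtain N where N: "openin X N" "r \<in> N" "\<forall>q\<in>N. g q = g r" using loc by blast
  have "q \<in> {r \<in> topspace X. g r \<in> B}" if "q \<in> N" for q
   using bspec[OF N(3) that] r openin_subset[OF N(1)] that by auto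
  then show "\<exists>T. openin X T \<and> r \<in> T \<and> T \<subseteq> {r \<in> topspace X. g r \<in> B}" using N by blast
 qed
 have "\<not> connected_space X"
  unfolding connected_space_def not_not
  by (intro exI[of _ "{r \<in> topspace X. g r \<in> {g p}}"] exI[of _ "{r \<in> topspace X. g r \<in> - {g p}}"] conjI op)
   (use p q ne in auto)
 then show False using X by simp
qed

context obata
begin

definition grd :: "('p, 'a) chart \<Rightarrow> 'p \<Rightarrow> 'a" where
 "grd c p = (THE v. \<forall>w. metric M c p v w = - deriv_in (chart_image c) (s \<circ> chart_inv c) (snd c p) w)"

lemma ds_ext:
 assumes c: "c \<in> charts M" and E: "obata_ext c W G S V" and x: "x \<in> W" "x \<in> half_space"
 shows "deriv_in (chart_image c) (s \<circ> chart_inv c) x = FD S x"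
 by (rule deriv_in_ext[OF image_open[OF c] obata_ext_open[OF E] x(1) obata_ext_image[OF E x] obata_ext_S[OF E]])
  (use obata_ext_s[OF E] image_half[OF c] in auto)

lemma grd_ext:
 assumes c: "c \<in> charts M" and E: "obata_ext c W G S V" and x: "x \<in> W" "x \<in> half_space"
 shows "grd c (chart_inv c x) = V x"
proof -
 have xI: "x \<in> chart_image c" by (rule obata_ext_image[OF E x])
 note p = chart_inv_in[OF xI]
 have V: "metric M c (chart_inv c x) (V x) w = - FD S x w" for w
  using obata_ext_grad[OF E x(1), of w] metric_ext_eq[OF obata_ext_metric[OF E] x, of "V x" w] by simp
 show ?thesis unfolding grd_def chart_inv_right[OF xI] ds_ext[OF c E x]
 proof (rule the_equality)
  fix v assume "\<forall>w. metric M c (chart_inv c x) v w = - FD S x w"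
  then show "v = V x" using metric_nondegenerate[OF c p, of v "V x"] V by simp
 qed (use V in blast)
qed

lemma
 assumes c: "c \<in> charts M" and E: "obata_ext c W G S V" and q: "q \<in> fst c" "snd c q \<in> W"
 shows ext_grd: "V (snd c q) = grd c q" and ext_s: "S (snd c q) = s q"
  and ext_metric: "G (snd c q) u v = metric M c q u v"
 using grd_ext[OF c E q(2) chart_half[OF c q(1)]] obata_ext_s[OF E q(2) chart_half[OF c q(1)]]
  metric_ext_eq[OF obata_ext_metric[OF E] q(2) chart_half[OF c q(1)]] chart_inv_left[OF c q(1)] by simp_all

lemma
 assumes c: "c \<in> charts M" and p: "p \<in> fst c"
 shows grd_metric: "metric M c p (grd c p) w = - deriv_in (chart_image c) (s \<circ> chart_inv c) (snd c p) w"
  and ds_within: "((s \<circ> chart_inv c) has_derivative deriv_in (chart_image c) (s \<circ> chart_inv c) (snd c p))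
   (at (snd c p) within chart_image c)"
proof -
 obtain W G S V where E: "snd c p \<in> W" "obata_ext c W G S V" by (rule obata_ext_exists[OF c p]) blast
 note ds = ds_ext[OF c E(2,1) chart_half[OF c p]]
 show "metric M c p (grd c p) w = - deriv_in (chart_image c) (s \<circ> chart_inv c) (snd c p) w"
  using obata_ext_grad[OF E(2,1), of w] ext_grd[OF c E(2) p E(1)] ext_metric[OF c E(2) p E(1)] ds by simp
 show "((s \<circ> chart_inv c) has_derivative deriv_in (chart_image c) (s \<circ> chart_inv c) (snd c p)) (at (snd c p) within chart_image c)"
  unfolding ds
  by (rule has_derivative_within_ext[OF obata_ext_open[OF E(2)] E(1) chart_in_image[OF p]
     C_inf_on_has_derivative[OF obata_ext_S[OF E(2)] E(1)]])
   (use obata_ext_s[OF E(2)] image_half[OF c] in auto)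
qed

text \<open>The differentials of s in the two charts correspond under the transition map, and so do
  the metrics; hence so do the vectors that represent them.\<close>

lemma grd_transition:
 assumes c: "c \<in> charts M" and d: "d \<in> charts M" and p: "p \<in> fst c" "p \<in> fst d" and T: "transition_map c d p W T"
 shows "grd d p = FD T (snd c p) (grd c p)"
proof -
 let ?x = "snd c p" and ?z = "snd d p"
 note W = transition_mapD[OF T]
 note xh = chart_half[OF c p(1)] and Tx = W(6)[OF c p(1)] and met = W(7)[OF c p(1)]
 have dT: "(T has_derivative FD T ?x) (at ?x)" by (rule C_inf_on_has_derivative[OF W(3,2)])
 have bij: "bij (FD T ?x)"
  by (rule transition_bij[OF c d p has_derivative_linear[OF dT] met])
 let ?Sc = "s \<circ> chart_inv c" and ?Sd = "s \<circ> chart_inv d"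
 let ?V = "W \<inter> half_space"
 have V: "openin (top_of_set half_space) ?V" using W(1) by (simp add: openin_open_Int Int_commute)
 have "(?Sc has_derivative deriv_in (chart_image c) ?Sc ?x) (at ?x within ?V)"
  by (rule has_derivative_subset[OF ds_within[OF c p(1)]]) (use W(4) in auto)
 moreover have "(?Sc has_derivative (\<lambda>w. deriv_in (chart_image d) ?Sd ?z (FD T ?x w))) (at ?x within ?V)"
 proof -
  have "T ` ?V \<subseteq> chart_image d" by (rule image_subsetI) (metis IntE W(4) chart_in_image)
  then have "(?Sd has_derivative deriv_in (chart_image d) ?Sd ?z) (at (T ?x) within T ` ?V)"
   using has_derivative_subset[OF ds_within[OF d p(2)]] Tx by simp
  from has_derivative_in_compose[OF has_derivative_at_withinI[OF dT] this]
  have "((\<lambda>y. ?Sd (T y)) has_derivative (\<lambda>w. deriv_in (chart_image d) ?Sd ?z (FD T ?x w))) (at ?x within ?V)" .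
  then show ?thesis
   by (rule has_derivative_transform[rotated -1]) (use W xh chart_inv_left[OF d] in auto)
 qed
 ultimately have D: "deriv_in (chart_image c) ?Sc ?x = (\<lambda>w. deriv_in (chart_image d) ?Sd ?z (FD T ?x w))"
  by (intro half_space_derivative_unique[OF V]) (use W xh in simp)
 show ?thesis
 proof (rule metric_nondegenerate[OF d p(2)])
  fix w'
  obtain w where w: "w' = FD T ?x w" using bij by (metis bij_pointE)
  show "metric M d p (grd d p) w' = metric M d p (FD T ?x (grd c p)) w'"
   unfolding grd_metric[OF d p(2)] w met[symmetric] grd_metric[OF c p(1)] D ..
 qed
qed

lemma energy_chart_independent:
 assumes c: "c \<in> charts M" and d: "d \<in> charts M" and p: "p \<in> fst c" "p \<in> fst d"
 shows "metric M c p (grd c p) (grd c p) = metric M d p (grd d p) (grd d p)"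
proof -
 obtain W T where T: "transition_map c d p W T" by (rule transition[OF c d p])
 show ?thesis using transition_mapD(7)[OF T c p(1)] grd_transition[OF c d p T] by simp
qed

lemma energy_constant:
 assumes conn: "connected_space (mtop M)"
 obtains K where "\<And>c p. c \<in> charts M \<Longrightarrow> p \<in> fst c \<Longrightarrow> metric M c p (grd c p) (grd c p) + (s p)\<^sup>2 = K"
proof -
 \<comment> \<open>The chart chosen at p is immaterial by
   \<open>energy_chart_independent\<close>.\<close>
 define en where "en p = (let c = SOME c. c \<in> charts M \<and> p \<in> fst c in metric M c p (grd c p) (grd c p) + (s p)\<^sup>2)" for p
 have en: "en p = metric M c p (grd c p) (grd c p) + (s p)\<^sup>2" if "c \<in> charts M" "p \<in> fst c" for c p
 proof -
  let ?c = "SOME c. c \<in> charts M \<and> p \<in> fst c"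
  have "?c \<in> charts M \<and> p \<in> fst ?c" by (rule someI[of _ c]) (use that in blast)
  then show ?thesis unfolding en_def Let_def using energy_chart_independent[of ?c c p] that by simp
 qed
 have "\<exists>N. openin (mtop M) N \<and> p \<in> N \<and> (\<forall>q\<in>N. en q = en p)" if pM: "p \<in> topspace (mtop M)" for p
 proof -
  obtain c where c: "c \<in> charts M" "p \<in> fst c" using chart_exists[OF pM] by blast
  let ?x = "snd c p"
  obtain W G S V where E: "?x \<in> W" "obata_ext c W G S V" by (rule obata_ext_exists[OF c]) blast
  obtain r where r: "r > 0" "ball ?x r \<subseteq> W" using obata_ext_open[OF E(2)] E(1) openE by blast
  let ?B = "ball ?x r \<inter> half_space"
  let ?e = "\<lambda>y. G y (V y) (V y) + (S y)\<^sup>2"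
  have d: "(?e has_derivative (\<lambda>u. 0)) (at y within ?B)" if "y \<in> ?B" for y
   by (rule has_derivative_at_withinI[OF energy_derivative[OF c(1) E(2)]]) (use that r in auto)
  have "convex ?B" by (intro convex_Int convex_ball half_space_convex)
  from has_derivative_zero_constant[OF this d]
  obtain k where k: "\<And>y. y \<in> ?B \<Longrightarrow> ?e y = k" by blast
  have eny: "en q = k" if q: "q \<in> fst c" "snd c q \<in> ball ?x r" for q
  proof -
   have yW: "snd c q \<in> W" using q r by blast
   show ?thesis
    using k[of "snd c q"] q chart_half[OF c(1) q(1)] en[OF c(1) q(1)]
    by (simp add: ext_grd[OF c(1) E(2) q(1) yW] ext_s[OF c(1) E(2) q(1) yW] ext_metric[OF c(1) E(2) q(1) yW])
  qed
  show ?thesis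
  proof (intro exI conjI ballI)
   show "openin (mtop M) {q \<in> fst c. snd c q \<in> ball ?x r}" by (rule chart_preimage_open[OF c(1) open_ball])
  qed (use eny c r in auto)
 qed
 from locally_constant_imp_constant[OF conn this]
 have "en p = en q" if "p \<in> topspace (mtop M)" "q \<in> topspace (mtop M)" for p q using that by blast
 then have "en p = en (SOME q. q \<in> topspace (mtop M))" if "p \<in> topspace (mtop M)" for p
  using that by (metis someI)
 then show ?thesis using that en chart_subset by (metis subsetD)
qed

end

section \<open>The backward gradient flow\<close>

text \<open>The normalised situation \<open>s = - f / A\<close>, where \<open>A\<^sup>2 = \<bar>\<nabla>f\<bar>\<^sup>2 + f\<^sup>2\<close>. The vector field \<open>grd\<close> is \<open>- \<nabla>s\<close>;
 it points outwards along the boundary and vanishes exactly where \<open>s = \<plusminus>1\<close>.\<close>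

locale obata_unit = obata M s for M :: "('p, 'a::euclidean_space) riemannian" and s +
 fixes A :: real
 assumes dim: "DIM('a) \<ge> 2"
  and conn: "connected_space (mtop M)" and comp: "compact_space (mtop M)"
  and bd_nonempty: "boundary M \<noteq> {}"
  and A_pos: "A > 0"
  and energy: "\<And>c p. c \<in> charts M \<Longrightarrow> p \<in> fst c \<Longrightarrow> metric M c p (grd c p) (grd c p) + (s p)\<^sup>2 = 1"
  and normal: "\<And>c p N. c \<in> charts M \<Longrightarrow> p \<in> fst c \<Longrightarrow> p \<in> boundary M \<Longrightarrow> metric M c p N N = 1 \<Longrightarrow>
    (\<And>v. v \<bullet> inward = 0 \<Longrightarrow> metric M c p N v = 0) \<Longrightarrow> N \<bullet> inward < 0 \<Longrightarrow> metric M c p (grd c p) N = 1 / A"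

context riemannian_mfd
begin

text \<open>Take the vector that represents the functional w \<mapsto> - (w . inward) in the metric,
  and normalise it.\<close>

lemma normal_exists:
 assumes c: "c \<in> charts M" "p \<in> fst c"
 obtains N where "metric M c p N N = 1" "\<And>v. v \<bullet> inward = 0 \<Longrightarrow> metric M c p N v = 0" "N \<bullet> inward < 0"
proof -
 have "linear (\<lambda>w::'a. - (w \<bullet> inward))" by (rule linearI) (auto simp: inner_add_left)
 from metric_represents[OF c this] obtain z where z: "\<And>w. metric M c p z w = - (w \<bullet> inward)" by blast
 have "z \<noteq> 0"
 proof
  assume "z = 0"
  then have "metric M c p z inward = 0" using bilinear_lzero[OF metric_bilinear[OF c]] by simp
  then show False using z[of inward] by (simp add: inner_Basis)
 qed
 then have pos: "metric M c p z z > 0" by (rule metric_pos[OF c])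
 let ?k = "sqrt (metric M c p z z)"
 have k: "?k > 0" using pos by simp
 have m: "metric M c p ((1/?k) *\<^sub>R z) w = (1/?k) * metric M c p z w" for w
  using bilinear_lmul[OF metric_bilinear[OF c], of "1/?k" z w] by simp
 show ?thesis
 proof (rule that[of "(1/?k) *\<^sub>R z"])
  have "metric M c p z ((1/?k) *\<^sub>R z) = (1/?k) * metric M c p z z"
   using bilinear_rmul[OF metric_bilinear[OF c], of z "1/?k" z] by simp
  then show "metric M c p ((1/?k) *\<^sub>R z) ((1/?k) *\<^sub>R z) = 1" unfolding m using pos by simp
  show "metric M c p ((1/?k) *\<^sub>R z) v = 0" if "v \<bullet> inward = 0" for v using that m[of v] z[of v] by simp
  have "z \<bullet> inward < 0" using pos z[of z] by simp
  then show "(1/?k) *\<^sub>R z \<bullet> inward < 0" using k by (simp add: divide_neg_pos)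
 qed
qed

end

context obata_unit
begin

text \<open>Up to a tangential vector \<open>grd c p\<close> is (1/A) N, and tangential vectors have
  no inward component.\<close>

lemma grd_outward:
 assumes c: "c \<in> charts M" "p \<in> fst c" and b: "p \<in> boundary M"
 shows "grd c p \<bullet> inward < 0"
proof -
 obtain N where N: "metric M c p N N = 1" "\<And>v. v \<bullet> inward = 0 \<Longrightarrow> metric M c p N v = 0" "N \<bullet> inward < 0"
  by (rule normal_exists[OF c]) blast
 let ?v = "grd c p"
 define k where "k = (?v \<bullet> inward) / (N \<bullet> inward)"
 have "(?v - k *\<^sub>R N) \<bullet> inward = 0" using N(3) by (simp add: k_def inner_diff_left)
 then have "metric M c p N (?v - k *\<^sub>R N) = 0" by (rule N(2))
 then have "metric M c p N ?v = k"
  using N(1) bilinear_rsub[OF metric_bilinear[OF c]] bilinear_rmul[OF metric_bilinear[OF c]] by simp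
 then have "k = 1 / A" using normal[OF c b N] metric_sym[OF c, of N ?v] by simp
 then have "k > 0" using A_pos by simp
 then show ?thesis using N(3) by (simp add: k_def zero_less_divide_iff)
qed

text \<open>A local flow of - V, thus of \<nabla>s, in one chart, on an open set that may cross the
  bounding hyperplane. The condition on \<open>FD Y\<close> is the variational equation; the last
  clause says that in forward time the half-space is preserved and its boundary is left at
  once.\<close>

definition flowbox where
 "flowbox c W G S V U a Y \<longleftrightarrow> c \<in> charts M \<and> obata_ext c W G S V \<and> open U \<and> U \<subseteq> W \<and> a > 0 \<and>
   C_inf_on ({-a<..<a} \<times> U) Y \<and> (\<forall>x\<in>U. Y (0, x) = x) \<and>
   (\<forall>t\<in>{-a<..<a}. \<forall>x\<in>U. Y (t, x) \<in> W \<and>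
    (\<forall>R. ((\<lambda>t. Y (t, x)) has_vector_derivative - V (Y (t, x))) (at t within R)) \<and>
    (\<forall>R v. ((\<lambda>t. FD Y (t, x) (0, v)) has_vector_derivative - FD V (Y (t, x)) (FD Y (t, x) (0, v))) (at t within R))) \<and>
   (\<forall>x\<in>U \<inter> half_space. \<forall>t. 0 \<le> t \<and> t < a \<longrightarrow> Y (t, x) \<in> half_space \<and> (0 < t \<longrightarrow> 0 < Y (t, x) \<bullet> inward))"

lemma flowbox_exists:
 assumes p: "p \<in> topspace (mtop M)"
 obtains c W G S V U a Y where "flowbox c W G S V U a Y" "p \<in> fst c" "snd c p \<in> U"
proof -
 obtain c where c: "c \<in> charts M" "p \<in> fst c" using chart_exists[OF p] by blast
 let ?x = "snd c p"
 obtain W G S V where E: "?x \<in> W" "obata_ext c W G S V" by (rule obata_ext_exists[OF c]) blast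
 note W = obata_ext_open[OF E(2)] and CV = obata_ext_V[OF E(2)]
 note xh = chart_half[OF c] and grd = ext_grd[OF c(1) E(2) c(2) E(1)]
 have openV: "open {x \<in> W. V x \<bullet> inward < 0}"
  using continuous_open_preimage[OF _ W, of "\<lambda>x. V x \<bullet> inward" "{..<0}"] C_inf_on_continuous_on[OF CV]
  by (simp add: vimage_def Int_def continuous_intros)
 \<comment> \<open>At a boundary point V . inward < 0 is secured nearby, so the inward coordinate
   grows along the flow of - V. At an interior point the flow is kept inside the open
   half-space.\<close>
 define W0 where "W0 = (if ?x \<bullet> inward = 0 then {x \<in> W. V x \<bullet> inward < 0} else W \<inter> {x. 0 < x \<bullet> inward})"
 have W0: "open W0" "W0 \<subseteq> W" unfolding W0_def
  by (auto intro!: open_Int W openV open_Collect_less continuous_intros)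
 have xW0: "?x \<in> W0"
 proof (cases "?x \<bullet> inward = 0")
  case True
  then have "p \<in> boundary M" using boundary_iff[OF c] by simp
  then show ?thesis using True E(1) grd grd_outward[OF c] by (simp add: W0_def)
 next
  case False
  then show ?thesis using E(1) xh by (simp add: W0_def half_space_def)
 qed
 have "C_inf_on W0 (\<lambda>x. - V x)" by (intro C_inf_on_minus W0 C_inf_on_subset[OF CV W0(2)])
 from smooth_flow[OF W0(1) this xW0]
 obtain a \<delta> Y where Y: "a > 0" "\<delta> > 0" "ball ?x \<delta> \<subseteq> W0" "C_inf_on ({-a<..<a} \<times> ball ?x \<delta>) Y"
  "\<And>q. q \<in> {-a<..<a} \<times> ball ?x \<delta> \<Longrightarrow> Y q \<in> W0"
  "\<And>x. x \<in> ball ?x \<delta> \<Longrightarrow> Y (0, x) = x"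
  "\<And>t x S. t \<in> {-a<..<a} \<Longrightarrow> x \<in> ball ?x \<delta> \<Longrightarrow>
    ((\<lambda>t. Y (t, x)) has_vector_derivative - V (Y (t, x))) (at t within S)"
  "\<And>t x S v. t \<in> {-a<..<a} \<Longrightarrow> x \<in> ball ?x \<delta> \<Longrightarrow>
    ((\<lambda>t. FD Y (t, x) (0, v)) has_vector_derivative FD (\<lambda>x. - V x) (Y (t, x)) (FD Y (t, x) (0, v))) (at t within S)"
  by blast
 have dV: "FD (\<lambda>x. - V x) y v = - FD V y v" if "y \<in> W0" for y v
 proof -
  have "((\<lambda>x. - V x) has_derivative (\<lambda>v. - FD V y v)) (at y)"
   using W0(2) that by (intro has_derivative_minus C_inf_on_has_derivative[OF CV]) blast
  from fun_cong[OF frechet_derivative_at[OF this]] show ?thesis by simp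
 qed
 have half: "Y (t, x) \<in> half_space \<and> (0 < t \<longrightarrow> 0 < Y (t, x) \<bullet> inward)"
  if x: "x \<in> ball ?x \<delta>" "x \<in> half_space" and t: "0 \<le> t" "t < a" for x t
 proof (cases "?x \<bullet> inward = 0")
  case False
  have "Y (t, x) \<in> W0" using Y(5) x t by auto
  then show ?thesis using False by (auto simp: W0_def half_space_def)
 next
  case True
  have x0: "Y (0, x) \<bullet> inward \<ge> 0" using Y(6)[OF x(1)] x(2) by (simp add: half_space_def)
  have inc: "Y (0, x) \<bullet> inward < Y (t, x) \<bullet> inward" if "0 < t"
  proof (rule DERIV_pos_imp_increasing[OF that])
   fix r assume r: "0 \<le> r" "r \<le> t"
   have rI: "r \<in> {-a<..<a}" using r t Y(1) by auto
   have "((\<lambda>t. Y (t, x) \<bullet> inward) has_vector_derivative - V (Y (r, x)) \<bullet> inward) (at r)"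
    using bounded_linear.has_vector_derivative[OF bounded_linear_inner_left Y(7)[OF rI x(1)]] by simp
   then have "((\<lambda>t. Y (t, x) \<bullet> inward) has_real_derivative - V (Y (r, x)) \<bullet> inward) (at r)"
    by (simp add: has_real_derivative_iff_has_vector_derivative)
   moreover have "V (Y (r, x)) \<bullet> inward < 0"
    using Y(5)[of "(r, x)"] rI x(1) True by (simp add: W0_def)
   ultimately show "\<exists>y. ((\<lambda>t. Y (t, x) \<bullet> inward) has_real_derivative y) (at r) \<and> 0 < y" by force
  qed
  show ?thesis
  proof (cases "t = 0")
   case True
   then show ?thesis using x0 by (simp add: half_space_def)
  next
   case False
   then have "0 < Y (t, x) \<bullet> inward" using inc x0 t(1) by linarith
   then show ?thesis by (simp add: half_space_def)
  qed
 qed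
 have "flowbox c W G S V (ball ?x \<delta>) a Y"
  unfolding flowbox_def
 proof (intro conjI ballI allI impI)
  fix t x assume tx: "t \<in> {-a<..<a}" "x \<in> ball ?x \<delta>"
  have yW: "Y (t, x) \<in> W0" using Y(5) tx by blast
  show "Y (t, x) \<in> W" using yW W0 by blast
  show "((\<lambda>t. Y (t, x)) has_vector_derivative - V (Y (t, x))) (at t within R)" for R by (rule Y(7)[OF tx])
  show "((\<lambda>t. FD Y (t, x) (0, v)) has_vector_derivative - FD V (Y (t, x)) (FD Y (t, x) (0, v))) (at t within R)" for R v
   using Y(8)[OF tx, of v R] by (simp add: dV[OF yW])
 qed (use c E Y W0 half in auto)
 then show ?thesis using that c(2) Y(2) by auto
qed

text \<open>Integral curves of \<nabla>s on a closed time interval, described in every chart they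
  meet, so that uniqueness and time shifts do not refer to a particular flow box.\<close>

definition bcurve :: "(real \<Rightarrow> 'p) \<Rightarrow> real \<Rightarrow> bool" where
 "bcurve \<gamma> T \<longleftrightarrow> continuous_map (top_of_set {0..T}) (mtop M) \<gamma> \<and>
   (\<forall>t\<in>{0..T}. \<forall>c\<in>charts M. \<gamma> t \<in> fst c \<longrightarrow>
    ((\<lambda>r. snd c (\<gamma> r)) has_vector_derivative - grd c (\<gamma> t)) (at t within {0..T}))"

lemma bcurve_near:
 assumes \<gamma>: "continuous_map (top_of_set {0..T}) (mtop M) \<gamma>" and t: "t \<in> {0..T::real}"
  and N: "openin (mtop M) N" "\<gamma> t \<in> N"
 obtains e where "e > 0" "\<And>r. r \<in> {0..T} \<Longrightarrow> \<bar>r - t\<bar> < e \<Longrightarrow> \<gamma> r \<in> N"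
proof -
 have "openin (top_of_set {0..T}) {r \<in> topspace (top_of_set {0..T}). \<gamma> r \<in> N}"
  by (rule openin_continuous_map_preimage[OF \<gamma> N(1)])
 moreover have "t \<in> {r \<in> topspace (top_of_set {0..T}). \<gamma> r \<in> N}" using t N(2) by simp
 ultimately obtain e where e: "e > 0" "ball t e \<inter> {0..T} \<subseteq> {r \<in> topspace (top_of_set {0..T}). \<gamma> r \<in> N}"
  unfolding openin_contains_ball by blast
 show ?thesis
 proof (rule that[OF e(1)])
  fix r assume "r \<in> {0..T}" "\<bar>r - t\<bar> < e"
  then have "r \<in> ball t e \<inter> {0..T}" by (simp add: dist_real_def abs_minus_commute)
  then show "\<gamma> r \<in> N" using e(2) by blast
 qed
qed

lemma bcurve_in: "bcurve \<gamma> T \<Longrightarrow> t \<in> {0..T} \<Longrightarrow> \<gamma> t \<in> topspace (mtop M)"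
 unfolding bcurve_def using continuous_map_image_subset_topspace by fastforce

lemma bcurve_ext:
 assumes \<gamma>: "bcurve \<gamma> T" and t: "t \<in> {0..T}" and c: "c \<in> charts M" "\<gamma> t \<in> fst c"
  and E: "obata_ext c W G S V" "snd c (\<gamma> t) \<in> W"
 obtains e where "e > 0" "\<And>r. r \<in> {0..T} \<Longrightarrow> \<bar>r - t\<bar> < e \<Longrightarrow> \<gamma> r \<in> fst c \<and> snd c (\<gamma> r) \<in> W \<and>
  ((\<lambda>r. snd c (\<gamma> r)) has_vector_derivative - V (snd c (\<gamma> r))) (at r within {0..T})"
proof -
 have \<gamma>': "continuous_map (top_of_set {0..T}) (mtop M) \<gamma>" using \<gamma> by (simp add: bcurve_def)
 have N: "openin (mtop M) {q \<in> fst c. snd c q \<in> W}" by (rule chart_preimage_open[OF c(1) obata_ext_open[OF E(1)]])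
 obtain e where e: "e > 0" "\<And>r. r \<in> {0..T} \<Longrightarrow> \<bar>r - t\<bar> < e \<Longrightarrow> \<gamma> r \<in> {q \<in> fst c. snd c q \<in> W}"
  using bcurve_near[OF \<gamma>' t N] c E by auto
 show ?thesis
 proof (rule that[OF e(1)])
  fix r assume r: "r \<in> {0..T}" "\<bar>r - t\<bar> < e"
  then have q: "\<gamma> r \<in> fst c" "snd c (\<gamma> r) \<in> W" using e(2) by auto
  then show "\<gamma> r \<in> fst c \<and> snd c (\<gamma> r) \<in> W \<and>
    ((\<lambda>r. snd c (\<gamma> r)) has_vector_derivative - V (snd c (\<gamma> r))) (at r within {0..T})"
   using \<gamma> r(1) c(1) by (simp add: bcurve_def ext_grd[OF c(1) E(1) q])
 qed
qed

text \<open>The times of coincidence form a closed set because M is Hausdorff and an open one by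
  local uniqueness. The meeting time is arbitrary; used with a later meeting time, the lemma gives
  injectivity of the time maps.\<close>

lemma bcurve_unique:
 assumes \<gamma>: "bcurve \<gamma> T" and \<delta>: "bcurve \<delta> T" and t0: "t0 \<in> {0..T}" "\<gamma> t0 = \<delta> t0" and t: "t \<in> {0..T}"
 shows "\<gamma> t = \<delta> t"
proof -
 let ?E = "{t \<in> {0..T}. \<gamma> t = \<delta> t}"
 have Haus: "Hausdorff_space (mtop M)" using rm by (simp add: riemannian_manifold_def smooth_manifold_def)
 have "closedin (top_of_set {0..T}) {t \<in> topspace (top_of_set {0..T}). \<gamma> t = \<delta> t}"
  by (rule closedin_continuous_maps_eq[OF Haus]) (use \<gamma> \<delta> in \<open>auto simp: bcurve_def\<close>)
 then have cl: "closedin (top_of_set {0..T}) ?E" by simp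
 have op: "openin (top_of_set {0..T}) ?E"
  unfolding openin_euclidean_subtopology_iff
 proof (intro conjI ballI)
  fix t1 assume "t1 \<in> ?E"
  then have t1: "t1 \<in> {0..T}" "\<gamma> t1 = \<delta> t1" by auto
  obtain c where c: "c \<in> charts M" "\<gamma> t1 \<in> fst c" using chart_exists[OF bcurve_in[OF \<gamma> t1(1)]] by blast
  obtain W G S V where E: "snd c (\<gamma> t1) \<in> W" "obata_ext c W G S V" by (rule obata_ext_exists[OF c]) blast
  obtain e1 where e1: "e1 > 0" "\<And>r. r \<in> {0..T} \<Longrightarrow> \<bar>r - t1\<bar> < e1 \<Longrightarrow> \<gamma> r \<in> fst c \<and> snd c (\<gamma> r) \<in> W \<and>
    ((\<lambda>r. snd c (\<gamma> r)) has_vector_derivative - V (snd c (\<gamma> r))) (at r within {0..T})"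
   by (rule bcurve_ext[OF \<gamma> t1(1) c E(2,1)]) blast
  obtain e2 where e2: "e2 > 0" "\<And>r. r \<in> {0..T} \<Longrightarrow> \<bar>r - t1\<bar> < e2 \<Longrightarrow> \<delta> r \<in> fst c \<and> snd c (\<delta> r) \<in> W \<and>
    ((\<lambda>r. snd c (\<delta> r)) has_vector_derivative - V (snd c (\<delta> r))) (at r within {0..T})"
   by (rule bcurve_ext[OF \<delta> t1(1) c[unfolded t1(2)] E(2) E(1)[unfolded t1(2)]]) blast
  have CmV: "C_inf_on W (\<lambda>x. - V x)" by (intro C_inf_on_minus obata_ext_open[OF E(2)] obata_ext_V[OF E(2)])
  obtain e' where e': "e' > 0" "\<And>r. r \<in> {0..T} \<Longrightarrow> \<bar>r - t1\<bar> < e' \<Longrightarrow> snd c (\<gamma> r) = snd c (\<delta> r)"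
   by (rule ode_unique_local[OF obata_ext_open[OF E(2)] CmV, where S="{0..T}" and ?t1.0=t1 and e="min e1 e2"
      and g="\<lambda>r. snd c (\<gamma> r)" and h="\<lambda>r. snd c (\<delta> r)"]) (use t1 e1 e2 E in auto)
  show "\<exists>e>0. \<forall>r\<in>{0..T}. dist r t1 < e \<longrightarrow> r \<in> ?E"
  proof (intro exI conjI ballI impI)
   show "0 < min e' (min e1 e2)" using e' e1 e2 by simp
   fix r assume r: "r \<in> {0..T}" "dist r t1 < min e' (min e1 e2)"
   then have "\<gamma> r \<in> fst c" "\<delta> r \<in> fst c" "snd c (\<gamma> r) = snd c (\<delta> r)"
    using e1(2)[of r] e2(2)[of r] e'(2)[of r] by (auto simp: dist_real_def)
   then have "\<gamma> r = \<delta> r" using chart_inj[OF c(1)] by (metis inj_onD)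
   then show "r \<in> ?E" using r by simp
  qed
 qed auto
 have "connected {0..T}" by (simp add: connected_Icc)
 then have "?E = {} \<or> ?E = {0..T}" using cl op unfolding connected_clopen by blast
 then show ?thesis using t0 t by blast
qed

lemma bcurve_chartI:
 assumes c: "c \<in> charts M" and E: "obata_ext c W G S V"
  and Yt: "\<And>t. t \<in> {0..T} \<Longrightarrow> Y t \<in> W" "\<And>t. t \<in> {0..T} \<Longrightarrow> Y t \<in> half_space"
   "\<And>t. t \<in> {0..T} \<Longrightarrow> (Y has_vector_derivative - V (Y t)) (at t within {0..T})"
 shows "bcurve (\<lambda>t. chart_inv c (Y t)) T"
proof -
 have YI: "Y t \<in> chart_image c" if "t \<in> {0..T}" for t by (rule obata_ext_image[OF E Yt(1)[OF that] Yt(2)[OF that]])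
 have contY: "continuous_on {0..T} (\<lambda>t. Y t)"
  using Yt(3) has_vector_derivative_continuous continuous_on_eq_continuous_within by blast
 have "continuous_map (top_of_set {0..T}) (top_of_set (chart_image c)) (\<lambda>t. Y t)"
  using contY YI by (simp add: continuous_map_in_subtopology image_subset_iff)
 from continuous_map_compose[OF this chart_inv_cont[OF c]]
 have cont: "continuous_map (top_of_set {0..T}) (mtop M) (\<lambda>t. chart_inv c (Y t))" by (simp add: o_def)
 show ?thesis unfolding bcurve_def
 proof (intro conjI cont ballI impI)
  fix t d assume t: "t \<in> {0..T}" and d: "d \<in> charts M" "chart_inv c (Y t) \<in> fst d"
  let ?p = "chart_inv c (Y t)"
  have p: "?p \<in> fst c" "snd c ?p = Y t" using chart_inv_in[OF YI[OF t]] chart_inv_right[OF YI[OF t]] by auto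
  obtain W' T' where T': "transition_map c d ?p W' T'" by (rule transition[OF c d(1) p(1) d(2)])
  note W' = transition_mapD[OF T']
  have "((\<lambda>r. T' (Y r)) has_vector_derivative FD T' (Y t) (- V (Y t))) (at t within {0..T})"
   by (rule has_vector_derivative_chain[where f=T' and p="\<lambda>r. Y r", OF C_inf_on_has_derivative[OF W'(3)] Yt(3)[OF t]])
    (use W' p in simp)
  moreover have "FD T' (Y t) (- V (Y t)) = - grd d ?p"
   using grd_transition[OF c d(1) p(1) d(2) T'] grd_ext[OF c E Yt(1)[OF t] Yt(2)[OF t]]
    linear_neg[OF has_derivative_linear[OF C_inf_on_has_derivative[OF W'(3,2)]]] p by simp
  moreover have "\<forall>\<^sub>F r in at t within {0..T}. T' (Y r) = snd d (chart_inv c (Y r))"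
  proof -
   have "((\<lambda>r. Y r) \<longlongrightarrow> Y t) (at t within {0..T})"
    using contY t by (simp add: continuous_on_def)
   then have "\<forall>\<^sub>F r in at t within {0..T}. Y r \<in> W'"
    using W'(1,2) p(2) topological_tendstoD by metis
   moreover have "\<forall>\<^sub>F r in at t within {0..T}. r \<in> {0..T}" by (simp add: eventually_at_filter)
   ultimately show ?thesis by eventually_elim (use W'(4) Yt(2) in blast)
  qed
  moreover have "T' (Y t) = snd d ?p" using W'(4)[of "Y t"] W'(2) p Yt(2)[OF t] by simp
  ultimately show "((\<lambda>r. snd d (chart_inv c (Y r))) has_vector_derivative - grd d ?p) (at t within {0..T})"
   unfolding has_vector_derivative_def
   by (auto intro: has_derivative_transform_eventually t)
 qed
qed

lemma flowbox_bcurve: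
 assumes F: "flowbox c W G S V U a Y" and x: "x \<in> U" "x \<in> half_space" and T: "T < a"
 shows "bcurve (\<lambda>t. chart_inv c (Y (t, x))) T"
proof (rule bcurve_chartI)
 show "c \<in> charts M" "obata_ext c W G S V" using F by (auto simp: flowbox_def)
 fix t assume "t \<in> {0..T}"
 then have t: "t \<in> {-a<..<a}" "0 \<le> t \<and> t < a" using T F by (auto simp: flowbox_def)
 show "Y (t, x) \<in> W" "((\<lambda>t. Y (t, x)) has_vector_derivative - V (Y (t, x))) (at t within {0..T})"
  using F t(1) x unfolding flowbox_def by blast+
 show "Y (t, x) \<in> half_space" using F t(2) x unfolding flowbox_def by blast
qed

end

lemma bilinear_family_curve:
 fixes G :: "'a::euclidean_space \<Rightarrow> 'a \<Rightarrow> 'a \<Rightarrow> real"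
 assumes W: "open W" "\<gamma> t \<in> W" and bil: "\<And>y. y \<in> W \<Longrightarrow> bilinear (G y)" and sm: "\<And>a b. C_inf_on W (\<lambda>y. G y a b)"
  and g: "(\<gamma> has_vector_derivative g') (at t within I)" and gW: "\<And>r. r \<in> I \<Longrightarrow> \<gamma> r \<in> W" and t: "t \<in> I"
  and u: "(u has_vector_derivative u') (at t within I)" and v: "(v has_vector_derivative v') (at t within I)"
 shows "((\<lambda>r. G (\<gamma> r) (u r) (v r)) has_real_derivative
  FD (\<lambda>y. G y (u t) (v t)) (\<gamma> t) g' + G (\<gamma> t) u' (v t) + G (\<gamma> t) (u t) v') (at t within I)"
proof -
 have diff: "(\<lambda>y. G y a b) differentiable (at (\<gamma> t))" for a b
  using C_inf_on_has_derivative[OF sm W(2)] by (auto simp: differentiable_def)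
 have dG: "((\<lambda>r. G (\<gamma> r) a b) has_real_derivative FD (\<lambda>y. G y a b) (\<gamma> t) g') (at t within I)" for a b
  using has_vector_derivative_chain[where f="\<lambda>y. G y a b" and p=\<gamma>, OF C_inf_on_has_derivative[OF sm W(2)] g]
  by (simp add: has_real_derivative_iff_has_vector_derivative)
 have du: "((\<lambda>r. u r \<bullet> a) has_real_derivative u' \<bullet> a) (at t within I)" for a
  using bounded_linear.has_vector_derivative[OF bounded_linear_inner_left u]
  by (simp add: has_real_derivative_iff_has_vector_derivative)
 have dv: "((\<lambda>r. v r \<bullet> a) has_real_derivative v' \<bullet> a) (at t within I)" for a
  using bounded_linear.has_vector_derivative[OF bounded_linear_inner_left v]
  by (simp add: has_real_derivative_iff_has_vector_derivative)
 have bilD: "bilinear (\<lambda>a b. FD (\<lambda>y. G y a b) (\<gamma> t) g')"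
  unfolding bilinear_def
  by (intro conjI allI FD_linear_param[OF W] FD_linear_param[OF W, where T="\<lambda>y a. G y a b" for b]
    bilinear_linear[OF bil] diff)
 let ?S = "\<lambda>r. \<Sum>a\<in>Basis. \<Sum>b\<in>Basis. (u r \<bullet> a) * (v r \<bullet> b) * G (\<gamma> r) a b"
 have "(?S has_real_derivative (\<Sum>a\<in>Basis. \<Sum>b\<in>Basis. (u t \<bullet> a) * (v t \<bullet> b) * FD (\<lambda>y. G y a b) (\<gamma> t) g'
   + ((u t \<bullet> a) * (v' \<bullet> b) + (u' \<bullet> a) * (v t \<bullet> b)) * G (\<gamma> t) a b)) (at t within I)"
  by (intro DERIV_sum DERIV_mult' du dv dG)
 moreover have "(\<Sum>a\<in>Basis. \<Sum>b\<in>Basis. (u t \<bullet> a) * (v t \<bullet> b) * FD (\<lambda>y. G y a b) (\<gamma> t) g'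
   + ((u t \<bullet> a) * (v' \<bullet> b) + (u' \<bullet> a) * (v t \<bullet> b)) * G (\<gamma> t) a b) =
  FD (\<lambda>y. G y (u t) (v t)) (\<gamma> t) g' + G (\<gamma> t) u' (v t) + G (\<gamma> t) (u t) v'"
  unfolding bilinear_basis_expand[OF bilD, of "u t" "v t"] bilinear_basis_expand[OF bil[OF W(2)], of u' "v t"]
   bilinear_basis_expand[OF bil[OF W(2)], of "u t" v']
  by (simp add: sum.distrib distrib_right)
 ultimately have "(?S has_real_derivative
   FD (\<lambda>y. G y (u t) (v t)) (\<gamma> t) g' + G (\<gamma> t) u' (v t) + G (\<gamma> t) (u t) v') (at t within I)" by simp
 then show ?thesis
  by (rule has_field_derivative_transform_within[OF _ zero_less_one t])
   (use bilinear_basis_expand[OF bil[OF gW]] in auto)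
qed

context obata_unit
begin

lemma s_le_1: assumes "p \<in> topspace (mtop M)" shows "s p \<le> 1" "-1 \<le> s p"
proof -
 obtain c where c: "c \<in> charts M" "p \<in> fst c" using chart_exists[OF assms] by blast
 have "metric M c p (grd c p) (grd c p) \<ge> 0"
  using metric_pos[OF c, of "grd c p"] bilinear_lzero[OF metric_bilinear[OF c]] by (cases "grd c p = 0") auto
 then have "(s p)\<^sup>2 \<le> 1" using energy[OF c] by simp
 then show "s p \<le> 1" "-1 \<le> s p" by (simp_all add: abs_square_le_1 abs_le_iff)
qed

lemma energy_ext:
 assumes c: "c \<in> charts M" and E: "obata_ext c W G S V" and x: "x \<in> W" "x \<in> half_space"
 shows "G x (V x) (V x) = 1 - (S x)\<^sup>2"
 using energy[OF c chart_inv_in[OF obata_ext_image[OF E x]]] grd_ext[OF c E x]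
  metric_ext_eq[OF obata_ext_metric[OF E] x] obata_ext_s[OF E x] by simp

text \<open>The form \<open>g / (1 + s)\<^sup>2\<close> is homogeneous of degree 2 under the flow of \<open>V\<close>.\<close>

lemma conformal_curve:
 assumes c: "c \<in> charts M" and E: "obata_ext c W G S V" and t: "t \<in> I"
  and \<gamma>: "\<And>r. r \<in> I \<Longrightarrow> \<gamma> r \<in> W" "\<gamma> t \<in> half_space" and S: "S (\<gamma> t) > -1"
  and g: "(\<gamma> has_vector_derivative a *\<^sub>R V (\<gamma> t)) (at t within I)"
  and u: "(u has_vector_derivative a *\<^sub>R (FD V (\<gamma> t) (u t) - u t)) (at t within I)"
  and v: "(v has_vector_derivative a *\<^sub>R (FD V (\<gamma> t) (v t) - v t)) (at t within I)"
 shows "((\<lambda>r. G (\<gamma> r) (u r) (v r) / (1 + S (\<gamma> r))\<^sup>2) has_real_derivative 0) (at t within I)"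
proof -
 note G = obata_ext_metric[OF E] and W = obata_ext_open[OF E]
 let ?x = "\<gamma> t"
 have xW: "?x \<in> W" by (rule \<gamma>(1)[OF t])
 note bil = metric_ext_bilinear[OF G xW]
 have linD: "linear (FD (\<lambda>y. G y (u t) (v t)) ?x)" "linear (FD S ?x)"
  using C_inf_on_has_derivative[OF metric_ext_smooth[OF G] xW] C_inf_on_has_derivative[OF obata_ext_S[OF E] xW]
  by (auto dest: has_derivative_linear)
 \<comment> \<open>The factor a is -1 along the flow of \<nabla>s and 1/k along rays of the
   linearising map. The terms - u and - v turn the conformal factor 2 s into 2 s - 2, which is the
   logarithmic derivative of (1 + s)^2, since V s = - (1 - s^2).\<close>
 have dG: "((\<lambda>r. G (\<gamma> r) (u r) (v r)) has_real_derivative a * ((2 * S ?x - 2) * G ?x (u t) (v t))) (at t within I)"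
 proof -
  have "((\<lambda>r. G (\<gamma> r) (u r) (v r)) has_real_derivative
    FD (\<lambda>y. G y (u t) (v t)) ?x (a *\<^sub>R V ?x) + G ?x (a *\<^sub>R (FD V ?x (u t) - u t)) (v t)
    + G ?x (u t) (a *\<^sub>R (FD V ?x (v t) - v t))) (at t within I)"
   by (rule bilinear_family_curve[OF W xW metric_ext_bilinear[OF G] metric_ext_smooth[OF G] g \<gamma>(1) t u v])
  moreover have "FD (\<lambda>y. G y (u t) (v t)) ?x (a *\<^sub>R V ?x) + G ?x (a *\<^sub>R (FD V ?x (u t) - u t)) (v t)
    + G ?x (u t) (a *\<^sub>R (FD V ?x (v t) - v t)) =
   a * ((FD (\<lambda>y. G y (u t) (v t)) ?x (V ?x) + G ?x (FD V ?x (u t)) (v t) + G ?x (u t) (FD V ?x (v t)))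
    - 2 * G ?x (u t) (v t))"
   by (simp add: linear_scale[OF linD(1)] bilinear_lmul[OF bil] bilinear_rmul[OF bil] bilinear_lsub[OF bil]
     bilinear_rsub[OF bil] algebra_simps)
  ultimately have "((\<lambda>r. G (\<gamma> r) (u r) (v r)) has_real_derivative
   a * ((FD (\<lambda>y. G y (u t) (v t)) ?x (V ?x) + G ?x (FD V ?x (u t)) (v t) + G ?x (u t) (FD V ?x (v t)))
    - 2 * G ?x (u t) (v t))) (at t within I)" by (simp only:)
  then show ?thesis unfolding conformal_identity[OF c E xW \<gamma>(2)] by (simp add: left_diff_distrib)
 qed
 have "((\<lambda>r. S (\<gamma> r)) has_real_derivative FD S ?x (a *\<^sub>R V ?x)) (at t within I)"
  using has_vector_derivative_chain[where f=S and p=\<gamma>, OF C_inf_on_has_derivative[OF obata_ext_S[OF E] xW] g]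
  by (simp add: has_real_derivative_iff_has_vector_derivative)
 moreover have "FD S ?x (a *\<^sub>R V ?x) = - a * (1 - (S ?x)\<^sup>2)"
  using obata_ext_grad[OF E xW, of "V ?x"] energy_ext[OF c E xW \<gamma>(2)] by (simp add: linear_scale[OF linD(2)])
 ultimately have dS: "((\<lambda>r. S (\<gamma> r)) has_real_derivative - a * (1 - (S ?x)\<^sup>2)) (at t within I)" by simp
 have d2: "((\<lambda>r. (1 + S (\<gamma> r))\<^sup>2) has_real_derivative 2 * (1 + S ?x) * (- a * (1 - (S ?x)\<^sup>2))) (at t within I)"
  by (auto intro!: derivative_eq_intros dS)
 have ne: "(1 + S ?x)\<^sup>2 \<noteq> 0" using S by simp
 have "((\<lambda>r. G (\<gamma> r) (u r) (v r) / (1 + S (\<gamma> r))\<^sup>2) has_real_derivative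
   (a * ((2 * S ?x - 2) * G ?x (u t) (v t)) * (1 + S ?x)\<^sup>2 - G ?x (u t) (v t) * (2 * (1 + S ?x) * (- a * (1 - (S ?x)\<^sup>2))))
   / ((1 + S ?x)\<^sup>2 * (1 + S ?x)\<^sup>2)) (at t within I)"
  by (rule DERIV_divide[OF dG d2 ne])
 moreover have "a * ((2 * S ?x - 2) * G ?x (u t) (v t)) * (1 + S ?x)\<^sup>2 - G ?x (u t) (v t) * (2 * (1 + S ?x) * (- a * (1 - (S ?x)\<^sup>2))) = 0"
  by (simp add: algebra_simps power2_eq_square)
 ultimately show ?thesis by simp
qed

subsection \<open>The time maps of the flow\<close>

text \<open>Compactness gives one existence time for all points. The bound is stated for 2 \<tau> so
  that two flow times up to \<tau> can be added.\<close>

lemma flowbox_uniform: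
 "\<exists>\<tau>>0. \<forall>p\<in>topspace (mtop M). \<exists>c W G S V U a Y. flowbox c W G S V U a Y \<and> p \<in> fst c \<and> snd c p \<in> U \<and> 2 * \<tau> < a"
proof -
 define Q where "Q p a \<longleftrightarrow> (\<exists>c W G S V U Y. flowbox c W G S V U a Y \<and> p \<in> fst c \<and> snd c p \<in> U)" for p a
 have "\<forall>p\<in>topspace (mtop M). \<exists>Na. openin (mtop M) (fst Na) \<and> p \<in> fst Na \<and> snd Na > 0 \<and> (\<forall>q\<in>fst Na. Q q (snd Na))"
 proof
  fix p assume "p \<in> topspace (mtop M)"
  from flowbox_exists[OF this] obtain c W G S V U a Y
   where F: "flowbox c W G S V U a Y" "p \<in> fst c" "snd c p \<in> U" by blast
  let ?N = "{q \<in> fst c. snd c q \<in> U}"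
  have "openin (mtop M) ?N" using F(1) by (intro chart_preimage_open) (auto simp: flowbox_def)
  moreover have "\<forall>q\<in>?N. Q q a" using F(1) unfolding Q_def by blast
  moreover have "a > 0" using F(1) by (simp add: flowbox_def)
  ultimately show "\<exists>Na. openin (mtop M) (fst Na) \<and> p \<in> fst Na \<and> snd Na > 0 \<and> (\<forall>q\<in>fst Na. Q q (snd Na))"
   using F by (intro exI[of _ "(?N, a)"]) auto
 qed
 from bchoice[OF this] obtain Na where Na: "\<And>p. p \<in> topspace (mtop M) \<Longrightarrow>
   openin (mtop M) (fst (Na p)) \<and> p \<in> fst (Na p) \<and> snd (Na p) > 0 \<and> (\<forall>q\<in>fst (Na p). Q q (snd (Na p)))" by blast
 have "\<exists>\<F>. finite \<F> \<and> \<F> \<subseteq> (\<lambda>p. fst (Na p)) ` topspace (mtop M) \<and> topspace (mtop M) \<subseteq> \<Union> \<F>"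
  using comp[unfolded compact_space_alt, rule_format, of "(\<lambda>p. fst (Na p)) ` topspace (mtop M)"] Na by blast
 then obtain P where P: "finite P" "P \<subseteq> topspace (mtop M)" "topspace (mtop M) \<subseteq> (\<Union>p\<in>P. fst (Na p))"
  by (metis finite_subset_image)
 have ne: "P \<noteq> {}" using P(3) bd_nonempty by (auto simp: boundary_def)
 define \<tau> where "\<tau> = Min ((\<lambda>p. snd (Na p)) ` P) / 3"
 have pos: "0 < Min ((\<lambda>p. snd (Na p)) ` P)" using P ne Na by (subst Min_gr_iff) auto
 have \<tau>: "2 * \<tau> < snd (Na p)" if "p \<in> P" for p
 proof -
  have "Min ((\<lambda>p. snd (Na p)) ` P) \<le> snd (Na p)" using P that by (intro Min_le) auto
  then show ?thesis using pos by (simp add: \<tau>_def)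
 qed
 show ?thesis
 proof (intro exI[of _ \<tau>] conjI ballI)
  show "0 < \<tau>" using pos by (simp add: \<tau>_def)
  fix q assume "q \<in> topspace (mtop M)"
  then obtain p where p: "p \<in> P" "q \<in> fst (Na p)" using P(3) by blast
  then have "Q q (snd (Na p))" using Na[of p] P(2) by blast
  then show "\<exists>c W G S V U a Y. flowbox c W G S V U a Y \<and> q \<in> fst c \<and> snd c q \<in> U \<and> 2 * \<tau> < a"
   unfolding Q_def using \<tau>[OF p(1)] by blast
 qed
qed

definition tau :: real where
 "tau = (SOME \<tau>. \<tau> > 0 \<and> (\<forall>p\<in>topspace (mtop M). \<exists>c W G S V U a Y.
   flowbox c W G S V U a Y \<and> p \<in> fst c \<and> snd c p \<in> U \<and> 2 * \<tau> < a))"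

lemma tau_pos: "tau > 0"
 and flowbox_tau: "p \<in> topspace (mtop M) \<Longrightarrow>
  \<exists>c W G S V U a Y. flowbox c W G S V U a Y \<and> p \<in> fst c \<and> snd c p \<in> U \<and> 2 * tau < a"
 using someI_ex[OF flowbox_uniform, folded tau_def] by blast+

text \<open>Times are meant in \<open>{0..2 * tau}\<close>: backward the flow would leave M through
  the boundary, and beyond \<open>2 * tau\<close> nothing is prescribed.\<close>

definition phi :: "real \<Rightarrow> 'p \<Rightarrow> 'p" where
 "phi t p = (SOME \<gamma>. bcurve \<gamma> (2 * tau) \<and> \<gamma> 0 = p) t"

lemma flowbox_phi:
 assumes F: "flowbox c W G S V U a Y" "2 * tau < a" and p: "p \<in> fst c" "snd c p \<in> U" and t: "t \<in> {0..2 * tau}"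
 shows "phi t p = chart_inv c (Y (t, snd c p))"
  and "bcurve (\<lambda>t. phi t p) (2 * tau)" and "phi 0 p = p"
proof -
 have c: "c \<in> charts M" using F by (simp add: flowbox_def)
 note xh = chart_half[OF c p(1)]
 let ?g = "\<lambda>t. chart_inv c (Y (t, snd c p))"
 have b: "bcurve ?g (2 * tau)" by (rule flowbox_bcurve[OF F(1) p(2) xh F(2)])
 have 0: "?g 0 = p" using F(1) p chart_inv_left[OF c p(1)] by (simp add: flowbox_def)
 let ?h = "SOME \<gamma>. bcurve \<gamma> (2 * tau) \<and> \<gamma> 0 = p"
 have "bcurve ?h (2 * tau) \<and> ?h 0 = p" by (rule someI[of _ ?g]) (use b 0 in blast)
 then have h: "bcurve (\<lambda>t. phi t p) (2 * tau)" "phi 0 p = p" unfolding phi_def by auto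
 then show "bcurve (\<lambda>t. phi t p) (2 * tau)" "phi 0 p = p" by auto
 show "phi t p = ?g t"
  by (rule bcurve_unique[OF h(1) b, of 0 t]) (use h 0 t tau_pos in auto)
qed

lemma
 assumes p: "p \<in> topspace (mtop M)"
 shows phi_bcurve: "bcurve (\<lambda>t. phi t p) (2 * tau)" and phi_0: "phi 0 p = p"
proof -
 from flowbox_tau[OF p] obtain c W G S V U a Y
  where F: "flowbox c W G S V U a Y" "p \<in> fst c" "snd c p \<in> U" "2 * tau < a" by blast
 show "bcurve (\<lambda>t. phi t p) (2 * tau)" "phi 0 p = p"
  using flowbox_phi(2,3)[OF F(1,4,2,3), of 0] tau_pos by auto
qed

lemma phi_in: "p \<in> topspace (mtop M) \<Longrightarrow> t \<in> {0..2 * tau} \<Longrightarrow> phi t p \<in> topspace (mtop M)"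
 by (rule bcurve_in[OF phi_bcurve])

lemma bcurve_shift:
 assumes \<gamma>: "bcurve \<gamma> T" and r: "0 \<le> r" "r + T' \<le> T"
 shows "bcurve (\<lambda>t. \<gamma> (r + t)) T'"
proof -
 have sub: "(\<lambda>t. r + t) ` {0..T'} \<subseteq> {0..T}" using r by auto
 have "continuous_map (top_of_set {0..T'}) (top_of_set {0..T}) (\<lambda>t. r + t)"
  using sub by (auto simp: continuous_map_in_subtopology intro!: continuous_intros)
 from continuous_map_compose[OF this, of "mtop M" \<gamma>]
 have "continuous_map (top_of_set {0..T'}) (mtop M) (\<lambda>t. \<gamma> (r + t))"
  using \<gamma> by (simp add: bcurve_def o_def)
 moreover have "((\<lambda>t. snd c (\<gamma> (r + t))) has_vector_derivative - grd c (\<gamma> (r + t))) (at t within {0..T'})"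
  if t: "t \<in> {0..T'}" and c: "c \<in> charts M" "\<gamma> (r + t) \<in> fst c" for t c
 proof -
  have "r + t \<in> {0..T}" using t r by auto
  then have "((\<lambda>r. snd c (\<gamma> r)) has_vector_derivative - grd c (\<gamma> (r + t))) (at (r + t) within {0..T})"
   using \<gamma> c unfolding bcurve_def by blast
  then have "((\<lambda>r. snd c (\<gamma> r)) has_vector_derivative - grd c (\<gamma> (r + t))) (at (r + t) within (\<lambda>t. r + t) ` {0..T'})"
   by (rule has_vector_derivative_within_subset[OF _ sub])
  moreover have "((\<lambda>t. r + t) has_vector_derivative 1) (at t within {0..T'})"
   by (auto intro!: derivative_eq_intros simp: has_real_derivative_iff_has_vector_derivative[symmetric])
  ultimately show ?thesis
   using vector_diff_chain_within[of "\<lambda>t. r + t" 1 t "{0..T'}" "\<lambda>r. snd c (\<gamma> r)"] by (simp add: o_def)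
 qed
 ultimately show ?thesis unfolding bcurve_def by blast
qed

lemma phi_add:
 assumes p: "p \<in> topspace (mtop M)" and r: "r \<in> {0..tau}" and t: "t \<in> {0..tau}"
 shows "phi t (phi r p) = phi (r + t) p"
proof -
 have q: "phi r p \<in> topspace (mtop M)" by (rule phi_in[OF p]) (use r tau_pos in auto)
 have "bcurve (\<lambda>t. phi (0 + t) (phi r p)) tau" by (rule bcurve_shift[OF phi_bcurve[OF q]]) (use tau_pos in auto)
 then have 1: "bcurve (\<lambda>t. phi t (phi r p)) tau" by simp
 have 2: "bcurve (\<lambda>t. phi (r + t) p) tau" by (rule bcurve_shift[OF phi_bcurve[OF p]]) (use r in auto)
 show ?thesis by (rule bcurve_unique[OF 1 2, of 0 t]) (use t phi_0[OF q] tau_pos in auto)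
qed

lemma phi_inj:
 assumes p: "p \<in> topspace (mtop M)" "q \<in> topspace (mtop M)" and t: "t \<in> {0..2 * tau}" and eq: "phi t p = phi t q"
 shows "p = q"
 using bcurve_unique[OF phi_bcurve[OF p(1)] phi_bcurve[OF p(2)] t eq, of 0] phi_0 p tau_pos by auto

lemma phi_interior:
 assumes p: "p \<in> topspace (mtop M)" and t: "0 < t" "t \<le> 2 * tau"
 shows "phi t p \<notin> boundary M"
proof -
 from flowbox_tau[OF p] obtain c W G S V U a Y
  where F: "flowbox c W G S V U a Y" "p \<in> fst c" "snd c p \<in> U" "2 * tau < a" by blast
 have c: "c \<in> charts M" and E: "obata_ext c W G S V" using F by (auto simp: flowbox_def)
 let ?x = "snd c p"
 note xh = chart_half[OF c F(2)]
 have tI: "t \<in> {-a<..<a}" "0 \<le> t" "t < a" using t F(4) by auto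
 have yW: "Y (t, ?x) \<in> W" using F(1) tI F(3) unfolding flowbox_def by blast
 have yh: "Y (t, ?x) \<in> half_space" "0 < Y (t, ?x) \<bullet> inward"
  using F(1) tI xh F(3) t(1) unfolding flowbox_def by blast+
 have yI: "Y (t, ?x) \<in> chart_image c" by (rule obata_ext_image[OF E yW yh(1)])
 have "phi t p = chart_inv c (Y (t, ?x))" by (rule flowbox_phi(1)[OF F(1,4,2,3)]) (use t in auto)
 then show ?thesis
  using boundary_iff[OF c chart_inv_in[OF yI]] chart_inv_right[OF yI] yh by simp
qed

text \<open>Along the flow of \<nabla>s the derivative of s is |\<nabla>s|^2, which is 1 - s^2 by
  the energy identity.\<close>

lemma s_bcurve:
 assumes \<gamma>: "bcurve \<gamma> T" and t: "t \<in> {0..T}"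
 shows "((\<lambda>r. s (\<gamma> r)) has_real_derivative 1 - (s (\<gamma> t))\<^sup>2) (at t within {0..T})"
proof -
 obtain c where c: "c \<in> charts M" "\<gamma> t \<in> fst c" using chart_exists[OF bcurve_in[OF \<gamma> t]] by blast
 let ?x = "snd c (\<gamma> t)"
 obtain W G S V where E: "?x \<in> W" "obata_ext c W G S V" by (rule obata_ext_exists[OF c]) blast
 obtain e where e: "e > 0" "\<And>r. r \<in> {0..T} \<Longrightarrow> \<bar>r - t\<bar> < e \<Longrightarrow> \<gamma> r \<in> fst c \<and> snd c (\<gamma> r) \<in> W \<and>
   ((\<lambda>r. snd c (\<gamma> r)) has_vector_derivative - V (snd c (\<gamma> r))) (at r within {0..T})"
  by (rule bcurve_ext[OF \<gamma> t c E(2,1)]) blast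
 have dS: "(S has_derivative FD S ?x) (at ?x)" by (rule C_inf_on_has_derivative[OF obata_ext_S[OF E(2)] E(1)])
 have "((\<lambda>r. S (snd c (\<gamma> r))) has_vector_derivative FD S ?x (- V ?x)) (at t within {0..T})"
  by (rule has_vector_derivative_chain[where f=S and p="\<lambda>r. snd c (\<gamma> r)", OF dS]) (use e(1) e(2)[OF t] in simp)
 moreover have "FD S ?x (- V ?x) = 1 - (s (\<gamma> t))\<^sup>2"
  using obata_ext_grad[OF E(2,1), of "V ?x"] energy_ext[OF c(1) E(2,1) chart_half[OF c]] ext_s[OF c(1) E(2) c(2) E(1)]
   linear_neg[OF has_derivative_linear[OF dS]] by simp
 ultimately have "((\<lambda>r. S (snd c (\<gamma> r))) has_real_derivative 1 - (s (\<gamma> t))\<^sup>2) (at t within {0..T})"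
  by (simp add: has_real_derivative_iff_has_vector_derivative)
 then show ?thesis
  by (rule has_field_derivative_transform_within[OF _ e(1) t])
   (use e(2) ext_s[OF c(1) E(2)] in \<open>auto simp: dist_real_def\<close>)
qed

text \<open>For s = cos r this is tan^2 (r / 2), the squared length of the stereographic
  image.\<close>

definition q_fun :: "'p \<Rightarrow> real" where "q_fun p = (1 - s p) / (1 + s p)"

text \<open>s does not decrease, so it stays above -1 and \<open>q_fun\<close> remains defined. From
  s' = 1 - s^2 one gets q' = - 2 q, that is, exp (2 t) q is constant.\<close>

lemma s_phi:
 assumes p: "p \<in> topspace (mtop M)" "s p > -1" and t: "t \<in> {0..2 * tau}"
 shows "s (phi t p) > -1" "q_fun (phi t p) = exp (- 2 * t) * q_fun p"
proof -
 let ?g = "\<lambda>t. s (phi t p)"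
 have d: "(?g has_real_derivative 1 - (?g t)\<^sup>2) (at t within {0..2 * tau})" if "t \<in> {0..2 * tau}" for t
  by (rule s_bcurve[OF phi_bcurve[OF p(1)] that])
 have cont: "continuous_on {0..2 * tau} ?g"
  using d DERIV_continuous continuous_on_eq_continuous_within by blast
 have le: "?g 0 \<le> ?g t" if t: "t \<in> {0..2 * tau}" for t
 proof (cases "t = 0")
  case False
  show ?thesis
  proof (rule DERIV_nonneg_imp_increasing_open[where f="\<lambda>t. s (phi t p)" and a=0 and b=t])
   show "0 \<le> t" using t by simp
   show "continuous_on {0..t} ?g" using cont by (rule continuous_on_subset) (use t in auto)
   fix r assume r: "0 < r" "r < t"
   then have "(?g has_real_derivative 1 - (?g r)\<^sup>2) (at r)"
    using d[of r] t at_within_Icc_at[of 0 r "2 * tau"] by simp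
   moreover have "0 \<le> 1 - (?g r)\<^sup>2"
    using s_le_1[OF phi_in[OF p(1), of r]] r t by (auto simp: abs_square_le_1 abs_le_iff)
   ultimately show "\<exists>y. (?g has_real_derivative y) (at r) \<and> 0 \<le> y" by blast
  qed
 qed simp
 have gt: "?g t > -1" if "t \<in> {0..2 * tau}" for t using le[OF that] p phi_0 by simp
 then show "s (phi t p) > -1" using t by blast
 have d2: "((\<lambda>t. exp (2 * t) * ((1 - ?g t) / (1 + ?g t))) has_derivative (\<lambda>h. 0)) (at t within {0..2 * tau})"
  if t: "t \<in> {0..2 * tau}" for t
 proof -
  have ne: "1 + ?g t \<noteq> 0" using gt[OF t] by simp
  have "((\<lambda>t. exp (2 * t) * ((1 - ?g t) / (1 + ?g t))) has_real_derivative
   exp (2 * t) * (((0 - (1 - (?g t)\<^sup>2)) * (1 + ?g t) - (1 - ?g t) * (0 + (1 - (?g t)\<^sup>2))) / ((1 + ?g t) * (1 + ?g t)))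
   + 2 * exp (2 * t) * ((1 - ?g t) / (1 + ?g t))) (at t within {0..2 * tau})"
   by (intro DERIV_mult' DERIV_divide DERIV_diff DERIV_add DERIV_const d t ne) (auto intro!: derivative_eq_intros)
  moreover have "exp (2 * t) * (((0 - (1 - (?g t)\<^sup>2)) * (1 + ?g t) - (1 - ?g t) * (0 + (1 - (?g t)\<^sup>2))) / ((1 + ?g t) * (1 + ?g t)))
   + 2 * exp (2 * t) * ((1 - ?g t) / (1 + ?g t)) = 0"
   using ne by (simp add: divide_simps) (simp add: algebra_simps power2_eq_square)
  ultimately have "((\<lambda>t. exp (2 * t) * ((1 - ?g t) / (1 + ?g t))) has_real_derivative 0) (at t within {0..2 * tau})" by simp
  then show ?thesis by (simp add: has_field_derivative_def lambda_zero)
 qed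
 obtain k where k: "\<And>t. t \<in> {0..2 * tau} \<Longrightarrow> exp (2 * t) * ((1 - ?g t) / (1 + ?g t)) = k"
  using has_derivative_zero_constant[OF _ d2] by auto
 have "exp (2 * t) * q_fun (phi t p) = q_fun p"
  using k[OF t] k[of 0] tau_pos phi_0[OF p(1)] by (simp add: q_fun_def)
 then have "exp (- 2 * t) * (exp (2 * t) * q_fun (phi t p)) = exp (- 2 * t) * q_fun p" by simp
 then show "q_fun (phi t p) = exp (- 2 * t) * q_fun p"
  by (simp only: mult.assoc[symmetric] exp_add[symmetric]) simp
qed

end

section \<open>Factorisation of positive definite forms\<close>

lemma form_factor_aux:
 fixes B :: "'a::euclidean_space \<Rightarrow> 'a \<Rightarrow> real"
 assumes "finite F" "F \<subseteq> Basis" "bilinear B" "\<And>u v. B u v = B v u" "\<And>i v. i \<in> Basis - F \<Longrightarrow> B i v = 0"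
  "\<And>u i. i \<in> F \<Longrightarrow> u \<bullet> i \<noteq> 0 \<Longrightarrow> B u u > 0"
 shows "\<exists>L :: 'a \<Rightarrow> 'a. linear L \<and> (\<forall>u v. B u v = L u \<bullet> L v) \<and> (\<forall>u. \<forall>i\<in>Basis - F. L u \<bullet> i = 0)"
 using assms
proof (induct F arbitrary: B rule: finite_induct)
 case empty
 have "B u v = 0" for u v
  using linear_basis_expand[OF bilinear_linear(2)[OF empty(2)], of u v] empty(4) by simp
 then show ?case by (intro exI[of _ "\<lambda>u. 0"]) (simp add: linear_zero)
next
 case (insert b F)
 note bil = insert(5) and sym = insert(6) and pos = insert(8)
 have b: "b \<in> Basis" using insert(4) by simp
 have k: "B b b > 0" by (rule pos[of b]) (use b in auto)
 \<comment> \<open>Completing the square, as in Cholesky's factorisation: what remains after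
   splitting off the square belonging to b also vanishes on b, so F shrinks. This is why positivity
   is asked only for vectors with a component in F.\<close>
 define B' where "B' u v = B u v - B u b * B v b / B b b" for u v
 have bil': "bilinear B'" unfolding B'_def[abs_def] bilinear_def
  by (auto intro!: linearI simp: bilinear_ladd[OF bil] bilinear_radd[OF bil] bilinear_lmul[OF bil] bilinear_rmul[OF bil]
    add_divide_distrib algebra_simps)
 have "\<exists>L :: 'a \<Rightarrow> 'a. linear L \<and> (\<forall>u v. B' u v = L u \<bullet> L v) \<and> (\<forall>u. \<forall>i\<in>Basis - F. L u \<bullet> i = 0)"
 proof (rule insert.hyps(3)[OF _ bil'])
  show "F \<subseteq> Basis" "B' u v = B' v u" for u v using insert(4) sym[of u v] by (auto simp: B'_def)
  show "B' i v = 0" if "i \<in> Basis - F" for i v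
   using insert(7)[of i] that k sym[of b v] by (cases "i = b") (auto simp: B'_def)
  fix u i assume i: "i \<in> F" "u \<bullet> i \<noteq> 0"
  \<comment> \<open>The B-orthogonal projection of u away from b; it has the same component along i,
    and B on it equals B' on u.\<close>
  let ?w = "u - (B u b / B b b) *\<^sub>R b"
  have "b \<bullet> i = 0" using i(1) insert(2,4) by (auto simp: inner_Basis)
  then have "B ?w ?w > 0" using i by (intro pos[of i]) (auto simp: inner_diff_left)
  moreover have "B ?w ?w = B' u u"
   using k sym[of b u] by (simp add: B'_def bilinear_lsub[OF bil] bilinear_rsub[OF bil] bilinear_lmul[OF bil] bilinear_rmul[OF bil])
  ultimately show "B' u u > 0" by simp
 qed
 then obtain L where L: "linear L" "\<And>u v. B' u v = L u \<bullet> L v" "\<And>u i. i \<in> Basis - F \<Longrightarrow> L u \<bullet> i = 0" by blast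
 define L' where "L' u = L u + (B u b / sqrt (B b b)) *\<^sub>R b" for u
 have "linear L'" unfolding L'_def[abs_def]
  by (intro linear_compose_add L linearI) (simp_all add: bilinear_ladd[OF bil] bilinear_lmul[OF bil] add_divide_distrib scaleR_add_left)
 moreover have "B u v = L' u \<bullet> L' v" for u v
 proof -
  have "L u \<bullet> b = 0" "b \<bullet> L v = 0" using L(3)[of b] b insert(2) by (auto simp: inner_commute[of b])
  then show ?thesis using L(2)[of u v] k b by (simp add: L'_def B'_def inner_add_left inner_add_right diff_eq_eq mult.commute)
 qed
 moreover have "L' u \<bullet> i = 0" if "i \<in> Basis - insert b F" for u i
  using L(3)[of i u] that b by (auto simp: L'_def inner_add_left inner_Basis)
 ultimately show ?case by blast
qed

lemma form_factor:
 fixes B :: "'a::euclidean_space \<Rightarrow> 'a \<Rightarrow> real"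
 assumes B: "bilinear B" and sym: "\<And>u v. B u v = B v u" and pos: "\<And>u. u \<noteq> 0 \<Longrightarrow> B u u > 0"
 obtains L :: "'a \<Rightarrow> 'a" where "linear L" "bij L" "\<And>u v. B u v = L u \<bullet> L v"
proof -
 have "\<exists>L :: 'a \<Rightarrow> 'a. linear L \<and> (\<forall>u v. B u v = L u \<bullet> L v) \<and> (\<forall>u. \<forall>i\<in>Basis - Basis. L u \<bullet> i = 0)"
  by (rule form_factor_aux[OF finite_Basis order_refl B sym]) (use pos in \<open>auto, metis inner_zero_left\<close>)
 then obtain L :: "'a \<Rightarrow> 'a" where L: "linear L" "\<And>u v. B u v = L u \<bullet> L v" by blast
 have "inj L" unfolding linear_injective_0[OF L(1)] using L(2) pos by (metis inner_zero_left less_irrefl)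
 then show ?thesis using that[OF L(1) _ L(2)] linear_injective_imp_surjective[OF L(1)] by (simp add: bij_def)
qed

section \<open>Local representatives and maps that pull the Euclidean metric back to g / (1 +
  s)^2\<close>

definition smooth_rep :: "('p, 'a::euclidean_space) chart \<Rightarrow> ('p \<Rightarrow> 'b::euclidean_space) \<Rightarrow> 'p \<Rightarrow> 'a set \<Rightarrow> ('a \<Rightarrow> 'b) \<Rightarrow> bool" where
 "smooth_rep c u p W F \<longleftrightarrow> open W \<and> snd c p \<in> W \<and> C_inf_on W F \<and>
   (\<forall>y\<in>W \<inter> half_space. y \<in> chart_image c \<and> F y = u (chart_inv c y))"

lemma smooth_repD:
 assumes "smooth_rep c u p W F"
 shows "open W" "snd c p \<in> W" "C_inf_on W F" "y \<in> W \<Longrightarrow> y \<in> half_space \<Longrightarrow> y \<in> chart_image c"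
  "y \<in> W \<Longrightarrow> y \<in> half_space \<Longrightarrow> F y = u (chart_inv c y)"
 using assms unfolding smooth_rep_def by simp_all

lemma smooth_rep_compose:
 assumes u: "smooth_rep c u p W F" and K: "C_inf_on K k" "open K" "F ` W \<subseteq> K"
 shows "smooth_rep c (\<lambda>q. k (u q)) p W (\<lambda>y. k (F y))"
 unfolding smooth_rep_def
proof (intro conjI ballI)
 show "open W" "snd c p \<in> W" by (fact smooth_repD[OF u])+
 show "C_inf_on W (\<lambda>y. k (F y))" by (rule C_inf_on_compose[OF smooth_repD(1)[OF u] K(2) smooth_repD(3)[OF u] K(1,3)])
 fix y assume "y \<in> W \<inter> half_space"
 then show "y \<in> chart_image c" "k (F y) = k (u (chart_inv c y))" using smooth_repD(4,5)[OF u] by auto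
qed

context obata_unit
begin

text \<open>On the round sphere with height s, stereographic projection from the pole s = -1 has
  this property. The exact factor is prescribed, so that such maps are local isometries for one flat
  metric.\<close>

definition conf_rep :: "('p, 'a) chart \<Rightarrow> ('p \<Rightarrow> 'a) \<Rightarrow> 'p \<Rightarrow> bool" where
 "conf_rep c u p \<longleftrightarrow> (\<exists>W F. smooth_rep c u p W F \<and>
   (\<forall>v w. FD F (snd c p) v \<bullet> FD F (snd c p) w = metric M c p v w / (1 + s p)\<^sup>2))"

definition conf_at :: "('p \<Rightarrow> 'a) \<Rightarrow> 'p \<Rightarrow> bool" where
 "conf_at u p \<longleftrightarrow> (\<forall>c\<in>charts M. p \<in> fst c \<longrightarrow> conf_rep c u p)"

lemma conf_rep_imp_conf_at:
 assumes d: "d \<in> charts M" "p \<in> fst d" and u: "conf_rep d u p"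
 shows "conf_at u p"
 unfolding conf_at_def
proof (intro ballI impI)
 fix c assume c: "c \<in> charts M" "p \<in> fst c"
 obtain W' F where F: "smooth_rep d u p W' F"
  "\<And>v w. FD F (snd d p) v \<bullet> FD F (snd d p) w = metric M d p v w / (1 + s p)\<^sup>2"
  using u unfolding conf_rep_def by blast
 obtain W T where T: "transition_map c d p W T" by (rule transition[OF c(1) d(1) c(2) d(2)])
 note W = transition_mapD[OF T] and Tx = transition_mapD(6)[OF T c]
 have W': "open W'" "C_inf_on W' F" "snd d p \<in> W'" using F(1) by (auto simp: smooth_rep_def)
 let ?U = "{y \<in> W. T y \<in> W'}"
 have U: "open ?U"
  using continuous_open_preimage[OF C_inf_on_continuous_on[OF W(3)] W(1) W'(1)] by (simp add: vimage_def Int_def)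
 have CF: "C_inf_on ?U (\<lambda>y. F (T y))"
  by (rule C_inf_on_compose[OF U W'(1) C_inf_on_subset[OF W(3)] W'(2)]) auto
 have eq: "F (T y) = u (chart_inv c y)" if "y \<in> ?U" "y \<in> half_space" for y
 proof -
  have y: "chart_inv c y \<in> fst d" "T y = snd d (chart_inv c y)" using W(4)[of y] that by auto
  then have "T y \<in> half_space" using chart_half[OF d(1)] by simp
  then have "F (T y) = u (chart_inv d (T y))" using F(1) that by (auto simp: smooth_rep_def)
  then show ?thesis using y chart_inv_left[OF d(1) y(1)] by simp
 qed
 have rep: "smooth_rep c u p ?U (\<lambda>y. F (T y))"
  unfolding smooth_rep_def using U CF eq W(2,4) W'(3) Tx by auto
 have "((\<lambda>y. F (T y)) has_derivative (\<lambda>v. FD F (T (snd c p)) (FD T (snd c p) v))) (at (snd c p))"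
  by (rule has_derivative_compose[OF C_inf_on_has_derivative[OF W(3,2)] C_inf_on_has_derivative[OF W'(2)]])
   (use W' Tx in simp)
 from frechet_derivative_at[OF this, symmetric]
 have D: "FD (\<lambda>y. F (T y)) (snd c p) = (\<lambda>v. FD F (snd d p) (FD T (snd c p) v))" by (simp add: Tx)
 have "\<forall>v w. FD (\<lambda>y. F (T y)) (snd c p) v \<bullet> FD (\<lambda>y. F (T y)) (snd c p) w = metric M c p v w / (1 + s p)\<^sup>2"
  by (simp add: D F(2) W(7)[OF c])
 then show "conf_rep c u p" unfolding conf_rep_def using rep by blast
qed

text \<open>The time map scales g / (1 + s)^2 by exp (- 2 t), and the factor exp t compensates. The
  scaling comes from \<open>conformal_curve\<close> applied to exp r times the linearised
  flow.\<close>

lemma conf_at_phi: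
 assumes p: "p \<in> topspace (mtop M)" "s p > -1" and t: "t \<in> {0..2 * tau}" and u: "conf_at u (phi t p)"
 shows "conf_at (\<lambda>q. exp t *\<^sub>R u (phi t q)) p"
proof -
 from flowbox_tau[OF p(1)] obtain c W G S V U a Y
  where B: "flowbox c W G S V U a Y" "p \<in> fst c" "snd c p \<in> U" "2 * tau < a" by blast
 have c: "c \<in> charts M" and E: "obata_ext c W G S V" and U: "open U" "U \<subseteq> W"
  and CY: "C_inf_on ({-a<..<a} \<times> U) Y" and a: "a > 0"
  using B(1) by (auto simp: flowbox_def)
 let ?x = "snd c p"
 note xh = chart_half[OF c B(2)]
 have tI: "r \<in> {-a<..<a}" "0 \<le> r \<and> r < a" if "r \<in> {0..2 * tau}" for r using that B(4) a by auto
 have Y: "Y (r, y) \<in> W" "Y (r, y) \<in> half_space" "Y (r, y) \<in> chart_image c" "phi r (chart_inv c y) = chart_inv c (Y (r, y))"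
  if r: "r \<in> {0..2 * tau}" and y: "y \<in> U" "y \<in> half_space" for r y
 proof -
  show 1: "Y (r, y) \<in> W" using B(1) tI(1)[OF r] y(1) unfolding flowbox_def by blast
  show 2: "Y (r, y) \<in> half_space" using B(1) tI(2)[OF r] y unfolding flowbox_def by blast
  show "Y (r, y) \<in> chart_image c" by (rule obata_ext_image[OF E 1 2])
  have yI: "y \<in> chart_image c" using obata_ext_image[OF E _ y(2)] y(1) U by blast
  show "phi r (chart_inv c y) = chart_inv c (Y (r, y))"
   using flowbox_phi(1)[OF B(1,4) chart_inv_in[OF yI] _ r] y(1) by (simp add: chart_inv_right[OF yI])
 qed
 let ?z = "Y (t, ?x)"
 have px: "chart_inv c ?x = p" by (rule chart_inv_left[OF c B(2)])
 have pz: "phi t p = chart_inv c ?z" using Y(4)[OF t B(3) xh] px by simp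
 have zc: "phi t p \<in> fst c" "snd c (phi t p) = ?z"
  using chart_inv_in[OF Y(3)[OF t B(3) xh]] chart_inv_right[OF Y(3)[OF t B(3) xh]] pz by auto
 obtain W' F where F: "smooth_rep c u (phi t p) W' F"
  "\<And>v w. FD F ?z v \<bullet> FD F ?z w = metric M c (phi t p) v w / (1 + s (phi t p))\<^sup>2"
  using u c zc unfolding conf_at_def conf_rep_def by metis
 have W': "open W'" "C_inf_on W' F" "?z \<in> W'" using F(1) zc by (auto simp: smooth_rep_def)
 have opQ: "open ({-a<..<a} \<times> U)" by (intro open_Times U) auto
 have CYt: "C_inf_on U (\<lambda>y. Y (t, y))"
  by (rule C_inf_on_compose[OF U(1) opQ _ CY]) (use tI(1)[OF t] in \<open>auto intro!: C_inf_on_Pair C_inf_on_const C_inf_on_ident U\<close>)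
 let ?U = "{y \<in> U. Y (t, y) \<in> W'}"
 have U': "open ?U"
  using continuous_open_preimage[OF C_inf_on_continuous_on[OF CYt] U(1) W'(1)] by (simp add: vimage_def Int_def)
 have CF: "C_inf_on ?U (\<lambda>y. exp t *\<^sub>R F (Y (t, y)))"
  by (intro C_inf_on_scaleR C_inf_on_const U' C_inf_on_compose[OF U' W'(1) C_inf_on_subset[OF CYt] W'(2)]) auto
 have rep: "smooth_rep c (\<lambda>q. exp t *\<^sub>R u (phi t q)) p ?U (\<lambda>y. exp t *\<^sub>R F (Y (t, y)))"
  unfolding smooth_rep_def
 proof (intro conjI U' CF ballI)
  show "?x \<in> ?U" using B(3) W'(3) by simp
  fix y assume y: "y \<in> ?U \<inter> half_space"
  then show "y \<in> chart_image c" using obata_ext_image[OF E] U by blast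
  show "exp t *\<^sub>R F (Y (t, y)) = exp t *\<^sub>R u (phi t (chart_inv c y))"
   using F(1) y Y(2,4)[OF t, of y] by (auto simp: smooth_rep_def)
 qed
 have dY: "(Y has_derivative FD Y (r, y)) (at (r, y))" if "r \<in> {-a<..<a}" "y \<in> U" for r y
  by (rule C_inf_on_has_derivative[OF CY]) (use that in simp)
 let ?Z = "\<lambda>v r. FD Y (r, ?x) (0, v)"
 have "((\<lambda>y. (t, y)) has_derivative (\<lambda>v. (0, v))) (at ?x)" by (auto intro!: derivative_eq_intros)
 from has_derivative_compose[OF this dY[OF tI(1)[OF t] B(3)]]
 have "((\<lambda>y. Y (t, y)) has_derivative (\<lambda>v. ?Z v t)) (at ?x)" .
 from has_derivative_scaleR_right[OF has_derivative_compose[OF this C_inf_on_has_derivative[OF W'(2,3)]], of "exp t"]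
 have "((\<lambda>y. exp t *\<^sub>R F (Y (t, y))) has_derivative (\<lambda>v. exp t *\<^sub>R FD F ?z (?Z v t))) (at ?x)" .
 from frechet_derivative_at[OF this, symmetric]
 have D: "FD (\<lambda>y. exp t *\<^sub>R F (Y (t, y))) ?x = (\<lambda>v. exp t *\<^sub>R FD F ?z (?Z v t))" .
 note G = obata_ext_metric[OF E]
 have const: "exp (2 * t) * G ?z (?Z v t) (?Z w t) / (1 + S ?z)\<^sup>2 = G ?x v w / (1 + S ?x)\<^sup>2" for v w
 proof -
  let ?f = "\<lambda>r. G (Y (r, ?x)) (exp r *\<^sub>R ?Z v r) (exp r *\<^sub>R ?Z w r) / (1 + S (Y (r, ?x)))\<^sup>2"
  have Z0: "?Z v 0 = v" for v
  proof -
   have "((\<lambda>y. (0, y)) has_derivative (\<lambda>v. (0, v))) (at ?x)" by (auto intro!: derivative_eq_intros)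
   from has_derivative_compose[OF this dY[OF _ B(3)]] a
   have "((\<lambda>y. Y (0, y)) has_derivative (\<lambda>v. ?Z v 0)) (at ?x)" by simp
   then have "((\<lambda>y. y) has_derivative (\<lambda>v. ?Z v 0)) (at ?x)"
    by (rule has_derivative_transform_within_open[OF _ U(1) B(3)]) (use B(1) in \<open>auto simp: flowbox_def\<close>)
   from fun_cong[OF has_derivative_unique[OF this has_derivative_ident], of v] show ?thesis by simp
  qed
  have "(?f has_derivative (\<lambda>h. 0)) (at r within {0..2 * tau})" if r: "r \<in> {0..2 * tau}" for r
  proof -
   have yr: "((\<lambda>r. Y (r, ?x)) has_vector_derivative (-1) *\<^sub>R V (Y (r, ?x))) (at r within {0..2 * tau})"
    using B(1) tI(1)[OF r] B(3) unfolding flowbox_def by simp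
   have zr: "((\<lambda>r. exp r *\<^sub>R ?Z v r) has_vector_derivative
     (-1) *\<^sub>R (FD V (Y (r, ?x)) (exp r *\<^sub>R ?Z v r) - exp r *\<^sub>R ?Z v r)) (at r within {0..2 * tau})" for v
   proof -
    have "((\<lambda>r. ?Z v r) has_vector_derivative - FD V (Y (r, ?x)) (?Z v r)) (at r within {0..2 * tau})"
     using B(1) tI(1)[OF r] B(3) unfolding flowbox_def by blast
    moreover have "(exp has_real_derivative exp r) (at r within {0..2 * tau})"
     using DERIV_exp has_field_derivative_at_within by blast
    ultimately have "((\<lambda>r. exp r *\<^sub>R ?Z v r) has_vector_derivative
      exp r *\<^sub>R (- FD V (Y (r, ?x)) (?Z v r)) + exp r *\<^sub>R ?Z v r) (at r within {0..2 * tau})"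
     by (rule has_vector_derivative_scaleR[rotated])
    moreover have "linear (FD V (Y (r, ?x)))"
     using C_inf_on_has_derivative[OF obata_ext_V[OF E] Y(1)[OF r B(3) xh]] has_derivative_linear by blast
    ultimately show ?thesis by (simp add: linear_scale)
   qed
   have "S (Y (r, ?x)) = s (phi r p)"
    using obata_ext_s[OF E Y(1,2)[OF r B(3) xh]] Y(4)[OF r B(3) xh] px by simp
   then have S1: "S (Y (r, ?x)) > -1" using s_phi(1)[OF p r] by simp
   have "(?f has_real_derivative 0) (at r within {0..2 * tau})"
    by (rule conformal_curve[OF c E r _ _ S1 yr zr zr]) (use Y(1,2)[OF _ B(3) xh] r in auto)
   then show ?thesis by (simp add: has_field_derivative_def lambda_zero)
  qed
  from has_derivative_zero_constant[OF convex_closed_interval[of 0 "2 * tau"], unfolded cbox_interval, OF this]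
  obtain k where k: "\<And>r. r \<in> {0..2 * tau} \<Longrightarrow> ?f r = k" by auto
  have x0: "Y (0, ?x) = ?x" using B(1,3) by (simp add: flowbox_def)
  have "?f t = ?f 0" using k[OF t] k[of 0] tau_pos by simp
  moreover have "G ?z (exp t *\<^sub>R ?Z v t) (exp t *\<^sub>R ?Z w t) = exp (2 * t) * G ?z (?Z v t) (?Z w t)"
   using metric_ext_bilinear[OF G Y(1)[OF t B(3) xh]]
   by (simp add: bilinear_lmul bilinear_rmul exp_double power2_eq_square)
  ultimately show ?thesis by (simp add: x0 Z0)
 qed
 have "FD (\<lambda>y. exp t *\<^sub>R F (Y (t, y))) ?x v \<bullet> FD (\<lambda>y. exp t *\<^sub>R F (Y (t, y))) ?x w = metric M c p v w / (1 + s p)\<^sup>2" for v w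
 proof -
  have "G ?z (?Z v t) (?Z w t) = metric M c (phi t p) (?Z v t) (?Z w t)" "S ?z = s (phi t p)"
   "G ?x v w = metric M c p v w" "S ?x = s p"
   using metric_ext_eq[OF G Y(1,2)[OF t B(3) xh]] pz obata_ext_s[OF E Y(1,2)[OF t B(3) xh]] px
    metric_ext_eq[OF G _ xh] obata_ext_s[OF E _ xh] U B(3) by auto
  moreover have "exp (2 * t) = exp t * exp t" by (simp add: exp_double power2_eq_square)
  ultimately show ?thesis using const[of v w] by (simp add: D F(2))
 qed
 then have "conf_rep c (\<lambda>q. exp t *\<^sub>R u (phi t q)) p" unfolding conf_rep_def using rep by blast
 then show ?thesis by (rule conf_rep_imp_conf_at[OF c B(2)])
qed

end

section \<open>Linearising coordinates near a maximum of s\<close>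

context obata_unit
begin

text \<open>The last clause says that small values of Ps occur only near p0. Together with the decay
  of Ps along the flow it makes every orbit that enters N converge to p0.\<close>

definition lin_nbhd :: "'p \<Rightarrow> 'p set \<Rightarrow> ('p \<Rightarrow> 'a) \<Rightarrow> bool" where
 "lin_nbhd p0 N Ps \<longleftrightarrow> openin (mtop M) N \<and> p0 \<in> N \<and> inj_on Ps N \<and>
   (\<forall>q\<in>N. s q > -1 \<and> conf_at Ps q \<and> (norm (Ps q))\<^sup>2 = q_fun q \<and>
    (\<forall>t\<in>{0..2 * tau}. phi t q \<in> N \<and> Ps (phi t q) = exp (- t) *\<^sub>R Ps q)) \<and>
   (\<forall>P. openin (mtop M) P \<and> p0 \<in> P \<longrightarrow> (\<exists>\<epsilon>>0. \<forall>q\<in>N. norm (Ps q) < \<epsilon> \<longrightarrow> q \<in> P))"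

text \<open>In the coordinates X the field V becomes the Euler field, and g / (1 + s)^2 scales by
  its flow like a form with constant coefficients. Hence it equals its value at the origin, an inner
  product, and a linear change L of coordinates makes it Euclidean.\<close>

lemma lin_nbhd_exists:
 assumes p0: "p0 \<in> topspace (mtop M)" and s1: "s p0 = 1"
 shows "\<exists>N Ps. lin_nbhd p0 N Ps"
proof -
 obtain c where c: "c \<in> charts M" "p0 \<in> fst c" using chart_exists[OF p0] by blast
 define x0 where "x0 = snd c p0"
 obtain W G S V where x0W: "x0 \<in> W" and E: "obata_ext c W G S V"
  unfolding x0_def by (rule obata_ext_exists[OF c]) blast
 note G = obata_ext_metric[OF E] and W = obata_ext_open[OF E] and CV = obata_ext_V[OF E] and CS = obata_ext_S[OF E]
 have xh: "x0 \<in> half_space" unfolding x0_def by (rule chart_half[OF c])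
 have px: "chart_inv c x0 = p0" unfolding x0_def by (rule chart_inv_left[OF c])
 have Sx: "S x0 = 1" using obata_ext_s[OF E x0W xh] px s1 by simp
 have Geq: "G x0 u v = metric M c p0 u v" for u v using metric_ext_eq[OF G x0W xh] px by simp
 have grd0: "grd c p0 = 0"
 proof (rule ccontr)
  assume "grd c p0 \<noteq> 0"
  from metric_pos[OF c this] energy[OF c] s1 show False by simp
 qed
 have V0: "V x0 = 0" using grd_ext[OF c(1) E x0W xh] px grd0 by simp
 \<comment> \<open>A critical point lies in the interior, since \<open>grd\<close> points strictly
   outwards on the boundary.\<close>
 have inw: "0 < x0 \<bullet> inward"
  using grd_outward[OF c] grd0 boundary_iff[OF c] xh by (force simp: half_space_def x0_def)
 \<comment> \<open>Where V vanishes, all derivatives of the metric drop out of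
   \<open>second_derivative_identity\<close>, leaving G(DV u, w) = s G(u, w) with s = 1.\<close>
 have DV: "FD V x0 u = u" for u
 proof (rule metric_nondegenerate[OF c])
  fix w
  have "FD (\<lambda>y. G y v 0) x0 = FD (\<lambda>y. 0) x0" for v
   by (rule frechet_derivative_transform_within_open[symmetric, OF _ W x0W])
    (use bilinear_rzero[OF metric_ext_bilinear[OF G]] in auto)
  then have z: "FD (\<lambda>y. G y v 0) x0 w = 0" for v w by simp
  have "linear (FD (\<lambda>y. G y u w) x0)"
   using C_inf_on_has_derivative[OF metric_ext_smooth[OF G] x0W] has_derivative_linear by blast
  then have "FD (\<lambda>y. G y u w) x0 0 = 0" by (rule linear_0)
  then show "metric M c p0 (FD V x0 u) w = metric M c p0 u w"
   using second_derivative_identity[OF c(1) E x0W xh, of u w] z by (simp add: V0 Sx Geq)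
 qed
 define W0 where "W0 = W \<inter> {x. 0 < x \<bullet> inward} \<inter> {x \<in> W. -1 < S x}"
 have W0: "open W0" "x0 \<in> W0" "W0 \<subseteq> W" "W0 \<subseteq> half_space" "\<And>x. x \<in> W0 \<Longrightarrow> S x > -1"
 proof -
  have "open {x \<in> W. -1 < S x}"
   using continuous_open_preimage[OF C_inf_on_continuous_on[OF CS] W, of "{-1<..}"] by (simp add: vimage_def Int_def)
  then show "open W0" unfolding W0_def by (intro open_Int W open_Collect_less continuous_intros)
  show "x0 \<in> W0" using x0W inw Sx by (simp add: W0_def)
 qed (auto simp: W0_def half_space_def)
 obtain r X where X: "r > 0" "C_inf_on (ball 0 r) X" "X 0 = x0" "\<And>x. FD X 0 x = x"
  "\<And>x. x \<in> ball 0 r \<Longrightarrow> X x \<in> W0" "\<And>x. x \<in> ball 0 r \<Longrightarrow> FD X x x = V (X x)"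
  by (rule linearise_radial_zero[OF W0(1) C_inf_on_subset[OF CV W0(3)] W0(2) V0 DV]) blast
 have "inj (FD X 0)" by (rule injI) (simp add: X(4))
 from smooth_inverse_function[OF open_ball X(2) _ this] X(1)
 obtain U H where U: "open U" "0 \<in> U" "U \<subseteq> ball 0 r" "inj_on X U" "open (X ` U)" "C_inf_on (X ` U) H"
  "\<And>x. x \<in> U \<Longrightarrow> H (X x) = x" "\<And>x. x \<in> U \<Longrightarrow> inj (FD X x)" by (metis centre_in_ball)
 obtain r0 where r0: "r0 > 0" "ball 0 r0 \<subseteq> U" using U(1,2) openE by blast
 define B where "B = ball (0::'a) r0"
 have B: "B \<subseteq> U" "B \<subseteq> ball 0 r" "0 \<in> B" "convex B" using r0 U(3) by (auto simp: B_def)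
 have Bs: "k *\<^sub>R y \<in> B" if "y \<in> B" "k \<in> {0..1}" for k y
 proof -
  have "k * norm y \<le> 1 * norm y" using that(2) by (intro mult_right_mono) auto
  then show ?thesis using that by (simp add: B_def)
 qed
 define P where "P = X ` B"
 have P_eq: "P = {z \<in> X ` U. H z \<in> B}" unfolding P_def using B(1) U(7) by auto
 have P: "open P" unfolding P_eq
  using continuous_open_preimage[OF C_inf_on_continuous_on[OF U(6)] U(5), of B] by (simp add: vimage_def Int_def B_def)
 have PW: "z \<in> W0" "z \<in> W" "z \<in> half_space" "z \<in> chart_image c" if "z \<in> P" for z
 proof -
  show 1: "z \<in> W0" using that X(5) B(2) by (auto simp: P_def)
  then show "z \<in> W" "z \<in> half_space" using W0 by auto
  then show "z \<in> chart_image c" by (rule obata_ext_image[OF E])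
 qed
 have XW: "X y \<in> W0" "X y \<in> W" "X y \<in> half_space" "X y \<in> chart_image c" "X y \<in> P" if "y \<in> B" for y
  using PW[of "X y"] that by (auto simp: P_def)
 have dX: "(X has_derivative FD X y) (at y)" "linear (FD X y)"
  "((\<lambda>z. FD X z v) has_derivative FD (\<lambda>z. FD X z v) y) (at y)" "linear (FD (\<lambda>z. FD X z v) y)" if "y \<in> B" for y v
  using C_inf_on_has_derivative[OF X(2)] C_inf_on_has_derivative[OF C_inf_on_FD[OF X(2)]] that B(2) has_derivative_linear
  by blast+
 have bil: "bilinear (metric M c p0)" by (rule metric_bilinear[OF c])
 obtain L :: "'a \<Rightarrow> 'a" where L: "linear L" "bij L" "\<And>u v. metric M c p0 u v = L u \<bullet> L v"
  using form_factor[OF bil metric_sym[OF c] metric_pos[OF c], of thesis] by fast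
 define N where "N = {q \<in> fst c. snd c q \<in> P}"
 \<comment> \<open>At p0 the factor 1 / (1 + s)^2 is 1/4, and L is a square root of the metric
   there; hence the factor 1/2.\<close>
 define Ps where "Ps q = (1/2) *\<^sub>R L (H (snd c q))" for q
 have N: "openin (mtop M) N" unfolding N_def by (rule chart_preimage_open[OF c(1) P])
 have Ny: "chart_inv c (X y) \<in> N" "Ps (chart_inv c (X y)) = (1/2) *\<^sub>R L y" if "y \<in> B" for y
  using chart_inv_in[OF XW(4)[OF that]] chart_inv_right[OF XW(4)[OF that]] XW(5)[OF that] U(7)[of y] B(1) that
  by (auto simp: N_def Ps_def)
 have Nq: "\<exists>y\<in>B. q = chart_inv c (X y) \<and> snd c q = X y" if q: "q \<in> N" for q
 proof -
  obtain y where y: "y \<in> B" "snd c q = X y" using q unfolding N_def P_def by blast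
  then show ?thesis using chart_inv_left[OF c(1), of q] q unfolding N_def by force
 qed
 have p0N: "p0 \<in> N" using Ny(1)[OF B(3)] X(3) px by simp
 have injPs: "inj_on Ps N"
 proof (rule inj_onI)
  fix q q' assume q: "q \<in> N" "q' \<in> N" "Ps q = Ps q'"
  obtain y y' where y: "y \<in> B" "q = chart_inv c (X y)" "y' \<in> B" "q' = chart_inv c (X y')" using Nq q by metis
  then have "L y = L y'" using q(3) Ny(2) by simp
  then have "y = y'" using L(2) by (metis bij_def injD)
  then show "q = q'" using y by simp
 qed
 have sN: "s q > -1" if "q \<in> N" for q
  using Nq[OF that] W0(5) obata_ext_s[OF E] XW by metis
 have ray: "((\<lambda>k. X (k *\<^sub>R y)) has_vector_derivative FD X (k *\<^sub>R y) y) (at k within I)"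
  and rayD: "((\<lambda>k. FD X (k *\<^sub>R y) v) has_vector_derivative FD (\<lambda>z. FD X z v) (k *\<^sub>R y) y) (at k within I)"
  if "y \<in> B" "k \<in> {0..1}" for y k v I
 proof -
  have p: "((\<lambda>k. k *\<^sub>R y) has_vector_derivative y) (at k within I)" by (auto intro!: derivative_eq_intros)
  show "((\<lambda>k. X (k *\<^sub>R y)) has_vector_derivative FD X (k *\<^sub>R y) y) (at k within I)"
   by (rule has_vector_derivative_chain[where f=X and p="\<lambda>k. k *\<^sub>R y", OF dX(1)[OF Bs[OF that]] p])
  show "((\<lambda>k. FD X (k *\<^sub>R y) v) has_vector_derivative FD (\<lambda>z. FD X z v) (k *\<^sub>R y) y) (at k within I)"
   by (rule has_vector_derivative_chain[where f="\<lambda>z. FD X z v" and p="\<lambda>k. k *\<^sub>R y", OF dX(3)[OF Bs[OF that]] p])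
 qed
 have XV: "FD X z z = V (X z)" if "z \<in> B" for z using X(6) that B(2) by blast
 \<comment> \<open>Differentiate DX(y) y = V(X y) in the direction v and exchange the second
   derivatives: this is the variational equation along rays.\<close>
 have second: "FD (\<lambda>z. FD X z v) z z = FD V (X z) (FD X z v) - FD X z v" if z: "z \<in> B" for z v
 proof -
  have diff: "(\<lambda>y. FD X y b) differentiable (at z)" for b using dX(3)[OF z] by (auto simp: differentiable_def)
  have B0: "open B" by (simp add: B_def)
  have "((\<lambda>y. FD X y y) has_derivative (\<lambda>u. FD (\<lambda>y. FD X y z) z u + FD X z u)) (at z)"
   by (rule FD_family[OF B0 z dX(2) diff has_derivative_ident])
  then have "((\<lambda>y. V (X y)) has_derivative (\<lambda>u. FD (\<lambda>y. FD X y z) z u + FD X z u)) (at z)"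
   by (rule has_derivative_transform_within_open[OF _ B0 z]) (rule XV)
  moreover have "((\<lambda>y. V (X y)) has_derivative (\<lambda>u. FD V (X z) (FD X z u))) (at z)"
   by (rule has_derivative_compose[OF dX(1)[OF z] C_inf_on_has_derivative[OF CV XW(2)[OF z]]])
  ultimately have "(\<lambda>u. FD (\<lambda>y. FD X y z) z u + FD X z u) = (\<lambda>u. FD V (X z) (FD X z u))"
   by (rule has_derivative_unique)
  from fun_cong[OF this, of v] have "FD (\<lambda>y. FD X y z) z v = FD V (X z) (FD X z v) - FD X z v" by (simp add: eq_diff_eq)
  moreover have "FD (\<lambda>y. FD X y z) z v = FD (\<lambda>y. FD X y v) z z"
   using symmetric_second_derivative[OF open_ball X(2), of z z v] z B(2) by blast
  ultimately show ?thesis by simp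
 qed
 \<comment> \<open>Constancy along the ray from the origin to y. The equation is divided by k and so
   is singular at k = 0; that point is bridged by continuity, and the value there uses X 0 = x0 and
   DX(0) = id.\<close>
 have conf: "G (X y) (FD X y v) (FD X y w) / (1 + S (X y))\<^sup>2 = G x0 v w / 4" if y: "y \<in> B" for y v w
 proof -
  let ?f = "\<lambda>k. G (X (k *\<^sub>R y)) (FD X (k *\<^sub>R y) v) (FD X (k *\<^sub>R y) w) / (1 + S (X (k *\<^sub>R y)))\<^sup>2"
  have d0: "(?f has_derivative (\<lambda>h. 0)) (at k within {0..1})" if k: "k \<in> {0..1} - {0}" for k
  proof -
   have k': "k \<in> {0..1}" "k \<noteq> 0" using k by auto
   note i = Bs[OF y k'(1)]
   have div: "z = (1/k) *\<^sub>R w'" if "k *\<^sub>R z = w'" for z w' :: 'a using that k'(2) by auto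
   have 1: "FD X (k *\<^sub>R y) y = (1/k) *\<^sub>R V (X (k *\<^sub>R y))"
    using XV[OF i] linear_scale[OF dX(2)[OF i], of k y] by (intro div) simp
   have 2: "FD (\<lambda>z. FD X z v) (k *\<^sub>R y) y = (1/k) *\<^sub>R (FD V (X (k *\<^sub>R y)) (FD X (k *\<^sub>R y) v) - FD X (k *\<^sub>R y) v)" for v
    using second[OF i, of v] linear_scale[OF dX(4)[OF i], of v k y] by (intro div) simp
   have "(?f has_real_derivative 0) (at k within {0..1})"
    by (rule conformal_curve[OF c(1) E k'(1) _ _ _ ray[OF y k'(1), unfolded 1] rayD[OF y k'(1), unfolded 2]
       rayD[OF y k'(1), unfolded 2]]) (use XW Bs[OF y] k'(1) W0(5) in auto)
   then show ?thesis by (simp add: has_field_derivative_def lambda_zero)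
  qed
  have B0: "open B" by (simp add: B_def)
  have CX: "C_inf_on B X" "C_inf_on B (\<lambda>z. FD X z a)" for a
   by (intro C_inf_on_subset[OF _ B(2)] X(2) C_inf_on_FD)+
  have CG: "C_inf_on B (\<lambda>z. G (X z) a b)" and CSX: "C_inf_on B (\<lambda>z. S (X z))" for a b
   using C_inf_on_compose[OF B0 W CX(1) metric_ext_smooth[OF G]] C_inf_on_compose[OF B0 W CX(1) CS] XW(2) by auto
  have Gv: "C_inf_on B (\<lambda>z. G (X z) (FD X z v) b)" for b
   by (rule C_inf_on_family[where T="\<lambda>z a. G (X z) a b", OF B0 _ CG CX(2)])
    (intro bilinear_linear(2) metric_ext_bilinear[OF G XW(2)])
  have "C_inf_on B (\<lambda>z. G (X z) (FD X z v) (FD X z w))"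
   by (rule C_inf_on_family[where T="\<lambda>z. G (X z) (FD X z v)", OF B0 _ Gv CX(2)])
    (intro bilinear_linear(1) metric_ext_bilinear[OF G XW(2)])
  moreover have ne: "1 + S (X z) \<noteq> 0" if "z \<in> B" for z using W0(5)[OF XW(1)[OF that]] by simp
  ultimately have contB: "continuous_on B (\<lambda>z. G (X z) (FD X z v) (FD X z w) / (1 + S (X z))\<^sup>2)"
   by (intro continuous_intros C_inf_on_continuous_on CSX) (use ne in auto)
  have contf: "continuous_on {0..1} ?f"
   by (rule continuous_on_compose2[OF contB]) (use Bs[OF y] in \<open>auto intro!: continuous_intros\<close>)
  have "?f 1 = ?f 0"
   by (rule has_derivative_zero_unique_strong_interval[OF _ contf refl, of "{0}"]) (use d0 in auto)
  then show ?thesis by (simp add: X(3,4) Sx)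
 qed
 have rep: "smooth_rep c Ps q P (\<lambda>z. (1/2) *\<^sub>R L (H z))" if q: "q \<in> N" for q
  unfolding smooth_rep_def
 proof (intro conjI P ballI)
  show "snd c q \<in> P" using q by (simp add: N_def)
  have "P \<subseteq> X ` U" unfolding P_eq by auto
  then show "C_inf_on P (\<lambda>z. (1/2) *\<^sub>R L (H z))"
   by (intro C_inf_on_scaleR C_inf_on_const P C_inf_on_linear_compose[OF P C_inf_on_subset[OF U(6)]])
    (use L(1) linear_conv_bounded_linear in auto)
  fix z assume "z \<in> P \<inter> half_space"
  then show "z \<in> chart_image c" using PW by blast
  then show "(1/2) *\<^sub>R L (H z) = Ps (chart_inv c z)" by (simp add: Ps_def chart_inv_right)
 qed
 have DPs: "FD (\<lambda>z. (1/2) *\<^sub>R L (H z)) (X y) (FD X y v) = (1/2) *\<^sub>R L v" if y: "y \<in> B" for y v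
 proof -
  have yU: "y \<in> U" using y B by blast
  have "((\<lambda>z. (1/2) *\<^sub>R L (H z)) has_derivative FD (\<lambda>z. (1/2) *\<^sub>R L (H z)) (X y)) (at (X y))"
   by (rule C_inf_on_has_derivative[OF smooth_repD(3)[OF rep[OF Ny(1)[OF y]]] XW(5)[OF y]])
  from has_derivative_compose[OF dX(1)[OF y] this]
  have "((\<lambda>y. (1/2) *\<^sub>R L (H (X y))) has_derivative (\<lambda>v. FD (\<lambda>z. (1/2) *\<^sub>R L (H z)) (X y) (FD X y v))) (at y)" .
  then have "((\<lambda>y. (1/2) *\<^sub>R L y) has_derivative (\<lambda>v. FD (\<lambda>z. (1/2) *\<^sub>R L (H z)) (X y) (FD X y v))) (at y)"
   by (rule has_derivative_transform_within_open[OF _ U(1) yU]) (simp add: U(7))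
  moreover have "((\<lambda>y. (1/2) *\<^sub>R L y) has_derivative (\<lambda>v. (1/2) *\<^sub>R L v)) (at y)"
   by (intro bounded_linear_imp_has_derivative linear_conv_bounded_linear[THEN iffD1] linear_compose_scale_right L)
  ultimately show ?thesis using fun_cong[OF has_derivative_unique] by blast
 qed
 have metq: "metric M c q v w / (1 + s q)\<^sup>2 = G (X y) v w / (1 + S (X y))\<^sup>2"
  if "q = chart_inv c (X y)" "y \<in> B" for q y v w
  using metric_ext_eq[OF G XW(2)[OF that(2)] XW(3)[OF that(2)]] obata_ext_s[OF E XW(2)[OF that(2)] XW(3)[OF that(2)]] that(1) by simp
 have Dconf: "FD (\<lambda>z. (1/2) *\<^sub>R L (H z)) (snd c q) v \<bullet> FD (\<lambda>z. (1/2) *\<^sub>R L (H z)) (snd c q) w = metric M c q v w / (1 + s q)\<^sup>2"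
  if q: "q \<in> N" for q v w
 proof -
  obtain y where y: "y \<in> B" "q = chart_inv c (X y)" "snd c q = X y" using Nq[OF q] by blast
  have "inj (FD X y)" using U(8) B(1) y(1) by blast
  then have "surj (FD X y)" using dX(2)[OF y(1)] linear_injective_imp_surjective by blast
  then obtain v' w' where vw: "v = FD X y v'" "w = FD X y w'" by (metis surjD)
  show ?thesis
   unfolding y(3) vw DPs[OF y(1)] metq[OF y(2,1)] conf[OF y(1)] by (simp add: Geq L(3))
 qed
 have confPs: "conf_at Ps q" if "q \<in> N" for q
  using conf_rep_imp_conf_at[OF c(1)] rep[OF that] Dconf[OF that] that unfolding conf_rep_def N_def by blast
 \<comment> \<open>Ps is radial, so Ps q is the image of V under its own derivative, and its length
   is that of V in g / (1 + s)^2, namely (1 - s^2) / (1 + s)^2 after squaring.\<close>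
 have normPs: "(norm (Ps q))\<^sup>2 = q_fun q" if q: "q \<in> N" for q
 proof -
  obtain y where y: "y \<in> B" "q = chart_inv c (X y)" "snd c q = X y" using Nq[OF q] by blast
  have "FD (\<lambda>z. (1/2) *\<^sub>R L (H z)) (X y) (V (X y)) = Ps q" using DPs[OF y(1), of y] XV[OF y(1)] Ny(2)[OF y(1)] y(2) by simp
  then have "Ps q \<bullet> Ps q = G (X y) (V (X y)) (V (X y)) / (1 + S (X y))\<^sup>2"
   using Dconf[OF q, of "V (X y)" "V (X y)"] metq[OF y(2,1)] y(3) by simp
  also have "\<dots> = (1 - (s q)\<^sup>2) / (1 + s q)\<^sup>2"
   using energy_ext[OF c(1) E XW(2)[OF y(1)] XW(3)[OF y(1)]] obata_ext_s[OF E XW(2)[OF y(1)] XW(3)[OF y(1)]] y(2) by simp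
  also have "\<dots> = q_fun q"
  proof -
   have "1 - (s q)\<^sup>2 = (1 - s q) * (1 + s q)" by (simp add: algebra_simps power2_eq_square)
   then show ?thesis using sN[OF q] by (simp add: q_fun_def power2_eq_square)
  qed
  finally show ?thesis by (simp add: power2_norm_eq_inner)
 qed
 have flow: "phi t q \<in> N \<and> Ps (phi t q) = exp (- t) *\<^sub>R Ps q" if q: "q \<in> N" and t: "t \<in> {0..2 * tau}" for q t
 proof -
  obtain y where y: "y \<in> B" "q = chart_inv c (X y)" "snd c q = X y" using Nq[OF q] by blast
  have e: "exp (- t) *\<^sub>R y \<in> B" if "0 \<le> t" for t by (rule Bs[OF y(1)]) (use that in auto)
  have b: "bcurve (\<lambda>t. chart_inv c (X (exp (- t) *\<^sub>R y))) (2 * tau)"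
  proof (rule bcurve_chartI[OF c(1) E])
   fix t assume t: "t \<in> {0..2 * tau}"
   then have i: "exp (- t) *\<^sub>R y \<in> B" using e by simp
   show "X (exp (- t) *\<^sub>R y) \<in> W" "X (exp (- t) *\<^sub>R y) \<in> half_space" using XW i by auto
   have p: "((\<lambda>t. exp (- t) *\<^sub>R y) has_vector_derivative - (exp (- t) *\<^sub>R y)) (at t within {0..2 * tau})"
    by (auto intro!: derivative_eq_intros)
   from has_vector_derivative_chain[where f=X and p="\<lambda>t. exp (- t) *\<^sub>R y", OF dX(1)[OF i] p]
   show "((\<lambda>t. X (exp (- t) *\<^sub>R y)) has_vector_derivative - V (X (exp (- t) *\<^sub>R y))) (at t within {0..2 * tau})"
    by (simp add: linear_neg[OF dX(2)[OF i]] XV[OF i])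
  qed
  have qM: "q \<in> topspace (mtop M)" using q openin_subset[OF N] by blast
  have "phi t q = chart_inv c (X (exp (- t) *\<^sub>R y))"
   by (rule bcurve_unique[OF phi_bcurve[OF qM] b, of 0 t]) (use t phi_0[OF qM] y tau_pos in auto)
  then show ?thesis using Ny[OF e, of t] Ny(2)[OF y(1)] y(2) t linear_scale[OF L(1)] by simp
 qed
 have small: "\<exists>\<epsilon>>0. \<forall>q\<in>N. norm (Ps q) < \<epsilon> \<longrightarrow> q \<in> P'" if P': "openin (mtop M) P'" "p0 \<in> P'" for P'
 proof -
  obtain r1 where r1: "r1 > 0" "\<And>x. x \<in> ball x0 r1 \<Longrightarrow> x \<in> half_space \<Longrightarrow> x \<in> chart_image c \<and> chart_inv c x \<in> P'"
   unfolding x0_def by (rule chart_nhd[OF c P']) blast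
  have "isCont X 0" using dX(1)[OF B(3)] has_derivative_continuous by blast
  then obtain \<delta> where \<delta>: "\<delta> > 0" "\<And>y. dist y 0 < \<delta> \<Longrightarrow> dist (X y) (X 0) < r1"
   using r1(1) unfolding continuous_at_eps_delta by blast
  obtain k where k: "k > 0" "\<And>y. k * norm y \<le> norm (L y)"
   using linear_inj_bounded_below_pos[OF L(1)] L(2) by (metis bij_def mult.commute)
  show ?thesis
  proof (intro exI[of _ "k * \<delta> / 2"] conjI ballI impI)
   show "0 < k * \<delta> / 2" using k \<delta> by simp
   fix q assume q: "q \<in> N" "norm (Ps q) < k * \<delta> / 2"
   obtain y where y: "y \<in> B" "q = chart_inv c (X y)" using Nq[OF q(1)] by blast
   have "k * norm y < k * \<delta>" using q(2) Ny(2)[OF y(1)] y(2) k(2)[of y] by simp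
   then have "norm y < \<delta>" using k(1) by simp
   then have "X y \<in> ball x0 r1" using \<delta>(2)[of y] X(3) by (simp add: dist_commute)
   then show "q \<in> P'" using r1(2) XW(3)[OF y(1)] y(2) by blast
  qed
 qed
 have "lin_nbhd p0 N Ps"
  unfolding lin_nbhd_def using N p0N injPs sN confPs normPs flow small by blast
 then show ?thesis by blast
qed

end

context atlas
begin

lemma smooth_rep_continuous:
 assumes c: "c \<in> charts M" "p \<in> fst c" and u: "smooth_rep c u p W F"
 shows "topcontinuous_at (mtop M) euclidean u p"
 unfolding topcontinuous_at_def
proof (intro conjI allI impI)
 show "p \<in> topspace (mtop M)" using chart_subset[OF c(1)] c(2) by blast
 note F = smooth_repD[OF u]
 have val: "u q = F (snd c q)" if "q \<in> fst c" "snd c q \<in> W" for q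
  using F(5)[OF that(2)] chart_inv_left[OF c(1) that(1)] image_half[OF c(1)] chart_in_image[OF that(1)] by auto
 fix V assume V: "openin euclidean V \<and> u p \<in> V"
 have "open (W \<inter> F -` V)" using continuous_open_preimage[OF C_inf_on_continuous_on[OF F(3)] F(1)] V by auto
 then have "openin (mtop M) {q \<in> fst c. snd c q \<in> W \<inter> F -` V}" by (rule chart_preimage_open[OF c(1)])
 moreover have "p \<in> {q \<in> fst c. snd c q \<in> W \<inter> F -` V}" using val[OF c(2) F(2)] V c(2) F(2) by simp
 moreover have "\<forall>q\<in>{q \<in> fst c. snd c q \<in> W \<inter> F -` V}. u q \<in> V" using val by simp
 ultimately show "\<exists>U. openin (mtop M) U \<and> p \<in> U \<and> (\<forall>q\<in>U. u q \<in> V)" by blast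
qed simp

lemma smooth_rep_cong:
 assumes c: "c \<in> charts M" "p \<in> fst c" and u: "smooth_rep c u p W F"
  and N: "openin (mtop M) N" "p \<in> N" "\<And>q. q \<in> N \<Longrightarrow> u q = v q"
 obtains W' where "smooth_rep c v p W' F"
proof -
 note F = smooth_repD[OF u]
 obtain r where r: "r > 0" "\<And>x. x \<in> ball (snd c p) r \<Longrightarrow> x \<in> half_space \<Longrightarrow> x \<in> chart_image c \<and> chart_inv c x \<in> N"
  by (rule chart_nhd[OF c N(1,2)]) blast
 have "smooth_rep c v p (W \<inter> ball (snd c p) r) F"
  unfolding smooth_rep_def
 proof (intro conjI ballI)
  show "C_inf_on (W \<inter> ball (snd c p) r) F" by (rule C_inf_on_subset[OF F(3)]) blast
  fix y assume "y \<in> W \<inter> ball (snd c p) r \<inter> half_space"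
  then have y: "y \<in> W" "y \<in> ball (snd c p) r" "y \<in> half_space" by auto
  show "y \<in> chart_image c" "F y = v (chart_inv c y)" using r(2)[OF y(2,3)] F(5)[OF y(1,3)] N(3) by auto
 qed (use F r(1) in auto)
 then show ?thesis by (rule that)
qed

end

lemma exp_decay: "c > 0 \<Longrightarrow> (\<lambda>k. exp (- c * real k) * b) \<longlonglongrightarrow> 0"
proof -
 assume "c > 0"
 then have "(\<lambda>k. exp (- c) ^ k) \<longlonglongrightarrow> 0" by (intro LIMSEQ_realpow_zero) auto
 from tendsto_mult_left_zero[OF this, of b] show ?thesis by (simp add: exp_of_nat_mult[symmetric] mult.commute)
qed

section \<open>Basins of the maxima and their global coordinates\<close>

context obata_unit
begin

lemma conf_at_cong:
 assumes u: "conf_at u p" and N: "openin (mtop M) N" "p \<in> N" "\<And>q. q \<in> N \<Longrightarrow> u q = v q"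
 shows "conf_at v p"
 unfolding conf_at_def
proof (intro ballI impI)
 fix c assume c: "c \<in> charts M" "p \<in> fst c"
 then obtain W F where F: "smooth_rep c u p W F"
  "\<forall>v w. FD F (snd c p) v \<bullet> FD F (snd c p) w = metric M c p v w / (1 + s p)\<^sup>2"
  using u unfolding conf_at_def conf_rep_def by blast
 obtain W' where "smooth_rep c v p W' F" by (rule smooth_rep_cong[OF c F(1) N])
 then show "conf_rep c v p" unfolding conf_rep_def using F(2) by blast
qed

lemma phi_cont:
 assumes t: "t \<in> {0..2 * tau}"
 shows "continuous_map (mtop M) (mtop M) (phi t)"
 unfolding continuous_map_eq_topcontinuous_at topcontinuous_at_def
proof (intro ballI conjI allI impI funcsetI)
 show "phi t p \<in> topspace (mtop M)" if "p \<in> topspace (mtop M)" for p by (rule phi_in[OF that t])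
 fix p Q assume p: "p \<in> topspace (mtop M)" and Q: "openin (mtop M) Q \<and> phi t p \<in> Q"
 obtain c W G S V U a Y where F: "flowbox c W G S V U a Y" "p \<in> fst c" "snd c p \<in> U" "2 * tau < a"
  using flowbox_tau[OF p] by blast
 have c: "c \<in> charts M" and E: "obata_ext c W G S V" and U: "open U" and CY: "C_inf_on ({-a<..<a} \<times> U) Y"
  and YW: "\<And>x. x \<in> U \<Longrightarrow> Y (t, x) \<in> W" and Yh: "\<And>x. x \<in> U \<Longrightarrow> x \<in> half_space \<Longrightarrow> Y (t, x) \<in> half_space"
  using F(1,4) t unfolding flowbox_def by auto
 have ph: "phi t q = chart_inv c (Y (t, snd c q))" if "q \<in> fst c" "snd c q \<in> U" for q
  by (rule flowbox_phi(1)[OF F(1,4) that t])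
 have yi: "Y (t, snd c q) \<in> chart_image c" if "q \<in> fst c" "snd c q \<in> U" for q
  by (rule obata_ext_image[OF E YW[OF that(2)] Yh[OF that(2) chart_half[OF c that(1)]]])
 have y: "chart_inv c (Y (t, snd c p)) \<in> fst c" "snd c (chart_inv c (Y (t, snd c p))) = Y (t, snd c p)"
  by (rule chart_inv_in[OF yi[OF F(2,3)]], rule chart_inv_right[OF yi[OF F(2,3)]])
 have yQ: "chart_inv c (Y (t, snd c p)) \<in> Q" using conjunct2[OF Q] ph[OF F(2,3)] by simp
 obtain r where r: "r > 0" "\<And>x. x \<in> ball (Y (t, snd c p)) r \<Longrightarrow> x \<in> half_space \<Longrightarrow> x \<in> chart_image c \<and> chart_inv c x \<in> Q"
  by (rule chart_nhd[OF c y(1) conjunct1[OF Q] yQ, unfolded y(2)]) blast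
 have tin: "t \<in> {-a<..<a}" using t F(4) tau_pos by auto
 have "continuous_on U (\<lambda>x. Y (t, x))"
  by (rule continuous_on_compose2[OF C_inf_on_continuous_on[OF CY]]) (use tin in \<open>auto intro!: continuous_intros\<close>)
 then have "open (U \<inter> (\<lambda>x. Y (t, x)) -` ball (Y (t, snd c p)) r)" using continuous_open_preimage[OF _ U open_ball] by blast
 then have O: "openin (mtop M) {q \<in> fst c. snd c q \<in> U \<inter> (\<lambda>x. Y (t, x)) -` ball (Y (t, snd c p)) r}"
  by (rule chart_preimage_open[OF c])
 show "\<exists>T. openin (mtop M) T \<and> p \<in> T \<and> (\<forall>q\<in>T. phi t q \<in> Q)"
 proof (intro exI conjI ballI)
  show "openin (mtop M) {q \<in> fst c. snd c q \<in> U \<inter> (\<lambda>x. Y (t, x)) -` ball (Y (t, snd c p)) r}" by (rule O)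
  show "p \<in> {q \<in> fst c. snd c q \<in> U \<inter> (\<lambda>x. Y (t, x)) -` ball (Y (t, snd c p)) r}" using F r(1) by simp
  fix q assume "q \<in> {q \<in> fst c. snd c q \<in> U \<inter> (\<lambda>x. Y (t, x)) -` ball (Y (t, snd c p)) r}"
  then have q: "q \<in> fst c" "snd c q \<in> U" "Y (t, snd c q) \<in> ball (Y (t, snd c p)) r" by auto
  show "phi t q \<in> Q" using r(2)[OF q(3) Yh[OF q(2) chart_half[OF c q(1)]]] ph[OF q(1,2)] by simp
 qed
qed

lemma s_cont: "continuous_map (mtop M) euclideanreal s"
 unfolding continuous_map_eq_topcontinuous_at
proof
 fix p assume "p \<in> topspace (mtop M)"
 then obtain c where c: "c \<in> charts M" "p \<in> fst c" using chart_exists by blast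
 obtain W G S V where W: "snd c p \<in> W" and E: "obata_ext c W G S V" by (rule obata_ext_exists[OF c]) blast
 have "smooth_rep c s p W S"
  unfolding smooth_rep_def
  using obata_ext_open[OF E] W obata_ext_S[OF E] obata_ext_image[OF E] obata_ext_s[OF E] by auto
 then show "topcontinuous_at (mtop M) euclideanreal s p" by (rule smooth_rep_continuous[OF c])
qed

lemma s_gt_minus_one_open: "openin (mtop M) {x \<in> topspace (mtop M). s x > -1}"
 using openin_continuous_map_preimage[OF s_cont, of "{-1<..}"] by simp

abbreviation phi_iter :: "nat \<Rightarrow> 'p \<Rightarrow> 'p" where "phi_iter k \<equiv> phi tau ^^ k"

lemma tau_in: "tau \<in> {0..2 * tau}" "tau \<in> {0..tau}" using tau_pos by auto

lemma phi_iter_diff: "j \<le> k \<Longrightarrow> phi_iter k x = phi_iter (k - j) (phi_iter j x)"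
 using funpow_add[of "k - j" j "phi tau"] by simp

lemma phi_iter_in: "x \<in> topspace (mtop M) \<Longrightarrow> phi_iter k x \<in> topspace (mtop M)"
 by (induct k) (auto intro: phi_in tau_in)

lemma phi_iter_s:
 assumes "x \<in> topspace (mtop M)" "s x > -1"
 shows "s (phi_iter k x) > -1 \<and> q_fun (phi_iter k x) = exp (- 2 * tau * k) * q_fun x"
proof (induct k)
 case (Suc k)
 show ?case
  using s_phi[OF phi_iter_in[OF assms(1)], of k, OF _ tau_in(1)] Suc by (simp add: mult_exp_exp algebra_simps)
qed (use assms in simp)

lemma phi_iter_cont: "continuous_map (mtop M) (mtop M) (phi_iter k)"
proof (induct k)
 case (Suc k)
 show ?case using continuous_map_compose[OF Suc phi_cont[OF tau_in(1)]] by (simp add: o_def)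
qed (simp add: id_def)

lemma phi_iter_inj:
 "x \<in> topspace (mtop M) \<Longrightarrow> y \<in> topspace (mtop M) \<Longrightarrow> phi_iter k x = phi_iter k y \<Longrightarrow> x = y"
proof (induct k)
 case (Suc k)
 then show ?case using phi_inj[OF phi_iter_in phi_iter_in tau_in(1), of x y k k] by simp
qed simp

lemma conf_at_phi_iter:
 assumes "x \<in> topspace (mtop M)" "s x > -1" "conf_at u (phi_iter k x)"
 shows "conf_at (\<lambda>q. exp (tau * k) *\<^sub>R u (phi_iter k q)) x"
 using assms
proof (induct k arbitrary: x)
 case (Suc k)
 have "conf_at (\<lambda>q. exp (tau * k) *\<^sub>R u (phi_iter k q)) (phi tau x)"
  using Suc.hyps[of "phi tau x"] Suc.prems phi_in[OF _ tau_in(1)] s_phi(1)[OF _ _ tau_in(1)] by (simp add: funpow_swap1)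
 from conf_at_phi[OF Suc.prems(1,2) tau_in(1) this]
 show ?case by (simp add: funpow_swap1 mult_exp_exp algebra_simps)
qed simp

text \<open>Convergence is asked along the iterates of the map for time \<open>tau\<close> only, so
  the flow need not be assembled for all positive times.\<close>

definition basin :: "'p \<Rightarrow> 'p set" where
 "basin p0 = {x \<in> topspace (mtop M). s x > -1 \<and> limitin (mtop M) (\<lambda>k. phi_iter k x) p0 sequentially}"

lemma basin_disjoint: "x \<in> basin p \<Longrightarrow> x \<in> basin q \<Longrightarrow> p = q"
 using limitin_Hausdorff_unique rm unfolding basin_def riemannian_manifold_def smooth_manifold_def
 by (metis (mono_tags, lifting) mem_Collect_eq trivial_limit_sequentially)

lemma lin_nbhd_iter:
 assumes N: "lin_nbhd p0 N Ps" and y: "y \<in> N"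
 shows "phi_iter j y \<in> N \<and> Ps (phi_iter j y) = exp (- tau * j) *\<^sub>R Ps y"
proof (induct j)
 case (Suc j)
 then have "phi tau (phi_iter j y) \<in> N \<and> Ps (phi tau (phi_iter j y)) = exp (- tau) *\<^sub>R Ps (phi_iter j y)"
  using N tau_in(1) unfolding lin_nbhd_def by blast
 then show ?case using Suc by (simp add: mult_exp_exp algebra_simps)
qed (use y in simp)

text \<open>A single visit to N suffices: N is invariant, and Ps decays along the orbit.\<close>

lemma basin_iff:
 assumes N: "lin_nbhd p0 N Ps"
 shows "x \<in> basin p0 \<longleftrightarrow> x \<in> topspace (mtop M) \<and> s x > -1 \<and> (\<exists>k. phi_iter k x \<in> N)"
proof (intro iffI)
 assume "x \<in> basin p0"
 then show "x \<in> topspace (mtop M) \<and> s x > -1 \<and> (\<exists>k. phi_iter k x \<in> N)"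
  using N unfolding basin_def limitin_sequentially lin_nbhd_def by blast
next
 assume x: "x \<in> topspace (mtop M) \<and> s x > -1 \<and> (\<exists>k. phi_iter k x \<in> N)"
 then obtain k where k: "phi_iter k x \<in> N" by blast
 have p0: "p0 \<in> topspace (mtop M)" using N openin_subset unfolding lin_nbhd_def by blast
 have "limitin (mtop M) (\<lambda>k. phi_iter k x) p0 sequentially"
  unfolding limitin_sequentially
 proof (intro conjI allI impI p0)
  fix P assume P: "openin (mtop M) P \<and> p0 \<in> P"
  then obtain e where e: "e > 0" "\<And>q. q \<in> N \<Longrightarrow> norm (Ps q) < e \<Longrightarrow> q \<in> P"
   using conjunct2[OF conjunct2[OF conjunct2[OF conjunct2[OF N[unfolded lin_nbhd_def]]]]] by meson
  have "(\<lambda>j. exp (- tau * real j) * norm (Ps (phi_iter k x))) \<longlonglongrightarrow> 0"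
   by (rule exp_decay[OF tau_pos])
  from order_tendstoD(2)[OF this e(1)]
  obtain J where J: "\<And>j. j \<ge> J \<Longrightarrow> exp (- tau * real j) * norm (Ps (phi_iter k x)) < e" unfolding eventually_sequentially by blast
  have "phi_iter n x \<in> P" if n: "n \<ge> J + k" for n
  proof -
   have eq: "phi_iter n x = phi_iter (n - k) (phi_iter k x)" by (rule phi_iter_diff) (use n in simp)
   show ?thesis unfolding eq by (rule e(2)) (use lin_nbhd_iter[OF N k, of "n - k"] J[of "n - k"] n in auto)
  qed
  then show "\<exists>J. \<forall>n\<ge>J. phi_iter n x \<in> P" by blast
 qed
 then show "x \<in> basin p0" using x unfolding basin_def by blast
qed

lemma basin_open:
 assumes p0: "p0 \<in> topspace (mtop M)" "s p0 = 1"
 shows "openin (mtop M) (basin p0)"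
proof -
 obtain N Ps where N: "lin_nbhd p0 N Ps" using lin_nbhd_exists[OF p0] by blast
 have "openin (mtop M) {x \<in> topspace (mtop M). phi_iter k x \<in> N}" for k
  using openin_continuous_map_preimage[OF phi_iter_cont] N unfolding lin_nbhd_def by blast
 then have "openin (mtop M) ({x \<in> topspace (mtop M). s x > -1} \<inter> (\<Union>k. {x \<in> topspace (mtop M). phi_iter k x \<in> N}))"
  by (intro openin_Int s_gt_minus_one_open openin_Union) auto
 moreover have "basin p0 = {x \<in> topspace (mtop M). s x > -1} \<inter> (\<Union>k. {x \<in> topspace (mtop M). phi_iter k x \<in> N})"
  by (auto simp: basin_iff[OF N])
 ultimately show ?thesis by simp
qed

text \<open>Outside the linearising neighbourhoods of all maxima s has, by compactness, a bound m <
  1. An orbit cannot stay there, since \<open>q_fun\<close> decays to 0 along it and dominates (1 -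
  s) / 2.\<close>

lemma basin_cover:
 assumes x: "x \<in> topspace (mtop M)" "s x > -1"
 obtains p0 where "p0 \<in> topspace (mtop M)" "s p0 = 1" "x \<in> basin p0"
proof -
 define NN where "NN = \<Union> {N. \<exists>p0 Ps. p0 \<in> topspace (mtop M) \<and> s p0 = 1 \<and> lin_nbhd p0 N Ps}"
 have "openin (mtop M) NN" unfolding NN_def lin_nbhd_def by (intro openin_Union) auto
 then have "closedin (mtop M) (topspace (mtop M) - NN)" by blast
 then have "compactin (mtop M) (topspace (mtop M) - NN)" by (rule closedin_compact_space[OF comp])
 then have K: "compact (s ` (topspace (mtop M) - NN))" using image_compactin[OF _ s_cont] by simp
 have lt: "s p < 1" if "p \<in> topspace (mtop M) - NN" for p
 proof (rule ccontr)
  assume "\<not> s p < 1"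
  then have p: "s p = 1" "p \<in> topspace (mtop M)" "p \<notin> NN" using s_le_1(1)[of p] that by auto
  obtain N Ps where N: "lin_nbhd p N Ps" using lin_nbhd_exists[OF p(2,1)] by blast
  then have "p \<in> N" unfolding lin_nbhd_def by blast
  then show False using N p unfolding NN_def by blast
 qed
 have "\<exists>k. phi_iter k x \<in> NN"
 proof (rule ccontr)
  assume "\<nexists>k. phi_iter k x \<in> NN"
  then have no: "phi_iter k x \<in> topspace (mtop M) - NN" for k using phi_iter_in[OF x(1)] by blast
  obtain m where m: "m \<in> s ` (topspace (mtop M) - NN)" "\<And>p. p \<in> topspace (mtop M) - NN \<Longrightarrow> s p \<le> m"
   using compact_attains_sup[OF K] no by blast
  have m1: "m < 1" using m(1) lt by auto
  have "(\<lambda>k. exp (- 2 * tau * real k) * q_fun x) \<longlonglongrightarrow> 0" using exp_decay[of "2 * tau" "q_fun x"] tau_pos by simp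
  from order_tendstoD(2)[OF this, of "(1 - m) / 2"] m1
  obtain k where k: "exp (- 2 * tau * real k) * q_fun x < (1 - m) / 2"
   unfolding eventually_sequentially by (meson half_gt_zero diff_gt_0_iff_gt order_refl)
  have "s (phi_iter k x) \<le> m" "s (phi_iter k x) > -1" "s (phi_iter k x) < 1" using m(2) no phi_iter_s[OF x] lt by auto
  moreover have "(1 - s (phi_iter k x)) / (1 + s (phi_iter k x)) < (1 - m) / 2" using k phi_iter_s[OF x, of k] by (simp add: q_fun_def)
  moreover have "(1 - s (phi_iter k x)) / 2 \<le> (1 - s (phi_iter k x)) / (1 + s (phi_iter k x))"
   using \<open>s (phi_iter k x) > -1\<close> \<open>s (phi_iter k x) < 1\<close> by (intro divide_left_mono) auto
  ultimately show False by simp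
 qed
 then obtain k p0 N Ps where "p0 \<in> topspace (mtop M)" "s p0 = 1" "lin_nbhd p0 N Ps" "phi_iter k x \<in> N"
  unfolding NN_def by blast
 then show ?thesis using that basin_iff x by blast
qed

text \<open>The usual globalisation of a linearising coordinate: flow into N and undo the
  contraction by the factor exp (tau k). The result does not depend on k, because Ps turns the flow
  into multiplication by exp (- t). Injectivity follows by bringing two points into N with a common
  k.\<close>

lemma basin_coordinates:
 assumes p0: "p0 \<in> topspace (mtop M)" "s p0 = 1"
 obtains Psi where "inj_on Psi (basin p0)" "\<And>x. x \<in> basin p0 \<Longrightarrow> conf_at Psi x"
  "\<And>x. x \<in> basin p0 \<Longrightarrow> (norm (Psi x))\<^sup>2 = q_fun x"
  "\<And>x t. x \<in> basin p0 \<Longrightarrow> t \<in> {0..tau} \<Longrightarrow> phi t x \<in> basin p0 \<and> Psi (phi t x) = exp (- t) *\<^sub>R Psi x"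
proof -
 obtain N Ps where N: "lin_nbhd p0 N Ps" using lin_nbhd_exists[OF p0] by blast
 note ND = N[unfolded lin_nbhd_def]
 define Psi where "Psi x = (let k = LEAST k. phi_iter k x \<in> N in exp (tau * k) *\<^sub>R Ps (phi_iter k x))" for x
 have Psi: "Psi x = exp (tau * k) *\<^sub>R Ps (phi_iter k x)" if k: "phi_iter k x \<in> N" for k x
 proof -
  define j where "j = (LEAST k. phi_iter k x \<in> N)"
  have j: "phi_iter j x \<in> N" "j \<le> k" unfolding j_def using k by (auto intro: LeastI Least_le)
  have "phi_iter k x = phi_iter (k - j) (phi_iter j x)" using j(2) by (simp add: phi_iter_diff)
  then have "Ps (phi_iter k x) = exp (- tau * real (k - j)) *\<^sub>R Ps (phi_iter j x)" using lin_nbhd_iter[OF N j(1), of "k - j"] by simp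
  then show ?thesis using j(2) unfolding Psi_def j_def[symmetric] Let_def by (simp add: mult_exp_exp algebra_simps of_nat_diff)
 qed
 have up: "phi_iter (k + j) x \<in> N" if "phi_iter k x \<in> N" for k j x
  using lin_nbhd_iter[OF N that, of j] by (simp add: funpow_add add.commute[of k])
 show ?thesis
 proof (rule that[of Psi])
  show "inj_on Psi (basin p0)"
  proof (rule inj_onI)
   fix x y assume xy: "x \<in> basin p0" "y \<in> basin p0" "Psi x = Psi y"
   then obtain j k where "phi_iter j x \<in> N" "phi_iter k y \<in> N" using basin_iff[OF N] by blast
   then have jk: "phi_iter (j + k) x \<in> N" "phi_iter (j + k) y \<in> N" using up[of j x k] up[of k y j] by (simp_all add: add.commute)
   then have "Ps (phi_iter (j + k) x) = Ps (phi_iter (j + k) y)" using Psi xy(3) by simp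
   then have "phi_iter (j + k) x = phi_iter (j + k) y" using ND jk inj_onD by metis
   then show "x = y" using phi_iter_inj xy basin_iff[OF N] by blast
  qed
  fix x assume "x \<in> basin p0"
  then obtain k where x: "x \<in> topspace (mtop M)" "s x > -1" "phi_iter k x \<in> N" using basin_iff[OF N] by blast
  show "conf_at Psi x"
  proof (rule conf_at_cong[OF conf_at_phi_iter[OF x(1,2)]])
   show "conf_at Ps (phi_iter k x)" using ND x(3) by blast
   show "openin (mtop M) {x \<in> topspace (mtop M). phi_iter k x \<in> N}"
    using openin_continuous_map_preimage[OF phi_iter_cont] ND by blast
  qed (use x Psi in auto)
  have "(norm (Psi x))\<^sup>2 = (exp (tau * k))\<^sup>2 * q_fun (phi_iter k x)" using Psi[OF x(3)] ND x(3) by (simp add: power_mult_distrib)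
  then show "(norm (Psi x))\<^sup>2 = q_fun x" using phi_iter_s[OF x(1,2), of k] by (simp add: power2_eq_square mult_exp_exp flip: exp_add mult.assoc)
  fix t assume t: "t \<in> {0..tau}"
  then have t2: "t \<in> {0..2 * tau}" by auto
  \<comment> \<open>The iterates commute with \<open>phi t\<close>, because both orders add up to
    the same flow time.\<close>
  have com: "phi_iter k (phi t x) = phi t (phi_iter k x)" for k
  proof (induct k)
   case (Suc k)
   show ?case using Suc phi_add[OF phi_iter_in[OF x(1)] tau_in(2) t, of k] phi_add[OF phi_iter_in[OF x(1)] t tau_in(2), of k]
    by (simp add: add.commute)
  qed simp
  have k: "phi_iter k (phi t x) \<in> N" "Ps (phi_iter k (phi t x)) = exp (- t) *\<^sub>R Ps (phi_iter k x)"
   unfolding com using ND x(3) t2 by blast+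
  show "phi t x \<in> basin p0 \<and> Psi (phi t x) = exp (- t) *\<^sub>R Psi x"
   using k Psi[OF k(1)] Psi[OF x(3)] basin_iff[OF N] phi_in[OF x(1) t2] s_phi(1)[OF x(1,2) t2] by auto
 qed
qed

end

text \<open>The implicit function theorem for \<open>\<beta> (y / m) = 0\<close>, solved for \<open>m\<close>.\<close>

lemma implicit_radial:
 fixes \<beta> :: "'a::euclidean_space \<Rightarrow> real"
 assumes V: "open V" "y0 \<in> V" and C: "C_inf_on V \<beta>"
  and d: "(\<beta> has_derivative (\<lambda>h. - a * (n \<bullet> h))) (at y0)"
  and a: "a > 0" and n: "n \<bullet> y0 = 1" and b0: "\<beta> y0 = 0"
 obtains m N where "open N" "y0 \<in> N" "(m has_derivative (\<lambda>h. n \<bullet> h)) (at y0)" "m y0 = 1"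
  "\<And>y. y \<in> N \<Longrightarrow> m y > 0 \<and> (1 / m y) *\<^sub>R y \<in> V \<and> \<beta> ((1 / m y) *\<^sub>R y) = 0"
proof -
 define D where "D = ({0<..} \<times> UNIV) \<inter> (\<lambda>q. inverse (fst q) *\<^sub>R snd q) -` V"
 define \<Phi> where "\<Phi> q = (\<beta> (inverse (fst q) *\<^sub>R snd q), snd q)" for q
 have P: "open ({0<..} \<times> UNIV :: (real \<times> 'a) set)" by (intro open_Times) auto
 have r: "C_inf_on ({0<..} \<times> UNIV) (\<lambda>q::real \<times> 'a. inverse (fst q) *\<^sub>R snd q)"
  by (intro C_inf_on_scaleR C_inf_on_inverse C_inf_on_fst C_inf_on_snd C_inf_on_ident P) auto
 have D: "open D" unfolding D_def by (rule continuous_open_preimage[OF C_inf_on_continuous_on[OF r] P V(1)])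
 have C\<Phi>: "C_inf_on D \<Phi>" unfolding \<Phi>_def[abs_def]
  by (intro C_inf_on_Pair C_inf_on_compose[OF D V(1) C_inf_on_subset[OF r] C] C_inf_on_snd C_inf_on_ident D) (auto simp: D_def)
 have p: "(1, y0) \<in> D" using V(2) by (simp add: D_def)
 have "((\<lambda>q::real \<times> 'a. inverse (fst q) *\<^sub>R snd q) has_derivative (\<lambda>h. snd h - fst h *\<^sub>R y0)) (at (1, y0))"
  by (auto intro!: derivative_eq_intros)
 from has_derivative_compose[OF this, of \<beta>] d
 have "((\<lambda>q. \<beta> (inverse (fst q) *\<^sub>R snd q)) has_derivative (\<lambda>h. - a * (n \<bullet> (snd h - fst h *\<^sub>R y0)))) (at (1, y0))" by simp
 from has_derivative_Pair[OF this bounded_linear_imp_has_derivative[OF bounded_linear_snd]]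
 have "FD \<Phi> (1, y0) = (\<lambda>h. (- a * (n \<bullet> (snd h - fst h *\<^sub>R y0)), snd h))"
  unfolding \<Phi>_def[abs_def] by (rule frechet_derivative_at[symmetric])
 \<comment> \<open>Injective because n . y0 = 1: the level set of \<beta> is transversal to the ray
   through y0.\<close>
 then have "inj (FD \<Phi> (1, y0))" using a n by (auto intro!: injI prod_eqI simp: inner_diff_right)
 from smooth_inverse_function[OF D C\<Phi> p this]
 obtain U H where U: "(1, y0) \<in> U" "U \<subseteq> D" "open (\<Phi> ` U)" "C_inf_on (\<Phi> ` U) H" "\<And>q. q \<in> U \<Longrightarrow> H (\<Phi> q) = q" by metis
 define N where "N = {y. (0, y) \<in> \<Phi> ` U}"
 define m where "m y = fst (H (0, y))" for y
 have N: "open N" unfolding N_def using continuous_open_vimage[OF U(3), of "Pair 0"] by (simp add: vimage_def)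
 have \<Phi>0: "\<Phi> (1, y0) = (0, y0)" using b0 by (simp add: \<Phi>_def)
 then have y0: "y0 \<in> N" and m0: "m y0 = 1" using U(1) U(5)[OF U(1)] by (force simp: N_def, simp add: m_def)
 have mN: "m y > 0 \<and> (1 / m y) *\<^sub>R y \<in> V \<and> \<beta> ((1 / m y) *\<^sub>R y) = 0" if y: "y \<in> N" for y
 proof -
  obtain q where q: "q \<in> U" "\<Phi> q = (0, y)" using y by (force simp: N_def)
  then have "m y = fst q" "snd q = y" using U(5)[OF q(1)] by (auto simp: m_def \<Phi>_def)
  then show ?thesis using q U(2) by (auto simp: \<Phi>_def D_def divide_inverse)
 qed
 have "C_inf_on N m" unfolding m_def
  by (intro C_inf_on_fst N C_inf_on_compose[OF N U(3) _ U(4)] C_inf_on_Pair C_inf_on_const C_inf_on_ident) (auto simp: N_def)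
 from C_inf_on_has_derivative[OF this y0] have dm: "(m has_derivative FD m y0) (at y0)" .
 have "((\<lambda>y. (1 / m y) *\<^sub>R y) has_derivative (\<lambda>h. h - FD m y0 h *\<^sub>R y0)) (at y0)"
  by (auto intro!: derivative_eq_intros dm simp: m0)
 from has_derivative_compose[OF this, of \<beta>] d
 have "((\<lambda>y. \<beta> ((1 / m y) *\<^sub>R y)) has_derivative (\<lambda>h. - a * (n \<bullet> (h - FD m y0 h *\<^sub>R y0)))) (at y0)" by (simp add: m0)
 then have "((\<lambda>y. 0) has_derivative (\<lambda>h. - a * (n \<bullet> (h - FD m y0 h *\<^sub>R y0)))) (at y0)"
  by (rule has_derivative_transform_within_open[OF _ N y0]) (use mN in auto)
 from fun_cong[OF has_derivative_unique[OF this has_derivative_const]]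
 have "FD m y0 h = n \<bullet> h" for h using a n by (simp add: inner_diff_right)
 then have "FD m y0 = (\<lambda>h. n \<bullet> h)" by auto
 then show ?thesis using that[OF N y0 _ m0 mN] dm by simp
qed

section \<open>The image of the boundary in the linearising coordinate\<close>

context obata_unit
begin

text \<open>At s = 1 or s = -1 the energy identity would force \<open>grd\<close> to vanish, but on
  the boundary it points outwards.\<close>

lemma boundary_s:
 assumes "p \<in> boundary M"
 shows "-1 < s p" "s p < 1"
proof -
 have "p \<in> topspace (mtop M)" using assms by (simp add: boundary_def)
 then obtain c where c: "c \<in> charts M" "p \<in> fst c" using chart_exists by blast
 have "grd c p \<noteq> 0" using grd_outward[OF c assms] by auto
 then have "(s p)\<^sup>2 < 1" using metric_pos[OF c] energy[OF c] by (smt (verit))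
 then show "-1 < s p" "s p < 1" by (simp_all add: abs_square_less_1)
qed

lemma boundary_closed: "closedin (mtop M) (boundary M)"
proof -
 have "openin (mtop M) (topspace (mtop M) - boundary M)"
  unfolding openin_subopen[of _ "topspace (mtop M) - boundary M"]
 proof (intro ballI)
  fix p assume p: "p \<in> topspace (mtop M) - boundary M"
  then obtain c where c: "c \<in> charts M" "p \<in> fst c" using chart_exists by blast
  have "open {x::'a. 0 < x \<bullet> inward}" by (intro open_Collect_less continuous_intros)
  from chart_preimage_open[OF c(1) this] have O: "openin (mtop M) {q \<in> fst c. snd c q \<in> {x. 0 < x \<bullet> inward}}" .
  have "0 < snd c p \<bullet> inward" using p boundary_iff[OF c] chart_half[OF c] by (force simp: half_space_def)
  then show "\<exists>T. openin (mtop M) T \<and> p \<in> T \<and> T \<subseteq> topspace (mtop M) - boundary M"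
   using O c boundary_iff[OF c(1)] chart_subset[OF c(1)] by (intro exI[of _ "{q \<in> fst c. snd c q \<in> {x. 0 < x \<bullet> inward}}"]) auto
 qed
 then show ?thesis by (auto simp: closedin_def boundary_def)
qed

end

text \<open>The basin is chosen to contain a boundary point b0; this keeps \<open>exits\<close> from
  being empty and starts the connectedness arguments below.\<close>

locale obata_basin = obata_unit M s A for M :: "('p, 'a::euclidean_space) riemannian" and s A +
 fixes p0 :: 'p and Psi :: "'p \<Rightarrow> 'a" and b0 :: 'p
 assumes p0: "p0 \<in> topspace (mtop M)" "s p0 = 1" and b0: "b0 \<in> boundary M" "b0 \<in> basin p0"
  and Psi_inj: "inj_on Psi (basin p0)" and Psi_conf: "\<And>x. x \<in> basin p0 \<Longrightarrow> conf_at Psi x"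
  and Psi_norm: "\<And>x. x \<in> basin p0 \<Longrightarrow> (norm (Psi x))\<^sup>2 = q_fun x"
  and Psi_phi: "\<And>x t. x \<in> basin p0 \<Longrightarrow> t \<in> {0..tau} \<Longrightarrow> phi t x \<in> basin p0 \<and> Psi (phi t x) = exp (- t) *\<^sub>R Psi x"
begin

text \<open>Named after its role: rays from the origin leave the image of the basin at these
  points.\<close>

definition exits :: "'a set" where "exits = Psi ` (boundary M \<inter> basin p0)"

text \<open>Differentiate Psi (phi t x) = exp (- t) Psi x at t = 0. The derivative is one-sided,
  since the flow exists in forward time only.\<close>

lemma Psi_grd:
 assumes x: "x \<in> basin p0" and c: "c \<in> charts M" "x \<in> fst c" and F: "smooth_rep c Psi x W F"
 shows "FD F (snd c x) (grd c x) = Psi x"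
proof -
 note r = smooth_repD[OF F]
 have xM: "x \<in> topspace (mtop M)" using x by (simp add: basin_def)
 have bc: "bcurve (\<lambda>t. phi t x) (2 * tau)" by (rule phi_bcurve[OF xM])
 have z: "(0::real) \<in> {0..2 * tau}" using tau_pos by auto
 have "openin (mtop M) {q \<in> fst c. snd c q \<in> W}" by (rule chart_preimage_open[OF c(1) r(1)])
 moreover have "phi 0 x \<in> {q \<in> fst c. snd c q \<in> W}" using phi_0[OF xM] c r(2) by simp
 ultimately obtain e where e: "e > 0" "\<And>r. r \<in> {0..2 * tau} \<Longrightarrow> \<bar>r - 0\<bar> < e \<Longrightarrow> phi r x \<in> {q \<in> fst c. snd c q \<in> W}"
  by (rule bcurve_near[OF conjunct1[OF bc[unfolded bcurve_def]] z]) blast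
 define a where "a = min (e / 2) tau"
 have a: "a > 0" "a \<le> tau" "a < e" using e(1) tau_pos by (auto simp: a_def)
 have "phi 0 x \<in> fst c" using c phi_0[OF xM] by simp
 then have "((\<lambda>r. snd c (phi r x)) has_vector_derivative - grd c (phi 0 x)) (at 0 within {0..2 * tau})"
  by (rule conjunct2[OF bc[unfolded bcurve_def], rule_format, OF z c(1)])
 then have d: "((\<lambda>r. snd c (phi r x)) has_vector_derivative - grd c x) (at 0 within {0..a})"
  unfolding phi_0[OF xM] by (rule has_vector_derivative_within_subset) (use a tau_pos in auto)
 have "(F has_derivative FD F (snd c x)) (at (snd c (phi 0 x)))"
  unfolding phi_0[OF xM] by (rule C_inf_on_has_derivative[OF r(3,2)])
 from has_vector_derivative_chain[where f=F and p="\<lambda>r. snd c (phi r x)", OF this d]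
 have 1: "((\<lambda>r. F (snd c (phi r x))) has_vector_derivative FD F (snd c x) (- grd c x)) (at 0 within {0..a})" .
 have "F (snd c (phi t x)) = exp (- t) *\<^sub>R Psi x" if t: "t \<in> {0..a}" for t
 proof -
  have "phi t x \<in> fst c" "snd c (phi t x) \<in> W" using e(2)[of t] t a by auto
  then have "F (snd c (phi t x)) = Psi (phi t x)" using r(5) chart_half[OF c(1)] chart_inv_left[OF c(1)] by simp
  then show ?thesis using Psi_phi[OF x, of t] t a by simp
 qed
 then have 2: "((\<lambda>t. exp (- t) *\<^sub>R Psi x) has_vector_derivative FD F (snd c x) (- grd c x)) (at 0 within {0..a})"
  using has_vector_derivative_transform[OF _ _ 1] a by auto
 have 3: "((\<lambda>t. exp (- t) *\<^sub>R Psi x) has_vector_derivative - Psi x) (at 0 within {0..a})"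
  by (auto intro!: derivative_eq_intros)
 have "FD F (snd c x) (- grd c x) = - Psi x"
  by (rule vector_derivative_unique_within_closed_interval[OF _ _ 2[unfolded interval_cbox] 3[unfolded interval_cbox]]) (use a in auto)
 moreover have "linear (FD F (snd c x))" using C_inf_on_has_derivative[OF r(3,2)] has_derivative_linear by blast
 ultimately show ?thesis by (simp add: linear_neg)
qed

text \<open>n is the Euclidean outward normal of the image hypersurface, scaled so that n . y0 = 1,
  and hence the differential of the local gauge m. Conformality gives the image of the unit normal
  the length 1 / (1 + s), and the normal derivative 1/A fixes the factor A (1 + s)^2; so |n| = A (1
  + s) = 2 A / (1 + |y0|^2). In this way the boundary condition becomes an equation for the
  gauge.\<close>

lemma exits_local:
 assumes y0: "y0 \<in> exits"
 shows "\<exists>n. norm n = 2 * A / (1 + (norm y0)\<^sup>2) \<and> n \<bullet> y0 = 1 \<and>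
  (\<exists>m N. open N \<and> y0 \<in> N \<and> (m has_derivative (\<lambda>h. n \<bullet> h)) (at y0) \<and> m y0 = 1 \<and>
   (\<forall>y\<in>N. m y > 0 \<and> (1 / m y) *\<^sub>R y \<in> exits))"
proof -
 obtain b where b: "b \<in> boundary M" "b \<in> basin p0" "y0 = Psi b" using y0 unfolding exits_def by blast
 have bM: "b \<in> topspace (mtop M)" using b(2) by (simp add: basin_def)
 obtain c where c: "c \<in> charts M" "b \<in> fst c" using chart_exists[OF bM] by blast
 define x0 where "x0 = snd c b"
 obtain W F where F: "smooth_rep c Psi b W F"
  and conf: "\<And>v w. FD F x0 v \<bullet> FD F x0 w = metric M c b v w / (1 + s b)\<^sup>2"
  using Psi_conf[OF b(2)] c unfolding conf_at_def conf_rep_def x0_def by blast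
 note r = smooth_repD[OF F, folded x0_def]
 have s1: "1 + s b > 0" "s b < 1" using boundary_s[OF b(1)] by auto
 have xh: "x0 \<in> half_space" unfolding x0_def by (rule chart_half[OF c])
 have Fx: "F x0 = y0" using r(5)[OF r(2) xh] chart_inv_left[OF c] b(3) by (simp add: x0_def)
 have dF: "(F has_derivative FD F x0) (at x0)" by (rule C_inf_on_has_derivative[OF r(3,2)])
 then have linF: "linear (FD F x0)" by (rule has_derivative_linear)
 have injF: "inj (FD F x0)"
  unfolding linear_injective_0[OF linF]
 proof (intro allI impI)
  fix v assume "FD F x0 v = 0"
  then have "metric M c b v v = 0" using conf[of v v] s1 by simp
  then show "v = 0" using metric_pos[OF c] by force
 qed
 then have surjF: "surj (FD F x0)" using linF linear_injective_imp_surjective by blast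
 from smooth_inverse_function[OF r(1,3,2) injF]
 obtain U H where U: "open U" "x0 \<in> U" "U \<subseteq> W" "inj_on F U" "open (F ` U)" "C_inf_on (F ` U) H"
  "\<And>x. x \<in> U \<Longrightarrow> H (F x) = x" by metis
 obtain \<rho> where \<rho>: "\<rho> > 0" "\<And>x. x \<in> ball x0 \<rho> \<Longrightarrow> x \<in> half_space \<Longrightarrow> x \<in> chart_image c \<and> chart_inv c x \<in> basin p0"
  unfolding x0_def by (rule chart_nhd[OF c basin_open[OF p0] b(2)]) blast
 \<comment> \<open>Small enough that every zero in V of the boundary defining function H z . inward
   is the image of a boundary point in the basin.\<close>
 define V where "V = F ` U \<inter> H -` ball x0 \<rho>"
 have contH: "continuous_on (F ` U) H" by (rule C_inf_on_continuous_on[OF U(6)])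
 have V: "open V" unfolding V_def by (rule continuous_open_preimage[OF contH U(5) open_ball])
 have yU: "y0 \<in> F ` U" using U(2) Fx by blast
 have Hy: "H y0 = x0" using U(7)[OF U(2)] Fx by simp
 have yV: "y0 \<in> V" using yU Hy \<rho>(1) by (simp add: V_def)
 have exitV: "z \<in> exits" if z: "z \<in> V" "H z \<bullet> inward = 0" for z
 proof -
  obtain x where x: "x \<in> U" "z = F x" "x \<in> ball x0 \<rho>" "x \<bullet> inward = 0" using z U(7) by (auto simp: V_def)
  have xh: "x \<in> half_space" using x(4) by (simp add: half_space_def)
  have q: "x \<in> chart_image c" "chart_inv c x \<in> basin p0" using \<rho>(2)[OF x(3) xh] by auto
  have "chart_inv c x \<in> boundary M"
   using boundary_iff[OF c(1) chart_inv_in[OF q(1)]] chart_inv_right[OF q(1)] x(4) by simp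
  moreover have "z = Psi (chart_inv c x)" using r(5) x U(3) xh by blast
  ultimately show ?thesis using q unfolding exits_def by blast
 qed
 obtain N where N: "metric M c b N N = 1" "\<And>v. v \<bullet> inward = 0 \<Longrightarrow> metric M c b N v = 0" "N \<bullet> inward < 0"
  by (rule normal_exists[OF c]) blast
 define n where "n = (A * (1 + s b)\<^sup>2) *\<^sub>R FD F x0 N"
 have dH: "(H has_derivative FD H y0) (at y0)" by (rule C_inf_on_has_derivative[OF U(6) yU])
 have HF: "FD H y0 (FD F x0 v) = v" for v
 proof -
  have "((\<lambda>x. H (F x)) has_derivative (\<lambda>v. FD H y0 (FD F x0 v))) (at x0)"
   by (rule has_derivative_compose[OF dF]) (use dH Fx in simp)
  then have "((\<lambda>x. x) has_derivative (\<lambda>v. FD H y0 (FD F x0 v))) (at x0)"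
   by (rule has_derivative_transform_within_open[OF _ U(1,2)]) (rule U(7))
  from fun_cong[OF has_derivative_unique[OF this has_derivative_ident]] show ?thesis .
 qed
 \<comment> \<open>Both functionals vanish on images of tangential vectors, so they are compared on
   N. The factor is negative, as Psi maps the outward side to growing n . h.\<close>
 have dH_eq: "FD H y0 h \<bullet> inward = - (- (N \<bullet> inward) / A) * (n \<bullet> h)" for h
 proof -
  obtain v where v: "h = FD F x0 v" using surjF by (metis surjD)
  define k where "k = (v \<bullet> inward) / (N \<bullet> inward)"
  have vk: "v \<bullet> inward = k * (N \<bullet> inward)" using N(3) by (simp add: k_def)
  note bil = metric_bilinear[OF c]
  have "metric M c b N (v - k *\<^sub>R N) = 0" by (rule N(2)) (simp add: inner_diff_left vk)
  then have "metric M c b N v = k" using N(1) by (simp add: bilinear_rsub[OF bil] bilinear_rmul[OF bil])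
  then have "n \<bullet> h = A * k" using conf[of N v] s1 by (simp add: n_def v)
  then show ?thesis using HF[of v] vk A_pos by (simp add: v)
 qed
 have d\<beta>: "((\<lambda>z. H z \<bullet> inward) has_derivative (\<lambda>h. - (- (N \<bullet> inward) / A) * (n \<bullet> h))) (at y0)"
  using has_derivative_inner_left[OF dH, of inward] unfolding dH_eq .
 have C\<beta>: "C_inf_on V (\<lambda>z. H z \<bullet> inward)"
  by (intro C_inf_on_inner V C_inf_on_const C_inf_on_subset[OF U(6)]) (auto simp: V_def)
 have ny: "n \<bullet> y0 = 1"
 proof -
  have "y0 = FD F x0 (grd c b)" using Psi_grd[OF b(2) c F] b(3) by (simp add: x0_def)
  then have "n \<bullet> y0 = A * metric M c b N (grd c b)" using conf[of N "grd c b"] s1 by (simp add: n_def)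
  also have "metric M c b N (grd c b) = 1 / A"
   using normal[OF c b(1) N] metric_sym[OF c, of N "grd c b"] by simp
  finally show ?thesis using A_pos by simp
 qed
 have nn: "norm n = 2 * A / (1 + (norm y0)\<^sup>2)"
 proof -
  have "(norm (FD F x0 N))\<^sup>2 = (1 / (1 + s b))\<^sup>2"
   using conf[of N N] N(1) by (simp add: power2_norm_eq_inner power_one_over)
  then have "norm (FD F x0 N) = 1 / (1 + s b)" using s1 by (simp add: power2_eq_iff_nonneg)
  then have 1: "norm n = A * (1 + s b)" using A_pos s1 by (simp add: n_def power2_eq_square)
  have "1 + (norm y0)\<^sup>2 = 2 / (1 + s b)" using Psi_norm[OF b(2)] b(3) s1 by (simp add: q_fun_def field_simps)
  then show ?thesis using 1 by simp
 qed
 have Hy0: "H y0 \<bullet> inward = 0" using Hy boundary_iff[OF c] b(1) by (simp add: x0_def)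
 have a: "- (N \<bullet> inward) / A > 0" using N(3) A_pos by (simp add: divide_neg_pos)
 obtain m Z where m: "open Z" "y0 \<in> Z" "(m has_derivative (\<lambda>h. n \<bullet> h)) (at y0)" "m y0 = 1"
  "\<And>y. y \<in> Z \<Longrightarrow> m y > 0 \<and> (1 / m y) *\<^sub>R y \<in> V \<and> H ((1 / m y) *\<^sub>R y) \<bullet> inward = 0"
  by (rule implicit_radial[OF V yV C\<beta> d\<beta> a ny Hy0]) blast
 then have "\<forall>y\<in>Z. m y > 0 \<and> (1 / m y) *\<^sub>R y \<in> exits" using exitV by blast
 then show ?thesis using nn ny m(1-4) by blast
qed

text \<open>Flow for the time - ln l, in steps of at most \<open>tau\<close>. Since that time is
  positive, the point reached is interior.\<close>

lemma Psi_scale: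
 assumes x: "x \<in> basin p0" and l: "0 < l" "l < 1"
 shows "\<exists>z\<in>basin p0 - boundary M. Psi z = l *\<^sub>R Psi x"
proof -
 have "\<exists>z\<in>basin p0 - boundary M. Psi z = exp (- t) *\<^sub>R Psi x" if "x \<in> basin p0" "0 < t" "t \<le> real k * tau" for k t x
  using that
 proof (induct k arbitrary: t x)
  case (Suc k)
  have step: "phi r x \<in> basin p0 - boundary M" "Psi (phi r x) = exp (- r) *\<^sub>R Psi x" if "0 < r" "r \<le> tau" for r
   using Psi_phi[OF Suc.prems(1), of r] phi_interior[of x r] Suc.prems(1) that by (auto simp: basin_def)
  show ?case
  proof (cases "t \<le> tau")
   case True
   then show ?thesis using step Suc.prems(2) by blast
  next
   case False
   then obtain z where "z \<in> basin p0 - boundary M" "Psi z = exp (- (t - tau)) *\<^sub>R Psi (phi tau x)"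
    using Suc.hyps[of "phi tau x" "t - tau"] step(1)[OF tau_pos order_refl] Suc.prems by (auto simp: algebra_simps)
   then show ?thesis using step(2)[OF tau_pos order_refl] by (auto simp: mult_exp_exp)
  qed
 qed simp
 note scale = this
 obtain k where k: "- ln l / tau \<le> real k" using real_arch_simple by blast
 show ?thesis
  using scale[OF x, of "- ln l" k] k l tau_pos by (simp add: field_simps)
qed

text \<open>By \<open>Psi_scale\<close>, shrinking an image point by a factor below 1 yields the
  image of an interior point, and by injectivity of Psi it cannot also be the image of a boundary
  point.\<close>

lemma exits_bound:
 assumes x: "x \<in> basin p0" and m: "m > 0" "(1/m) *\<^sub>R Psi x \<in> exits"
 shows "m \<le> 1" and "x \<in> boundary M \<Longrightarrow> m = 1"
proof -
 obtain b where b: "b \<in> boundary M" "b \<in> basin p0" "Psi b = (1/m) *\<^sub>R Psi x" using m(2) unfolding exits_def by force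
 show 1: "m \<le> 1"
 proof (rule ccontr)
  assume "\<not> m \<le> 1"
  then obtain z where "z \<in> basin p0 - boundary M" "Psi z = (1/m) *\<^sub>R Psi x" using Psi_scale[OF x, of "1/m"] m by auto
  then show False using b Psi_inj by (metis DiffD1 DiffD2 inj_onD)
 qed
 assume bx: "x \<in> boundary M"
 show "m = 1"
 proof (rule ccontr)
  assume "m \<noteq> 1"
  then obtain z where z: "z \<in> basin p0 - boundary M" "Psi z = m *\<^sub>R Psi b" using Psi_scale[OF b(2), of m] m 1 by auto
  then have "Psi z = Psi x" using b(3) m by simp
  then show False using z x bx Psi_inj by (metis DiffD1 DiffD2 inj_onD)
 qed
qed

lemma exits_unique:
 assumes "m > 0" "(1/m) *\<^sub>R y \<in> exits" "k > 0" "(1/k) *\<^sub>R y \<in> exits"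
 shows "m = k"
proof -
 obtain b where b: "b \<in> boundary M" "b \<in> basin p0" "Psi b = (1/m) *\<^sub>R y" using assms(2) unfolding exits_def by force
 have "(1/(k/m)) *\<^sub>R Psi b \<in> exits" using assms b(3) by simp
 from exits_bound(2)[OF b(2) _ this b(1)] show ?thesis using assms by (simp add: field_simps)
qed

lemma exits_nonzero: "y \<in> exits \<Longrightarrow> y \<noteq> 0"
proof
 assume "y \<in> exits" "y = 0"
 then obtain b where b: "b \<in> boundary M" "b \<in> basin p0" "Psi b = 0" unfolding exits_def by auto
 then show False using Psi_norm[OF b(2)] boundary_s[OF b(1)] by (simp add: q_fun_def)
qed

text \<open>On the boundary s > -1, so the basins cover it. They are open and pairwise disjoint,
  hence the part of the boundary in one of them is closed as well.\<close>

lemma exits_compact: "compact exits"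
proof -
 let ?Q = "\<Union> {basin p |p. p \<in> topspace (mtop M) \<and> s p = 1 \<and> p \<noteq> p0}"
 have Q: "openin (mtop M) ?Q" by (intro openin_Union) (auto intro: basin_open)
 have "boundary M \<inter> basin p0 = boundary M - ?Q"
 proof (intro equalityI subsetI)
  fix x assume "x \<in> boundary M - ?Q"
  then have x: "x \<in> boundary M" "x \<notin> ?Q" by auto
  then have "x \<in> topspace (mtop M)" by (simp add: boundary_def)
  then obtain p where "p \<in> topspace (mtop M)" "s p = 1" "x \<in> basin p" using basin_cover boundary_s(1)[OF x(1)] by blast
  then show "x \<in> boundary M \<inter> basin p0" using x by blast
 qed (use basin_disjoint in blast)
 then have "closedin (mtop M) (boundary M \<inter> basin p0)" using closedin_diff[OF boundary_closed Q] by simp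
 then have "compactin (mtop M) (boundary M \<inter> basin p0)" by (rule closedin_compact_space[OF comp])
 then have K: "compactin (subtopology (mtop M) (basin p0)) (boundary M \<inter> basin p0)" by (simp add: compactin_subtopology)
 have "continuous_map (subtopology (mtop M) (basin p0)) euclidean Psi"
  unfolding continuous_map_eq_topcontinuous_at topcontinuous_at_def
 proof (intro ballI conjI allI impI)
  fix x V assume x: "x \<in> topspace (subtopology (mtop M) (basin p0))" and V: "openin euclidean V \<and> Psi x \<in> V"
  then have xb: "x \<in> basin p0" "x \<in> topspace (mtop M)" by auto
  obtain c where c: "c \<in> charts M" "x \<in> fst c" using chart_exists[OF xb(2)] by blast
  then obtain W F where "smooth_rep c Psi x W F" using Psi_conf[OF xb(1)] unfolding conf_at_def conf_rep_def by blast
  from smooth_rep_continuous[OF c this] obtain U where "openin (mtop M) U" "x \<in> U" "\<forall>y\<in>U. Psi y \<in> V"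
   using V unfolding topcontinuous_at_def by blast
  then show "\<exists>U. openin (subtopology (mtop M) (basin p0)) U \<and> x \<in> U \<and> (\<forall>y\<in>U. Psi y \<in> V)"
   using xb(1) by (intro exI[of _ "U \<inter> basin p0"]) (auto simp: openin_subtopology)
 qed auto
 from image_compactin[OF K this] show ?thesis by (simp add: exits_def)
qed

text \<open>The directions of exit points form a closed set by compactness and an open one by the
  local gauge, so they fill the unit sphere, which is connected in dimension at least 2.\<close>

lemma exits_hit:
 assumes y: "y \<noteq> 0"
 obtains m where "m > 0" "(1/m) *\<^sub>R y \<in> exits"
proof -
 define T where "T = (\<lambda>y. (1 / norm y) *\<^sub>R y) ` exits"
 have Ts: "T \<subseteq> sphere 0 1" using exits_nonzero by (auto simp: T_def)
 have "continuous_on exits (\<lambda>y. (1 / norm y) *\<^sub>R y)"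
  by (intro continuous_intros) (use exits_nonzero in auto)
 then have "compact T" unfolding T_def using exits_compact by (rule compact_continuous_image)
 then have cl: "closedin (top_of_set (sphere 0 1)) T" using Ts by (simp add: closed_subset compact_imp_closed)
 have op: "openin (top_of_set (sphere 0 1)) T"
  unfolding openin_contains_ball
 proof (intro conjI ballI Ts)
  fix u assume "u \<in> T"
  then obtain y0 where y0: "y0 \<in> exits" "u = (1 / norm y0) *\<^sub>R y0" unfolding T_def by blast
  have n0: "norm y0 > 0" using exits_nonzero[OF y0(1)] by simp
  obtain m N where N: "open N" "y0 \<in> N" "\<And>y. y \<in> N \<Longrightarrow> m y > 0 \<and> (1 / m y) *\<^sub>R y \<in> exits"
   using exits_local[OF y0(1)] by blast
  have "open ((\<lambda>v. norm y0 *\<^sub>R v) -` N)" by (intro continuous_open_vimage N continuous_intros)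
  moreover have "u \<in> (\<lambda>v. norm y0 *\<^sub>R v) -` N" using N(2) y0(2) n0 by simp
  ultimately obtain e where e: "e > 0" "ball u e \<subseteq> (\<lambda>v. norm y0 *\<^sub>R v) -` N" by (rule openE)
  have "ball u e \<inter> sphere 0 1 \<subseteq> T"
  proof
   fix v assume v: "v \<in> ball u e \<inter> sphere 0 1"
   let ?z = "norm y0 *\<^sub>R v"
   have "?z \<in> N" using e(2) v by blast
   then have m: "m ?z > 0" "(1 / m ?z) *\<^sub>R ?z \<in> exits" using N(3) by blast+
   have "v = (1 / norm ((1 / m ?z) *\<^sub>R ?z)) *\<^sub>R ((1 / m ?z) *\<^sub>R ?z)" using m(1) n0 v by simp
   then show "v \<in> T" unfolding T_def using m(2) by (rule image_eqI)
  qed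
  then show "\<exists>e>0. ball u e \<inter> sphere 0 1 \<subseteq> T" using e(1) by blast
 qed
 have "T = {} \<or> T = sphere 0 1"
  by (rule connected_clopen[THEN iffD1, rule_format, OF connected_sphere[OF dim]]) (use cl op in blast)
 then have "T = sphere 0 1" using b0 by (auto simp: T_def exits_def)
 moreover have "(1 / norm y) *\<^sub>R y \<in> sphere 0 1" using y by simp
 ultimately obtain z where z: "z \<in> exits" "(1 / norm y) *\<^sub>R y = (1 / norm z) *\<^sub>R z" unfolding T_def by blast
 have nz: "norm z > 0" using exits_nonzero[OF z(1)] by simp
 have "z = norm z *\<^sub>R ((1 / norm z) *\<^sub>R z)" using nz by simp
 also have "\<dots> = (1 / (norm y / norm z)) *\<^sub>R y" unfolding z(2)[symmetric] by simp
 finally have "(1 / (norm y / norm z)) *\<^sub>R y \<in> exits" using z(1) by simp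
 then show ?thesis using that[of "norm y / norm z"] y nz by simp
qed

text \<open>Boundedness of the exit points bounds Psi on the basin and thereby keeps s away from -1.
  So the complement of the basin consists of other basins and of the open set where s < k, and
  connectedness of M excludes it.\<close>

lemma basin_eq: "basin p0 = topspace (mtop M)"
proof -
 obtain R where R: "\<And>y. y \<in> exits \<Longrightarrow> norm y \<le> R" using exits_compact compact_imp_bounded bounded_iff by metis
 have le: "norm (Psi x) \<le> R" if x: "x \<in> basin p0" for x
 proof (cases "Psi x = 0")
  case False
  obtain m where m: "m > 0" "(1/m) *\<^sub>R Psi x \<in> exits" by (rule exits_hit[OF False])
  have "norm (Psi x) = m * norm ((1/m) *\<^sub>R Psi x)" using m(1) by simp
  also have "\<dots> \<le> 1 * R" using R[OF m(2)] exits_bound(1)[OF x m] m(1) by (intro mult_mono) auto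
  finally show ?thesis by simp
 next
  case True
  have "norm (Psi b0) \<le> R" using R b0 unfolding exits_def by blast
  then show ?thesis unfolding True norm_zero using norm_ge_zero[of "Psi b0"] by linarith
 qed
 \<comment> \<open>The value of s at which |Psi| would equal R.\<close>
 define k where "k = (1 - R\<^sup>2) / (1 + R\<^sup>2)"
 have R2: "1 + R\<^sup>2 > 0" by (simp add: add_pos_nonneg)
 have k1: "k > -1" using R2 by (simp add: k_def field_simps)
 have sk: "s x \<ge> k" if x: "x \<in> basin p0" for x
 proof -
  have s1: "1 + s x > 0" using x by (auto simp: basin_def)
  have "(norm (Psi x))\<^sup>2 \<le> R\<^sup>2" using le[OF x] by (intro power_mono) auto
  then have "(1 - s x) \<le> R\<^sup>2 * (1 + s x)" using Psi_norm[OF x] s1 by (simp add: q_fun_def field_simps)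
  then show ?thesis using R2 by (simp add: k_def field_simps)
 qed
 let ?Q = "\<Union> {basin p |p. p \<in> topspace (mtop M) \<and> s p = 1 \<and> p \<noteq> p0} \<union> {x \<in> topspace (mtop M). s x < k}"
 have "openin (mtop M) {x \<in> topspace (mtop M). s x < k}"
  using openin_continuous_map_preimage[OF s_cont, of "{..<k}"] by simp
 then have "openin (mtop M) ?Q" by (intro openin_Un openin_Union) (auto intro: basin_open)
 moreover have "topspace (mtop M) - basin p0 = ?Q"
 proof (intro equalityI subsetI)
  fix x assume x: "x \<in> topspace (mtop M) - basin p0"
  show "x \<in> ?Q"
  proof (cases "s x < k")
   case False
   then have "s x > -1" using k1 by simp
   then obtain p where "p \<in> topspace (mtop M)" "s p = 1" "x \<in> basin p" using basin_cover x by blast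
   then show ?thesis using x by blast
  qed (use x in blast)
 next
  fix x assume x: "x \<in> ?Q"
  have "x \<in> topspace (mtop M)" using x by (auto simp: basin_def)
  moreover have "x \<notin> basin p0" using x
  proof
   assume "x \<in> \<Union> {basin p |p. p \<in> topspace (mtop M) \<and> s p = 1 \<and> p \<noteq> p0}"
   then show ?thesis using basin_disjoint by blast
  qed (use sk in force)
  ultimately show "x \<in> topspace (mtop M) - basin p0" by blast
 qed
 ultimately have "closedin (mtop M) (basin p0)" unfolding closedin_def by (auto simp: basin_def)
 then show ?thesis using basin_open[OF p0] conn b0 unfolding connected_space_clopen_in by blast
qed

lemma Psi_image: "Psi ` topspace (mtop M) = {y. y = 0 \<or> (\<exists>m. 0 < m \<and> m \<le> 1 \<and> (1/m) *\<^sub>R y \<in> exits)}"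
proof (intro equalityI subsetI)
 fix y assume "y \<in> Psi ` topspace (mtop M)"
 then obtain x where x: "x \<in> basin p0" "y = Psi x" by (auto simp: basin_eq)
 show "y \<in> {y. y = 0 \<or> (\<exists>m. 0 < m \<and> m \<le> 1 \<and> (1/m) *\<^sub>R y \<in> exits)}"
 proof (cases "y = 0")
  case False
  then obtain m where "m > 0" "(1/m) *\<^sub>R y \<in> exits" by (rule exits_hit)
  then show ?thesis using exits_bound(1)[OF x(1)] x(2) by blast
 qed simp
next
 fix y assume y: "y \<in> {y. y = 0 \<or> (\<exists>m. 0 < m \<and> m \<le> 1 \<and> (1/m) *\<^sub>R y \<in> exits)}"
 have "Psi p0 = 0" using Psi_norm[of p0] p0 by (simp add: basin_eq q_fun_def)
 moreover have "y \<in> Psi ` topspace (mtop M)" if m: "0 < m" "m \<le> 1" "(1/m) *\<^sub>R y \<in> exits" for m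
 proof -
  obtain b where b: "b \<in> basin p0" "Psi b = (1/m) *\<^sub>R y" using m(3) unfolding exits_def by force
  show ?thesis
  proof (cases "m = 1")
   case False
   then obtain z where "z \<in> basin p0" "Psi z = m *\<^sub>R Psi b" using Psi_scale[OF b(1), of m] m by auto
   then show ?thesis using b m by (force simp: basin_eq)
  qed (use b basin_eq in force)
 qed
 ultimately show "y \<in> Psi ` topspace (mtop M)" using y p0 by force
qed

end

section \<open>Homogeneous functions of degree 1 with gradient of constant length\<close>

locale homogeneous_eikonal =
 fixes U :: "'a::euclidean_space \<Rightarrow> real" and B :: real
 assumes hom: "\<And>c y. c > 0 \<Longrightarrow> y \<noteq> 0 \<Longrightarrow> U (c *\<^sub>R y) = c * U y"
  and grad: "\<And>y. y \<noteq> 0 \<Longrightarrow> \<exists>g. norm g = B \<and> (U has_derivative (\<lambda>h. g \<bullet> h)) (at y)"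
begin

text \<open>Euler's identity g . y = U y for homogeneous functions, followed by the Cauchy-Schwarz
  inequality.\<close>

lemma bound:
 assumes y: "y \<noteq> 0" shows "\<bar>U y\<bar> \<le> B * norm y"
proof -
 obtain g where g: "norm g = B" "(U has_derivative (\<lambda>h. g \<bullet> h)) (at y)" using grad[OF y] by blast
 have "((\<lambda>t::real. t *\<^sub>R y) has_derivative (\<lambda>t. t *\<^sub>R y)) (at 1)" by (auto intro!: derivative_eq_intros)
 from has_derivative_compose[OF this, of U "\<lambda>h. g \<bullet> h"] g(2)
 have "((\<lambda>t. U (t *\<^sub>R y)) has_derivative (\<lambda>t. g \<bullet> (t *\<^sub>R y))) (at 1)" by simp
 then have "((\<lambda>t. t * U y) has_derivative (\<lambda>t. g \<bullet> (t *\<^sub>R y))) (at 1)"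
  by (rule has_derivative_transform_within_open[of _ _ _ _ "{0<..}"]) (use hom y in auto)
 moreover have "((\<lambda>t. t * U y) has_derivative (\<lambda>t. t * U y)) (at 1)" by (auto intro!: derivative_eq_intros)
 ultimately have "(\<lambda>t. g \<bullet> (t *\<^sub>R y)) = (\<lambda>t. t * U y)" by (rule has_derivative_unique)
 from fun_cong[OF this, of 1] have "g \<bullet> y = U y" by simp
 then show ?thesis using Cauchy_Schwarz_ineq2[of g y] g(1) by simp
qed

text \<open>At an extremum of U(y) / |y| the gradient is radial, equal to U(x) x, so its length is
  |U(x)|.\<close>

lemma critical:
 assumes x: "norm x = 1" and ext: "(\<forall>y. y \<noteq> 0 \<longrightarrow> U y \<le> U x * norm y) \<or> (\<forall>y. y \<noteq> 0 \<longrightarrow> U x * norm y \<le> U y)"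
 shows "\<bar>U x\<bar> = B"
proof -
 have x0: "x \<noteq> 0" using x by auto
 obtain g where g: "norm g = B" "(U has_derivative (\<lambda>h. g \<bullet> h)) (at x)" using grad[OF x0] by blast
 have "((\<lambda>y. U y - U x * norm y) has_derivative (\<lambda>h. g \<bullet> h - U x * (h \<bullet> sgn x))) (at x)"
  by (intro has_derivative_diff g(2) has_derivative_mult_right has_derivative_norm x0)
 from differential_zero_maxmin[OF _ _ this, of "- {0}"]
 have eq: "(\<lambda>h. g \<bullet> h - U x * (h \<bullet> sgn x)) = (\<lambda>h. 0)" using ext x x0 by auto
 then have "g \<bullet> h = (U x *\<^sub>R x) \<bullet> h" for h
  using fun_cong[OF eq, of h] x by (simp add: sgn_div_norm inner_commute)
 then have "g = U x *\<^sub>R x" by (metis vector_eq_rdot inner_commute)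
 then show ?thesis using g(1) x by simp
qed

text \<open>A segment through the origin, where U need not be differentiable, is harmless: there |x
  - y| = |x| + |y|, and \<open>bound\<close> applies to both ends.\<close>

lemma lipschitz:
 assumes x: "x \<noteq> 0" and y: "y \<noteq> 0"
 shows "\<bar>U x - U y\<bar> \<le> B * norm (x - y)"
proof (cases "0 \<in> closed_segment x y")
 case True
 then have "norm (x - y) = norm x + norm y" unfolding between_mem_segment[symmetric] between by (simp add: dist_norm)
 then show ?thesis using bound[OF x] bound[OF y] by (simp add: algebra_simps)
next
 case False
 then have nz: "z \<noteq> 0" if "z \<in> closed_segment x y" for z using that by auto
 have "\<forall>z\<in>closed_segment x y. \<exists>g. norm g = B \<and> (U has_derivative (\<lambda>h. g \<bullet> h)) (at z)" using nz grad by blast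
 then obtain g where g: "\<And>z. z \<in> closed_segment x y \<Longrightarrow> norm (g z) = B \<and> (U has_derivative (\<lambda>h. g z \<bullet> h)) (at z)" by metis
 have "norm (U x - U y) \<le> B * norm (x - y)"
 proof (rule differentiable_bound[of "closed_segment x y" U "\<lambda>z h. g z \<bullet> h"])
  fix z assume z: "z \<in> closed_segment x y"
  show "(U has_derivative (\<lambda>h. g z \<bullet> h)) (at z within closed_segment x y)"
   using g[OF z] has_derivative_at_withinI by blast
  show "onorm (\<lambda>h. g z \<bullet> h) \<le> B"
   using g[OF z] Cauchy_Schwarz_ineq2[of "g z"] by (intro onorm_le) auto
 qed auto
 then show ?thesis by simp
qed

text \<open>Comparison with the far point t e gives U x <= B (|x - t e| - t), and the right-hand
  side tends to - B (x . e) as t grows. The argument uses one sufficiently large t in place of the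
  limit.\<close>

lemma asymptotic:
 assumes B: "B > 0" and e: "norm e = 1" "U e = - B" and x: "x \<noteq> 0"
 shows "U x \<le> - B * (x \<bullet> e)"
proof (rule ccontr)
 assume neg: "\<not> U x \<le> - B * (x \<bullet> e)"
 define d where "d = U x + B * (x \<bullet> e)"
 have d: "d > 0" using neg by (simp add: d_def)
 \<comment> \<open>t >= |x| makes U x + B t nonnegative, so that the inequality may be squared; t d
   >= B |x|^2 contradicts what squaring yields, 2 t d <= B |x|^2.\<close>
 define t where "t = max (norm x) (B * (norm x)\<^sup>2 / d)"
 have t: "t \<ge> norm x" by (simp add: t_def)
 then have t: "t \<ge> norm x" "t > 0" using x by (auto intro: less_le_trans[of 0 "norm x"])
 have "B * (norm x)\<^sup>2 / d \<le> t" by (simp add: t_def)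
 then have td: "B * (norm x)\<^sup>2 \<le> t * d" using d by (simp add: pos_divide_le_eq)
 have e0: "e \<noteq> 0" using e by auto
 have "U (t *\<^sub>R e) = - B * t" using hom[OF t(2) e0] e by simp
 then have le: "U x + B * t \<le> B * norm (x - t *\<^sub>R e)" using lipschitz[OF x, of "t *\<^sub>R e"] e0 t(2) by simp
 have "B * norm x \<le> B * t" using t(1) B by simp
 then have "0 \<le> U x + B * t" using bound[OF x] by linarith
 from power_mono[OF le this, of 2]
 have "(U x + B * t)\<^sup>2 \<le> B\<^sup>2 * (norm (x - t *\<^sub>R e))\<^sup>2" by (simp add: power_mult_distrib)
 also have "(norm (x - t *\<^sub>R e))\<^sup>2 = (norm x)\<^sup>2 - 2 * t * (x \<bullet> e) + t\<^sup>2"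
  unfolding power2_norm_eq_inner using e(1)[unfolded norm_eq_1]
  by (simp add: inner_diff_left inner_diff_right inner_commute[of e x] power2_eq_square algebra_simps)
 finally have "(U x)\<^sup>2 + B * (2 * t * (U x + B * (x \<bullet> e))) \<le> B * (B * (norm x)\<^sup>2)"
  by (simp add: power2_eq_square algebra_simps)
 then have "B * (2 * t * d) \<le> B * (B * (norm x)\<^sup>2)" unfolding d_def using zero_le_power2[of "U x"] by linarith
 then have "2 * t * d \<le> B * (norm x)\<^sup>2" using B by simp
 moreover have "t * d > 0" using t d by simp
 ultimately show False using td by simp
qed

end

text \<open>The extrema p and q of U on the unit sphere have values B or - B. If the values agree, U
  is radial. Otherwise \<open>asymptotic\<close> for U and for - U gives B (y . p) <= U y <= - B (y
  . q) for all y \<noteq> 0, which forces q = - p and hence equality.\<close>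

theorem homogeneous_eikonal_rigidity:
 fixes U :: "'a::euclidean_space \<Rightarrow> real"
 assumes U: "homogeneous_eikonal U B"
 obtains "\<And>y. y \<noteq> 0 \<Longrightarrow> U y = B * norm y" | "\<And>y. y \<noteq> 0 \<Longrightarrow> U y = - B * norm y"
  | e where "norm e = 1" "\<And>y. y \<noteq> 0 \<Longrightarrow> U y = B * (e \<bullet> y)"
proof -
 interpret homogeneous_eikonal U B by (rule U)
 interpret neg: homogeneous_eikonal "\<lambda>y. - U y" B
 proof
  show "\<exists>g. norm g = B \<and> ((\<lambda>y. - U y) has_derivative (\<lambda>h. g \<bullet> h)) (at y)" if y: "y \<noteq> 0" for y
  proof -
   obtain g where "norm g = B" "(U has_derivative (\<lambda>h. g \<bullet> h)) (at y)" using grad[OF y] by blast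
   then show ?thesis by (intro exI[of _ "- g"]) (auto intro!: derivative_eq_intros)
  qed
 qed (use hom in simp)
 obtain b :: 'a where b: "b \<in> Basis" using nonempty_Basis by blast
 then have b1: "b \<in> sphere 0 1" by simp
 have cont: "continuous_on (sphere 0 1) U"
 proof (intro continuous_at_imp_continuous_on ballI)
  fix y :: 'a assume "y \<in> sphere 0 1"
  then have "y \<noteq> 0" by auto
  then show "isCont U y" using grad has_derivative_continuous by blast
 qed
 have scale: "U y = norm y * U (y /\<^sub>R norm y)" "y /\<^sub>R norm y \<in> sphere 0 1" if "y \<noteq> 0" for y
  using hom[of "norm y" "y /\<^sub>R norm y"] that by auto
 obtain p where p: "p \<in> sphere 0 1" "\<And>y. y \<in> sphere 0 1 \<Longrightarrow> U y \<le> U p"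
  using continuous_attains_sup[OF compact_sphere _ cont] b1 by blast
 obtain q where q: "q \<in> sphere 0 1" "\<And>y. y \<in> sphere 0 1 \<Longrightarrow> U q \<le> U y"
  using continuous_attains_inf[OF compact_sphere _ cont] b1 by blast
 have up: "U y \<le> U p * norm y" and lo: "U q * norm y \<le> U y" if "y \<noteq> 0" for y
  unfolding scale(1)[OF that] using p(2)[OF scale(2)[OF that]] q(2)[OF scale(2)[OF that]]
  by (simp_all add: mult.commute mult_left_mono)
 have n: "norm p = 1" "norm q = 1" using p q by auto
 have pB: "\<bar>U p\<bar> = B" and qB: "\<bar>U q\<bar> = B" using critical[OF n(1)] critical[OF n(2)] up lo by auto
 consider "U p = B" "U q = B" | "U p = - B" "U q = - B" | "B > 0" "U p = B" "U q = - B"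
  using pB qB q(2)[OF p(1)] by linarith
 then show ?thesis
 proof cases
  case 3
  have 1: "U y \<le> - B * (y \<bullet> q)" if "y \<noteq> 0" for y by (rule asymptotic[OF 3(1) n(2) 3(3) that])
  have 2: "- U y \<le> - B * (y \<bullet> p)" if "y \<noteq> 0" for y by (rule neg.asymptotic[OF 3(1) n(1) _ that]) (use 3 in simp)
  have "y \<bullet> (p + q) \<le> 0" for y
  proof (cases "y = 0")
   case False
   then have "B * (y \<bullet> (p + q)) \<le> 0" using 1 2 by (smt (verit) distrib_left inner_add_right mult_minus_left)
   then show ?thesis using 3(1) by (simp add: mult_le_0_iff)
  qed simp
  from this[of "p + q"] have "p + q = 0" by (metis inner_gt_zero_iff not_less)
  then have "q = - p" by (simp add: add_eq_0_iff)
  then show ?thesis using that(3)[of p] n 1 2 by (force simp: inner_commute)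
 next
  case 1
  then show ?thesis using that(1) up lo by force
 next
  case 2
  then show ?thesis using that(2) up lo by force
 qed
qed

text \<open>w is the gauge with E as its level set 1. The condition |n| = 2 A / (1 + |y|^2) is an
  awkward equation for Dw, but U = (w - |y|^2 / w) / 2 has a gradient of constant length. The form
  of U is found by homogenising 1 - |y|^2 = 2 B (e . y) to w^2 - |y|^2 = 2 B w (e . y). On E, where
  w = 1, the alternatives for U are those of the conclusion.\<close>

lemma gauge_rigidity:
 fixes E :: "'a::euclidean_space set"
 assumes A: "A > 0"
  and hit: "\<And>y. y \<noteq> 0 \<Longrightarrow> \<exists>m>0. (1/m) *\<^sub>R y \<in> E"
  and uniq: "\<And>m k y. m > 0 \<Longrightarrow> (1/m) *\<^sub>R y \<in> E \<Longrightarrow> k > 0 \<Longrightarrow> (1/k) *\<^sub>R y \<in> E \<Longrightarrow> m = k"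
  and nz: "\<And>y. y \<in> E \<Longrightarrow> y \<noteq> 0"
  and loc: "\<And>y. y \<in> E \<Longrightarrow> \<exists>n. norm n = 2 * A / (1 + (norm y)\<^sup>2) \<and> n \<bullet> y = 1 \<and>
   (\<exists>m N. open N \<and> y \<in> N \<and> (m has_derivative (\<lambda>h. n \<bullet> h)) (at y) \<and> m y = 1 \<and> (\<forall>z\<in>N. m z > 0 \<and> (1 / m z) *\<^sub>R z \<in> E))"
 obtains B where "B \<ge> 0" "B\<^sup>2 = A\<^sup>2 - 1"
  "(\<forall>y\<in>E. 1 - (norm y)\<^sup>2 = 2 * B * norm y) \<or> (\<forall>y\<in>E. 1 - (norm y)\<^sup>2 = - 2 * B * norm y) \<or>
   (\<exists>e. norm e = 1 \<and> (\<forall>y\<in>E. 1 - (norm y)\<^sup>2 = 2 * B * (e \<bullet> y)))"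
proof -
 define w where "w y = (THE m. m > 0 \<and> (1/m) *\<^sub>R y \<in> E)" for y
 have w_eq: "w y = m" if "m > 0" "(1/m) *\<^sub>R y \<in> E" for y m
  unfolding w_def by (rule the_equality) (use uniq that in blast)+
 have w: "w y > 0" "(1 / w y) *\<^sub>R y \<in> E" if "y \<noteq> 0" for y using hit[OF that] w_eq by auto
 have w_hom: "w (c *\<^sub>R y) = c * w y" if "c > 0" "y \<noteq> 0" for c y
  by (rule w_eq) (use w[OF that(2)] that(1) in auto)
 have dw: "\<exists>n. norm n = 2 * A / (1 + (norm y / w y)\<^sup>2) \<and> n \<bullet> y = w y \<and> (w has_derivative (\<lambda>h. n \<bullet> h)) (at y)"
  if y: "y \<noteq> 0" for y
 proof -
  define k where "k = w y"
  have k: "k > 0" "(1 / k) *\<^sub>R y \<in> E" using w[OF y] by (simp_all add: k_def)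
  obtain n m N where n: "norm n = 2 * A / (1 + (norm ((1 / k) *\<^sub>R y))\<^sup>2)" "n \<bullet> ((1 / k) *\<^sub>R y) = 1"
   and N: "open N" "(1 / k) *\<^sub>R y \<in> N" "(m has_derivative (\<lambda>h. n \<bullet> h)) (at ((1 / k) *\<^sub>R y))"
    "\<And>z. z \<in> N \<Longrightarrow> m z > 0 \<and> (1 / m z) *\<^sub>R z \<in> E"
   using loc[OF k(2)] by blast
  have "((\<lambda>z. (1 / k) *\<^sub>R z) has_derivative (\<lambda>h. (1 / k) *\<^sub>R h)) (at y)" by (auto intro!: derivative_eq_intros)
  from has_derivative_mult_right[OF has_derivative_compose[OF this N(3)], of k]
  have "((\<lambda>z. k * m ((1 / k) *\<^sub>R z)) has_derivative (\<lambda>h. n \<bullet> h)) (at y)" using k(1) by simp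
  moreover have "open ((\<lambda>z. (1 / k) *\<^sub>R z) -` N)" by (intro continuous_open_vimage N continuous_intros)
  ultimately have "(w has_derivative (\<lambda>h. n \<bullet> h)) (at y)"
  proof (rule has_derivative_transform_within_open)
   show "y \<in> (\<lambda>z. (1 / k) *\<^sub>R z) -` N" using N(2) by simp
   fix z assume "z \<in> (\<lambda>z. (1 / k) *\<^sub>R z) -` N"
   then show "k * m ((1 / k) *\<^sub>R z) = w z"
    using N(4)[of "(1 / k) *\<^sub>R z"] k(1) by (intro w_eq[symmetric]) (auto simp: mult.commute)
  qed
  then show ?thesis using n(1,2) k(1) unfolding k_def[symmetric]
   by (intro exI[of _ n]) (auto simp: field_simps)
 qed
 define U where "U y = (w y - (norm y)\<^sup>2 / w y) / 2" for y
 have grad: "\<exists>g. (norm g)\<^sup>2 = A\<^sup>2 - 1 \<and> (U has_derivative (\<lambda>h. g \<bullet> h)) (at y)" if y: "y \<noteq> 0" for y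
 proof -
  obtain n where n: "norm n = 2 * A / (1 + (norm y / w y)\<^sup>2)" "n \<bullet> y = w y" "(w has_derivative (\<lambda>h. n \<bullet> h)) (at y)"
   using dw[OF y] by blast
  define k where "k = w y"
  define r where "r = (norm y / k)\<^sup>2"
  have k: "k > 0" using w[OF y] by (simp add: k_def)
  have r: "1 + r > 0" by (simp add: r_def add_pos_nonneg)
  \<comment> \<open>The gradient of U, where n is that of w and r = |y / w|^2. With |n| = 2 A / (1 +
    r), n . y = w and |y|^2 = r w^2 one gets 4 |g|^2 = 4 A^2 - 4 (1 + r) + 4 r.\<close>
  define g where "g = (1/2) *\<^sub>R ((1 + r) *\<^sub>R n - (2 / k) *\<^sub>R y)"
  have ry: "y \<bullet> y = r * k\<^sup>2" using k by (simp add: r_def power_divide power2_norm_eq_inner)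
  have "((\<lambda>y. (w y - (y \<bullet> y) / w y) / 2) has_derivative (\<lambda>h. g \<bullet> h)) (at y)"
  proof (rule has_derivative_eq_rhs)
   show "((\<lambda>y. (w y - (y \<bullet> y) / w y) / 2) has_derivative
     (\<lambda>h. (n \<bullet> h - ((- (y \<bullet> y) * (inverse k * (n \<bullet> h) * inverse k)) + (y \<bullet> h + h \<bullet> y) / k)) / 2)) (at y)"
    unfolding k_def by (rule derivative_eq_intros n(3) refl has_derivative_inner has_derivative_ident | use w[OF y] in simp)+
   show "(\<lambda>h. (n \<bullet> h - ((- (y \<bullet> y) * (inverse k * (n \<bullet> h) * inverse k)) + (y \<bullet> h + h \<bullet> y) / k)) / 2) = (\<lambda>h. g \<bullet> h)"
    unfolding ry using k by (auto simp: fun_eq_iff g_def inner_diff_left inner_add_left inner_commute[of _ y] field_simps power2_eq_square)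
  qed
  moreover have "(norm g)\<^sup>2 = A\<^sup>2 - 1"
  proof -
   have nn: "n \<bullet> n = 4 * A\<^sup>2 / (1 + r)\<^sup>2"
    unfolding power2_norm_eq_inner[symmetric] n(1)[folded k_def, folded r_def] by (simp add: power_divide power_mult_distrib)
   have "4 * (norm g)\<^sup>2 = (1 + r)\<^sup>2 * (n \<bullet> n) - 4 * (1 + r) * (n \<bullet> y) / k + 4 * (y \<bullet> y) / k\<^sup>2"
    unfolding power2_norm_eq_inner g_def
    by (simp add: inner_diff_left inner_diff_right inner_commute[of y n] power2_eq_square algebra_simps add_divide_distrib)
   also have "\<dots> = 4 * A\<^sup>2 - 4" unfolding nn ry using n(2) k r by (simp add: k_def[symmetric] algebra_simps add_divide_distrib)
   finally show ?thesis by simp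
  qed
  ultimately show ?thesis unfolding U_def power2_norm_eq_inner by blast
 qed
 obtain b :: 'a where "b \<in> Basis" using nonempty_Basis by blast
 then have "b \<noteq> 0" by auto
 then have A1: "A\<^sup>2 - 1 \<ge> 0" using grad zero_le_power2 by metis
 define B where "B = sqrt (A\<^sup>2 - 1)"
 have B: "B \<ge> 0" "B\<^sup>2 = A\<^sup>2 - 1" using A1 by (simp_all add: B_def)
 have U: "homogeneous_eikonal U B"
 proof
  show "U (c *\<^sub>R y) = c * U y" if "c > 0" "y \<noteq> 0" for c y
   using w_hom[OF that] w(1)[OF that(2)] that(1) by (simp add: U_def power_mult_distrib power2_eq_square field_simps)
  show "\<exists>g. norm g = B \<and> (U has_derivative (\<lambda>h. g \<bullet> h)) (at y)" if "y \<noteq> 0" for y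
   using grad[OF that] by (metis B_def norm_ge_zero real_sqrt_abs abs_of_nonneg)
 qed
 have UE: "1 - (norm y)\<^sup>2 = 2 * U y" if "y \<in> E" for y using w_eq[of 1 y] that by (simp add: U_def)
 show ?thesis
  by (rule that[OF B], cases rule: homogeneous_eikonal_rigidity[OF U]) (use UE nz in auto)
qed

section \<open>Isometries obtained from immersions into Euclidean space\<close>

text \<open>With \<open>A\<close> the derivative at \<open>x\<close>, the map \<open>A\<^sup>T \<circ> F\<close> is a local diffeomorphism of \<open>'a\<close>.\<close>

lemma immersion_left_inverse:
 fixes F :: "'a::euclidean_space \<Rightarrow> 'b::euclidean_space"
 assumes W: "open W" and F: "C_inf_on W F" and x: "x \<in> W" and inj: "inj (FD F x)"
 obtains U V L where "open U" "x \<in> U" "U \<subseteq> W" "open V" "C_inf_on V L" "\<And>y. y \<in> U \<Longrightarrow> F y \<in> V \<and> L (F y) = y"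
proof -
 note dF = C_inf_on_has_derivative[OF F x]
 then have linF: "linear (FD F x)" by (rule has_derivative_linear)
 define A where "A = adjoint (FD F x)"
 have linA: "linear A" unfolding A_def by (rule adjoint_linear[OF linF])
 then have blA: "bounded_linear A" by (simp add: linear_conv_bounded_linear)
 have K: "C_inf_on W (\<lambda>y. A (F y))" by (rule C_inf_on_linear_compose[OF W F blA])
 have "((\<lambda>y. A (F y)) has_derivative (\<lambda>v. A (FD F x v))) (at x)"
  by (rule has_derivative_compose[OF dF]) (rule bounded_linear_imp_has_derivative[OF blA])
 then have dK: "FD (\<lambda>y. A (F y)) x = (\<lambda>v. A (FD F x v))" using frechet_derivative_at by metis
 have "inj (FD (\<lambda>y. A (F y)) x)"
  unfolding dK
 proof (rule injI)
  fix u v assume "A (FD F x u) = A (FD F x v)"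
  then have "A (FD F x (u - v)) = 0" by (simp add: linear_diff[OF linF] linear_diff[OF linA])
  moreover have "FD F x (u - v) \<bullet> FD F x (u - v) = (u - v) \<bullet> A (FD F x (u - v))"
   using adjoint_works[OF linF, of "u - v" "FD F x (u - v)"] by (simp only: A_def)
  ultimately have "FD F x (u - v) = 0" by simp
  then have "FD F x u = FD F x v" by (simp add: linear_diff[OF linF])
  then show "u = v" using inj injD by metis
 qed
 from smooth_inverse_function[OF W K x this]
 obtain U H where U: "open U" "x \<in> U" "U \<subseteq> W" "open ((\<lambda>y. A (F y)) ` U)" "C_inf_on ((\<lambda>y. A (F y)) ` U) H"
  "\<And>y. y \<in> U \<Longrightarrow> H (A (F y)) = y" by metis
 define V where "V = A -` ((\<lambda>y. A (F y)) ` U)"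
 have V: "open V" unfolding V_def
  by (rule continuous_open_vimage[OF U(4) linear_continuous_at[OF blA]])
 have "C_inf_on V (\<lambda>z. H (A z))"
  by (rule C_inf_on_compose[OF V U(4) C_inf_on_bounded_linear[OF V blA] U(5)]) (auto simp: V_def)
 then show ?thesis using that[OF U(1-3) V, of "\<lambda>z. H (A z)"] U(6) by (auto simp: V_def)
qed

text \<open>If \<kappa> is covered by the identity of the ambient space, its coordinate expression
  is L o F1 with L a smooth left inverse of F2. Being symmetric in the two structures, the lemma
  yields smoothness of an isometry and of its inverse alike.\<close>

lemma transition_of_immersions:
 assumes M: "atlas M" and N: "atlas N" and c: "c \<in> charts M" "p \<in> fst c" and d: "d \<in> charts N" "\<kappa> p \<in> fst d"
  and \<kappa>: "continuous_map (mtop M) (mtop N) \<kappa>"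
  and F1: "smooth_rep c h1 p W1 F1" and F2: "smooth_rep d h2 (\<kappa> p) W2 F2" and inj: "inj (FD F2 (snd d (\<kappa> p)))"
  and h: "\<And>q. q \<in> topspace (mtop M) \<Longrightarrow> h2 (\<kappa> q) = h1 q"
 obtains W T where "open W" "snd c p \<in> W" "C_inf_on W T"
  "\<And>y. y \<in> W \<Longrightarrow> y \<in> half_space \<Longrightarrow> T y = coord_map c d \<kappa> y"
  "\<And>v. FD F2 (snd d (\<kappa> p)) (FD T (snd c p) v) = FD F1 (snd c p) v"
proof -
 interpret M: atlas M by (rule M)
 interpret N: atlas N by (rule N)
 note r1 = smooth_repD[OF F1] and r2 = smooth_repD[OF F2]
 define x where "x = snd c p"
 define y0 where "y0 = snd d (\<kappa> p)"
 obtain U V L where U: "open U" "y0 \<in> U" "U \<subseteq> W2" "open V" "C_inf_on V L" "\<And>y. y \<in> U \<Longrightarrow> F2 y \<in> V \<and> L (F2 y) = y"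
  using immersion_left_inverse[OF r2(1,3,2) inj] unfolding y0_def by metis
 have "openin (mtop N) {q \<in> fst d. snd d q \<in> U}" by (rule N.chart_preimage_open[OF d(1) U(1)])
 from openin_continuous_map_preimage[OF \<kappa> this]
 have O: "openin (mtop M) {q \<in> topspace (mtop M). \<kappa> q \<in> {q \<in> fst d. snd d q \<in> U}}" .
 have pM: "p \<in> topspace (mtop M)" using M.chart_subset[OF c(1)] c(2) by blast
 obtain r where r: "r > 0" "\<And>y. y \<in> ball x r \<Longrightarrow> y \<in> half_space \<Longrightarrow>
   y \<in> chart_image c \<and> chart_inv c y \<in> {q \<in> topspace (mtop M). \<kappa> q \<in> {q \<in> fst d. snd d q \<in> U}}"
  unfolding x_def by (rule M.chart_nhd[OF c O]) (use pM d U(2) in \<open>auto simp: y0_def\<close>)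
 define W where "W = (W1 \<inter> F1 -` V) \<inter> ball x r"
 have W1: "open (W1 \<inter> F1 -` V)" by (rule continuous_open_preimage[OF C_inf_on_continuous_on[OF r1(3)] r1(1) U(4)])
 have W: "open W" unfolding W_def by (intro open_Int W1 open_ball)
 have val: "coord_map c d \<kappa> y \<in> U" "F2 (coord_map c d \<kappa> y) = F1 y" if y: "y \<in> ball x r" "y \<in> W1" "y \<in> half_space" for y
 proof -
  define q where "q = chart_inv c y"
  have q: "q \<in> topspace (mtop M)" "\<kappa> q \<in> fst d" "snd d (\<kappa> q) \<in> U" using r(2)[OF y(1,3)] by (auto simp: q_def)
  then show "coord_map c d \<kappa> y \<in> U" by (simp add: coord_map_def q_def)
  have "snd d (\<kappa> q) \<in> half_space" using N.image_half[OF d(1)] M.chart_in_image[OF q(2)] by blast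
  then have "F2 (snd d (\<kappa> q)) = h2 (\<kappa> q)" using r2(5) q U(3) N.chart_inv_left[OF d(1) q(2)] by auto
  also have "\<dots> = F1 y" using h[OF q(1)] r1(5)[OF y(2,3)] by (simp add: q_def)
  finally show "F2 (coord_map c d \<kappa> y) = F1 y" by (simp add: coord_map_def q_def)
 qed
 have xh: "x \<in> half_space" using M.image_half[OF c(1)] M.chart_in_image[OF c(2)] by (auto simp: x_def)
 have cx: "coord_map c d \<kappa> x = y0" using M.chart_inv_left[OF c] by (simp add: coord_map_def x_def y0_def)
 have xW1: "x \<in> W1" "x \<in> ball x r" using r1(2) r(1) by (simp_all add: x_def)
 have Fxy: "F2 y0 = F1 x" using val(2)[OF xW1(2,1) xh] cx by simp
 have xW: "x \<in> W" using xW1 U(6)[OF U(2)] Fxy by (simp add: W_def)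
 have T: "C_inf_on W (\<lambda>y. L (F1 y))"
  by (rule C_inf_on_compose[OF W U(4) C_inf_on_subset[OF r1(3)] U(5)]) (auto simp: W_def)
 have TL: "L (F1 y) = coord_map c d \<kappa> y" if "y \<in> W" "y \<in> half_space" for y
  using val[of y] U(6)[of "coord_map c d \<kappa> y"] that by (auto simp: W_def)
 have Tx: "L (F1 x) = y0" using TL[OF xW xh] cx by simp
 have dT: "((\<lambda>y. L (F1 y)) has_derivative FD (\<lambda>y. L (F1 y)) x) (at x)" by (rule C_inf_on_has_derivative[OF T xW])
 have dF2: "(F2 has_derivative FD F2 y0) (at (L (F1 x)))"
  unfolding Tx using C_inf_on_has_derivative[OF r2(3,2)] by (simp add: y0_def)
 from has_derivative_at_withinI[OF has_derivative_compose[OF dT dF2], of half_space]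
 have 1: "((\<lambda>y. F2 (L (F1 y))) has_derivative (\<lambda>v. FD F2 y0 (FD (\<lambda>y. L (F1 y)) x v))) (at x within half_space)" .
 have dF1: "(F1 has_derivative FD F1 x) (at x)" using C_inf_on_has_derivative[OF r1(3,2)] by (simp add: x_def)
 have 2: "((\<lambda>y. F2 (L (F1 y))) has_derivative FD F1 x) (at x within half_space)"
  by (rule has_derivative_within_ext[OF W xW xh dF1]) (use val(2) TL in \<open>auto simp: W_def\<close>)
 have "(\<lambda>v. FD F2 y0 (FD (\<lambda>y. L (F1 y)) x v)) = FD F1 x"
  by (rule half_space_derivative_unique[OF _ xh 1 2]) simp
 from fun_cong[OF this] show ?thesis using that[of W "\<lambda>y. L (F1 y)"] W xW T TL by (simp add: x_def y0_def)
qed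

lemma smooth_onI:
 assumes "\<And>x. x \<in> D \<Longrightarrow> \<exists>W T. open W \<and> x \<in> W \<and> C_inf_on W T \<and> (\<forall>y\<in>W \<inter> D. T y = f y)"
 shows "smooth_on D f"
 using assms unfolding smooth_on_def C_inf_on_def by blast

lemma coord_dom_subset: "atlas M \<Longrightarrow> c \<in> charts M \<Longrightarrow> coord_dom c d k \<subseteq> half_space"
 using atlas.image_half[of M c] by (auto simp: coord_dom_def chart_image_def)

lemma induced_atlas: "atlas (induced_riemannian X)"
 by unfold_locales (simp add: induced_riemannian_def)

lemma induced_smooth_rep:
 fixes d :: "('b::euclidean_space, 'a::euclidean_space) chart"
 assumes d: "d \<in> charts (induced_riemannian X)" "z \<in> fst d"
 obtains W F where "smooth_rep d (\<lambda>z. z) z W F" "inj (FD F (snd d z))"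
  "deriv_in (chart_image d) (chart_inv d) (snd d z) = FD F (snd d z)"
proof -
 interpret atlas "induced_riemannian X :: ('b, 'a) riemannian" by (rule induced_atlas)
 have z: "snd d z \<in> chart_image d" by (rule chart_in_image[OF d(2)])
 have sm: "smooth_on (chart_image d) (chart_inv d)" and inj: "inj (deriv_in (chart_image d) (chart_inv d) (snd d z))"
  using d(1) z by (auto simp: induced_riemannian_def)
 obtain W F where W: "open W" "snd d z \<in> W" "C_inf_on W F" "\<And>y. y \<in> W \<Longrightarrow> y \<in> chart_image d \<Longrightarrow> F y = chart_inv d y"
  by (rule smooth_onE[OF sm z]) blast
 have der: "deriv_in (chart_image d) (chart_inv d) (snd d z) = FD F (snd d z)"
  by (rule deriv_in_ext[OF image_open[OF d(1)] W(1,2) z W(3,4)])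
 obtain r where r: "r > 0" "ball (snd d z) r \<inter> half_space \<subseteq> chart_image d"
  by (rule openin_half_spaceE[OF image_open[OF d(1)] z])
 have "smooth_rep d (\<lambda>z. z) z (W \<inter> ball (snd d z) r) F"
  unfolding smooth_rep_def using W r by (auto intro: C_inf_on_subset[OF W(3)])
 then show ?thesis using that der inj by simp
qed

context riemannian_mfd
begin

text \<open>Compactness makes the continuous injection a homeomorphism onto its image. On the image
  the inclusion is an immersion by the choice of charts, so both directions are smooth by
  \<open>transition_of_immersions\<close>; and since the induced metric is the Euclidean one,
  metrics correspond.\<close>

theorem isometric_immersion_imp_isometric:
 fixes h :: "'p \<Rightarrow> 'b::euclidean_space"
 assumes comp: "compact_space (mtop M)" and inj: "inj_on h (topspace (mtop M))"
  and iso: "\<And>c p. c \<in> charts M \<Longrightarrow> p \<in> fst c \<Longrightarrow>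
   \<exists>W F. smooth_rep c h p W F \<and> (\<forall>v w. FD F (snd c p) v \<bullet> FD F (snd c p) w = metric M c p v w)"
 shows "isometric M (induced_riemannian (h ` topspace (mtop M)) :: ('b, 'a) riemannian)"
proof -
 define X where "X = h ` topspace (mtop M)"
 define N where "N = (induced_riemannian X :: ('b, 'a) riemannian)"
 have top_N: "mtop N = top_of_set X" by (simp add: N_def induced_riemannian_def)
 have aN: "atlas N" unfolding N_def by (rule induced_atlas)
 have aM: "atlas M" by (rule atlas_axioms)
 interpret N: atlas N by (rule aN)
 have injF: "inj (FD F (snd c p))" if c: "c \<in> charts M" "p \<in> fst c" and F: "smooth_rep c h p W F"
  "\<And>v w. FD F (snd c p) v \<bullet> FD F (snd c p) w = metric M c p v w" for c p W F
 proof -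
  have lin: "linear (FD F (snd c p))" using C_inf_on_has_derivative[OF smooth_repD(3,2)[OF F(1)]] by (rule has_derivative_linear)
  show ?thesis unfolding linear_injective_0[OF lin]
   using F(2) metric_pos[OF c] by (metis inner_zero_left less_irrefl)
 qed
 have "continuous_map (mtop M) euclidean h"
  unfolding continuous_map_eq_topcontinuous_at
 proof
  fix p assume "p \<in> topspace (mtop M)"
  then obtain c where c: "c \<in> charts M" "p \<in> fst c" using chart_exists by blast
  then obtain W F where "smooth_rep c h p W F" using iso by blast
  then show "topcontinuous_at (mtop M) euclidean h p" by (rule smooth_rep_continuous[OF c])
 qed
 then have cont: "continuous_map (mtop M) (mtop N) h" by (simp add: top_N continuous_map_in_subtopology X_def)
 have "homeomorphic_map (mtop M) (mtop N) h"
  by (rule continuous_imp_homeomorphic_map[OF cont comp _ _ inj]) (simp_all add: top_N X_def Hausdorff_space_subtopology)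
 then obtain k where hk: "homeomorphic_maps (mtop M) (mtop N) h k" unfolding homeomorphic_map_maps by blast
 have contk: "continuous_map (mtop N) (mtop M) k" and kX: "\<And>z. z \<in> topspace (mtop N) \<Longrightarrow> h (k z) = z"
  using hk by (auto simp: homeomorphic_maps_def)
 have forth: "\<exists>W T F2. open W \<and> snd c p \<in> W \<and> C_inf_on W T \<and> (\<forall>y\<in>W \<inter> half_space. T y = coord_map c d h y) \<and>
   (\<forall>v w. metric M c p v w = FD F2 (snd d (h p)) (FD T (snd c p) v) \<bullet> FD F2 (snd d (h p)) (FD T (snd c p) w)) \<and>
   deriv_in (chart_image d) (chart_inv d) (snd d (h p)) = FD F2 (snd d (h p))"
  if c: "c \<in> charts M" "p \<in> fst c" and d: "d \<in> charts N" "h p \<in> fst d" for c d p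
 proof -
  obtain W1 F1 where F1: "smooth_rep c h p W1 F1" "\<And>v w. FD F1 (snd c p) v \<bullet> FD F1 (snd c p) w = metric M c p v w"
   using iso[OF c] by blast
  obtain W2 F2 where F2: "smooth_rep d (\<lambda>z. z) (h p) W2 F2" "inj (FD F2 (snd d (h p)))"
   "deriv_in (chart_image d) (chart_inv d) (snd d (h p)) = FD F2 (snd d (h p))"
   using induced_smooth_rep[OF d[unfolded N_def]] by metis
  obtain W T where "open W" "snd c p \<in> W" "C_inf_on W T" "\<And>y. y \<in> W \<Longrightarrow> y \<in> half_space \<Longrightarrow> T y = coord_map c d h y"
   "\<And>v. FD F2 (snd d (h p)) (FD T (snd c p) v) = FD F1 (snd c p) v"
   by (rule transition_of_immersions[OF aM aN c d cont F1(1) F2(1,2)]) auto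
  then show ?thesis using F1(2) F2(3) by (intro exI[of _ W] exI[of _ T] exI[of _ F2]) auto
 qed
 have bwd: "\<exists>W T. open W \<and> snd d z \<in> W \<and> C_inf_on W T \<and> (\<forall>y\<in>W \<inter> half_space. T y = coord_map d c k y)"
  if d: "d \<in> charts N" "z \<in> fst d" and c: "c \<in> charts M" "k z \<in> fst c" for c d z
 proof -
  obtain W1 F1 where F1: "smooth_rep d (\<lambda>z. z) z W1 F1" using induced_smooth_rep[OF d[unfolded N_def]] by metis
  obtain W2 F2 where F2: "smooth_rep c h (k z) W2 F2" "\<And>v w. FD F2 (snd c (k z)) v \<bullet> FD F2 (snd c (k z)) w = metric M c (k z) v w"
   using iso[OF c] by blast
  obtain W T where "open W" "snd d z \<in> W" "C_inf_on W T" "\<And>y. y \<in> W \<Longrightarrow> y \<in> half_space \<Longrightarrow> T y = coord_map d c k y"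
   by (rule transition_of_immersions[OF aN aM d c contk F1 F2(1) injF[OF c F2]]) (auto simp: kX)
  then show ?thesis by blast
 qed
 have "smooth_map M N h"
  unfolding smooth_map_def
 proof (intro conjI cont ballI smooth_onI)
  fix c d x assume c: "c \<in> charts M" and d: "d \<in> charts N" and x: "x \<in> coord_dom c d h"
  then obtain p where p: "p \<in> fst c" "h p \<in> fst d" "x = snd c p" unfolding coord_dom_def by blast
  show "\<exists>W T. open W \<and> x \<in> W \<and> C_inf_on W T \<and> (\<forall>y\<in>W \<inter> coord_dom c d h. T y = coord_map c d h y)"
   using forth[OF c p(1) d p(2)] coord_dom_subset[OF aM c, of d h] unfolding p(3) by blast
 qed
 moreover have "smooth_map N M k"
  unfolding smooth_map_def
 proof (intro conjI contk ballI smooth_onI)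
  fix d c x assume d: "d \<in> charts N" and c: "c \<in> charts M" and x: "x \<in> coord_dom d c k"
  then obtain z where z: "z \<in> fst d" "k z \<in> fst c" "x = snd d z" unfolding coord_dom_def by blast
  show "\<exists>W T. open W \<and> x \<in> W \<and> C_inf_on W T \<and> (\<forall>y\<in>W \<inter> coord_dom d c k. T y = coord_map d c k y)"
   using bwd[OF d z(1) c z(2)] coord_dom_subset[OF aN d, of c k] unfolding z(3) by blast
 qed
 ultimately have diffeo: "diffeomorphism M N h" unfolding diffeomorphism_def using hk by blast
 have met: "metric M c p u v = metric N d (h p) (deriv_in (coord_dom c d h) (coord_map c d h) (snd c p) u)
   (deriv_in (coord_dom c d h) (coord_map c d h) (snd c p) v)"
  if c: "c \<in> charts M" "p \<in> fst c" and d: "d \<in> charts N" "h p \<in> fst d" for c d p u v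
 proof -
  obtain W T F2 where T: "open W" "snd c p \<in> W" "C_inf_on W T" "\<And>y. y \<in> W \<inter> half_space \<Longrightarrow> T y = coord_map c d h y"
   "\<And>v w. metric M c p v w = FD F2 (snd d (h p)) (FD T (snd c p) v) \<bullet> FD F2 (snd d (h p)) (FD T (snd c p) w)"
   "deriv_in (chart_image d) (chart_inv d) (snd d (h p)) = FD F2 (snd d (h p))"
   using forth[OF c d] by blast
  have "coord_dom c d h = snd c ` (fst c \<inter> {q \<in> topspace (mtop M). h q \<in> fst d})"
   using chart_subset[OF c(1)] by (auto simp: coord_dom_def)
  then have O: "openin (top_of_set half_space) (coord_dom c d h)"
   using chart_image_of_open[OF c(1) openin_continuous_map_preimage[OF cont N.chart_open[OF d(1)]]] by simp
  have pD: "snd c p \<in> coord_dom c d h" using c d by (auto simp: coord_dom_def)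
  have "deriv_in (coord_dom c d h) (coord_map c d h) (snd c p) = FD T (snd c p)"
   by (rule deriv_in_ext[OF O T(1,2) pD T(3)]) (use T(4) coord_dom_subset[OF aM c(1), of d h] in blast)
  then show ?thesis using T(5,6) by (simp add: N_def induced_riemannian_def Let_def)
 qed
 show ?thesis
  unfolding isometric_def Let_def X_def[symmetric] N_def[symmetric]
  by (rule exI[of _ h]) (use diffeo met in blast)
qed

end

section \<open>Geodesic distance and geodesic balls in the unit sphere\<close>

lemma orthogonal_unit:
 assumes "norm (p::'b::euclidean_space) = 1" "DIM('b) \<ge> 2"
 obtains e where "norm e = 1" "p \<bullet> e = 0"
proof -
 obtain x where x: "x \<noteq> 0" "orthogonal p x" using orthogonal_to_vector_exists[OF assms(2)] by blast
 then show ?thesis using that[of "x /\<^sub>R norm x"] by (auto simp: orthogonal_def)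
qed

lemma great_circle_direction:
 fixes p x :: "'b::euclidean_space"
 assumes p: "norm p = 1" and x: "norm x = 1" and dim: "DIM('b) \<ge> 2"
 obtains e where "norm e = 1" "p \<bullet> e = 0" "x = cos (arccos (p \<bullet> x)) *\<^sub>R p + sin (arccos (p \<bullet> x)) *\<^sub>R e"
proof -
 have "\<bar>p \<bullet> x\<bar> \<le> 1" using Cauchy_Schwarz_ineq2[of p x] p x by simp
 then have c: "cos (arccos (p \<bullet> x)) = p \<bullet> x" "sin (arccos (p \<bullet> x)) = sqrt (1 - (p \<bullet> x)\<^sup>2)"
  by (auto simp: cos_arccos sin_arccos abs_le_iff)
 define v where "v = x - (p \<bullet> x) *\<^sub>R p"
 have pp: "p \<bullet> p = 1" "x \<bullet> x = 1" using p x by (simp_all add: norm_eq_1)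
 have nv: "norm v = sqrt (1 - (p \<bullet> x)\<^sup>2)"
  unfolding norm_eq_sqrt_inner v_def using pp
  by (simp add: inner_diff_left inner_diff_right inner_commute[of x p] power2_eq_square)
 have pv: "p \<bullet> v = 0" using pp by (simp add: v_def inner_diff_right)
 show ?thesis
 proof (cases "v = 0")
  \<comment> \<open>Here x is p or - p, and every unit vector orthogonal to p will do.\<close>
  case True
  obtain e where "norm e = 1" "p \<bullet> e = 0" by (rule orthogonal_unit[OF p dim])
  then show ?thesis using that[of e] True nv unfolding c by (simp add: v_def)
 next
  case False
  show ?thesis
   by (rule that[of "v /\<^sub>R norm v"]) (use False pv in \<open>simp_all add: c nv[symmetric]\<close>, simp add: v_def)
 qed
qed

text \<open>The function arccos (p . \<gamma>) changes at most as fast as arc length. As arccos is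
  not differentiable at 1 and -1, values taken for instance at the start, p is first scaled by l <
  1, and then l tends to 1.\<close>

lemma sphere_curve_length:
 fixes \<gamma> :: "real \<Rightarrow> 'b::euclidean_space"
 assumes C1: "\<gamma> C1_differentiable_on {0..1}" and im: "path_image \<gamma> \<subseteq> sphere 0 1"
 shows "arccos (pathstart \<gamma> \<bullet> pathfinish \<gamma>) \<le> integral {0..1} (\<lambda>t. norm (vector_derivative \<gamma> (at t)))"
proof -
 define D where "D t = vector_derivative \<gamma> (at t)" for t
 define L where "L = integral {0..1} (\<lambda>t. norm (D t))"
 define p where "p = pathstart \<gamma>"
 have D: "(\<gamma> has_vector_derivative D t) (at t)" if "t \<in> {0..1}" for t
  using C1 that unfolding C1_differentiable_on_eq D_def by (auto simp: vector_derivative_works)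
 have contD: "continuous_on {0..1} D" using C1 unfolding C1_differentiable_on_eq D_def by simp
 have L: "((\<lambda>t. norm (D t)) has_integral L) {0..1}"
  unfolding L_def by (intro integrable_integral integrable_continuous_real continuous_on_norm contD)
 have unit: "\<gamma> t \<bullet> \<gamma> t = 1" if "t \<in> {0..1}" for t
 proof -
  have "\<gamma> t \<in> sphere 0 1" using im that unfolding path_image_def by blast
  then show ?thesis by (simp add: norm_eq_1)
 qed
 have pp: "p \<bullet> p = 1" using unit[of 0] by (simp add: p_def pathstart_def)
 have orth: "\<gamma> t \<bullet> D t = 0" if t: "t \<in> {0..1}" for t
 proof -
  have "((\<lambda>t. \<gamma> t \<bullet> \<gamma> t) has_vector_derivative \<gamma> t \<bullet> D t + D t \<bullet> \<gamma> t) (at t)"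
   using bounded_bilinear.has_vector_derivative[OF bounded_bilinear_inner D[OF t] D[OF t]] .
  then have 1: "((\<lambda>t. \<gamma> t \<bullet> \<gamma> t) has_vector_derivative \<gamma> t \<bullet> D t + D t \<bullet> \<gamma> t) (at t within cbox 0 1)"
   by (rule has_vector_derivative_at_within)
  have 2: "((\<lambda>t. \<gamma> t \<bullet> \<gamma> t) has_vector_derivative 0) (at t within cbox 0 1)"
   by (rule has_vector_derivative_transform[of _ _ _ "\<lambda>t. 1"]) (use unit t in auto)
  have "\<gamma> t \<bullet> D t + D t \<bullet> \<gamma> t = 0"
   by (rule vector_derivative_unique_within_closed_interval[OF _ _ 1 2]) (use t in auto)
  then show ?thesis by (simp add: inner_commute)
 qed
 have ineq: "arccos (l * (p \<bullet> \<gamma> 1)) - arccos (l * (p \<bullet> \<gamma> 0)) \<le> L" if l: "0 \<le> l" "l < 1" for l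
 proof -
  have cs: "(p \<bullet> \<gamma> t)\<^sup>2 \<le> 1" if "t \<in> {0..1}" for t
   using Cauchy_Schwarz_ineq[of p "\<gamma> t"] pp unit[OF that] by simp
  have ls: "l\<^sup>2 * (p \<bullet> \<gamma> t)\<^sup>2 < 1" if "t \<in> {0..1}" for t
   using mult_mono[of "l\<^sup>2" "l\<^sup>2" "(p \<bullet> \<gamma> t)\<^sup>2" 1] cs[OF that] l power_strict_mono[of l 1 2] by simp
  then have lt: "-1 < l * (p \<bullet> \<gamma> t)" "l * (p \<bullet> \<gamma> t) < 1" if "t \<in> {0..1}" for t
   using that abs_square_less_1[of "l * (p \<bullet> \<gamma> t)"] by (auto simp: power_mult_distrib)
  define g' where "g' t = - (l * (p \<bullet> D t)) / sqrt (1 - (l * (p \<bullet> \<gamma> t))\<^sup>2)" for t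
  have "(g' has_integral arccos (l * (p \<bullet> \<gamma> 1)) - arccos (l * (p \<bullet> \<gamma> 0))) {0..1}"
  proof (rule fundamental_theorem_of_calculus)
   fix t :: real assume t: "t \<in> {0..1}"
   have "((\<lambda>t. l * (p \<bullet> \<gamma> t)) has_vector_derivative l * (p \<bullet> D t)) (at t)"
    by (intro has_vector_derivative_mult_right bounded_linear.has_vector_derivative[OF bounded_linear_inner_right] D t)
   then have "((\<lambda>t. l * (p \<bullet> \<gamma> t)) has_real_derivative l * (p \<bullet> D t)) (at t)"
    by (simp add: has_real_derivative_iff_has_vector_derivative)
   from DERIV_chain2[OF DERIV_arccos[OF lt[OF t]] this]
   have "((\<lambda>t. arccos (l * (p \<bullet> \<gamma> t))) has_real_derivative g' t) (at t)" by (simp add: g'_def divide_inverse mult.commute)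
   then show "((\<lambda>t. arccos (l * (p \<bullet> \<gamma> t))) has_vector_derivative g' t) (at t within {0..1})"
    by (simp add: has_real_derivative_iff_has_vector_derivative has_vector_derivative_at_within)
  qed simp
  moreover have "g' t \<le> norm (D t)" if t: "t \<in> {0..1}" for t
  proof -
   \<comment> \<open>The velocity is tangent to the sphere, so only the tangential part of p counts;
     its length is sqrt (1 - (p . \<gamma>)^2).\<close>
   have "p \<bullet> D t = (p - (p \<bullet> \<gamma> t) *\<^sub>R \<gamma> t) \<bullet> D t" using orth[OF t] by (simp add: inner_diff_left)
   then have "\<bar>p \<bullet> D t\<bar> \<le> norm (p - (p \<bullet> \<gamma> t) *\<^sub>R \<gamma> t) * norm (D t)" using Cauchy_Schwarz_ineq2 by metis
   also have "norm (p - (p \<bullet> \<gamma> t) *\<^sub>R \<gamma> t) = sqrt (1 - (p \<bullet> \<gamma> t)\<^sup>2)"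
    unfolding norm_eq_sqrt_inner using pp unit[OF t]
    by (simp add: inner_diff_left inner_diff_right inner_commute[of "\<gamma> t" p] power2_eq_square)
   finally have 1: "\<bar>p \<bullet> D t\<bar> \<le> sqrt (1 - (p \<bullet> \<gamma> t)\<^sup>2) * norm (D t)" .
   have pos: "sqrt (1 - (l * (p \<bullet> \<gamma> t))\<^sup>2) > 0" using ls[OF t] by (simp add: power_mult_distrib)
   have "l\<^sup>2 * (p \<bullet> \<gamma> t)\<^sup>2 \<le> 1 * (p \<bullet> \<gamma> t)\<^sup>2" using l power_mono[of l 1 2] by (intro mult_right_mono) auto
   then have "sqrt (1 - (p \<bullet> \<gamma> t)\<^sup>2) \<le> sqrt (1 - (l * (p \<bullet> \<gamma> t))\<^sup>2)" by (simp add: power_mult_distrib)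
   then have "sqrt (1 - (p \<bullet> \<gamma> t)\<^sup>2) * norm (D t) \<le> sqrt (1 - (l * (p \<bullet> \<gamma> t))\<^sup>2) * norm (D t)" by (rule mult_right_mono) simp
   then have "\<bar>p \<bullet> D t\<bar> \<le> sqrt (1 - (l * (p \<bullet> \<gamma> t))\<^sup>2) * norm (D t)" using 1 by linarith
   moreover have "- (l * (p \<bullet> D t)) \<le> \<bar>p \<bullet> D t\<bar>"
    using mult_right_mono[of l 1 "\<bar>p \<bullet> D t\<bar>"] mult_left_mono[of "- (p \<bullet> D t)" "\<bar>p \<bullet> D t\<bar>" l] abs_ge_minus_self[of "p \<bullet> D t"] l by simp
   ultimately show ?thesis unfolding g'_def pos_divide_le_eq[OF pos] by (metis mult.commute order_trans)
  qed
  ultimately show ?thesis using has_integral_le[OF _ L] by blast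
 qed
 have tend: "((\<lambda>l. arccos (l * a)) \<longlongrightarrow> arccos a) (at_left 1)" if a: "\<bar>a\<bar> \<le> 1" for a
 proof -
  have "continuous_on {0..1} (\<lambda>l. arccos (l * a))"
  proof (rule continuous_on_compose2[OF continuous_on_arccos'])
   show "(\<lambda>l. l * a) ` {0..1} \<subseteq> {-1..1}"
   proof clarify
    fix l :: real assume "l \<in> {0..1}"
    then have "\<bar>l * a\<bar> \<le> 1" using mult_mono[of "\<bar>l\<bar>" 1 "\<bar>a\<bar>" 1] a by (simp add: abs_mult)
    then show "l * a \<in> {-1..1}" by (simp add: abs_le_iff)
   qed
  qed (auto intro!: continuous_intros)
  then have "((\<lambda>l. arccos (l * a)) \<longlongrightarrow> arccos (1 * a)) (at 1 within {0..1})"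
   unfolding continuous_on_def by (rule bspec) simp
  moreover have "at (1::real) within {0..1} = at_left 1" by (rule at_within_Icc_at_left) simp
  ultimately show ?thesis by simp
 qed
 have ab: "\<bar>p \<bullet> \<gamma> t\<bar> \<le> 1" if "t \<in> {0..1}" for t
  using Cauchy_Schwarz_ineq2[of p "\<gamma> t"] pp unit[OF that] by (simp add: norm_eq_sqrt_inner)
 have "((\<lambda>l. arccos (l * (p \<bullet> \<gamma> 1)) - arccos (l * (p \<bullet> \<gamma> 0))) \<longlongrightarrow> arccos (p \<bullet> \<gamma> 1) - arccos (p \<bullet> \<gamma> 0)) (at_left 1)"
  by (intro tendsto_diff tend ab) auto
 moreover have "\<forall>\<^sub>F l in at_left 1. arccos (l * (p \<bullet> \<gamma> 1)) - arccos (l * (p \<bullet> \<gamma> 0)) \<le> L"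
  using ineq by (auto simp: eventually_at_left[of 0 1] intro!: exI[of _ 0])
 ultimately have "arccos (p \<bullet> \<gamma> 1) - arccos (p \<bullet> \<gamma> 0) \<le> L"
  by (rule tendsto_upperbound) simp
 moreover have "p \<bullet> \<gamma> 0 = 1" using pp by (simp add: p_def pathstart_def)
 ultimately show ?thesis by (simp add: p_def pathfinish_def L_def D_def)
qed

lemma sphere_geodesic_dist:
 fixes p x :: "'b::euclidean_space"
 assumes p: "p \<in> sphere 0 1" and x: "x \<in> sphere 0 1" and dim: "DIM('b) \<ge> 2"
 shows "geodesic_dist (sphere 0 1) p x = arccos (p \<bullet> x)"
 unfolding geodesic_dist_def
proof (rule cInf_eq_minimum)
 have n: "norm p = 1" "norm x = 1" using p x by auto
 obtain e where e: "norm e = 1" "p \<bullet> e = 0" "x = cos (arccos (p \<bullet> x)) *\<^sub>R p + sin (arccos (p \<bullet> x)) *\<^sub>R e"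
  by (rule great_circle_direction[OF n dim])
 define \<theta> where "\<theta> = arccos (p \<bullet> x)"
 have "\<bar>p \<bullet> x\<bar> \<le> 1" using Cauchy_Schwarz_ineq2[of p x] n by simp
 then have \<theta>: "0 \<le> \<theta>" unfolding \<theta>_def by (intro arccos_lbound) (auto simp: abs_le_iff)
 define \<gamma> where "\<gamma> t = cos (\<theta> * t) *\<^sub>R p + sin (\<theta> * t) *\<^sub>R e" for t
 have unit: "norm (a *\<^sub>R p + b *\<^sub>R e) = sqrt (a\<^sup>2 + b\<^sup>2)" for a b
  unfolding norm_eq_sqrt_inner using n e
  by (simp add: inner_add_left inner_add_right norm_eq_1 inner_commute[of e p] power2_eq_square)
 have d: "(\<gamma> has_vector_derivative (- \<theta> * sin (\<theta> * t)) *\<^sub>R p + (\<theta> * cos (\<theta> * t)) *\<^sub>R e) (at t)" for t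
  unfolding \<gamma>_def by (auto intro!: derivative_eq_intros simp: has_vector_derivative_def algebra_simps)
 have "norm (vector_derivative \<gamma> (at t)) = \<theta>" for t
 proof -
  have "norm (vector_derivative \<gamma> (at t)) = sqrt ((- \<theta> * sin (\<theta> * t))\<^sup>2 + (\<theta> * cos (\<theta> * t))\<^sup>2)"
   unfolding vector_derivative_at[OF d] by (rule unit)
  also have "(- \<theta> * sin (\<theta> * t))\<^sup>2 + (\<theta> * cos (\<theta> * t))\<^sup>2 = \<theta>\<^sup>2 * ((sin (\<theta> * t))\<^sup>2 + (cos (\<theta> * t))\<^sup>2)"
   by (simp only: power_mult_distrib power2_minus distrib_left)
  finally show ?thesis using \<theta> by simp
 qed
 moreover have "\<gamma> C1_differentiable_on {0..1}"
  unfolding C1_differentiable_on_def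
  by (rule exI[of _ "\<lambda>t. (- \<theta> * sin (\<theta> * t)) *\<^sub>R p + (\<theta> * cos (\<theta> * t)) *\<^sub>R e"]) (intro conjI ballI d continuous_intros)
 moreover have "path_image \<gamma> \<subseteq> sphere 0 1" using unit by (auto simp: path_image_def \<gamma>_def)
 moreover have "pathstart \<gamma> = p" "pathfinish \<gamma> = x" using e(3) by (auto simp: pathstart_def pathfinish_def \<gamma>_def \<theta>_def)
 ultimately show "arccos (p \<bullet> x) \<in> {integral {0..1} (\<lambda>t. norm (vector_derivative \<gamma> (at t))) | \<gamma>.
   \<gamma> C1_differentiable_on {0..1} \<and> path_image \<gamma> \<subseteq> sphere 0 1 \<and> pathstart \<gamma> = p \<and> pathfinish \<gamma> = x}"
  by (intro CollectI exI[of _ \<gamma>]) (simp add: \<theta>_def)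
qed (use sphere_curve_length in blast)

lemma closed_geodesic_ball_eq:
 fixes p :: "'b::euclidean_space"
 assumes p: "p \<in> sphere 0 1" and r: "0 \<le> r" "r \<le> pi" and dim: "DIM('b) \<ge> 2"
 shows "closed_geodesic_ball p r = {x \<in> sphere 0 1. cos r \<le> p \<bullet> x}"
proof -
 have "arccos (p \<bullet> x) \<le> r \<longleftrightarrow> cos r \<le> p \<bullet> x" if x: "x \<in> sphere 0 1" for x
 proof -
  have "\<bar>p \<bullet> x\<bar> \<le> 1" using Cauchy_Schwarz_ineq2[of p x] p x by simp
  then have a: "-1 \<le> p \<bullet> x" "p \<bullet> x \<le> 1" by (auto simp: abs_le_iff)
  show ?thesis
   using cos_mono_le_eq[of r "arccos (p \<bullet> x)"] arccos_lbound[OF a] arccos_ubound[OF a] cos_arccos[OF a] r by simp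
 qed
 then show ?thesis
  unfolding closed_geodesic_ball_def using sphere_geodesic_dist[OF p _ dim] by auto
qed

section \<open>Inverse stereographic projection from the south pole (0, -1)\<close>

definition stereo :: "'a::euclidean_space \<Rightarrow> 'a \<times> real" where
 "stereo y = ((2 / (1 + y \<bullet> y)) *\<^sub>R y, 2 / (1 + y \<bullet> y) - 1)"

lemma one_plus_inner_pos: "1 + y \<bullet> y > 0"
 by (simp add: add_pos_nonneg)

lemma stereo_smooth: "C_inf_on UNIV stereo"
proof -
 have "C_inf_on UNIV (\<lambda>y::'a. inverse (1 + y \<bullet> y))"
  by (intro C_inf_on_inverse C_inf_on_add C_inf_on_const C_inf_on_inner C_inf_on_ident)
   (use one_plus_inner_pos in \<open>auto simp: less_le\<close>)
 then have k: "C_inf_on UNIV (\<lambda>y::'a. 2 / (1 + y \<bullet> y))"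
  unfolding divide_inverse by (intro C_inf_on_mult C_inf_on_const) auto
 show ?thesis unfolding stereo_def[abs_def]
  by (intro C_inf_on_Pair C_inf_on_scaleR C_inf_on_diff C_inf_on_const C_inf_on_ident k) auto
qed

lemma stereo_conformal: "FD stereo y v \<bullet> FD stereo y w = 4 * (v \<bullet> w) / (1 + y \<bullet> y)\<^sup>2"
proof -
 define k where "k = 1 + y \<bullet> y"
 have k: "k > 0" "y \<bullet> y = k - 1" using one_plus_inner_pos[of y] by (simp_all add: k_def)
 have d: "((\<lambda>y. 2 / (1 + y \<bullet> y)) has_derivative (\<lambda>v. - 4 * (y \<bullet> v) / k\<^sup>2)) (at y)"
 proof -
  have 1: "((\<lambda>y. y \<bullet> y) has_derivative (\<lambda>v. 2 * (y \<bullet> v))) (at y)"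
   by (auto intro!: derivative_eq_intros simp: inner_commute)
  have "((\<lambda>t. 2 / (1 + t)) has_real_derivative - 2 / k\<^sup>2) (at (y \<bullet> y))"
   using k by (auto intro!: derivative_eq_intros simp: power2_eq_square)
  from has_derivative_compose[OF 1 this[unfolded has_field_derivative_def]] show ?thesis by (simp add: mult.assoc)
 qed
 have "(stereo has_derivative (\<lambda>v. ((2 / k) *\<^sub>R v + (- 4 * (y \<bullet> v) / k\<^sup>2) *\<^sub>R y, - 4 * (y \<bullet> v) / k\<^sup>2))) (at y)"
  unfolding stereo_def[abs_def]
  using has_derivative_Pair[OF has_derivative_scaleR[OF d has_derivative_ident] has_derivative_diff[OF d has_derivative_const]]
  by (simp add: k_def[symmetric])
 then have "FD stereo y = (\<lambda>v. ((2 / k) *\<^sub>R v + (- 4 * (y \<bullet> v) / k\<^sup>2) *\<^sub>R y, - 4 * (y \<bullet> v) / k\<^sup>2))"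
  by (rule frechet_derivative_at[symmetric])
 then have "FD stereo y v \<bullet> FD stereo y w = (2 / k)\<^sup>2 * (v \<bullet> w) - 2 * (2 / k) * (4 / k\<^sup>2) * ((y \<bullet> v) * (y \<bullet> w))
   + (4 / k\<^sup>2)\<^sup>2 * ((y \<bullet> v) * (y \<bullet> w)) * (y \<bullet> y + 1)"
  by (simp add: inner_Pair inner_add_left inner_add_right inner_commute[of v y] power2_eq_square algebra_simps add_divide_distrib)
 also have "\<dots> = 4 * (v \<bullet> w) / k\<^sup>2" using k by (simp add: field_simps power2_eq_square)
 finally show ?thesis by (simp add: k_def)
qed

lemma stereo_range: "range stereo = sphere 0 1 - {(0, -1)}"
proof (intro equalityI subsetI)
 fix z assume "z \<in> range stereo"
 then obtain y where z: "z = stereo y" by blast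
 define k where "k = 1 + y \<bullet> y"
 have k: "k > 0" "y \<bullet> y = k - 1" using one_plus_inner_pos[of y] by (simp_all add: k_def)
 have "z \<bullet> z = (2 / k)\<^sup>2 * (y \<bullet> y) + (2 / k - 1)\<^sup>2" by (simp add: z stereo_def inner_Pair k_def power2_eq_square)
 also have "\<dots> = 1" using k by (simp add: field_simps power2_eq_square)
 finally have "norm z = 1" by (simp add: norm_eq_1)
 moreover have "snd z \<noteq> -1" using k by (simp add: z stereo_def flip: k_def)
 ultimately show "z \<in> sphere 0 1 - {(0, -1)}" by auto
next
 fix z :: "'a \<times> real" assume z: "z \<in> sphere 0 1 - {(0, -1)}"
 obtain u t where ut: "z = (u, t)" by (cases z)
 have "(norm z)\<^sup>2 = 1" using z by simp
 then have uu: "u \<bullet> u = 1 - t\<^sup>2" unfolding power2_norm_eq_inner ut by (simp add: inner_Pair power2_eq_square)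
 have "t \<noteq> -1" using uu z ut by auto
 moreover have "t\<^sup>2 \<le> 1" using uu inner_ge_zero[of u] by linarith
 then have "-1 \<le> t" by (simp add: abs_square_le_1 abs_le_iff)
 ultimately have t: "1 + t > 0" by simp
 define y where "y = (1 / (1 + t)) *\<^sub>R u"
 have "y \<bullet> y = (1 - t\<^sup>2) / (1 + t)\<^sup>2" by (simp add: y_def uu power2_eq_square)
 also have "\<dots> = (1 - t) / (1 + t)" using t by (simp add: power2_eq_square divide_simps) (simp add: algebra_simps)
 finally have "1 + y \<bullet> y = 2 / (1 + t)" using t by (simp add: field_simps)
 then have "2 / (1 + y \<bullet> y) = 1 + t" by simp
 then have "stereo y = z" using t by (simp add: stereo_def ut y_def)
 then show "z \<in> range stereo" by blast
qed

lemma stereo_inj: "inj stereo"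
proof (rule injI)
 fix x y :: 'a assume eq: "stereo x = stereo y"
 then have 1: "2 / (1 + x \<bullet> x) = 2 / (1 + y \<bullet> y)" by (simp add: stereo_def)
 then have "(2 / (1 + x \<bullet> x)) *\<^sub>R x = (2 / (1 + x \<bullet> x)) *\<^sub>R y" using eq by (simp add: stereo_def)
 then show "x = y" using one_plus_inner_pos[of x] by (auto simp: less_le)
qed

text \<open>The Householder reflection along a - b. It serves to move the axis of the hemisphere to
  the pole (0, 1).\<close>

lemma reflection_exists:
 fixes a b :: "'b::euclidean_space"
 assumes "norm a = norm b"
 obtains Q where "linear Q" "\<And>u v. Q u \<bullet> Q v = u \<bullet> v" "\<And>z. Q (Q z) = z" "Q a = b"
proof -
 define v where "v = a - b"
 \<comment> \<open>For a = b the quotient by zero is 0, so that Q is the identity.\<close>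
 define k where "k z = 2 * (z \<bullet> v) / (v \<bullet> v)" for z
 define Q where "Q z = z - k z *\<^sub>R v" for z
 have k: "k z * (v \<bullet> v) = 2 * (z \<bullet> v)" for z by (simp add: k_def)
 show ?thesis
 proof (rule that[of Q])
  show "linear Q" unfolding Q_def k_def
   by (rule linearI) (simp_all add: inner_add_left add_divide_distrib scaleR_add_left scaleR_diff_right distrib_left)
  show "Q x \<bullet> Q y = x \<bullet> y" for x y
  proof -
   have "Q x \<bullet> Q y = x \<bullet> y - k y * (x \<bullet> v) - k x * (y \<bullet> v) + k x * (k y * (v \<bullet> v))"
    by (simp add: Q_def inner_diff_left inner_diff_right inner_commute[of v y] right_diff_distrib)
   moreover have "k y * (2 * (x \<bullet> v)) = k x * (k y * (v \<bullet> v))" unfolding k[symmetric] by simp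
   ultimately show ?thesis unfolding k by linarith
  qed
  show "Q (Q z) = z" for z
  proof -
   have "k (Q z) = 2 * (z \<bullet> v - k z * (v \<bullet> v)) / (v \<bullet> v)"
    unfolding k_def[of "Q z"] by (simp add: Q_def inner_diff_left)
   then have "k (Q z) = - k z" unfolding k by (simp add: k_def)
   then show ?thesis unfolding Q_def[of "Q z"] by (simp add: Q_def)
  qed
  have "2 * (a \<bullet> v) = v \<bullet> v"
   using assms by (simp add: v_def inner_diff_left inner_diff_right inner_commute[of b a] norm_eq_sqrt_inner)
  then show "Q a = b" by (cases "v = 0") (simp_all add: Q_def k_def, simp_all add: v_def)
 qed
qed

lemma norm_stereo: "norm (stereo y) = 1"
proof -
 have "stereo y \<in> sphere 0 1 - {(0, -1)}" unfolding stereo_range[symmetric] by blast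
 then show ?thesis by simp
qed

section \<open>The image of M in the sphere: cap or hemisphere\<close>

context obata_basin
begin

lemma exits_norm:
 assumes "b \<in> boundary M"
 shows "Psi b \<in> exits" "s b = (1 - (norm (Psi b))\<^sup>2) / (1 + (norm (Psi b))\<^sup>2)"
proof -
 have b: "b \<in> basin p0" using assms by (simp add: basin_eq boundary_def)
 then show "Psi b \<in> exits" using assms by (simp add: exits_def)
 show "s b = (1 - (norm (Psi b))\<^sup>2) / (1 + (norm (Psi b))\<^sup>2)"
  unfolding Psi_norm[OF b] using boundary_s(1)[OF assms] by (simp add: q_fun_def field_simps)
qed

text \<open>Since |Psi|^2 = (1 - s) / (1 + s), the stereographic factor 4 / (1 + |Psi|^2)^2 equals
  (1 + s)^2 and cancels the conformal factor of Psi. The linear isometry Q leaves room for moving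
  the image on the sphere.\<close>

lemma isometric_stereo_image:
 assumes Q: "linear Q" "\<And>u v. Q u \<bullet> Q v = u \<bullet> v"
 shows "isometric M (induced_riemannian ((\<lambda>y. Q (stereo y)) ` Psi ` topspace (mtop M)) :: ('a \<times> real, 'a) riemannian)"
proof -
 define h where "h p = Q (stereo (Psi p))" for p
 have blQ: "bounded_linear Q" using Q(1) by (simp add: linear_conv_bounded_linear)
 have injQ: "inj Q" unfolding linear_injective_0[OF Q(1)] using Q(2) by (metis inner_eq_zero_iff)
 have smooth: "C_inf_on UNIV (\<lambda>y::'a. Q (stereo y))" by (rule C_inf_on_linear_compose[OF open_UNIV stereo_smooth blQ])
 have "isometric M (induced_riemannian (h ` topspace (mtop M)) :: ('a \<times> real, 'a) riemannian)"
 proof (rule isometric_immersion_imp_isometric[OF comp])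
  show "inj_on h (topspace (mtop M))"
   using Psi_inj stereo_inj injQ unfolding h_def inj_on_def basin_eq by blast
  fix c p assume c: "c \<in> charts M" "p \<in> fst c"
  then have p: "p \<in> basin p0" using chart_subset basin_eq by blast
  define x where "x = snd c p"
  obtain W F where F: "smooth_rep c Psi p W F" "\<And>v w. FD F x v \<bullet> FD F x w = metric M c p v w / (1 + s p)\<^sup>2"
   using Psi_conf[OF p] c unfolding conf_at_def conf_rep_def x_def by blast
  note r = smooth_repD[OF F(1), folded x_def]
  have Fx: "F x = Psi p" using r(5)[OF r(2)] chart_half[OF c] chart_inv_left[OF c] by (simp add: x_def)
  have s1: "1 + s p > 0" using p by (auto simp: basin_def)
  have "1 + F x \<bullet> F x = 2 / (1 + s p)"
   using Psi_norm[OF p] s1 unfolding Fx power2_norm_eq_inner by (simp add: q_fun_def field_simps)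
  then have k: "(1 + F x \<bullet> F x)\<^sup>2 = 4 / (1 + s p)\<^sup>2" by (simp add: power_divide)
  have dF: "(F has_derivative FD F x) (at x)" by (rule C_inf_on_has_derivative[OF r(3,2)])
  have dS: "(stereo has_derivative FD stereo (F x)) (at (F x))" by (rule C_inf_on_has_derivative[OF stereo_smooth]) simp
  have "((\<lambda>y. Q (stereo (F y))) has_derivative (\<lambda>v. Q (FD stereo (F x) (FD F x v)))) (at x)"
   by (rule bounded_linear.has_derivative[OF blQ has_derivative_compose[OF dF dS]])
  then have "FD (\<lambda>y. Q (stereo (F y))) x = (\<lambda>v. Q (FD stereo (F x) (FD F x v)))" by (rule frechet_derivative_at[symmetric])
  then have "FD (\<lambda>y. Q (stereo (F y))) x v \<bullet> FD (\<lambda>y. Q (stereo (F y))) x w = metric M c p v w" for v w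
   using s1 by (simp add: Q(2) stereo_conformal F(2) k)
  moreover have "smooth_rep c h p W (\<lambda>y. Q (stereo (F y)))"
   unfolding h_def by (rule smooth_rep_compose[OF F(1) smooth]) auto
  ultimately show "\<exists>W F. smooth_rep c h p W F \<and> (\<forall>v w. FD F (snd c p) v \<bullet> FD F (snd c p) w = metric M c p v w)"
   unfolding x_def by blast
 qed
 then show ?thesis by (simp add: h_def image_image)
qed

lemma spherical_cap_case:
 assumes "s constant_on boundary M"
 shows "isometric_to_spherical_cap M"
proof -
 define R where "R = norm (Psi b0)"
 have sc: "s b = s b0" if "b \<in> boundary M" for b using assms that b0(1) by (auto simp: constant_on_def)
 have R: "norm y = R" if y: "y \<in> exits" for y
 proof -
  obtain b where b: "b \<in> boundary M" "b \<in> basin p0" "y = Psi b" using y unfolding exits_def by blast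
  then have "(norm y)\<^sup>2 = R\<^sup>2" using Psi_norm b0 sc[OF b(1)] by (simp add: R_def q_fun_def)
  then show ?thesis by (simp add: R_def power2_eq_iff_nonneg)
 qed
 have R0: "R > 0" using exits_nonzero exits_norm(1)[OF b0(1)] by (simp add: R_def)
 have img: "Psi ` topspace (mtop M) = cball 0 R"
  unfolding Psi_image
 proof (intro equalityI subsetI)
  fix y assume "y \<in> {y. y = 0 \<or> (\<exists>m. 0 < m \<and> m \<le> 1 \<and> (1/m) *\<^sub>R y \<in> exits)}"
  moreover have "norm y \<le> R" if "0 < m" "m \<le> 1" "(1/m) *\<^sub>R y \<in> exits" for m
   using R[OF that(3)] that R0 by (simp add: field_simps)
  ultimately show "y \<in> cball 0 R" using R0 by auto
 next
  fix y :: 'a assume y: "y \<in> cball 0 R"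
  show "y \<in> {y. y = 0 \<or> (\<exists>m. 0 < m \<and> m \<le> 1 \<and> (1/m) *\<^sub>R y \<in> exits)}"
  proof (cases "y = 0")
   case False
   then obtain m where m: "m > 0" "(1/m) *\<^sub>R y \<in> exits" by (rule exits_hit)
   have "norm y = m * R" using R[OF m(2)] m(1) by (simp add: field_simps)
   then have "m \<le> 1" using y R0 by simp
   then show ?thesis using m by blast
  qed simp
 qed
 \<comment> \<open>The angular radius for which cos r is the height of the stereographic image of
   the sphere |y| = R.\<close>
 define r where "r = arccos (2 / (1 + R\<^sup>2) - 1)"
 have R1: "1 + R\<^sup>2 > 0" by (simp add: add_pos_nonneg)
 have "-1 < 2 / (1 + R\<^sup>2) - 1" "2 / (1 + R\<^sup>2) - 1 < 1" using R0 R1 by (auto simp: field_simps)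
 then have r: "0 < r" "r < pi" "cos r = 2 / (1 + R\<^sup>2) - 1" unfolding r_def using arccos_lt_bounded cos_arccos by auto
 have pole: "(0, 1) \<in> sphere (0 :: 'a \<times> real) 1" by (simp add: norm_Pair)
 have ball: "stereo ` cball 0 R = closed_geodesic_ball ((0, 1) :: 'a \<times> real) r"
  unfolding closed_geodesic_ball_eq[OF pole less_imp_le[OF r(1)] less_imp_le[OF r(2)], simplified] r(3)
 proof (intro equalityI subsetI)
  fix z assume "z \<in> stereo ` cball (0::'a) R"
  then obtain y where y: "z = stereo y" "norm y \<le> R" by auto
  have "y \<bullet> y \<le> R\<^sup>2" using power_mono[OF y(2) norm_ge_zero, of 2] by (simp add: power2_norm_eq_inner)
  then have "2 / (1 + R\<^sup>2) \<le> 2 / (1 + y \<bullet> y)" using one_plus_inner_pos[of y] by (intro divide_left_mono) auto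
  then show "z \<in> {x. norm x = 1 \<and> 2 / (1 + R\<^sup>2) - 1 \<le> (0, 1) \<bullet> x}"
   using norm_stereo[of y] y(1) by (simp add: stereo_def)
 next
  fix z :: "'a \<times> real" assume z: "z \<in> {x. norm x = 1 \<and> 2 / (1 + R\<^sup>2) - 1 \<le> (0, 1) \<bullet> x}"
  then have sz: "2 / (1 + R\<^sup>2) - 1 \<le> snd z" by (cases z) (simp add: inner_Pair)
  then have "z \<noteq> (0, -1)" using R1 by auto
  then have "z \<in> range stereo" unfolding stereo_range using z by simp
  then obtain y where y: "z = stereo y" by (rule imageE)
  have le: "2 / (1 + R\<^sup>2) \<le> 2 / (1 + y \<bullet> y)" using sz by (simp add: y stereo_def)
  have "y \<bullet> y \<le> R\<^sup>2"
  proof (rule ccontr)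
   assume "\<not> y \<bullet> y \<le> R\<^sup>2"
   then have "2 / (1 + y \<bullet> y) < 2 / (1 + R\<^sup>2)"
    using mult_pos_pos[OF one_plus_inner_pos[of y] R1] by (intro divide_strict_left_mono) auto
   then show False using le by linarith
  qed
  then have "(norm y)\<^sup>2 \<le> R\<^sup>2" by (simp add: power2_norm_eq_inner)
  then have "norm y \<le> R" using R0 by (rule power2_le_imp_le[OF _ less_imp_le])
  then show "z \<in> stereo ` cball 0 R" using y by simp
 qed
 have "isometric M (induced_riemannian (stereo ` Psi ` topspace (mtop M)) :: ('a \<times> real, 'a) riemannian)"
  by (rule isometric_stereo_image[of "\<lambda>z. z", OF linear_ident refl])
 then show ?thesis
  unfolding isometric_to_spherical_cap_def img ball using r(1,2) pole by blast
qed

text \<open>The radial alternatives of the rigidity lemma would make s constant on the boundary. In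
  the remaining one the image of the boundary has the equation 1 - |y|^2 = 2 B (e . y), which
  stereographically is the great sphere orthogonal to P, so the image of M is a hemisphere up to the
  reflection Q.\<close>

lemma hemisphere_case:
 assumes nc: "\<not> s constant_on boundary M"
 shows "isometric M (standard_hemisphere :: ('a \<times> real, 'a) riemannian)"
proof -
 have hit: "\<exists>m>0. (1/m) *\<^sub>R y \<in> exits" if "y \<noteq> 0" for y using exits_hit[OF that] by blast
 obtain B where B: "B \<ge> 0" "B\<^sup>2 = A\<^sup>2 - 1"
  and alt: "(\<forall>y\<in>exits. 1 - (norm y)\<^sup>2 = 2 * B * norm y) \<or> (\<forall>y\<in>exits. 1 - (norm y)\<^sup>2 = - 2 * B * norm y) \<or>
   (\<exists>e. norm e = 1 \<and> (\<forall>y\<in>exits. 1 - (norm y)\<^sup>2 = 2 * B * (e \<bullet> y)))"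
  by (rule gauge_rigidity[OF A_pos hit exits_unique exits_nonzero exits_local]) blast
 \<comment> \<open>The equation 1 - x^2 = 2 k x has roots with product -1, hence only one positive
   root; it is used for k = B and k = - B. A constant |Psi| on the boundary means a constant
   s.\<close>
 have no: False if eq: "\<forall>y\<in>exits. 1 - (norm y)\<^sup>2 = 2 * k * norm y" for k
 proof -
  have "norm y = norm z" if "y \<in> exits" "z \<in> exits" for y z
  proof (rule ccontr)
   define a b where "a = norm y" "b = norm z"
   assume "norm y \<noteq> norm z"
   then have ne: "a - b \<noteq> 0" by (simp add: a_b_def)
   have ab: "1 - a\<^sup>2 = 2 * k * a" "1 - b\<^sup>2 = 2 * k * b" "a > 0" "b > 0"
    using eq that exits_nonzero by (auto simp: a_b_def)
   have "(1 - a\<^sup>2) * b = (1 - b\<^sup>2) * a" using ab by simp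
   then have "(a - b) * (1 + a * b) = 0" by (simp add: power2_eq_square algebra_simps)
   then have "1 + a * b = 0" using ne by simp
   moreover have "a * b > 0" using ab by simp
   ultimately show False by linarith
  qed
  then have "norm (Psi b) = norm (Psi b0)" if "b \<in> boundary M" for b using exits_norm(1) that b0(1) by blast
  then have "s constant_on boundary M" unfolding constant_on_def using exits_norm(2) by metis
  then show False using nc by blast
 qed
 obtain e where e: "norm e = 1" "\<And>y. y \<in> exits \<Longrightarrow> 1 - (norm y)\<^sup>2 = 2 * B * (e \<bullet> y)"
  using alt no[of B] no[of "- B"] by auto
 have img: "Psi ` topspace (mtop M) = {y. 2 * B * (e \<bullet> y) \<le> 1 - y \<bullet> y}"
 proof -
  \<comment> \<open>Along the ray through an exit point y0 the defining quadratic polynomial factors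
    as (1 - m) (1 + m |y0|^2), so its sign tells whether m <= 1.\<close>
  have key: "2 * B * (e \<bullet> y) \<le> 1 - y \<bullet> y \<longleftrightarrow> m \<le> 1" if m: "m > 0" "(1/m) *\<^sub>R y \<in> exits" for m y
  proof -
   define y0 where "y0 = (1/m) *\<^sub>R y"
   have y: "y = m *\<^sub>R y0" using m by (simp add: y0_def)
   have E: "2 * B * (e \<bullet> y0) = 1 - y0 \<bullet> y0"
    using e(2)[OF m(2)] unfolding y0_def power2_norm_eq_inner by (rule sym)
   have "1 - y \<bullet> y - 2 * B * (e \<bullet> y) = 1 - m * m * (y0 \<bullet> y0) - m * (2 * B * (e \<bullet> y0))" by (simp add: y)
   also have "\<dots> = (1 - m) * (1 + m * (y0 \<bullet> y0))" unfolding E by (simp add: algebra_simps)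
   finally have 1: "1 - y \<bullet> y - 2 * B * (e \<bullet> y) = (1 - m) * (1 + m * (y0 \<bullet> y0))" .
   have "1 + m * (y0 \<bullet> y0) > 0" using m by (simp add: add_pos_nonneg)
   then have "0 \<le> (1 - m) * (1 + m * (y0 \<bullet> y0)) \<longleftrightarrow> m \<le> 1" by (simp add: zero_le_mult_iff)
   then show ?thesis using 1 by linarith
  qed
  show ?thesis unfolding Psi_image using key hit by (auto; metis)
 qed
 \<comment> \<open>The centre of the hemisphere, read off from 1 - |y|^2 - 2 B (e . y) as a multiple
   of P . stereo y. It is a unit vector because B^2 + 1 = A^2.\<close>
 define P where "P = (1 / A) *\<^sub>R (- B *\<^sub>R e, 1::real)"
 have "P \<bullet> P = (B\<^sup>2 * (e \<bullet> e) + 1) / A\<^sup>2" by (simp add: P_def inner_Pair power2_eq_square add_divide_distrib)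
 also have "\<dots> = 1" using e(1) B(2) A_pos by (simp add: norm_eq_1)
 finally have P1: "norm P = 1" by (simp add: norm_eq_1)
 obtain Q where Q: "linear Q" "\<And>u v. Q u \<bullet> Q v = u \<bullet> v" "\<And>z. Q (Q z) = z" "Q P = (0, 1)"
  using reflection_exists[of P "(0, 1)"] P1 by (auto simp: norm_Pair)
 have normQ: "norm (Q z) = norm z" for z using Q(2)[of z z] by (simp add: norm_eq_sqrt_inner)
 have Pst: "P \<bullet> stereo y = (1 - y \<bullet> y - 2 * B * (e \<bullet> y)) / (A * (1 + y \<bullet> y))" for y
 proof -
  have "2 / (1 + y \<bullet> y) - 1 = (1 - y \<bullet> y) / (1 + y \<bullet> y)" using one_plus_inner_pos[of y] by (simp add: field_simps)
  then show ?thesis unfolding P_def stereo_def by (simp add: inner_Pair diff_divide_distrib mult.commute)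
 qed
 have "(\<lambda>y. Q (stereo y)) ` Psi ` topspace (mtop M) = {x \<in> sphere 0 1. cos (pi/2) \<le> (0, 1) \<bullet> x}"
 proof (intro equalityI subsetI)
  fix x assume "x \<in> (\<lambda>y. Q (stereo y)) ` Psi ` topspace (mtop M)"
  then obtain y where y: "x = Q (stereo y)" "2 * B * (e \<bullet> y) \<le> 1 - y \<bullet> y" unfolding img by blast
  have "(0, 1) \<bullet> x = P \<bullet> stereo y" unfolding y(1) Q(4)[symmetric] Q(2) ..
  also have "\<dots> \<ge> 0" unfolding Pst using y(2) A_pos one_plus_inner_pos[of y] by simp
  finally have "(0, 1) \<bullet> x \<ge> 0" .
  moreover have "norm x = 1" unfolding y(1) normQ by (rule norm_stereo)
  ultimately show "x \<in> {x \<in> sphere 0 1. cos (pi/2) \<le> (0, 1) \<bullet> x}" by simp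
 next
  fix x :: "'a \<times> real" assume "x \<in> {x \<in> sphere 0 1. cos (pi/2) \<le> (0, 1) \<bullet> x}"
  then have x: "norm x = 1" "(0, 1) \<bullet> x \<ge> 0" by auto
  have "(0, 1) \<bullet> x = P \<bullet> Q x" using Q(2)[of P "Q x"] by (simp add: Q(3,4))
  then have PQ: "P \<bullet> Q x \<ge> 0" using x(2) by simp
  moreover have "P \<bullet> (0, -1) < 0" using A_pos by (simp add: P_def inner_Pair)
  ultimately have "Q x \<noteq> (0, -1)" by auto
  then have "Q x \<in> range stereo" unfolding stereo_range using x(1) normQ by simp
  then obtain y where y: "Q x = stereo y" by blast
  have "0 \<le> (1 - y \<bullet> y - 2 * B * (e \<bullet> y)) / (A * (1 + y \<bullet> y))" using PQ unfolding y Pst .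
  moreover have "A * (1 + y \<bullet> y) > 0" using A_pos one_plus_inner_pos[of y] by simp
  ultimately have "2 * B * (e \<bullet> y) \<le> 1 - y \<bullet> y" unfolding zero_le_divide_iff by linarith
  then have "y \<in> Psi ` topspace (mtop M)" unfolding img by simp
  moreover have "x = Q (stereo y)" using Q(3)[of x] y by simp
  ultimately show "x \<in> (\<lambda>y. Q (stereo y)) ` Psi ` topspace (mtop M)" by blast
 qed
 also have "\<dots> = closed_geodesic_ball (0, 1) (pi/2)"
  by (rule closed_geodesic_ball_eq[symmetric]) (simp_all add: norm_Pair)
 finally show ?thesis using isometric_stereo_image[OF Q(1,2)] unfolding standard_hemisphere_def by simp
qed

end

context obata_unit
begin

lemma basin_interpretation: "\<exists>p0 Psi b0. obata_basin M s A p0 Psi b0"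
proof -
 obtain b0 where b0: "b0 \<in> boundary M" using bd_nonempty by blast
 then have "b0 \<in> topspace (mtop M)" by (simp add: boundary_def)
 then obtain p0 where p0: "p0 \<in> topspace (mtop M)" "s p0 = 1" "b0 \<in> basin p0"
  using boundary_s(1)[OF b0] by (rule basin_cover)
 obtain Psi where "inj_on Psi (basin p0)" "\<And>x. x \<in> basin p0 \<Longrightarrow> conf_at Psi x"
  "\<And>x. x \<in> basin p0 \<Longrightarrow> (norm (Psi x))\<^sup>2 = q_fun x"
  "\<And>x t. x \<in> basin p0 \<Longrightarrow> t \<in> {0..tau} \<Longrightarrow> phi t x \<in> basin p0 \<and> Psi (phi t x) = exp (- t) *\<^sub>R Psi x"
  by (rule basin_coordinates[OF p0(1,2)]) blast
 then have "obata_basin M s A p0 Psi b0" using p0 b0 by unfold_locales auto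
 then show ?thesis by blast
qed

lemma obata_unit_rigidity:
 "(s constant_on boundary M \<longrightarrow> isometric_to_spherical_cap M) \<and>
  (\<not> s constant_on boundary M \<longrightarrow> isometric M (standard_hemisphere :: ('a \<times> real, 'a) riemannian))"
proof -
 obtain p0 Psi b0 where "obata_basin M s A p0 Psi b0" using basin_interpretation by blast
 then interpret obata_basin M s A p0 Psi b0 .
 show ?thesis using spherical_cap_case hemisphere_case by blast
qed

end

section \<open>Normalisation of the given function\<close>

context riemannian_mfd
begin

lemma smooth_function_scale:
 assumes "smooth_function M f"
 shows "smooth_function M (\<lambda>p. k * f p)"
 unfolding smooth_function_def
proof (intro ballI smooth_onI)
 fix c x assume c: "c \<in> charts M" and x: "x \<in> chart_image c"
 have "smooth_on (chart_image c) (f \<circ> chart_inv c)" using assms c by (auto simp: smooth_function_def)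
 then obtain W F where W: "open W" "x \<in> W" "C_inf_on W F" "\<And>y. y \<in> W \<Longrightarrow> y \<in> chart_image c \<Longrightarrow> F y = (f \<circ> chart_inv c) y"
  using smooth_onE[OF _ x] by blast
 have "C_inf_on W (\<lambda>y. k * F y)" by (intro C_inf_on_mult C_inf_on_const W)
 then show "\<exists>W T. open W \<and> x \<in> W \<and> C_inf_on W T \<and> (\<forall>y\<in>W \<inter> chart_image c. T y = ((\<lambda>p. k * f p) \<circ> chart_inv c) y)"
  using W by (intro exI[of _ W] exI[of _ "\<lambda>y. k * F y"]) auto
qed

lemma
 assumes f: "smooth_function M f" and c: "c \<in> charts M" "p \<in> fst c"
 shows deriv_scale: "deriv_in (chart_image c) ((\<lambda>p. k * f p) \<circ> chart_inv c) (snd c p) v =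
   k * deriv_in (chart_image c) (f \<circ> chart_inv c) (snd c p) v"
  and hessian_scale: "hessian M (\<lambda>p. k * f p) c p u v = k * hessian M f c p u v"
proof -
 let ?V = "chart_image c"
 define x where "x = snd c p"
 have x: "x \<in> ?V" unfolding x_def by (rule chart_in_image[OF c(2)])
 have "smooth_on ?V (f \<circ> chart_inv c)" using f c by (auto simp: smooth_function_def)
 then obtain W F where W: "open W" "x \<in> W" "C_inf_on W F" "\<And>y. y \<in> W \<Longrightarrow> y \<in> ?V \<Longrightarrow> F y = (f \<circ> chart_inv c) y"
  using smooth_onE[OF _ x] by blast
 note ext = deriv_in_ext[OF image_open[OF c(1)] W(1)]
 have kF: "C_inf_on W (\<lambda>y. k * F y)" by (intro C_inf_on_mult C_inf_on_const W)
 have D: "FD (\<lambda>y. k * G y) y v = k * FD G y v" if "C_inf_on W G" "y \<in> W" for G :: "'a \<Rightarrow> real" and y v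
  using fun_cong[OF frechet_derivative_at[OF has_derivative_mult_right[OF C_inf_on_has_derivative[OF that]]]] by simp
 have d1: "deriv_in ?V (f \<circ> chart_inv c) y v = FD F y v"
  and d2: "deriv_in ?V ((\<lambda>p. k * f p) \<circ> chart_inv c) y v = k * FD F y v" if "y \<in> W" "y \<in> ?V" for y v
  using ext[OF that W(3)] W(4) ext[OF that kF, of "(\<lambda>p. k * f p) \<circ> chart_inv c"] D[OF W(3) that(1)] by auto
 show "deriv_in ?V ((\<lambda>p. k * f p) \<circ> chart_inv c) (snd c p) v = k * deriv_in ?V (f \<circ> chart_inv c) (snd c p) v" for v
  using d1 d2 W(2) x by (simp add: x_def)
 have CF: "C_inf_on W (\<lambda>y. FD F y v)" by (rule C_inf_on_FD[OF W(3)])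
 have kCF: "C_inf_on W (\<lambda>y. k * FD F y v)" by (intro C_inf_on_mult C_inf_on_const W CF)
 have "deriv_in ?V (\<lambda>y. deriv_in ?V (f \<circ> chart_inv c) y v) x u = FD (\<lambda>y. FD F y v) x u"
  using ext[OF W(2) x CF] d1 by simp
 moreover have "deriv_in ?V (\<lambda>y. deriv_in ?V ((\<lambda>p. k * f p) \<circ> chart_inv c) y v) x u = k * FD (\<lambda>y. FD F y v) x u"
  using ext[OF W(2) x kCF] d2 D[OF CF W(2)] by simp
 ultimately show "hessian M (\<lambda>p. k * f p) c p u v = k * hessian M f c p u v"
  unfolding hessian_def Let_def x_def[symmetric] using d1 d2 W(2) x by (simp add: right_diff_distrib)
qed

text \<open>So the definite description in \<open>outward_normal\<close> denotes: a suitable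
  multiple of one candidate differs from the other by a tangential vector orthogonal to itself, and
  unit length with the sign condition fixes the multiple.\<close>

lemma outward_normal_eq:
 assumes c: "c \<in> charts M" "p \<in> fst c"
  and N: "metric M c p N N = 1" "\<And>v. v \<bullet> inward = 0 \<Longrightarrow> metric M c p N v = 0" "N \<bullet> inward < 0"
 shows "outward_normal M c p = N"
 unfolding outward_normal_def
proof (rule the_equality)
 show "metric M c p N N = 1 \<and> (\<forall>v. v \<bullet> inward = 0 \<longrightarrow> metric M c p N v = 0) \<and> N \<bullet> inward < 0" using N by blast
 fix N' assume N': "metric M c p N' N' = 1 \<and> (\<forall>v. v \<bullet> inward = 0 \<longrightarrow> metric M c p N' v = 0) \<and> N' \<bullet> inward < 0"
 define k where "k = (N' \<bullet> inward) / (N \<bullet> inward)"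
 note bil = metric_bilinear[OF c]
 have k: "k > 0" using N(3) N' by (simp add: k_def divide_neg_neg)
 have z: "(N' - k *\<^sub>R N) \<bullet> inward = 0" using N(3) by (simp add: inner_diff_left k_def)
 have "metric M c p (N' - k *\<^sub>R N) (N' - k *\<^sub>R N) = 0"
  using N' N(2)[OF z] z by (simp add: bilinear_lsub[OF bil] bilinear_lmul[OF bil])
 then have "N' - k *\<^sub>R N = 0" using metric_pos[OF c, of "N' - k *\<^sub>R N"] by fastforce
 then have eq: "N' = k *\<^sub>R N" by simp
 then have "k * k = 1" using N(1) N' by (simp add: bilinear_lmul[OF bil] bilinear_rmul[OF bil])
 then have "k = 1" using k by (simp only: square_eq_1_iff) linarith
 then show "N' = N" using eq by simp
qed

end

theorem theorem3:
 fixes M :: "('p, 'a::euclidean_space) riemannian" and f :: "'p \<Rightarrow> real"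
 assumes "DIM('a) \<ge> 2"
  and "riemannian_manifold M"
  and "connected_space (mtop M)" and "compact_space (mtop M)"
  and "boundary M \<noteq> {}"
  and "smooth_function M f"
  and "\<forall>c\<in>charts M. \<forall>p\<in>fst c. \<forall>u v. hessian M f c p u v + f p * metric M c p u v = 0"
  and "\<forall>p\<in>boundary M. \<forall>c\<in>charts M. p \<in> fst c \<longrightarrow> normal_derivative M f c p = 1"
 shows "(f constant_on boundary M \<longrightarrow> isometric_to_spherical_cap M) \<and>
     (\<not> f constant_on boundary M \<longrightarrow> isometric M (standard_hemisphere :: ('a \<times> real, 'a) riemannian))"
proof -
 interpret F: obata M f
  using assms(2,6,7) by unfold_locales auto
 obtain K where K: "\<And>c p. c \<in> charts M \<Longrightarrow> p \<in> fst c \<Longrightarrow> metric M c p (F.grd c p) (F.grd c p) + (f p)\<^sup>2 = K"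
  by (rule F.energy_constant[OF assms(3)]) blast
 have nd: "metric M c p (F.grd c p) N = -1"
  if c: "c \<in> charts M" "p \<in> fst c" and b: "p \<in> boundary M" and N: "metric M c p N N = 1"
   "\<And>v. v \<bullet> inward = 0 \<Longrightarrow> metric M c p N v = 0" "N \<bullet> inward < 0" for c p N
  using assms(8) b c F.outward_normal_eq[OF c N] F.grd_metric[OF c, of N] by (force simp: normal_derivative_def)
 obtain b where b: "b \<in> boundary M" using assms(5) by blast
 then obtain c where c: "c \<in> charts M" "b \<in> fst c" using F.chart_exists by (auto simp: boundary_def)
 obtain N where N: "metric M c b N N = 1" "\<And>v. v \<bullet> inward = 0 \<Longrightarrow> metric M c b N v = 0" "N \<bullet> inward < 0"
  by (rule F.normal_exists[OF c]) blast
 note bil = F.metric_bilinear[OF c]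
 have nonneg: "0 \<le> metric M c b v v" for v using F.metric_pos[OF c, of v] bilinear_lzero[OF bil] by (cases "v = 0") auto
 \<comment> \<open>The Cauchy-Schwarz inequality: the gradient of f is at least as long as its
   normal component, which is 1. Hence K >= 1, and f can be divided by A.\<close>
 have "0 \<le> metric M c b (F.grd c b + N) (F.grd c b + N)" by (rule nonneg)
 also have "\<dots> = metric M c b (F.grd c b) (F.grd c b) - 1"
  using nd[OF c b N] N(1) F.metric_sym[OF c, of N "F.grd c b"] by (simp add: bilinear_ladd[OF bil] bilinear_radd[OF bil])
 finally have K1: "K \<ge> 1" using K[OF c] zero_le_power2[of "f b"] by linarith
 define A where "A = sqrt K"
 have A: "A > 0" "A\<^sup>2 = K" using K1 by (simp_all add: A_def)
 \<comment> \<open>The sign turns the outward derivative 1 of f into - 1/A for s, so that -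
   \<nabla>s points out of M along the boundary.\<close>
 define k where "k = - (1 / A)"
 have k: "k * k * K = 1" using A by (simp add: k_def power2_eq_square flip: A(2))
 define s where "s p = k * f p" for p
 interpret S: obata M s
 proof unfold_locales
  show "smooth_function M s" unfolding s_def by (rule F.smooth_function_scale[OF assms(6)])
  fix c p u v assume c: "c \<in> charts M" "p \<in> fst c"
  have "hessian M s c p u v = k * hessian M f c p u v" unfolding s_def by (rule F.hessian_scale[OF assms(6) c])
  then show "hessian M s c p u v + s p * metric M c p u v = 0"
   using assms(7) c by (simp add: s_def) (metis distrib_left mult.assoc mult_zero_right)
 qed
 have grd: "S.grd c p = k *\<^sub>R F.grd c p" if c: "c \<in> charts M" "p \<in> fst c" for c p
 proof (rule F.metric_nondegenerate[OF c])
  fix w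
  show "metric M c p (S.grd c p) w = metric M c p (k *\<^sub>R F.grd c p) w"
   using S.grd_metric[OF c, of w] F.grd_metric[OF c, of w] F.deriv_scale[OF assms(6) c, of k w]
   by (simp add: s_def[abs_def] bilinear_lmul[OF F.metric_bilinear[OF c]])
 qed
 interpret U: obata_unit M s A
 proof unfold_locales
  fix c p assume c: "c \<in> charts M" "p \<in> fst c"
  have "metric M c p (S.grd c p) (S.grd c p) + (s p)\<^sup>2 = k * k * (metric M c p (F.grd c p) (F.grd c p) + (f p)\<^sup>2)"
   by (simp add: grd[OF c] s_def bilinear_lmul[OF F.metric_bilinear[OF c]] bilinear_rmul[OF F.metric_bilinear[OF c]]
     power2_eq_square algebra_simps)
  then show "metric M c p (S.grd c p) (S.grd c p) + (s p)\<^sup>2 = 1" using K[OF c] k by simp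
  fix N assume "p \<in> boundary M" "metric M c p N N = 1" "\<And>v. v \<bullet> inward = 0 \<Longrightarrow> metric M c p N v = 0" "N \<bullet> inward < 0"
  from nd[OF c this] show "metric M c p (S.grd c p) N = 1 / A"
   unfolding grd[OF c] bilinear_lmul[OF F.metric_bilinear[OF c]] by (simp add: k_def)
 qed (use assms A in auto)
 have "k \<noteq> 0" using A by (simp add: k_def)
 then have "f constant_on boundary M \<longleftrightarrow> s constant_on boundary M"
  unfolding constant_on_def s_def by (metis mult_cancel_left)
 then show ?thesis using U.obata_unit_rigidity by simp
qed

end
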